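(* Let $1\le p,r<\infty$, $0<q<\infty$ and $\beta\in\mathbb{R}$. Then $$\int_0^\infty\int_{\mathbb{R}^d}|f(s,y)|\cdot|g(s,y)|\,\frac{\mathrm{d}y\,\mathrm{d}s}{s}\lesssim\|f\|_{\mathrm T^{p',q',r'}_{-\beta}}\|g\|_{\mathrm T^{p,q,r}_\beta}$$ for all measurable functions $f,g$ on $\mathbb{R}^{d+1}_+$, with an implicit constant independent of $f,g$. Moreover, one can identify $(\mathrm T^{p,q,r}_\beta)'\simeq\mathrm T^{p',q',r'}_{-\beta}$ with equivalent norms via the $L^2$-duality pairing.
   Context: The symbol ⨍ denotes the mean-value integral and $B(x,t)$ the open ball in $\mathbb{R}^d$; $\mathbb{R}^{d+1}_+=(0,\infty)\times\mathbb{R}^d$. Conjugate exponents: for $p\in(1,\infty)$, $\frac1p+\frac1{p'}=1$; for $p\in(0,1]$, $p'=\infty$; for $p=\infty$, $p'=1$. $X'$ denotes the anti-dual space (bounded conjugate-linear functionals) of a (quasi-)Banach space $X$. The identification via the $L^2$-duality pairing means that $f$ corresponds to the functional $g\mapsto\int_0^\infty\int_{\mathbb{R}^d}f(s,y)\overline{g(s,y)}\,\frac{\mathrm{d}y\,\mathrm{d}s}{s}$. For $0<r\le\infty$, $\beta\in\mathbb{R}$ and measurable $f$ on $\mathbb{R}^{d+1}_+$ write $W_{r,\beta}f(t,x)=\big(⨍_{t/2}^t⨍_{B(x,t)}|s^{-\beta}f(s,y)|^r\,\mathrm{d}y\,\mathrm{d}s\big)^{1/r}$ (essential supremum of $|s^{-\beta}f(s,y)|$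 over $(\frac t2,t]\times B(x,t)$ if $r=\infty$). For $0<p,q,r\le\infty$ the tent space $\mathrm T^{p,q,r}_\beta$ is the set of measurable $f$ with finite (quasi-)norm, where $$\|f\|_{\mathrm T^{p,q,r}_\beta}=\Big\|\Big(\int_0^\infty (W_{r,\beta}f(t,\cdot))^q\frac{\mathrm{d}t}{t}\Big)^{1/q}\Big\|_{L^p(\mathbb{R}^d)}\quad(p<\infty),$$ with $\operatorname{ess\,sup}_{t>0}$ in place of the $t$-integral if $q=\infty$; $$\|f\|_{\mathrm T^{\infty,q,r}_\beta}=\sup_{\tau>0}\sup_{y\in\mathbb{R}^d}\Big(\int_0^\tau⨍_{B(y,\tau)}(W_{r,\beta}f(t,x))^q\frac{\mathrm{d}x\,\mathrm{d}t}{t}\Big)^{1/q}\quad(q<\infty),\qquad \|f\|_{\mathrm T^{\infty,\infty,r}_\beta}=\sup_{t>0}\sup_{x\in\mathbb{R}^d}W_{r,\beta}f(t,x).$$ *)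

theory Defs
  imports "HOL-Probability.Essential_Supremum" "HOL-Library.FuncSet"
begin

text \<open>
  The Euclidean space of dimension \<open>d\<close> is a type \<open>'a\<close> of class \<open>euclidean_space\<close>, so that
  \<open>d = DIM('a)\<close>. Functions on the half-space are total functions on \<open>real \<times> 'a\<close>; their values
  outside \<open>half_space\<close> are irrelevant everywhere. Exponents and (quasi-)norms live in \<open>ennreal\<close>,
  so that a norm is \<open>\<infinity>\<close> exactly when it fails to be finite.
\<close>

definition half_space :: "(real \<times> 'a::euclidean_space) set"
  where "half_space = {0<..} \<times> UNIV"

abbreviation half_space_measurable :: "(real \<times> 'a::euclidean_space \<Rightarrow> complex) \<Rightarrow> bool"
  where "half_space_measurable f \<equiv> f \<in> borel_measurable (lebesgue_on half_space)"

text \<open>The measure \<open>dt/t\<close> on the half-line and the measure \<open>dy ds/s\<close> on the half-space.\<close>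

definition dt_over_t :: "real measure"
  where "dt_over_t = density (lebesgue_on {0<..}) (\<lambda>t. ennreal (1 / t))"

definition dyds_over_s :: "(real \<times> 'a::euclidean_space) measure"
  where "dyds_over_s = density (lebesgue_on half_space) (\<lambda>(s, y). ennreal (1 / s))"

text \<open>Powers with base in \<open>[0,\<infinity>]\<close>; only exponents \<open>a > 0\<close> are used.\<close>

definition epow :: "ennreal \<Rightarrow> real \<Rightarrow> ennreal"
  where "epow x a = (if x = \<infinity> then \<infinity> else ennreal (enn2real x powr a))"

definition Lp_norm :: "'b measure \<Rightarrow> ennreal \<Rightarrow> ('b \<Rightarrow> ennreal) \<Rightarrow> ennreal"
  where "Lp_norm M p h =
    (if p = \<infinity> then esssup M h
     else epow (\<integral>\<^sup>+ x. epow (h x) (enn2real p) \<partial>M) (1 / enn2real p))"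

definition mean_value :: "'b::euclidean_space set \<Rightarrow> ('b \<Rightarrow> ennreal) \<Rightarrow> ennreal"
  where "mean_value S h = (\<integral>\<^sup>+ x\<in>S. h x \<partial>lebesgue) / emeasure lebesgue S"

definition conj_exponent :: "ennreal \<Rightarrow> ennreal"
  where "conj_exponent p = (if p \<le> 1 then \<infinity> else if p = \<infinity> then 1 else p / (p - 1))"

lemma conj_exponent_sum:
  assumes "1 < p" "p < \<infinity>"
  shows "1 / p + 1 / conj_exponent p = 1"
proof -
  obtain x where x: "p = ennreal x" "0 \<le> x"
    using assms by (cases p) auto
  have x1: "1 < x"
    using assms(1) unfolding x(1) ennreal_1[symmetric] by (subst (asm) ennreal_less_iff) auto
  have "p - 1 = ennreal (x - 1)"
    unfolding x(1) ennreal_1[symmetric] by (rule ennreal_minus) simp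
  then have "conj_exponent p = ennreal (x / (x - 1))"
    using assms x x1 by (auto simp: conj_exponent_def divide_ennreal)
  moreover have "1 / ennreal x = ennreal (1 / x)"
    using x1 unfolding ennreal_1[symmetric] by (subst divide_ennreal) auto
  moreover have "1 / ennreal (x / (x - 1)) = ennreal ((x - 1) / x)"
    using x1 unfolding ennreal_1[symmetric] by (subst divide_ennreal) auto
  moreover have "ennreal (1 / x) + ennreal ((x - 1) / x) = ennreal (1 / x + (x - 1) / x)"
    using x1 by (intro ennreal_plus[symmetric]) auto
  moreover have "1 / x + (x - 1) / x = 1"
    using x1 by (simp add: field_simps)
  ultimately show ?thesis
    by (simp add: x(1))
qed

text \<open>
  The Whitney average. For measurable \<open>f\<close> the iterated mean over \<open>t/2 < s \<le> t\<close> and over the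
  ball is the mean over the box, by Tonelli's theorem.
\<close>

definition whitney_box :: "real \<Rightarrow> 'a::euclidean_space \<Rightarrow> (real \<times> 'a) set"
  where "whitney_box t x = {t/2<..t} \<times> ball x t"

definition whitney ::
  "ennreal \<Rightarrow> real \<Rightarrow> (real \<times> 'a::euclidean_space \<Rightarrow> complex) \<Rightarrow> real \<Rightarrow> 'a \<Rightarrow> ennreal"
  where "whitney r \<beta> f t x =
    (let h = (\<lambda>(s, y). ennreal (norm (s powr (- \<beta>) *\<^sub>R f (s, y)))) in
     if r = \<infinity> then esssup (lebesgue_on (whitney_box t x)) h
     else epow (mean_value (whitney_box t x) (\<lambda>z. epow (h z) (enn2real r))) (1 / enn2real r))"

definition tent_norm ::
  "ennreal \<Rightarrow> ennreal \<Rightarrow> ennreal \<Rightarrow> real \<Rightarrow> (real \<times> 'a::euclidean_space \<Rightarrow> complex) \<Rightarrow> ennreal"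
  where "tent_norm p q r \<beta> f =
    (if p < \<infinity> then Lp_norm lebesgue p (\<lambda>x. Lp_norm dt_over_t q (\<lambda>t. whitney r \<beta> f t x))
     else if q < \<infinity> then
       (SUP \<tau>\<in>{0<..}. SUP y. epow
         (\<integral>\<^sup>+ t\<in>{0<..<\<tau>}. mean_value (ball y \<tau>) (\<lambda>x. epow (whitney r \<beta> f t x) (enn2real q))
            \<partial>dt_over_t) (1 / enn2real q))
     else (SUP t\<in>{0<..}. SUP x. whitney r \<beta> f t x))"

text \<open>
  Elements are functions rather than classes modulo equality almost everywhere.
\<close>

definition tent_space ::
  "ennreal \<Rightarrow> ennreal \<Rightarrow> ennreal \<Rightarrow> real \<Rightarrow> (real \<times> 'a::euclidean_space \<Rightarrow> complex) set"
  where "tent_space p q r \<beta> = {f. half_space_measurable f \<and> tent_norm p q r \<beta> f < \<infinity>}"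

text \<open>
  The anti-dual of a space \<open>V\<close> of functions with (quasi-)norm \<open>N\<close>. Functionals are extensional,
  i.e. fixed to a dummy value outside \<open>V\<close>, so that equality of functionals is equality on \<open>V\<close>.
  By boundedness they agree on functions whose difference has \<open>N\<close>-norm zero, hence they are the
  functionals on the quotient by equality almost everywhere.
\<close>

definition anti_dual ::
  "('b \<Rightarrow> complex) set \<Rightarrow> (('b \<Rightarrow> complex) \<Rightarrow> ennreal) \<Rightarrow> (('b \<Rightarrow> complex) \<Rightarrow> complex) set"
  where "anti_dual V N = {\<Lambda> \<in> extensional V.
    (\<forall>g\<in>V. \<forall>h\<in>V. \<Lambda> (\<lambda>z. g z + h z) = \<Lambda> g + \<Lambda> h) \<and>
    (\<forall>c. \<forall>g\<in>V. \<Lambda> (\<lambda>z. c * g z) = cnj c * \<Lambda> g) \<and>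
    (\<exists>C::real. \<forall>g\<in>V. ennreal (norm (\<Lambda> g)) \<le> ennreal C * N g)}"

definition anti_dual_norm ::
  "('b \<Rightarrow> complex) set \<Rightarrow> (('b \<Rightarrow> complex) \<Rightarrow> ennreal) \<Rightarrow> (('b \<Rightarrow> complex) \<Rightarrow> complex) \<Rightarrow> ennreal"
  where "anti_dual_norm V N \<Lambda> = (SUP g\<in>{g\<in>V. N g \<le> 1}. ennreal (norm (\<Lambda> g)))"

definition L2_pairing ::
  "(real \<times> 'a::euclidean_space \<Rightarrow> complex) set \<Rightarrow> (real \<times> 'a \<Rightarrow> complex)
     \<Rightarrow> (real \<times> 'a \<Rightarrow> complex) \<Rightarrow> complex"
  where "L2_pairing V f = (\<lambda>g\<in>V. \<integral>z. f z * cnj (g z) \<partial>dyds_over_s)"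

text \<open>
  \<open>V'\<close> with norm \<open>N'\<close> is identified with the anti-dual of \<open>V\<close> via the pairing: \<open>f \<mapsto> L2_pairing V f\<close>
  is linear, maps \<open>V'\<close> onto the anti-dual, is injective modulo equality almost everywhere, and
  the norms are equivalent.
\<close>

definition anti_dual_identified ::
  "(real \<times> 'a::euclidean_space \<Rightarrow> complex) set \<Rightarrow> ((real \<times> 'a \<Rightarrow> complex) \<Rightarrow> ennreal)
     \<Rightarrow> (real \<times> 'a \<Rightarrow> complex) set \<Rightarrow> ((real \<times> 'a \<Rightarrow> complex) \<Rightarrow> ennreal) \<Rightarrow> bool"
  where "anti_dual_identified V N V' N' \<longleftrightarrow>
    (\<forall>f1\<in>V'. \<forall>f2\<in>V'. \<forall>a b. \<forall>g\<in>V.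
        L2_pairing V (\<lambda>z. a * f1 z + b * f2 z) g = a * L2_pairing V f1 g + b * L2_pairing V f2 g) \<and>
    L2_pairing V ` V' = anti_dual V N \<and>
    (\<forall>f1\<in>V'. \<forall>f2\<in>V'.
        L2_pairing V f1 = L2_pairing V f2 \<longleftrightarrow> (AE z in lebesgue_on half_space. f1 z = f2 z)) \<and>
    (\<exists>c::real. \<exists>C::real. 0 < c \<and> 0 < C \<and> (\<forall>f\<in>V'.
        ennreal c * N' f \<le> anti_dual_norm V N (L2_pairing V f) \<and>
        anti_dual_norm V N (L2_pairing V f) \<le> ennreal C * N' f))"

end

theory Submission
  imports Defs
begin

text \<open>
  Whitney averages are comparable with averages over boxes on top of dyadic cubes, provided that
  every ball is covered by a cube of one of finitely many shifted grids. This turns a tent norm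
  into a mixed \<open>L\<^sup>p(\<ell>\<^sup>q)\<close> norm of a sequence of functions, the \<open>k\<close>-th being constant on the cubes of
  generation \<open>k\<close>. Such a norm does not essentially decrease when every function is restricted to a
  subset filling a fixed proportion of each of its cubes; this takes the place of the maximal
  function, also in the range \<open>q < 1\<close>. The inequality follows from the scalar ones, for \<open>p = 1\<close>
  after a restriction given by Carleson's stopping times. Conversely, a function satisfying the
  dual estimate is tested with an extremal sequence, whose \<open>k\<close>-th entry may depend only on
  scales not smaller than \<open>k\<close> because it must be constant on the cubes of generation \<open>k\<close>. A functional
  is represented by applying the Radon-Nikodym theorem to its values on indicator functions times
  a strictly positive element of the tent space.
\<close>

section \<open>Powers, Hoelder and Young inequalities in \<open>[0,\<infinity>]\<close>\<close>

text \<open>For q < 1 the tent space is only quasi-normed, and for q \<le> 1 its dual has exponent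
  \<infinity> in the scale variable. Arguments by convexity or by duality of Banach-space valued L^p
  spaces do not reach this range, so explicit test functions are used in both directions. The
  obstacle to working with cubes is that a ball near a dyadic hyperplane lies in no dyadic cube of
  comparable size; shifting by a third in any subset of the coordinates gives 2^d grids, one of
  which serves each ball. The price is an enlargement of coefficients from cubes to big cubes, which
  is unbounded pointwise and is undone only after integration. Scales are truncated to
  \<open>ks M\<close> with constants independent of \<open>M\<close>, which keeps finite what has to
  be absorbed. For functionals, finiteness of p, q and r enters through dominated convergence, which
  makes the values on indicators times the positive element countably additive. The density obtained
  from them is at first only integrable; that it belongs to the dual tent space is the converse of
  the Hoelder inequality.\<close>

abbreviation nn_lborel :: "('a::euclidean_space \<Rightarrow> ennreal) \<Rightarrow> ennreal" (binder "NN " 10)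
  where "nn_lborel f \<equiv> nn_integral lborel f"

abbreviation bm :: "('a::topological_space \<Rightarrow> 'b::topological_space) \<Rightarrow> bool"
  where "bm f \<equiv> f \<in> borel_measurable borel"

abbreviation ks :: "nat \<Rightarrow> int set"
  where "ks M \<equiv> {- int M..int M}"

lemma epow_0 [simp]: "epow 0 a = 0" by (simp add: epow_def)

lemma epow_1_left [simp]: "epow 1 a = 1" by (simp add: epow_def)

lemma epow_top [simp]: "epow top a = top" by (simp add: epow_def)

lemma epow_ennreal: "0 \<le> x \<Longrightarrow> epow (ennreal x) a = ennreal (x powr a)"
  by (simp add: epow_def)

lemma epow_eq_top_iff [simp]: "epow x a = top \<longleftrightarrow> x = top" by (simp add: epow_def)

lemma epow_less_top_iff [simp]: "epow x a < top \<longleftrightarrow> x < top"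
  by (simp add: less_top[symmetric])

lemma epow_eq_0_iff [simp]: "epow x a = 0 \<longleftrightarrow> x = 0" by (cases x) (auto simp: epow_ennreal)

lemma epow_one [simp]: "epow x 1 = x" by (cases x) (auto simp: epow_ennreal)

lemma epow_mono: "x \<le> y \<Longrightarrow> 0 \<le> a \<Longrightarrow> epow x a \<le> epow y a"
  by (cases x; cases y) (auto simp: epow_ennreal ennreal_le_iff powr_mono2 top_unique)

lemma epow_epow: "epow (epow x a) b = epow x (a * b)" by (cases x) (auto simp: epow_ennreal powr_powr)

lemma epow_mult: "epow (x * y) a = epow x a * epow y a"
proof (cases "x = 0 \<or> y = 0")
  case False
  then show ?thesis by (cases x; cases y)
       (auto simp: epow_ennreal ennreal_mult[symmetric] powr_mult ennreal_mult_top ennreal_top_mult)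
qed auto

text \<open>The conventions that 0 and \<infinity> are fixed by every power, also by negative ones,
  make the rule unconditional. It is used later with negative exponents, to divide by a power of a
  norm that may vanish.\<close>

lemma epow_add: "epow x (a + b) = epow x a * epow x b"
  by (cases x) (auto simp: epow_ennreal ennreal_mult[symmetric] powr_add)

lemma epow_le_iff: "0 < a \<Longrightarrow> epow x a \<le> epow y a \<longleftrightarrow> x \<le> y"
  using epow_mono[of x y a] epow_mono[of "epow x a" "epow y a" "1 / a"] by (auto simp: epow_epow)

lemma epow_le_swap: "0 < a \<Longrightarrow> epow x a \<le> y \<longleftrightarrow> x \<le> epow y (1 / a)"
  using epow_le_iff[of a x "epow y (1 / a)"] by (simp add: epow_epow)

lemma epow_ge_swap: "0 < a \<Longrightarrow> y \<le> epow x a \<longleftrightarrow> epow y (1 / a) \<le> x"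
  using epow_le_iff[of a "epow y (1 / a)" x] by (simp add: epow_epow)

lemma epow_SUP: "0 < a \<Longrightarrow> epow (SUP i\<in>I. f i) a = (SUP i\<in>I. epow (f i) a)"
proof (rule antisym)
  assume a: "0 < a"
  show "epow (SUP i\<in>I. f i) a \<le> (SUP i\<in>I. epow (f i) a)" unfolding epow_le_swap[OF a]
    by (intro SUP_least, subst epow_le_swap[OF a, symmetric]) (rule SUP_upper)
  show "(SUP i\<in>I. epow (f i) a) \<le> epow (SUP i\<in>I. f i) a"
    using a by (intro SUP_least epow_mono SUP_upper) auto
qed

lemma borel_measurable_epow [measurable (raw)]:
  assumes "f \<in> borel_measurable M"
  shows "(\<lambda>x. epow (f x) a) \<in> borel_measurable M"
proof -
  have "(\<lambda>x. if f x = \<infinity> then \<infinity> else ennreal (enn2real (f x) powr a)) \<in> borel_measurable M"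
    using assms by measurable
  then show ?thesis unfolding epow_def .
qed

text \<open>The sum is at most the cardinality times its largest term. This crude bound covers
  concave and convex powers at once; it is applied to index sets of bounded size or where only
  finiteness matters.\<close>

lemma epow_sum_le:
  assumes "finite I" "0 \<le> a"
  shows "epow (\<Sum>i\<in>I. f i) a \<le> ennreal (real (card I) powr a) * (\<Sum>i\<in>I. epow (f i) a)"
proof (cases "I = {}")
  case False
  define m where "m = Max (f ` I)"
  have m: "m \<in> f ` I" unfolding m_def using assms False by (intro Max_in) auto
  have "(\<Sum>i\<in>I. f i) \<le> of_nat (card I) * m"
    unfolding m_def using assms by (intro sum_bounded_above Max_ge) auto
  then have "epow (\<Sum>i\<in>I. f i) a \<le> epow (ennreal (real (card I)) * m) a"
    using assms by (intro epow_mono) (auto simp: ennreal_of_nat_eq_real_of_nat)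
  also have "\<dots> = ennreal (real (card I) powr a) * epow m a" by (simp add: epow_mult epow_ennreal)
  also have "\<dots> \<le> ennreal (real (card I) powr a) * (\<Sum>i\<in>I. epow (f i) a)"
  proof -
    obtain i where i: "i \<in> I" "m = f i" using m by auto
    show ?thesis unfolding i(2) using i(1) assms by (intro mult_left_mono member_le_sum) auto
  qed
  finally show ?thesis .
qed auto

lemma epow_add_le:
  assumes "0 \<le> a"
  shows "epow (x + y) a \<le> ennreal (2 powr a) * (epow x a + epow y a)"
  using epow_sum_le[of "{False, True}" a "\<lambda>b. if b then x else y"] assms by (simp add: add.commute)

text \<open>The embedding of l^a into l^1 for a \<le> 1: when \<open>f i\<close> is split into its
  powers a and 1 - a, the second factor is at most the power 1 - a of the l^a norm.\<close>

lemma sum_le_epow_sum: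
  assumes "finite I" "0 < a" "a \<le> 1"
  shows "(\<Sum>i\<in>I. f i) \<le> epow (\<Sum>i\<in>I. epow (f i) a) (1 / a)"
proof -
  define s where "s = (\<Sum>i\<in>I. epow (f i) a)"
  have le: "f i \<le> epow s (1 / a)" if "i \<in> I" for i unfolding s_def using assms that
    by (subst epow_le_swap[symmetric]) (auto intro: member_le_sum)
  show ?thesis
  proof (cases "s = 0 \<or> s = top")
    case True
    then show ?thesis using le assms by (auto simp: s_def[symmetric] intro!: sum_nonneg_eq_0_iff[THEN iffD2])
  next
    case False
    show ?thesis
    proof (cases "a = 1")
      case a: False
      have "(\<Sum>i\<in>I. f i) = (\<Sum>i\<in>I. epow (f i) (a + (1 - a)))" by simp
      also have "\<dots> = (\<Sum>i\<in>I. epow (f i) a * epow (f i) (1 - a))" by (simp only: epow_add)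
      also have "\<dots> \<le> (\<Sum>i\<in>I. epow (f i) a * epow (epow s (1 / a)) (1 - a))"
        using le assms by (intro sum_mono mult_left_mono epow_mono) auto
      also have "\<dots> = s * epow s (1 / a - 1)"
        using assms by (simp add: s_def[symmetric] sum_distrib_right[symmetric] epow_epow field_simps)
      also have "\<dots> = epow s (1 / a)" using epow_add[of s 1 "1 / a - 1"] by simp
      finally show ?thesis by (simp add: s_def)
    qed simp
  qed
qed

lemma Youngs_inequality_ennreal:
  fixes a b :: ennreal
  assumes "1 < p" "1 < q" "1 / p + 1 / q = 1"
  shows "a * b \<le> ennreal (1 / p) * epow a p + ennreal (1 / q) * epow b q"
proof (cases "a = top \<or> b = top")
  case True
  then show ?thesis using assms by (auto simp: ennreal_mult_top)
next
  case False
  then obtain x y where xy: "a = ennreal x" "0 \<le> x" "b = ennreal y" "0 \<le> y" by (cases a; cases b) auto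
  have "ennreal (x * y) \<le> ennreal (x powr p / p + y powr q / q)"
    using Youngs_inequality[of p q x y] assms xy by (intro ennreal_leI) auto
  also have "\<dots> = ennreal (1 / p) * epow a p + ennreal (1 / q) * epow b q"
    using assms xy by (simp add: epow_ennreal ennreal_mult[symmetric] ennreal_plus[symmetric] del: ennreal_plus)
  finally show ?thesis using xy by (simp add: ennreal_mult)
qed

lemma Holder_nn_integral:
  assumes [measurable]: "f \<in> borel_measurable M" "g \<in> borel_measurable M"
    and pq: "1 < p" "1 < q" "1 / p + 1 / q = 1"
  shows "(\<integral>\<^sup>+x. f x * g x \<partial>M) \<le>
    epow (\<integral>\<^sup>+x. epow (f x) p \<partial>M) (1 / p) * epow (\<integral>\<^sup>+x. epow (g x) q \<partial>M) (1 / q)"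
proof -
  define A where "A = (\<integral>\<^sup>+x. epow (f x) p \<partial>M)"
  define B where "B = (\<integral>\<^sup>+x. epow (g x) q \<partial>M)"
  show ?thesis
  proof (cases "A = 0 \<or> B = 0")
    case True
    then have "AE x in M. f x * g x = 0"
    proof
      assume "A = 0"
      then have "AE x in M. epow (f x) p = 0" unfolding A_def by (subst (asm) nn_integral_0_iff_AE) auto
      then show ?thesis by eventually_elim auto
    next
      assume "B = 0"
      then have "AE x in M. epow (g x) q = 0" unfolding B_def by (subst (asm) nn_integral_0_iff_AE) auto
      then show ?thesis by eventually_elim auto
    qed
    then have "(\<integral>\<^sup>+x. f x * g x \<partial>M) = 0" by (subst nn_integral_0_iff_AE) auto
    then show ?thesis by simp
  next
    case nz: False
    show ?thesis
    proof (cases "A = top \<or> B = top")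
      case True
      then have "epow A (1 / p) * epow B (1 / q) = top" using nz by (auto simp: ennreal_mult_eq_top_iff)
      then show ?thesis by (simp add: A_def B_def)
    next
      case False
      then obtain a b where ab: "A = ennreal a" "0 < a" "B = ennreal b" "0 < b"
        using nz by (cases A; cases B) (auto simp: less_le)
      \<comment> \<open>The functions are divided by their norms \<open>s\<close> and
        \<open>t\<close>, after which Young's inequality integrates to 1 / p + 1 / q = 1.\<close>
      define s t where "s = a powr (1 / p)" and "t = b powr (1 / q)"
      have st: "0 < s" "0 < t" "s powr p = a" "t powr q = b" using ab pq by (auto simp: s_def t_def powr_powr)
      have "(\<integral>\<^sup>+x. f x * g x \<partial>M) =
          (\<integral>\<^sup>+x. ennreal (s * t) * ((ennreal (1 / s) * f x) * (ennreal (1 / t) * g x)) \<partial>M)"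
      proof (intro nn_integral_cong)
        fix x
        have "ennreal (s * t) * ((ennreal (1 / s) * f x) * (ennreal (1 / t) * g x)) =
          (ennreal (s * t) * ennreal (1 / s) * ennreal (1 / t)) * (f x * g x)" by (simp only: ac_simps)
        also have "ennreal (s * t) * ennreal (1 / s) * ennreal (1 / t) = 1"
          using st by (simp add: ennreal_mult[symmetric] ennreal_1[symmetric] del: ennreal_1)
        finally show "f x * g x = ennreal (s * t) * ((ennreal (1 / s) * f x) * (ennreal (1 / t) * g x))" by simp
      qed
      also have "\<dots> = ennreal (s * t) * (\<integral>\<^sup>+x. (ennreal (1 / s) * f x) * (ennreal (1 / t) * g x) \<partial>M)"
        by (rule nn_integral_cmult) measurable
      also have "(\<integral>\<^sup>+x. (ennreal (1 / s) * f x) * (ennreal (1 / t) * g x) \<partial>M) \<le>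
         (\<integral>\<^sup>+x. ennreal (1 / p) * epow (ennreal (1 / s) * f x) p
                + ennreal (1 / q) * epow (ennreal (1 / t) * g x) q \<partial>M)"
        using pq by (intro nn_integral_mono Youngs_inequality_ennreal)
      also have "\<dots> = ennreal (1 / p) * (ennreal (1 / a) * A) + ennreal (1 / q) * (ennreal (1 / b) * B)"
        using st pq by (simp add: nn_integral_add nn_integral_cmult epow_mult A_def B_def
            epow_ennreal powr_divide)
      also have "\<dots> = ennreal (1 / p + 1 / q)"
        using ab pq by (simp add: ennreal_mult[symmetric] ennreal_plus[symmetric] del: ennreal_plus)
      also have "\<dots> = 1" using pq by simp
      finally have "(\<integral>\<^sup>+x. f x * g x \<partial>M) \<le> ennreal (s * t)"
        using mult_left_mono by fastforce
      also have "\<dots> = epow A (1 / p) * epow B (1 / q)"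
        using ab st by (simp add: epow_ennreal s_def t_def ennreal_mult)
      finally show ?thesis by (simp add: A_def B_def)
    qed
  qed
qed

lemma Holder_sum_ennreal:
  fixes f g :: "'b \<Rightarrow> ennreal"
  assumes "finite I" and pq: "1 < p" "1 < q" "1 / p + 1 / q = 1"
  shows "(\<Sum>i\<in>I. f i * g i) \<le>
    epow (\<Sum>i\<in>I. epow (f i) p) (1 / p) * epow (\<Sum>i\<in>I. epow (g i) q) (1 / q)"
  using Holder_nn_integral[of f "count_space I" g p q] assms by (simp add: nn_integral_count_space_finite)

section \<open>Sums weighted by powers of partial sums\<close>

text \<open>
  For a nondecreasing sequence with increments \<open>v i\<close> and partial sums \<open>a i\<close>, the sum of
  \<open>v i * a i powr (\<theta> - 1)\<close> compares with \<open>\<integral> u powr (\<theta> - 1) du\<close>.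
\<close>

lemma powr_increment_le:
  fixes x y \<theta> :: real
  assumes "0 \<le> x" "x \<le> y" "0 < \<theta>"
  shows "y powr \<theta> - x powr \<theta> \<le> max 1 \<theta> * ((y - x) * y powr (\<theta> - 1))"
    and "min 1 \<theta> * ((y - x) * y powr (\<theta> - 1)) \<le> y powr \<theta> - x powr \<theta>"
proof -
  have "y powr \<theta> - x powr \<theta> \<le> max 1 \<theta> * ((y - x) * y powr (\<theta> - 1)) \<and>
    min 1 \<theta> * ((y - x) * y powr (\<theta> - 1)) \<le> y powr \<theta> - x powr \<theta>"
  proof (cases "x = 0 \<or> x = y")
    case True
    then show ?thesis
    proof
      assume "x = 0"
      moreover have "y * y powr (\<theta> - 1) = y powr \<theta>"
        using assms by (cases "y = 0") (auto simp: powr_mult_base)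
      moreover have "1 * y powr \<theta> \<le> max 1 \<theta> * y powr \<theta>" "min 1 \<theta> * y powr \<theta> \<le> 1 * y powr \<theta>"
        by (intro mult_right_mono; simp)+
      ultimately show ?thesis by simp
    qed auto
  next
    case False
    then have xy: "0 < x" "x < y" using assms by auto
    have y: "y * y powr (\<theta> - 1) = y powr \<theta>" and x: "x * x powr (\<theta> - 1) = x powr \<theta>"
      using xy by (simp_all add: powr_mult_base)
    \<comment> \<open>The mean value theorem gives the bound with factor \<theta>; the one with
      factor 1 comes from comparing the powers of x and y of exponent \<theta> - 1 directly.\<close>
    obtain z where z: "x < z" "z < y" "y powr \<theta> - x powr \<theta> = (y - x) * (\<theta> * z powr (\<theta> - 1))"
    proof -
      have "\<exists>z>x. z < y \<and> y powr \<theta> - x powr \<theta> = (y - x) * (\<theta> * z powr (\<theta> - 1))"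
        using xy by (intro MVT2) (auto intro!: derivative_eq_intros)
      then show ?thesis using that by blast
    qed
    show ?thesis
    proof (cases "\<theta> \<le> 1")
      case True
      have "y powr (\<theta> - 1) \<le> z powr (\<theta> - 1)" using z xy True by (intro powr_mono2') auto
      then have "(y - x) * (\<theta> * y powr (\<theta> - 1)) \<le> y powr \<theta> - x powr \<theta>"
        unfolding z(3) using xy assms by (intro mult_left_mono) auto
      moreover have "y powr (\<theta> - 1) \<le> x powr (\<theta> - 1)" using xy True by (intro powr_mono2') auto
      then have "x * y powr (\<theta> - 1) \<le> x powr \<theta>"
        unfolding x[symmetric] using xy by (intro mult_left_mono) auto
      then have "y powr \<theta> - x powr \<theta> \<le> (y - x) * y powr (\<theta> - 1)"
        using y by (simp add: algebra_simps)
      ultimately show ?thesis using True xy by (simp add: max_def min_def ac_simps)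
    next
      case False
      have "z powr (\<theta> - 1) \<le> y powr (\<theta> - 1)" using z xy False by (intro powr_mono2) auto
      then have "y powr \<theta> - x powr \<theta> \<le> (y - x) * (\<theta> * y powr (\<theta> - 1))"
        unfolding z(3) using xy assms by (intro mult_left_mono) auto
      moreover have "x powr (\<theta> - 1) \<le> y powr (\<theta> - 1)" using xy False by (intro powr_mono2) auto
      then have "x powr \<theta> \<le> x * y powr (\<theta> - 1)"
        unfolding x[symmetric] using xy by (intro mult_left_mono) auto
      then have "(y - x) * y powr (\<theta> - 1) \<le> y powr \<theta> - x powr \<theta>"
        using y by (simp add: algebra_simps)
      ultimately show ?thesis using False xy by (simp add: max_def min_def ac_simps)
    qed
  qed
  then show "y powr \<theta> - x powr \<theta> \<le> max 1 \<theta> * ((y - x) * y powr (\<theta> - 1))"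
    "min 1 \<theta> * ((y - x) * y powr (\<theta> - 1)) \<le> y powr \<theta> - x powr \<theta>" by auto
qed

lemma sum_powr_partial_sums:
  fixes v :: "nat \<Rightarrow> real"
  assumes v: "\<And>i. i < n \<Longrightarrow> 0 \<le> v i" and \<theta>: "0 < \<theta>"
  shows "(\<Sum>i<n. v i) powr \<theta> \<le> max 1 \<theta> * (\<Sum>i<n. v i * (\<Sum>j\<le>i. v j) powr (\<theta> - 1))"
    and "min 1 \<theta> * (\<Sum>i<n. v i * (\<Sum>j\<le>i. v j) powr (\<theta> - 1)) \<le> (\<Sum>i<n. v i) powr \<theta>"
proof -
  have "(\<Sum>i<n. v i) powr \<theta> \<le> max 1 \<theta> * (\<Sum>i<n. v i * (\<Sum>j\<le>i. v j) powr (\<theta> - 1)) \<and>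
    min 1 \<theta> * (\<Sum>i<n. v i * (\<Sum>j\<le>i. v j) powr (\<theta> - 1)) \<le> (\<Sum>i<n. v i) powr \<theta>"
    using v
  proof (induction n)
    case (Suc n)
    have a: "0 \<le> (\<Sum>i<n. v i)" "(\<Sum>i<n. v i) \<le> (\<Sum>j\<le>n. v j)" "(\<Sum>j\<le>n. v j) - (\<Sum>i<n. v i) = v n"
      using Suc.prems by (auto intro!: sum_nonneg simp: lessThan_Suc_atMost[symmetric])
    note inc = powr_increment_le[OF a(1,2) \<theta>]
    from Suc.IH[OF Suc.prems] inc show ?case
      unfolding a(3) by (simp add: lessThan_Suc_atMost[symmetric] algebra_simps)
  qed simp
  then show "(\<Sum>i<n. v i) powr \<theta> \<le> max 1 \<theta> * (\<Sum>i<n. v i * (\<Sum>j\<le>i. v j) powr (\<theta> - 1))"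
    "min 1 \<theta> * (\<Sum>i<n. v i * (\<Sum>j\<le>i. v j) powr (\<theta> - 1)) \<le> (\<Sum>i<n. v i) powr \<theta>" by auto
qed

section \<open>Restriction to subsets of cells\<close>

text \<open>A partition is encoded by a labelling \<open>\<kappa>\<close> whose fibres are the
  cells, so that nestedness and constancy on cells become implications between equal labels. With
  countably many Borel cells such functions are automatically measurable.\<close>

definition cell_inv :: "('a \<Rightarrow> 'b) \<Rightarrow> ('a \<Rightarrow> 'c) \<Rightarrow> bool"
  where "cell_inv \<kappa> \<psi> \<longleftrightarrow> (\<forall>x y. \<kappa> x = \<kappa> y \<longrightarrow> \<psi> x = \<psi> y)"

lemma cell_invI: "(\<And>x y. \<kappa> x = \<kappa> y \<Longrightarrow> \<psi> x = \<psi> y) \<Longrightarrow> cell_inv \<kappa> \<psi>"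
  unfolding cell_inv_def by blast

lemma cell_invD: "cell_inv \<kappa> \<psi> \<Longrightarrow> \<kappa> x = \<kappa> y \<Longrightarrow> \<psi> x = \<psi> y"
  unfolding cell_inv_def by blast

locale cells =
  fixes \<kappa> :: "'a::euclidean_space \<Rightarrow> 'b" and v :: real
  assumes countable_cells: "countable (range \<kappa>)"
    and cell_sets: "\<And>a. \<kappa> -` {a} \<in> sets borel"
    and cell_measure: "\<And>x. emeasure lborel (\<kappa> -` {\<kappa> x}) = ennreal v"
    and cell_pos: "0 < v"
begin

lemma cell_inv_measurable:
  assumes "cell_inv \<kappa> \<psi>" "\<And>x. \<psi> x \<in> space N"
  shows "\<psi> \<in> measurable borel N"
proof -
  have \<kappa>: "\<kappa> \<in> measurable borel (count_space (range \<kappa>))"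
    using cell_sets by (auto simp: measurable_count_space_eq_countable[OF countable_cells])
  have eq: "\<psi> = (\<lambda>x. (\<lambda>a. \<psi> (inv \<kappa> a)) (\<kappa> x))"
  proof
    fix x
    have "\<kappa> (inv \<kappa> (\<kappa> x)) = \<kappa> x" by (rule f_inv_into_f) simp
    then show "\<psi> x = \<psi> (inv \<kappa> (\<kappa> x))" using assms(1) unfolding cell_inv_def by metis
  qed
  have "(\<lambda>a. \<psi> (inv \<kappa> a)) \<in> measurable (count_space (range \<kappa>)) N"
    using assms(2) by auto
  then show ?thesis by (subst eq) (rule measurable_compose[OF \<kappa>])
qed

lemma cell_inv_borel_measurable:
  fixes \<psi> :: "'a \<Rightarrow> 'c::topological_space"
  shows "cell_inv \<kappa> \<psi> \<Longrightarrow> bm \<psi>" by (rule cell_inv_measurable) auto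

text \<open>The conditional expectation with respect to the partition; all cells have the same
  volume \<open>v\<close>, so it divides by a constant.\<close>

definition avg :: "('a \<Rightarrow> ennreal) \<Rightarrow> 'a \<Rightarrow> ennreal"
  where "avg \<phi> x = (NN y. \<phi> y * indicator (\<kappa> -` {\<kappa> x}) y) / ennreal v"

lemma avg_inv: "cell_inv \<kappa> (avg \<phi>)" by (rule cell_invI) (simp add: avg_def)

lemma avg_measurable [measurable]: "bm (avg \<phi>)" by (rule cell_inv_borel_measurable[OF avg_inv])

lemma avg_one: "avg (\<lambda>_. 1) x = 1"
  using cell_pos by (simp add: avg_def cell_measure cell_sets ennreal_divide_self)

lemma avg_mono: "(\<And>y. \<phi> y \<le> \<psi> y) \<Longrightarrow> avg \<phi> x \<le> avg \<psi> x"
  unfolding avg_def by (intro divide_right_mono_ennreal nn_integral_mono mult_right_mono) auto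

lemma avg_add:
  assumes [measurable]: "bm \<phi>" "bm \<psi>"
  shows "avg (\<lambda>y. \<phi> y + \<psi> y) x = avg \<phi> x + avg \<psi> x"
proof -
  have [measurable]: "\<kappa> -` {\<kappa> x} \<in> sets borel" by (rule cell_sets)
  show ?thesis by (simp add: avg_def distrib_right nn_integral_add add_divide_distrib_ennreal)
qed

lemma avg_cmult_inv:
  assumes [measurable]: "bm \<phi>" and "cell_inv \<kappa> \<psi>"
  shows "avg (\<lambda>y. \<psi> y * \<phi> y) x = \<psi> x * avg \<phi> x"
proof -
  have [measurable]: "\<kappa> -` {\<kappa> x} \<in> sets borel" by (rule cell_sets)
  have "(NN y. \<psi> y * \<phi> y * indicator (\<kappa> -` {\<kappa> x}) y) =
      (NN y. \<psi> x * (\<phi> y * indicator (\<kappa> -` {\<kappa> x}) y))"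
    using assms(2) by (intro nn_integral_cong) (auto simp: indicator_def dest: cell_invD)
  also have "\<dots> = \<psi> x * (NN y. \<phi> y * indicator (\<kappa> -` {\<kappa> x}) y)"
    by (rule nn_integral_cmult) measurable
  finally show ?thesis by (simp add: avg_def ennreal_times_divide)
qed

text \<open>The averaging operator has the symmetric kernel \<open>indicator D / v\<close>, where
  \<open>D\<close> is the relation of lying in a common cell, a countable union of squares of cells.
  Tonelli's theorem moves it to \<open>\<psi>\<close>, which it leaves unchanged.\<close>

lemma nn_integral_avg:
  assumes [measurable]: "bm \<phi>" and \<psi>: "cell_inv \<kappa> \<psi>"
  shows "(NN x. \<phi> x * \<psi> x) = (NN x. avg \<phi> x * \<psi> x)"
proof -
  have [measurable]: "bm \<psi>" by (rule cell_inv_borel_measurable[OF \<psi>])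
  define D where "D = {p. \<kappa> (fst p) = \<kappa> (snd p)}"
  have "D = (\<Union>a\<in>range \<kappa>. (\<kappa> -` {a}) \<times> (\<kappa> -` {a}))" by (auto simp: D_def)
  also have "\<dots> \<in> sets (borel \<Otimes>\<^sub>M borel)"
    by (intro sets.countable_UN'[OF countable_cells]) (auto intro!: pair_measureI cell_sets)
  finally have [measurable]: "D \<in> sets (borel \<Otimes>\<^sub>M borel)" .
  have D: "indicator (\<kappa> -` {\<kappa> x}) y = (indicator D (x, y) :: ennreal)"
    "indicator D (x, y) = (indicator (\<kappa> -` {\<kappa> y}) x :: ennreal)" for x y
    by (auto simp: D_def indicator_def)
  have "(NN x. avg \<phi> x * \<psi> x) =
    (NN x. (NN y. \<phi> y * indicator D (x, y) * \<psi> x / ennreal v))"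
  proof (intro nn_integral_cong)
    fix x
    have "avg \<phi> x * \<psi> x = (NN y. \<phi> y * indicator D (x, y)) / ennreal v * \<psi> x"
        unfolding avg_def D(1) ..
    also have "\<dots> = (NN y. \<phi> y * indicator D (x, y)) * \<psi> x / ennreal v"
      by (metis ennreal_times_divide mult.commute)
    also have "\<dots> = (NN y. \<phi> y * indicator D (x, y) * \<psi> x) / ennreal v"
      by (subst nn_integral_multc) measurable
    also have "\<dots> = (NN y. \<phi> y * indicator D (x, y) * \<psi> x / ennreal v)"
      by (subst nn_integral_divide) measurable
    finally show "avg \<phi> x * \<psi> x = \<dots>" .
  qed
  also have "\<dots> = (NN y. (NN x. \<phi> y * indicator D (x, y) * \<psi> x / ennreal v))"
    by (rule lborel_pair.Fubini') measurable
  also have "\<dots> = (NN y. \<phi> y * \<psi> y)"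
  proof (intro nn_integral_cong)
    fix y
    have [measurable]: "\<kappa> -` {\<kappa> y} \<in> sets borel" by (rule cell_sets)
    have "(NN x. \<phi> y * indicator D (x, y) * \<psi> x / ennreal v) =
      (NN x. \<phi> y * \<psi> y / ennreal v * indicator (\<kappa> -` {\<kappa> y}) x)"
      unfolding D(2) using \<psi> by (intro nn_integral_cong) (auto simp: indicator_def dest: cell_invD)
    also have "\<dots> = \<phi> y * \<psi> y / ennreal v * ennreal v"
      by (simp add: nn_integral_cmult_indicator cell_measure)
    also have "\<dots> = \<phi> y * \<psi> y"
      using cell_pos by (simp add: ennreal_divide_times ennreal_mult_divide_eq)
    finally show "(NN x. \<phi> y * indicator D (x, y) * \<psi> x / ennreal v) = \<phi> y * \<psi> y" .
  qed
  finally show ?thesis ..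
qed

end

text \<open>
  The sets \<open>E i\<close> fill a fixed proportion of every cell of generation \<open>i\<close>; restricting each
  \<open>V i\<close> to \<open>E i\<close> does not essentially decrease the mixed norm. Testing the hypothesis with the
  powers \<open>a i powr (\<theta> - 1)\<close> of the partial sums, which are constant on the cells of generation
  \<open>i\<close>, replaces the maximal function of the classical proof.
\<close>

lemma sum_restrict_cells_real:
  fixes V :: "nat \<Rightarrow> 'a::euclidean_space \<Rightarrow> real" and \<kappa> :: "nat \<Rightarrow> 'a \<Rightarrow> 'b"
  assumes V: "\<And>i x. i < n \<Longrightarrow> 0 \<le> V i x" "\<And>i. i < n \<Longrightarrow> cell_inv (\<kappa> i) (V i)"
    and meas: "\<And>i. i < n \<Longrightarrow> bm (V i)" "\<And>i. i < n \<Longrightarrow> E i \<in> sets borel"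
    and nested: "\<And>i j x y. j \<le> i \<Longrightarrow> i < n \<Longrightarrow> \<kappa> i x = \<kappa> i y \<Longrightarrow> \<kappa> j x = \<kappa> j y"
    and H: "\<And>i \<psi>. i < n \<Longrightarrow> cell_inv (\<kappa> i) \<psi> \<Longrightarrow> bm \<psi> \<Longrightarrow>
      (NN x. \<psi> x) \<le> ennreal K * (NN x. \<psi> x * indicator (E i) x)"
    and K: "0 < K" and \<theta>: "0 < \<theta>"
    and fin: "(NN x. ennreal ((\<Sum>i<n. V i x * indicator (E i) x) powr \<theta>)) < top"
  shows "(NN x. ennreal ((\<Sum>i<n. V i x) powr \<theta>)) \<le>
    ennreal ((max 1 \<theta> * K / min 1 \<theta>) powr max 1 \<theta>) *
    (NN x. ennreal ((\<Sum>i<n. V i x * indicator (E i) x) powr \<theta>))"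
proof -
  define w where "w i x = V i x * indicator (E i) x" for i x
  define a where "a i x = (\<Sum>j\<le>i. V j x)" for i x
  define A where "A x = (\<Sum>i<n. V i x)" for x
  define B where "B x = (\<Sum>i<n. w i x)" for x
  define I where "I = (NN x. ennreal (A x powr \<theta>))"
  define J where "J = (NN x. ennreal (B x powr \<theta>))"
  have w: "0 \<le> w i x" "w i x \<le> V i x" if "i < n" for i x
    using V(1)[OF that] by (auto simp: w_def indicator_def)
  have [measurable]: "bm (w i)" if "i < n" for i using meas that unfolding w_def by measurable
  have a_meas [measurable]: "bm (a i)" if "i < n" for i
    using meas that unfolding a_def by (intro borel_measurable_sum) auto
  have [measurable]: "bm A" "bm B" using meas unfolding A_def B_def by measurable
  have a0: "0 \<le> a i x" if "i < n" for i x unfolding a_def using V(1) that by (intro sum_nonneg) auto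
  have AB: "0 \<le> B x" "B x \<le> A x" "0 \<le> A x" for x
    unfolding A_def B_def using V(1) w by (auto intro!: sum_nonneg sum_mono)
  have a_inv: "cell_inv (\<kappa> i) (a i)" if "i < n" for i
  proof (rule cell_invI)
    fix x y assume "\<kappa> i x = \<kappa> i y"
    then have "V j x = V j y" if "j \<le> i" for j
      using nested[OF that \<open>i < n\<close>] V(2)[of j] that \<open>i < n\<close> by (auto dest: cell_invD)
    then show "a i x = a i y" by (simp add: a_def)
  qed
  \<comment> \<open>The partial sum \<open>a i\<close> involves only indices up to \<open>i\<close>,
    whose cells are coarser, so \<open>V i * a i powr (\<theta> - 1)\<close> is constant on the
    cells of index \<open>i\<close> and \<open>H\<close> applies to each summand.\<close>
  have step: "I \<le> ennreal (max 1 \<theta> * K) *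
    (NN x. ennreal (\<Sum>i<n. w i x * a i x powr (\<theta> - 1)))"
  proof -
    have "I \<le> (NN x. ennreal (max 1 \<theta>) * (\<Sum>i<n. ennreal (V i x * a i x powr (\<theta> - 1))))"
      unfolding I_def
    proof (intro nn_integral_mono)
      fix x
      have "A x powr \<theta> \<le> max 1 \<theta> * (\<Sum>i<n. V i x * a i x powr (\<theta> - 1))"
        unfolding A_def a_def using V(1) \<theta> by (rule sum_powr_partial_sums(1))
      then have "ennreal (A x powr \<theta>) \<le> ennreal (max 1 \<theta> * (\<Sum>i<n. V i x * a i x powr (\<theta> - 1)))"
        by (rule ennreal_leI)
      also have "\<dots> = ennreal (max 1 \<theta>) * (\<Sum>i<n. ennreal (V i x * a i x powr (\<theta> - 1)))"
        using V(1) \<theta> by (subst sum_ennreal) (auto simp: ennreal_mult')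
      finally show "ennreal (A x powr \<theta>) \<le> \<dots>" .
    qed
    also have "\<dots> = ennreal (max 1 \<theta>) * (\<Sum>i<n. (NN x. ennreal (V i x * a i x powr (\<theta> - 1))))"
      using meas by (subst nn_integral_cmult, measurable) (subst nn_integral_sum, auto)
    also have "\<dots> \<le> ennreal (max 1 \<theta>) *
      (\<Sum>i<n. ennreal K * (NN x. ennreal (w i x * a i x powr (\<theta> - 1))))"
    proof (intro mult_left_mono sum_mono)
      fix i assume "i \<in> {..<n}"
      then have i: "i < n" by simp
      have "(NN x. ennreal (V i x * a i x powr (\<theta> - 1))) \<le>
        ennreal K * (NN x. ennreal (V i x * a i x powr (\<theta> - 1)) * indicator (E i) x)"
      proof (rule H[OF i])
        show "cell_inv (\<kappa> i) (\<lambda>x. ennreal (V i x * a i x powr (\<theta> - 1)))"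
          using V(2)[OF i] a_inv[OF i] unfolding cell_inv_def by metis
      qed (use i meas in measurable)
      also have "(NN x. ennreal (V i x * a i x powr (\<theta> - 1)) * indicator (E i) x) =
        (NN x. ennreal (w i x * a i x powr (\<theta> - 1)))"
        by (intro nn_integral_cong) (auto simp: w_def indicator_def)
      finally show "(NN x. ennreal (V i x * a i x powr (\<theta> - 1))) \<le>
        ennreal K * (NN x. ennreal (w i x * a i x powr (\<theta> - 1)))" .
    qed simp
    also have "\<dots> = ennreal (max 1 \<theta>) * (ennreal K *
      (NN x. (\<Sum>i<n. ennreal (w i x * a i x powr (\<theta> - 1)))))"
      by (subst nn_integral_sum) (auto simp: sum_distrib_left)
    also have "(NN x. (\<Sum>i<n. ennreal (w i x * a i x powr (\<theta> - 1)))) =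
      (NN x. ennreal (\<Sum>i<n. w i x * a i x powr (\<theta> - 1)))"
      using w by (intro nn_integral_cong sum_ennreal) auto
    finally show ?thesis using K by (simp add: ennreal_mult mult.assoc)
  qed
  have "I \<le> ennreal ((max 1 \<theta> * K / min 1 \<theta>) powr max 1 \<theta>) * J"
  proof (cases "\<theta> \<le> 1")
    case True
    \<comment> \<open>As \<theta> - 1 \<le> 0, replacing the partial sums of \<open>V\<close> by the
      smaller ones of \<open>w\<close> increases every term; the resulting sum is controlled by
      \<open>B powr \<theta>\<close>.\<close>
    have "(NN x. ennreal (\<Sum>i<n. w i x * a i x powr (\<theta> - 1))) \<le>
      (NN x. ennreal (1 / \<theta>) * ennreal (B x powr \<theta>))"
    proof (intro nn_integral_mono)
      fix x
      have "(\<Sum>i<n. w i x * a i x powr (\<theta> - 1)) \<le> (\<Sum>i<n. w i x * (\<Sum>j\<le>i. w j x) powr (\<theta> - 1))"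
      proof (intro sum_mono)
        fix i assume "i \<in> {..<n}"
        then have i: "i < n" by simp
        show "w i x * a i x powr (\<theta> - 1) \<le> w i x * (\<Sum>j\<le>i. w j x) powr (\<theta> - 1)"
        proof (cases "w i x = 0")
          case False
          then have "0 < w i x" using w(1)[OF i, of x] by simp
          moreover have "w i x \<le> (\<Sum>j\<le>i. w j x)" using w(1) i by (intro member_le_sum) auto
          moreover have "(\<Sum>j\<le>i. w j x) \<le> a i x" unfolding a_def using w(2) i by (intro sum_mono) auto
          ultimately show ?thesis using True by (intro mult_left_mono powr_mono2') auto
        qed simp
      qed
      also have "\<dots> \<le> B x powr \<theta> / \<theta>"
        using sum_powr_partial_sums(2)[of n "\<lambda>i. w i x" \<theta>] w(1) \<theta> True
        by (simp add: B_def min_def field_simps split: if_splits)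
      finally show "ennreal (\<Sum>i<n. w i x * a i x powr (\<theta> - 1)) \<le> ennreal (1 / \<theta>) * ennreal (B x powr \<theta>)"
        using \<theta> by (simp add: ennreal_mult[symmetric] ennreal_leI)
    qed
    also have "\<dots> = ennreal (1 / \<theta>) * J" unfolding J_def by (rule nn_integral_cmult) measurable
    finally have "I \<le> ennreal (max 1 \<theta> * K) * (ennreal (1 / \<theta>) * J)"
      by (intro order_trans[OF step] mult_left_mono) auto
    then show ?thesis
      using True K \<theta> by (cases "\<theta> = 1") (simp_all add: min_def max_def ennreal_mult[symmetric] mult.assoc[symmetric])
  next
    case False
    then have \<theta>1: "1 < \<theta>" by simp
    \<comment> \<open>Hoelder's inequality below bounds \<open>I\<close> by a multiple of its power
      1 - 1 / \<theta>, and dividing by that power requires finiteness. This follows from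
      \<open>H\<close> applied to each \<open>V i powr \<theta>\<close> separately.\<close>
    have I_fin: "I < top"
    proof -
      have "I \<le> (NN x. ennreal (real n powr \<theta>) * (\<Sum>i<n. ennreal (V i x powr \<theta>)))"
        unfolding I_def
      proof (intro nn_integral_mono)
        fix x
        show "ennreal (A x powr \<theta>) \<le> ennreal (real n powr \<theta>) * (\<Sum>i<n. ennreal (V i x powr \<theta>))"
        proof -
          have "(\<Sum>i<n. ennreal (V i x)) = ennreal (A x)"
            unfolding A_def using V(1) by (intro sum_ennreal) auto
          then show ?thesis
            using epow_sum_le[of "{..<n}" \<theta> "\<lambda>i. ennreal (V i x)"] \<theta> V(1) AB
            by (simp add: epow_ennreal)
        qed
      qed
      also have "\<dots> = ennreal (real n powr \<theta>) * (\<Sum>i<n. (NN x. ennreal (V i x powr \<theta>)))"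
        using meas by (subst nn_integral_cmult, measurable) (subst nn_integral_sum, auto)
      also have "\<dots> < top"
      proof (intro ennreal_mult_less_top[THEN iffD2] disjI2 conjI)
        have "(NN x. ennreal (V i x powr \<theta>)) < top" if i: "i < n" for i
        proof -
          have "(NN x. ennreal (V i x powr \<theta>)) \<le>
            ennreal K * (NN x. ennreal (V i x powr \<theta>) * indicator (E i) x)"
          proof (rule H[OF i])
            show "cell_inv (\<kappa> i) (\<lambda>x. ennreal (V i x powr \<theta>))"
              using V(2)[OF i] unfolding cell_inv_def by metis
          qed (use i meas in measurable)
          also have "\<dots> \<le> ennreal K * J" unfolding J_def
          proof (intro mult_left_mono nn_integral_mono)
            fix x
            have "w i x \<le> B x" unfolding B_def using w(1) i by (intro member_le_sum) auto
            then have "w i x powr \<theta> \<le> B x powr \<theta>" using w(1)[OF i] \<theta> by (intro powr_mono2) auto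
            then show "ennreal (V i x powr \<theta>) * indicator (E i) x \<le> ennreal (B x powr \<theta>)"
              by (auto simp: w_def indicator_def intro!: ennreal_leI)
          qed simp
          also have "\<dots> < top" using fin by (simp add: J_def B_def w_def ennreal_mult_less_top)
          finally show ?thesis .
        qed
        then show "(\<Sum>i<n. (NN x. ennreal (V i x powr \<theta>))) < top" by (simp add: less_top[symmetric])
      qed simp
      finally show ?thesis .
    qed
    define q where "q = \<theta> / (\<theta> - 1)"
    have q: "1 < q" "1 / \<theta> + 1 / q = 1" "(\<theta> - 1) * q = \<theta>" "1 / q = 1 - 1 / \<theta>"
      using \<theta>1 by (simp_all add: q_def field_simps)
    have "(NN x. ennreal (\<Sum>i<n. w i x * a i x powr (\<theta> - 1))) \<le>
      (NN x. ennreal (B x) * ennreal (A x powr (\<theta> - 1)))"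
    proof (intro nn_integral_mono)
      fix x
      have "(\<Sum>i<n. w i x * a i x powr (\<theta> - 1)) \<le> (\<Sum>i<n. w i x * A x powr (\<theta> - 1))"
      proof (intro sum_mono mult_left_mono powr_mono2)
        fix i assume "i \<in> {..<n}"
        then show "a i x \<le> A x" "0 \<le> a i x" "0 \<le> w i x"
          unfolding a_def A_def using V(1) w(1) by (auto intro!: sum_mono2 sum_nonneg)
      qed (use \<theta>1 in auto)
      then show "ennreal (\<Sum>i<n. w i x * a i x powr (\<theta> - 1)) \<le> ennreal (B x) * ennreal (A x powr (\<theta> - 1))"
        using AB by (simp add: ennreal_mult[symmetric] B_def sum_distrib_right ennreal_leI)
    qed
    also have "\<dots> \<le> epow (NN x. epow (ennreal (B x)) \<theta>) (1 / \<theta>) *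
        epow (NN x. epow (ennreal (A x powr (\<theta> - 1))) q) (1 / q)"
      using \<theta>1 q by (intro Holder_nn_integral) auto
    also have "\<dots> = epow J (1 / \<theta>) * epow I (1 - 1 / \<theta>)"
      using AB q by (simp add: epow_ennreal I_def J_def powr_powr)
    finally have "I \<le> ennreal (max 1 \<theta> * K) * (epow J (1 / \<theta>) * epow I (1 - 1 / \<theta>))"
      by (intro order_trans[OF step] mult_left_mono) auto
    then have le: "I \<le> ennreal (\<theta> * K) * (epow J (1 / \<theta>) * epow I (1 - 1 / \<theta>))"
      using \<theta>1 by (simp add: max_def)
    obtain i' where i': "I = ennreal i'" "0 \<le> i'" using I_fin by (cases I) auto
    have J_fin: "J < top" using fin by (simp add: J_def B_def w_def)
    obtain j' where j': "J = ennreal j'" "0 \<le> j'" using J_fin by (cases J) auto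
    have "i' \<le> (\<theta> * K) powr \<theta> * j'"
    proof (cases "i' = 0")
      case False
      then have ip: "0 < i'" using i' by simp
      have "i' \<le> \<theta> * K * (j' powr (1 / \<theta>) * i' powr (1 - 1 / \<theta>))"
        using le i' j' K \<theta>1 by (simp add: epow_ennreal ennreal_mult[symmetric])
      then have "i' powr (1 / \<theta>) * i' powr (1 - 1 / \<theta>) \<le> \<theta> * K * j' powr (1 / \<theta>) * i' powr (1 - 1 / \<theta>)"
        using ip by (simp add: powr_add[symmetric] mult.assoc)
      then have "i' powr (1 / \<theta>) \<le> \<theta> * K * j' powr (1 / \<theta>)" using ip by simp
      then have "(i' powr (1 / \<theta>)) powr \<theta> \<le> (\<theta> * K * j' powr (1 / \<theta>)) powr \<theta>"
        using \<theta>1 by (intro powr_mono2) auto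
      then show ?thesis using \<theta>1 i' j' K by (simp add: powr_powr powr_mult)
    qed (use K j' in auto)
    then show ?thesis using i' j' \<theta>1 by (simp add: max_def min_def ennreal_mult[symmetric] ennreal_leI)
  qed
  then show ?thesis by (simp add: I_def J_def A_def B_def w_def)
qed

text \<open>Unless the right-hand side is infinite, \<open>H\<close> applied to the powers of
  \<open>V i\<close> shows every \<open>V i\<close> to be finite almost everywhere, and real
  representatives may be used.\<close>

lemma sum_restrict_cells:
  fixes V :: "nat \<Rightarrow> 'a::euclidean_space \<Rightarrow> ennreal" and \<kappa> :: "nat \<Rightarrow> 'a \<Rightarrow> 'b"
  assumes V: "\<And>i. i < n \<Longrightarrow> cell_inv (\<kappa> i) (V i)"
    and meas: "\<And>i. i < n \<Longrightarrow> bm (V i)" "\<And>i. i < n \<Longrightarrow> E i \<in> sets borel"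
    and nested: "\<And>i j x y. j \<le> i \<Longrightarrow> i < n \<Longrightarrow> \<kappa> i x = \<kappa> i y \<Longrightarrow> \<kappa> j x = \<kappa> j y"
    and H: "\<And>i \<psi>. i < n \<Longrightarrow> cell_inv (\<kappa> i) \<psi> \<Longrightarrow> bm \<psi> \<Longrightarrow>
      (NN x. \<psi> x) \<le> ennreal K * (NN x. \<psi> x * indicator (E i) x)"
    and K: "0 < K" and \<theta>: "0 < \<theta>"
  shows "(NN x. epow (\<Sum>i<n. V i x) \<theta>) \<le>
    ennreal ((max 1 \<theta> * K / min 1 \<theta>) powr max 1 \<theta>) *
    (NN x. epow (\<Sum>i<n. V i x * indicator (E i) x) \<theta>)"
proof (cases "(NN x. epow (\<Sum>i<n. V i x * indicator (E i) x) \<theta>) = top")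
  case True
  then show ?thesis using K \<theta> by (auto simp: ennreal_mult_top zero_less_mult_iff)
next
  case fin: False
  have AE_fin: "AE x in lborel. V i x \<noteq> top" if i: "i < n" for i
  proof -
    have "(NN x. epow (V i x) \<theta>) \<le>
      ennreal K * (NN x. epow (V i x) \<theta> * indicator (E i) x)"
    proof (rule H[OF i])
      show "cell_inv (\<kappa> i) (\<lambda>x. epow (V i x) \<theta>)"
        using V[OF i] unfolding cell_inv_def by metis
    qed (use i meas in measurable)
    also have "\<dots> \<le> ennreal K * (NN x. epow (\<Sum>i<n. V i x * indicator (E i) x) \<theta>)"
    proof (intro mult_left_mono nn_integral_mono)
      fix x
      have "V i x * indicator (E i) x \<le> (\<Sum>i<n. V i x * indicator (E i) x)"
        using i by (intro member_le_sum) auto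
      then have "epow (V i x * indicator (E i) x) \<theta> \<le> epow (\<Sum>i<n. V i x * indicator (E i) x) \<theta>"
        using \<theta> by (intro epow_mono) auto
      then show "epow (V i x) \<theta> * indicator (E i) x \<le> epow (\<Sum>i<n. V i x * indicator (E i) x) \<theta>"
        by (auto simp: indicator_def)
    qed simp
    also have "\<dots> < top" using fin by (simp add: ennreal_mult_less_top less_top)
    finally have "AE x in lborel. epow (V i x) \<theta> \<noteq> \<infinity>"
      using i meas by (intro nn_integral_PInf_AE) auto
    then show ?thesis by simp
  qed
  define R where "R i x = enn2real (V i x)" for i x
  have AE: "AE x in lborel. \<forall>i\<in>{..<n}. V i x = ennreal (R i x)"
  proof (rule AE_finite_allI)
    fix i assume "i \<in> {..<n}"
    then have "AE x in lborel. V i x \<noteq> top" using AE_fin by simp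
    then show "AE x in lborel. V i x = ennreal (R i x)" by eventually_elim (simp add: R_def less_top)
  qed simp
  have eq1: "(NN x. epow (\<Sum>i<n. V i x) \<theta>) = (NN x. ennreal ((\<Sum>i<n. R i x) powr \<theta>))"
    using AE
  proof (intro nn_integral_cong_AE, eventually_elim)
    fix x assume x: "\<forall>i\<in>{..<n}. V i x = ennreal (R i x)"
    have "(\<Sum>i<n. V i x) = (\<Sum>i<n. ennreal (R i x))" using x by (intro sum.cong) auto
    also have "\<dots> = ennreal (\<Sum>i<n. R i x)" by (rule sum_ennreal) (simp add: R_def)
    finally show "epow (\<Sum>i<n. V i x) \<theta> = ennreal ((\<Sum>i<n. R i x) powr \<theta>)"
      by (simp add: epow_ennreal R_def sum_nonneg)
  qed
  have eq2: "(NN x. epow (\<Sum>i<n. V i x * indicator (E i) x) \<theta>) =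
    (NN x. ennreal ((\<Sum>i<n. R i x * indicator (E i) x) powr \<theta>))" using AE
  proof (intro nn_integral_cong_AE, eventually_elim)
    fix x assume x: "\<forall>i\<in>{..<n}. V i x = ennreal (R i x)"
    have "(\<Sum>i<n. V i x * indicator (E i) x) = (\<Sum>i<n. ennreal (R i x * indicator (E i) x))"
      using x by (intro sum.cong) (auto simp: indicator_def)
    also have "\<dots> = ennreal (\<Sum>i<n. R i x * indicator (E i) x)" by (rule sum_ennreal) (simp add: R_def)
    finally show "epow (\<Sum>i<n. V i x * indicator (E i) x) \<theta> = ennreal ((\<Sum>i<n. R i x * indicator (E i) x) powr \<theta>)"
      by (simp add: epow_ennreal R_def sum_nonneg)
  qed
  show ?thesis unfolding eq1 eq2
  proof (rule sum_restrict_cells_real[OF _ _ _ meas(2) nested H K \<theta>])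
    show "cell_inv (\<kappa> i) (R i)" if "i < n" for i using V[OF that] unfolding cell_inv_def R_def by metis
    show "bm (R i)" if "i < n" for i using meas(1)[OF that] unfolding R_def by measurable
    show "(NN x. ennreal ((\<Sum>i<n. R i x * indicator (E i) x) powr \<theta>)) < top"
      using fin eq2 by (simp add: less_top)
  qed (auto simp: R_def)
qed

text \<open>The running maximum from coarse to fine is bounded by the sum of its increments
  \<open>m i\<close>, each constant on the cells of index \<open>i\<close>, so \<open>H\<close>
  applies to them. The restricted increments add up to no more than the restricted maximum: an
  increment counted at \<open>x\<close> in \<open>E i\<close> raises the sum at most to
  \<open>V i x\<close>. A supremum commutes with powers, so exponent one is enough.\<close>

lemma SUP_restrict_cells:
  fixes V :: "nat \<Rightarrow> 'a::euclidean_space \<Rightarrow> ennreal" and \<kappa> :: "nat \<Rightarrow> 'a \<Rightarrow> 'b"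
  assumes V: "\<And>i. i < n \<Longrightarrow> cell_inv (\<kappa> i) (V i)"
    and meas: "\<And>i. i < n \<Longrightarrow> bm (V i)" "\<And>i. i < n \<Longrightarrow> E i \<in> sets borel"
    and nested: "\<And>i j x y. j \<le> i \<Longrightarrow> i < n \<Longrightarrow> \<kappa> i x = \<kappa> i y \<Longrightarrow> \<kappa> j x = \<kappa> j y"
    and H: "\<And>i \<psi>. i < n \<Longrightarrow> cell_inv (\<kappa> i) \<psi> \<Longrightarrow> bm \<psi> \<Longrightarrow>
      (NN x. \<psi> x) \<le> ennreal K * (NN x. \<psi> x * indicator (E i) x)"
  shows "(NN x. (SUP i\<in>{..<n}. V i x)) \<le>
    ennreal K * (NN x. (SUP i\<in>{..<n}. V i x * indicator (E i) x))"
proof -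
  define a where "a i x = (SUP j\<in>{..<i}. V j x)" for i x
  define b where "b i x = (SUP j\<in>{..<i}. V j x * indicator (E j) x)" for i x
  define m where "m i x = (if a i x < V i x then V i x - a i x else 0)" for i x
  have a_Suc: "a (Suc i) x = max (a i x) (V i x)" for i x by (simp add: a_def lessThan_Suc sup_max max.commute)
  have b_Suc: "b (Suc i) x = max (b i x) (V i x * indicator (E i) x)" for i x
    by (simp add: b_def lessThan_Suc sup_max max.commute)
  have ba: "b i x \<le> a i x" for i x unfolding a_def b_def by (intro SUP_mono) (auto simp: indicator_def)
  have [measurable]: "bm (a i)" if "i \<le> n" for i
    unfolding a_def using meas that by (intro borel_measurable_SUP) auto
  have [measurable]: "bm (m i)" if "i < n" for i
  proof -
    have [measurable]: "bm (a i)" "bm (V i)" using meas that by auto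
    show ?thesis unfolding m_def by measurable
  qed
  have m_inv: "cell_inv (\<kappa> i) (m i)" if "i < n" for i
  proof (rule cell_invI)
    fix x y assume *: "\<kappa> i x = \<kappa> i y"
    then have "V j x = V j y" if "j \<le> i" for j
      using nested[OF that \<open>i < n\<close>] V[of j] that \<open>i < n\<close> by (auto dest: cell_invD)
    then show "m i x = m i y" by (simp add: m_def a_def)
  qed
  have a_le: "a i x \<le> (\<Sum>j<i. m j x)" for i x
  proof (induction i)
    case (Suc i)
    show ?case
    proof (cases "a i x < V i x")
      case True
      then have "a (Suc i) x = (V i x - a i x) + a i x"
        by (simp add: a_Suc max_def diff_add_cancel_ennreal less_imp_le)
      also have "\<dots> \<le> m i x + (\<Sum>j<i. m j x)" using Suc True by (intro add_mono) (auto simp: m_def)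
      finally show ?thesis by (simp add: add.commute)
    next
      case False
      then show ?thesis using Suc by (simp add: a_Suc m_def max_def)
    qed
  qed (simp add: a_def bot_ennreal)
  have le_b: "(\<Sum>j<i. m j x * indicator (E j) x) \<le> b i x" for i x
  proof (induction i)
    case (Suc i)
    show ?case
    proof (cases "a i x < V i x \<and> x \<in> E i")
      case True
      have "(\<Sum>j<Suc i. m j x * indicator (E j) x) \<le> a i x + (V i x - a i x)"
        using Suc ba[of i x] True by (auto simp: m_def intro: add_mono order_trans)
      also have "\<dots> = V i x"
        using True by (simp add: add.commute[of "a i x"] diff_add_cancel_ennreal less_imp_le)
      finally show ?thesis using True by (simp add: b_Suc le_max_iff_disj)
    next
      case False
      then have "m i x * indicator (E i) x = 0" by (auto simp: m_def)
      then have "(\<Sum>j<Suc i. m j x * indicator (E j) x) = (\<Sum>j<i. m j x * indicator (E j) x)"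
        by (simp only: sum.lessThan_Suc add_0_right)
      then show ?thesis using Suc by (simp only: b_Suc le_max_iff_disj simp_thms)
    qed
  qed simp
  have "(NN x. a n x) \<le> (NN x. (\<Sum>i<n. m i x))" by (intro nn_integral_mono a_le)
  also have "\<dots> = (\<Sum>i<n. (NN x. m i x))" by (rule nn_integral_sum) auto
  also have "\<dots> \<le> (\<Sum>i<n. ennreal K * (NN x. m i x * indicator (E i) x))"
    using m_inv by (intro sum_mono H) auto
  also have "\<dots> = ennreal K * (NN x. (\<Sum>i<n. m i x * indicator (E i) x))"
    using meas by (subst nn_integral_sum) (auto simp: sum_distrib_left)
  also have "\<dots> \<le> ennreal K * (NN x. b n x)" by (intro mult_left_mono nn_integral_mono le_b) auto
  finally show ?thesis by (simp add: a_def b_def)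
qed

section \<open>Shifted dyadic grids\<close>

text \<open>\<open>B\<close> is the set of coordinates in which the grid is shifted by a third of
  the side length \<open>2 powr j\<close>. The sign alternates with the parity of \<open>j\<close>,
  since with a constant sign grids of different generations would not be nested.\<close>

definition grid :: "'a::euclidean_space set \<Rightarrow> int \<Rightarrow> 'a \<Rightarrow> 'a \<Rightarrow> int"
  where "grid B j x = (\<lambda>i\<in>Basis. \<lfloor>(x \<bullet> i) / 2 powr j + (if i \<in> B then (if even j then 1 / 3 else - 1 / 3) else 0)\<rfloor>)"

lemma grid_eq_iff:
  "grid B j x = grid B j y \<longleftrightarrow> (\<forall>i\<in>Basis.
    \<lfloor>(x \<bullet> i) / 2 powr j + (if i \<in> B then (if even j then 1 / 3 else - 1 / 3) else 0)\<rfloor> =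
    \<lfloor>(y \<bullet> i) / 2 powr j + (if i \<in> B then (if even j then 1 / 3 else - 1 / 3) else 0)\<rfloor>)"
  unfolding grid_def restrict_def fun_eq_iff by (auto split: if_splits)

lemma cells_grid: "cells (grid B j :: 'a::euclidean_space \<Rightarrow> 'a \<Rightarrow> int) ((2 powr j) ^ DIM('a))"
proof
  define s where "s = (2::real) powr j"
  have s: "0 < s" by (simp add: s_def)
  define c :: "'a \<Rightarrow> real" where "c i = (if i \<in> B then (if even j then 1 / 3 else - 1 / 3) else 0)" for i
  have "range (grid B j) \<subseteq> PiE Basis (\<lambda>_. UNIV)" unfolding grid_def by auto
  moreover have "countable (PiE (Basis :: 'a set) (\<lambda>_. UNIV :: int set))" by (rule countable_PiE) auto
  ultimately show "countable (range (grid B j))" by (rule countable_subset)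
  have cell: "grid B j -` {grid B j x} = (\<Inter>i\<in>Basis. {y. \<lfloor>(y \<bullet> i) / s + c i\<rfloor> = \<lfloor>(x \<bullet> i) / s + c i\<rfloor>})" for x
    unfolding s_def c_def using grid_eq_iff[of B j] by blast
  have sets: "grid B j -` {grid B j x} \<in> sets borel" for x unfolding cell by (intro sets.finite_INT) auto
  show "grid B j -` {a} \<in> sets borel" for a
  proof (cases "grid B j -` {a} = {}")
    case False
    then obtain x where "grid B j x = a" by auto
    then show ?thesis using sets[of x] by simp
  qed simp
  show "emeasure lborel (grid B j -` {grid B j x}) = ennreal ((2 powr j) ^ DIM('a))" for x
  proof -
    define l where "l = (\<Sum>i\<in>Basis. (s * (of_int \<lfloor>(x \<bullet> i) / s + c i\<rfloor> - c i)) *\<^sub>R i)"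
    define u where "u = l + (\<Sum>i\<in>Basis. s *\<^sub>R i)"
    have l: "l \<bullet> i = s * (of_int \<lfloor>(x \<bullet> i) / s + c i\<rfloor> - c i)" if "i \<in> Basis" for i
      using that by (simp add: l_def)
    have u: "u \<bullet> i = l \<bullet> i + s" if "i \<in> Basis" for i
      using that by (simp add: u_def inner_add_left)
    have iff: "\<lfloor>(y \<bullet> i) / s + c i\<rfloor> = \<lfloor>(x \<bullet> i) / s + c i\<rfloor> \<longleftrightarrow> l \<bullet> i \<le> y \<bullet> i \<and> y \<bullet> i < u \<bullet> i"
      if "i \<in> Basis" for y i using s unfolding u[OF that] l[OF that] floor_eq_iff by (simp add: field_simps)
    have "box l u \<subseteq> grid B j -` {grid B j x}" "grid B j -` {grid B j x} \<subseteq> cbox l u"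
      unfolding cell by (auto simp: iff mem_box less_imp_le)
    then have "emeasure lborel (box l u) \<le> emeasure lborel (grid B j -` {grid B j x})"
      "emeasure lborel (grid B j -` {grid B j x}) \<le> emeasure lborel (cbox l u)"
      using sets by (auto intro!: emeasure_mono)
    moreover have "emeasure lborel (box l u) = ennreal (s ^ DIM('a))"
      "emeasure lborel (cbox l u) = ennreal (s ^ DIM('a))"
      using s by (auto simp: emeasure_lborel_box_eq emeasure_lborel_cbox_eq u inner_diff_left)
    ultimately show ?thesis by (simp add: s_def[symmetric])
  qed
  show "0 < (2 powr j) ^ DIM('a)" for j :: real by simp
qed

lemma grid_nested:
  assumes "j \<le> j'" "grid B j x = grid B j y"
  shows "grid B j' x = grid B j' y" using assms
proof (induction j' rule: int_ge_induct)
  case (step j')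
  define \<sigma> :: int where "\<sigma> = (if even j' then 1 else - 1)"
  have s: "2 powr (real_of_int (j' + 1)) = 2 * 2 powr j'" by (simp add: powr_add)
  \<comment> \<open>The coarser label is a function of the finer one: subtracting the integer
    \<sigma> from the shift \<sigma> / 3 and halving leaves - \<sigma> / 3, the shift of the next
    generation.\<close>
  have half: "\<lfloor>w / 2 powr (real_of_int (j' + 1)) + (if b then (if even (j' + 1) then 1 / 3 else - 1 / 3) else 0)\<rfloor> =
    (\<lfloor>w / 2 powr j' + (if b then (if even j' then 1 / 3 else - 1 / 3) else 0)\<rfloor> - (if b then \<sigma> else 0)) div 2"
    for w b
  proof -
    define u where "u = w / 2 powr j' + (if b then (if even j' then 1 / 3 else - 1 / 3) else 0)"
    have "w / 2 powr (real_of_int (j' + 1)) + (if b then (if even (j' + 1) then 1 / 3 else - 1 / 3) else 0) =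
      (u - of_int (if b then \<sigma> else 0)) / of_int 2"
      unfolding s u_def \<sigma>_def by (auto simp: field_simps)
    also have "\<lfloor>\<dots>\<rfloor> = \<lfloor>u - of_int (if b then \<sigma> else 0)\<rfloor> div 2"
      by (rule floor_divide_real_eq_div) simp
    finally show ?thesis by (simp add: u_def)
  qed
  from step show ?case unfolding grid_eq_iff half by auto
qed

lemma grid_coordinate_dist:
  assumes "grid B j x = grid B j y" "i \<in> Basis"
  shows "\<bar>x \<bullet> i - y \<bullet> i\<bar> < 2 powr j"
proof -
  define c where "c = (if i \<in> B then (if even j then 1 / 3 else - 1 / 3) else 0 :: real)"
  have "\<lfloor>(x \<bullet> i) / 2 powr j + c\<rfloor> = \<lfloor>(y \<bullet> i) / 2 powr j + c\<rfloor>"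
    using assms by (auto simp: grid_eq_iff c_def)
  then have "\<bar>(x \<bullet> i) / 2 powr j - (y \<bullet> i) / 2 powr j\<bar> < 1" by linarith
  then show ?thesis by (simp add: diff_divide_distrib[symmetric] abs_divide)
qed

lemma grid_dist:
  fixes x y :: "'a::euclidean_space"
  assumes "grid B j x = grid B j y"
  shows "dist x y < DIM('a) * 2 powr j"
proof -
  have "dist x y \<le> (\<Sum>i\<in>Basis. \<bar>(x - y) \<bullet> i\<bar>)"
    unfolding dist_norm by (rule norm_le_l1)
  also have "\<dots> < (\<Sum>i\<in>(Basis::'a set). 2 powr j)"
    using grid_coordinate_dist[OF assms] by (intro sum_strict_mono) (auto simp: inner_diff_left)
  finally show ?thesis by simp
qed

text \<open>If both floors changed within \<epsilon>, then \<open>u\<close> and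
  \<open>u + \<sigma>\<close> would both lie within \<epsilon> of integers and \<sigma> within 2
  \<epsilon> < 1 / 3 of one, whereas its distance from the integers is exactly 1 / 3.\<close>

lemma floor_eq_or_shift_eq:
  fixes u \<epsilon> \<sigma> :: real
  assumes \<epsilon>: "\<epsilon> < 1 / 6" and \<sigma>: "\<sigma> = 1 / 3 \<or> \<sigma> = - 1 / 3"
  shows "(\<forall>v. \<bar>v - u\<bar> \<le> \<epsilon> \<longrightarrow> \<lfloor>v\<rfloor> = \<lfloor>u\<rfloor>) \<or> (\<forall>v. \<bar>v - u\<bar> \<le> \<epsilon> \<longrightarrow> \<lfloor>v + \<sigma>\<rfloor> = \<lfloor>u + \<sigma>\<rfloor>)"
proof (rule ccontr)
  assume "\<not> ?thesis"
  then obtain v1 v2 where v: "\<bar>v1 - u\<bar> \<le> \<epsilon>" "\<lfloor>v1\<rfloor> \<noteq> \<lfloor>u\<rfloor>" "\<bar>v2 - u\<bar> \<le> \<epsilon>" "\<lfloor>v2 + \<sigma>\<rfloor> \<noteq> \<lfloor>u + \<sigma>\<rfloor>"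
    by auto
  have near: "\<exists>n::int. \<bar>b - n\<bar> \<le> \<epsilon>" if "\<bar>a - b\<bar> \<le> \<epsilon>" "\<lfloor>a\<rfloor> \<noteq> \<lfloor>b\<rfloor>" for a b :: real
  proof (cases "\<lfloor>a\<rfloor> < \<lfloor>b\<rfloor>")
    case True
    then show ?thesis using that by (intro exI[of _ "\<lfloor>b\<rfloor>"]) linarith
  next
    case False
    then show ?thesis using that by (intro exI[of _ "\<lfloor>a\<rfloor>"]) linarith
  qed
  obtain n :: int where n: "\<bar>u - n\<bar> \<le> \<epsilon>" using near v by blast
  obtain m :: int where m: "\<bar>u + \<sigma> - m\<bar> \<le> \<epsilon>" using near[of "v2 + \<sigma>" "u + \<sigma>"] v by auto
  have "\<bar>n + \<sigma> - m\<bar> < 1 / 3" using n m \<epsilon> by linarith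
  then have *: "- 1 < 3 * n + 3 * \<sigma> - 3 * m" "3 * n + 3 * \<sigma> - 3 * m < 1" by linarith+
  from \<sigma> show False
  proof
    assume "\<sigma> = 1 / 3"
    then have "real_of_int (- 2) < real_of_int (3 * n - 3 * m)" "real_of_int (3 * n - 3 * m) < real_of_int 0"
      using * by auto
    then show False unfolding of_int_less_iff by presburger
  next
    assume "\<sigma> = - 1 / 3"
    then have "real_of_int 0 < real_of_int (3 * n - 3 * m)" "real_of_int (3 * n - 3 * m) < real_of_int 2"
      using * by auto
    then show False unfolding of_int_less_iff by presburger
  qed
qed

text \<open>
  The dyadic one-third trick: in every coordinate in which the point is close to the boundary of
  its dyadic interval, it is far from the boundary in the grid shifted by a third.
\<close>

lemma grid_one_third:
  fixes x :: "'a::euclidean_space"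
  assumes R: "R < 2 powr j / 6"
  obtains B where "B \<subseteq> Basis" "\<And>y. (\<And>i. i \<in> Basis \<Longrightarrow> \<bar>y \<bullet> i - x \<bullet> i\<bar> \<le> R) \<Longrightarrow> grid B j y = grid B j x"
proof -
  define \<sigma> :: real where "\<sigma> = (if even j then 1 / 3 else - 1 / 3)"
  define \<epsilon> where "\<epsilon> = R / 2 powr j"
  define B where "B = {i\<in>Basis. \<not> (\<forall>v. \<bar>v - (x \<bullet> i) / 2 powr j\<bar> \<le> \<epsilon> \<longrightarrow> \<lfloor>v\<rfloor> = \<lfloor>(x \<bullet> i) / 2 powr j\<rfloor>)}"
  have \<epsilon>: "\<epsilon> < 1 / 6" using R by (simp add: \<epsilon>_def field_simps)
  show thesis
  proof (rule that)
    show "B \<subseteq> Basis" by (auto simp: B_def)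
    fix y assume y: "\<And>i. i \<in> Basis \<Longrightarrow> \<bar>y \<bullet> i - x \<bullet> i\<bar> \<le> R"
    show "grid B j y = grid B j x" unfolding grid_eq_iff \<sigma>_def[symmetric]
    proof
      fix i :: 'a assume i: "i \<in> Basis"
      have le: "\<bar>(y \<bullet> i) / 2 powr j - (x \<bullet> i) / 2 powr j\<bar> \<le> \<epsilon>"
        using y[OF i] by (simp add: \<epsilon>_def diff_divide_distrib[symmetric] abs_divide divide_right_mono)
      show "\<lfloor>(y \<bullet> i) / 2 powr j + (if i \<in> B then \<sigma> else 0)\<rfloor> = \<lfloor>(x \<bullet> i) / 2 powr j + (if i \<in> B then \<sigma> else 0)\<rfloor>"
      proof (cases "i \<in> B")
        case True
        then have "\<not> (\<forall>v. \<bar>v - (x \<bullet> i) / 2 powr j\<bar> \<le> \<epsilon> \<longrightarrow> \<lfloor>v\<rfloor> = \<lfloor>(x \<bullet> i) / 2 powr j\<rfloor>)"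
          unfolding B_def by blast
        moreover have "(\<forall>v. \<bar>v - (x \<bullet> i) / 2 powr j\<bar> \<le> \<epsilon> \<longrightarrow> \<lfloor>v\<rfloor> = \<lfloor>(x \<bullet> i) / 2 powr j\<rfloor>) \<or>
            (\<forall>v. \<bar>v - (x \<bullet> i) / 2 powr j\<bar> \<le> \<epsilon> \<longrightarrow> \<lfloor>v + \<sigma>\<rfloor> = \<lfloor>(x \<bullet> i) / 2 powr j + \<sigma>\<rfloor>)"
          by (rule floor_eq_or_shift_eq[OF \<epsilon>]) (simp add: \<sigma>_def)
        ultimately have *: "\<forall>v. \<bar>v - (x \<bullet> i) / 2 powr j\<bar> \<le> \<epsilon> \<longrightarrow> \<lfloor>v + \<sigma>\<rfloor> = \<lfloor>(x \<bullet> i) / 2 powr j + \<sigma>\<rfloor>"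
          by (rule mp[OF iffD1[OF disj_imp], rotated])
        show ?thesis using True *[rule_format, OF le] by simp
      next
        case False
        then have *: "\<forall>v. \<bar>v - (x \<bullet> i) / 2 powr j\<bar> \<le> \<epsilon> \<longrightarrow> \<lfloor>v\<rfloor> = \<lfloor>(x \<bullet> i) / 2 powr j\<rfloor>"
          unfolding B_def using i by blast
        show ?thesis using False *[rule_format, OF le] by simp
      qed
    qed
  qed
qed

section \<open>Scales, cubes and big cubes\<close>

text \<open>
  There are two scales to every dyadic generation, so that the slab at scale \<open>k\<close> is contained in
  \<open>{t/2<..t}\<close> whenever \<open>t\<close> lies in the slab at scale \<open>k + 1\<close>. The cubes are small enough for a ball of
  radius \<open>t\<close> to contain the cube of its centre, and the big cubes large enough for one of them to
  contain all cubes that meet the ball.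
\<close>

definition sc :: "int \<Rightarrow> real"
  where "sc k = 2 powr (k / 2)"

definition cube :: "int \<Rightarrow> 'a::euclidean_space \<Rightarrow> 'a \<Rightarrow> int"
  where "cube k = grid {} (k div 2 - int DIM('a))"

definition big_cube :: "'a::euclidean_space set \<Rightarrow> int \<Rightarrow> 'a \<Rightarrow> 'a \<Rightarrow> int"
  where "big_cube B k = grid B (k div 2 + 5)"

definition cube_vol :: "'a::euclidean_space itself \<Rightarrow> int \<Rightarrow> real"
  where "cube_vol _ k = (2 powr real_of_int (k div 2 - int DIM('a))) ^ DIM('a)"

text \<open>The volume of a big cube divided by that of a small one; 5 + d is the difference of
  their generations and does not depend on the scale.\<close>

definition big_ratio :: "'a::euclidean_space itself \<Rightarrow> real"
  where "big_ratio _ = (2 powr (5 + DIM('a))) ^ DIM('a)"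

lemma sc_pos [simp]: "0 < sc k" by (simp add: sc_def)

lemma sc_add: "sc (k + l) = sc k * sc l" by (simp add: sc_def powr_add[symmetric] add_divide_distrib)

lemma sc_2: "sc 2 = 2" by (simp add: sc_def)

lemma sc_1: "sc 1 = sqrt 2" by (simp add: sc_def powr_half_sqrt)

lemma sc_plus_1: "sc (k + 1) = sqrt 2 * sc k" by (simp add: sc_add sc_1)

lemma sc_minus_1: "sc (k - 1) = sc k / sqrt 2" using sc_plus_1[of "k - 1"] by (simp add: field_simps)

lemma sc_plus_2: "sc (k + 2) = 2 * sc k" by (simp add: sc_add sc_2)

lemma sc_mono: "k \<le> l \<Longrightarrow> sc k \<le> sc l" by (simp add: sc_def)

lemma sc_less_iff: "sc k < sc l \<longleftrightarrow> k < l" by (simp add: sc_def)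

lemma sqrt2_bounds: "1 < sqrt 2" "sqrt 2 < 3 / 2" by (simp, rule real_less_lsqrt) (auto simp: power2_eq_square)

lemma sc_div_bounds: "2 powr real_of_int (k div 2) \<le> sc k" "sc k \<le> sqrt 2 * 2 powr real_of_int (k div 2)"
proof -
  have "k = 2 * (k div 2) \<or> k = 2 * (k div 2) + 1" by presburger
  then have "sc k = 2 powr real_of_int (k div 2) \<or> sc k = sqrt 2 * 2 powr real_of_int (k div 2)"
  proof
    assume "k = 2 * (k div 2)"
    then show ?thesis by (metis mult_2 nonzero_mult_div_cancel_left of_int_mult of_int_numeral sc_def zero_neq_numeral)
  next
    assume "k = 2 * (k div 2) + 1"
    then have "sc k = sqrt 2 * sc (2 * (k div 2))" by (metis sc_plus_1)
    also have "sc (2 * (k div 2)) = 2 powr real_of_int (k div 2)" by (simp add: sc_def)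
    finally show ?thesis by simp
  qed
  moreover have "1 * 2 powr real_of_int (k div 2) \<le> sqrt 2 * 2 powr (real_of_int (k div 2))"
    using sqrt2_bounds by (intro mult_right_mono) auto
  ultimately show "2 powr real_of_int (k div 2) \<le> sc k" "sc k \<le> sqrt 2 * 2 powr real_of_int (k div 2)" by auto
qed

lemma scale_exists:
  assumes "0 < t"
  obtains k where "sc k < t" "t \<le> sc (k + 1)"
proof -
  define k where "k = \<lceil>2 * log 2 t\<rceil> - 1"
  have k: "k / 2 < log 2 t" "log 2 t \<le> (k + 1) / 2" unfolding k_def by (auto simp: field_simps) linarith+
  have "sc k < 2 powr (log 2 t)" "2 powr (log 2 t) \<le> sc (k + 1)" using k by (simp_all add: sc_def)
  then show thesis using that assms by simp
qed

lemma cells_cube: "cells (cube k :: 'a::euclidean_space \<Rightarrow> _) (cube_vol TYPE('a) k)"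
  unfolding cube_def cube_vol_def by (rule cells_grid)

lemma big_cube_vol:
  "(2 powr real_of_int (k div 2 + 5)) ^ DIM('a::euclidean_space) = big_ratio TYPE('a) * cube_vol TYPE('a) k"
  unfolding big_ratio_def cube_vol_def power_mult_distrib[symmetric] powr_add[symmetric]
  by (simp add: add.commute)

lemma cells_big_cube:
  "cells (big_cube B k :: 'a::euclidean_space \<Rightarrow> _) (big_ratio TYPE('a) * cube_vol TYPE('a) k)"
  unfolding big_cube_def big_cube_vol[symmetric] using cells_grid[of B "k div 2 + 5"] by simp

lemma cube_vol_pos [simp]: "0 < cube_vol TYPE('a::euclidean_space) k" by (simp add: cube_vol_def)

lemma big_ratio_pos [simp]: "0 < big_ratio TYPE('a::euclidean_space)" by (simp add: big_ratio_def)

lemma cube_vol_upper: "cube_vol TYPE('a::euclidean_space) k \<le> sc k ^ DIM('a)"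
proof -
  have "2 powr real_of_int (k div 2 - int DIM('a)) \<le> 2 powr real_of_int (k div 2)" by simp
  also have "\<dots> \<le> sc k" by (rule sc_div_bounds)
  finally show ?thesis unfolding cube_vol_def by (intro power_mono) auto
qed

lemma cube_vol_lower: "sc k ^ DIM('a) \<le> (2 ^ (DIM('a) + 1)) ^ DIM('a) * cube_vol TYPE('a::euclidean_space) k"
proof -
  have "sc k \<le> 2 * 2 powr real_of_int (k div 2)" using sc_div_bounds(2)[of k] sqrt2_bounds
    by (intro order_trans[OF sc_div_bounds(2)] mult_right_mono) auto
  also have "\<dots> = 2 ^ (DIM('a) + 1) * 2 powr real_of_int (k div 2 - int DIM('a))"
    by (simp add: powr_diff powr_realpow)
  finally have "sc k ^ DIM('a) \<le> (2 ^ (DIM('a) + 1) * 2 powr real_of_int (k div 2 - int DIM('a))) ^ DIM('a)"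
    by (intro power_mono) (auto simp: less_imp_le)
  then show ?thesis by (simp only: power_mult_distrib cube_vol_def)
qed

lemma cube_dist:
  fixes x y :: "'a::euclidean_space"
  assumes "cube k x = cube k y"
  shows "dist x y < sc k"
proof -
  have "dist x y < DIM('a) * 2 powr real_of_int (k div 2 - int DIM('a))"
    using assms unfolding cube_def by (rule grid_dist)
  also have "\<dots> = (DIM('a) / 2 ^ DIM('a)) * 2 powr real_of_int (k div 2)"
    by (simp add: powr_diff powr_realpow)
  \<comment> \<open>The inequality d \<le> 2^d is the reason why \<open>cube\<close> lowers the
    generation by the dimension.\<close>
  also have "\<dots> \<le> 1 * 2 powr real_of_int (k div 2)"
    using less_exp[of "DIM('a)"] by (intro mult_right_mono) (auto simp: field_simps of_nat_less_numeral_power_cancel_iff less_imp_le)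
  also have "\<dots> \<le> sc k" using sc_div_bounds(1)[of k] by simp
  finally show ?thesis .
qed

lemma big_cube_dist:
  fixes x y :: "'a::euclidean_space"
  assumes "big_cube B k x = big_cube B k y"
  shows "dist x y < 32 * DIM('a) * sc k"
proof -
  have "dist x y < DIM('a) * 2 powr real_of_int (k div 2 + 5)"
    using grid_dist[OF assms[unfolded big_cube_def]] by simp
  also have "\<dots> = 32 * DIM('a) * 2 powr real_of_int (k div 2)" by (simp add: powr_add)
  also have "\<dots> \<le> 32 * DIM('a) * sc k" by (intro mult_left_mono sc_div_bounds) auto
  finally show ?thesis .
qed

lemma cube_nested: "k \<le> l \<Longrightarrow> cube k x = cube k y \<Longrightarrow> cube l x = cube l y"
  unfolding cube_def by (erule grid_nested[rotated]) (simp add: zdiv_mono1)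

lemma big_cube_nested: "k \<le> l \<Longrightarrow> big_cube B k x = big_cube B k y \<Longrightarrow> big_cube B l x = big_cube B l y"
  unfolding big_cube_def by (erule grid_nested[rotated]) (simp add: zdiv_mono1)

lemma big_cube_covers:
  fixes x :: "'a::euclidean_space"
  obtains B where "B \<subseteq> Basis"
    "\<And>y z. dist y x < 2 * sc k \<Longrightarrow> cube k z = cube k y \<Longrightarrow> big_cube B k z = big_cube B k x"
proof -
  \<comment> \<open>The radius 3 \<open>sc k\<close> is 2 \<open>sc k\<close> for the ball plus the
    diameter of a cube meeting it. The 5 in \<open>big_cube\<close> makes this smaller than a sixth
    of the side: 3 sqrt 2 lies between 16 / 6 and 32 / 6.\<close>
  have "3 * sc k \<le> 3 * (sqrt 2 * 2 powr real_of_int (k div 2))" by (intro mult_left_mono sc_div_bounds) auto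
  also have "\<dots> < 32 / 6 * 2 powr real_of_int (k div 2)"
    using sqrt2_bounds by (simp add: mult.assoc[symmetric])
  also have "\<dots> = 2 powr real_of_int (k div 2 + 5) / 6" by (simp add: powr_add)
  finally have R: "3 * sc k < 2 powr real_of_int (k div 2 + 5) / 6" by simp
  obtain B where B: "B \<subseteq> Basis"
    "\<And>y. (\<And>i. i \<in> Basis \<Longrightarrow> \<bar>y \<bullet> i - x \<bullet> i\<bar> \<le> 3 * sc k) \<Longrightarrow> grid B (k div 2 + 5) y = grid B (k div 2 + 5) x"
    using grid_one_third[OF R] by blast
  show thesis
  proof (rule that[OF B(1)])
    fix y z assume "dist y x < 2 * sc k" "cube k z = cube k y"
    then have "dist z x < 3 * sc k" using cube_dist[of k z y] dist_triangle[of z x y] by linarith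
    then have "\<bar>z \<bullet> i - x \<bullet> i\<bar> \<le> 3 * sc k" if "i \<in> Basis" for i
      using Basis_le_norm[OF that, of "z - x"] by (simp add: inner_diff_left dist_norm)
    then show "big_cube B k z = big_cube B k x" unfolding big_cube_def by (rule B(2))
  qed
qed

text \<open>The union of the small cubes lying entirely inside the big cube of \<open>x\<close>. In
  a shifted grid a small cube may straddle the boundary of a big one; such cubes are left
  out.\<close>

definition subcubes :: "'a::euclidean_space set \<Rightarrow> int \<Rightarrow> 'a \<Rightarrow> 'a set"
  where "subcubes B k x = {y. \<forall>z. cube k z = cube k y \<longrightarrow> big_cube B k z = big_cube B k x}"

text \<open>Replaces a supremum over a ball around \<open>x\<close> by a function that is constant
  on big cubes. If \<open>b\<close> is constant on cubes, only finitely many values compete; the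
  supremum over no subcube is 0.\<close>

definition enl :: "'a::euclidean_space set \<Rightarrow> int \<Rightarrow> ('a \<Rightarrow> ennreal) \<Rightarrow> 'a \<Rightarrow> ennreal"
  where "enl B k b x = (SUP y\<in>subcubes B k x. b y)"

lemma subcubes_cong: "big_cube B k x = big_cube B k y \<Longrightarrow> subcubes B k x = subcubes B k y"
  by (simp add: subcubes_def)

lemma enl_inv: "cell_inv (big_cube B k) (enl B k b)" by (rule cell_invI) (simp add: enl_def cong: subcubes_cong)

lemma enl_measurable [measurable]: "bm (enl B k b)"
  by (rule cells.cell_inv_borel_measurable[OF cells_big_cube enl_inv])

lemma finite_cubes_in_big_cube:
  fixes x :: "'a::euclidean_space"
  shows "finite (cube k ` {y. big_cube B k y = big_cube B k x})"
proof -
  define s where "s = (2::real) powr real_of_int (k div 2 - int DIM('a))"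
  define R where "R = (2::real) powr real_of_int (k div 2 + 5)"
  have s: "0 < s" by (simp add: s_def)
  have "cube k ` {y. big_cube B k y = big_cube B k x} \<subseteq>
    PiE Basis (\<lambda>i. {\<lfloor>(x \<bullet> i - R) / s\<rfloor>..\<lfloor>(x \<bullet> i + R) / s\<rfloor>})"
  proof (rule image_subsetI)
    fix y assume "y \<in> {y. big_cube B k y = big_cube B k x}"
    then have y: "big_cube B k y = big_cube B k x" by simp
    show "cube k y \<in> PiE Basis (\<lambda>i. {\<lfloor>(x \<bullet> i - R) / s\<rfloor>..\<lfloor>(x \<bullet> i + R) / s\<rfloor>})"
    proof (rule PiE_I)
      fix i :: 'a assume i: "i \<in> Basis"
      have "\<bar>y \<bullet> i - x \<bullet> i\<bar> < R"
        using grid_coordinate_dist[OF y[unfolded big_cube_def] i] by (simp add: R_def)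
      then have "(x \<bullet> i - R) / s \<le> (y \<bullet> i) / s" "(y \<bullet> i) / s \<le> (x \<bullet> i + R) / s"
        using s by (auto intro!: divide_right_mono)
      then have "\<lfloor>(x \<bullet> i - R) / s\<rfloor> \<le> \<lfloor>(y \<bullet> i) / s\<rfloor>" "\<lfloor>(y \<bullet> i) / s\<rfloor> \<le> \<lfloor>(x \<bullet> i + R) / s\<rfloor>"
        by (auto intro: floor_mono)
      then show "cube k y i \<in> {\<lfloor>(x \<bullet> i - R) / s\<rfloor>..\<lfloor>(x \<bullet> i + R) / s\<rfloor>}"
        using i by (simp add: cube_def grid_def s_def)
    qed (simp add: cube_def grid_def)
  qed
  then show ?thesis by (rule finite_subset) (auto intro: finite_PiE)
qed

text \<open>
  In each big cube select the points of the subcubes where \<open>b\<close> is maximal. They fill a fixed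
  proportion of the big cube, so that restriction to this set undoes the enlargement.
\<close>

definition enl_set :: "'a::euclidean_space set \<Rightarrow> int \<Rightarrow> ('a \<Rightarrow> ennreal) \<Rightarrow> 'a set"
  where "enl_set B k b = {y. subcubes B k y = {} \<or> y \<in> subcubes B k y \<and> b y = enl B k b y}"

lemma enl_set_measurable:
  assumes "cell_inv (cube k) b"
  shows "enl_set B k b \<in> sets borel"
proof -
  have [measurable]: "bm b" by (rule cells.cell_inv_borel_measurable[OF cells_cube assms])
  have [measurable]: "Measurable.pred borel (\<lambda>y. subcubes B k y = {})"
    by (rule cells.cell_inv_measurable[OF cells_big_cube[of B k]])
      (auto simp: cell_inv_def dest: subcubes_cong)
  have [measurable]: "Measurable.pred borel (\<lambda>y. y \<in> subcubes B k y)"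
  proof (rule cells.cell_inv_measurable[OF cells_cube[of k]])
    have "y \<in> subcubes B k y" if "x \<in> subcubes B k x" "cube k x = cube k y" for x y
    proof -
      have *: "big_cube B k z = big_cube B k x" if "cube k z = cube k x" for z
        using \<open>x \<in> subcubes B k x\<close> that unfolding subcubes_def by blast
      have "big_cube B k z = big_cube B k y" if "cube k z = cube k y" for z
        using *[of z] *[of y] that \<open>cube k x = cube k y\<close> by simp
      then show ?thesis unfolding subcubes_def by blast
    qed
    then show "cell_inv (cube k) (\<lambda>y. y \<in> subcubes B k y)" unfolding cell_inv_def by metis
  qed simp
  show ?thesis unfolding enl_set_def by measurable
qed

lemma enl_le: "enl B k b x * indicator (enl_set B k b) x \<le> b x"
  by (cases "subcubes B k x = {}") (simp_all add: enl_set_def indicator_def enl_def bot_ennreal)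

lemma nn_integral_enl_set:
  fixes \<psi> :: "'a::euclidean_space \<Rightarrow> ennreal"
  assumes b: "cell_inv (cube k) b" and \<psi>: "cell_inv (big_cube B k) \<psi>"
  shows "(NN x. \<psi> x) \<le> ennreal (big_ratio TYPE('a)) * (NN x. \<psi> x * indicator (enl_set B k b) x)"
proof -
  interpret big: cells "big_cube B k :: 'a \<Rightarrow> _" "big_ratio TYPE('a) * cube_vol TYPE('a) k"
    by (rule cells_big_cube)
  interpret c: cells "cube k :: 'a \<Rightarrow> _" "cube_vol TYPE('a) k" by (rule cells_cube)
  define E where "E = enl_set B k b"
  have [measurable]: "E \<in> sets borel" unfolding E_def by (rule enl_set_measurable[OF b])
  have [measurable]: "bm \<psi>" by (rule big.cell_inv_borel_measurable[OF \<psi>])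
  \<comment> \<open>The selected set contains at least one whole small cube of each big cube, or all
    of the big cube, and therefore fills the proportion 1 / \<open>big_ratio\<close>. Symmetry of
    the average turns this into the integral inequality.\<close>
  have avg: "1 \<le> ennreal (big_ratio TYPE('a)) * big.avg (indicator E) x" for x
  proof -
    have "ennreal (cube_vol TYPE('a) k) \<le>
      (NN y. indicator E y * indicator (big_cube B k -` {big_cube B k x}) y)"
    proof (cases "subcubes B k x = {}")
      case True
      then have "indicator E y * indicator (big_cube B k -` {big_cube B k x}) y =
        (indicator (big_cube B k -` {big_cube B k x}) y :: ennreal)" for y
        by (auto simp: indicator_def E_def enl_set_def dest: subcubes_cong)
      then have "(NN y. indicator E y * indicator (big_cube B k -` {big_cube B k x}) y) =
        ennreal (big_ratio TYPE('a) * cube_vol TYPE('a) k)" by (simp add: big.cell_sets big.cell_measure)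
      moreover have "1 * cube_vol TYPE('a) k \<le> big_ratio TYPE('a) * cube_vol TYPE('a) k"
        by (intro mult_right_mono) (auto simp: big_ratio_def intro!: ge_one_powr_ge_zero one_le_power less_imp_le)
      ultimately show ?thesis by (simp add: ennreal_leI)
    next
      case False
      have sub: "subcubes B k x \<subseteq> {y. big_cube B k y = big_cube B k x}" by (auto simp: subcubes_def)
      have "finite (cube k ` subcubes B k x)"
        by (rule finite_subset[OF image_mono[OF sub] finite_cubes_in_big_cube])
      moreover have "b ` subcubes B k x = (\<lambda>c. b (inv (cube k) c)) ` (cube k ` subcubes B k x)"
      proof -
        have "b (inv (cube k) (cube k y)) = b y" for y using b by (rule cell_invD) (simp add: f_inv_into_f)
        then show ?thesis by (simp add: image_image)
      qed
      ultimately have "finite (b ` subcubes B k x)" by simp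
      then have "(SUP y\<in>subcubes B k x. b y) \<in> b ` subcubes B k x"
        using False by (simp add: Max_Sup[symmetric])
      \<comment> \<open>Since \<open>b\<close> takes finitely many values on the subcubes, the
        supremum is attained, and then on a whole small cube.\<close>
      then obtain y where y: "y \<in> subcubes B k x" "b y = enl B k b x" by (auto simp: enl_def)
      have "cube k -` {cube k y} \<subseteq> E \<inter> big_cube B k -` {big_cube B k x}"
      proof
        fix z assume "z \<in> cube k -` {cube k y}"
        then have z: "cube k z = cube k y" by simp
        then have bz: "big_cube B k z = big_cube B k x" using y(1) by (auto simp: subcubes_def)
        have "z \<in> subcubes B k z" using y(1) z bz by (simp add: subcubes_def)
        moreover have "b z = b y" using b z by (rule cell_invD)
        moreover have "enl B k b z = enl B k b x" using enl_inv bz by (rule cell_invD)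
        ultimately show "z \<in> E \<inter> big_cube B k -` {big_cube B k x}"
          using y(2) bz by (simp add: E_def enl_set_def)
      qed
      then have "emeasure lborel (cube k -` {cube k y}) \<le> emeasure lborel (E \<inter> big_cube B k -` {big_cube B k x})"
        by (intro emeasure_mono) (auto intro: big.cell_sets)
      also have "\<dots> = (NN y. indicator E y * indicator (big_cube B k -` {big_cube B k x}) y)"
        unfolding indicator_inter_arith[symmetric]
        by (rule nn_integral_indicator[symmetric]) (auto intro: big.cell_sets)
      finally show ?thesis by (simp add: c.cell_measure)
    qed
    then have "ennreal (cube_vol TYPE('a) k) / ennreal (big_ratio TYPE('a) * cube_vol TYPE('a) k) \<le> big.avg (indicator E) x"
      unfolding big.avg_def by (rule divide_right_mono_ennreal)
    then have "ennreal (1 / big_ratio TYPE('a)) \<le> big.avg (indicator E) x"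
      by (subst (asm) divide_ennreal) (auto simp: less_imp_le less_imp_neq[symmetric])
    then have "ennreal (big_ratio TYPE('a)) * ennreal (1 / big_ratio TYPE('a)) \<le> ennreal (big_ratio TYPE('a)) * big.avg (indicator E) x"
      by (rule mult_left_mono) simp
    moreover have "ennreal (big_ratio TYPE('a)) * ennreal (1 / big_ratio TYPE('a)) = 1"
      by (simp add: ennreal_mult[symmetric] less_imp_le less_imp_neq[symmetric])
    ultimately show ?thesis by simp
  qed
  have "(NN x. \<psi> x) \<le> (NN x. ennreal (big_ratio TYPE('a)) * (big.avg (indicator E) x * \<psi> x))"
    using mult_right_mono[OF avg] by (intro nn_integral_mono) (simp add: mult.assoc[symmetric])
  also have "\<dots> = ennreal (big_ratio TYPE('a)) * (NN x. big.avg (indicator E) x * \<psi> x)"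
    by (rule nn_integral_cmult) measurable
  also have "(NN x. big.avg (indicator E) x * \<psi> x) = (NN x. indicator E x * \<psi> x)"
    by (rule big.nn_integral_avg[symmetric, OF _ \<psi>]) measurable
  finally show ?thesis by (simp add: E_def mult.commute)
qed

text \<open>Scales are enumerated from the coarsest, index 0 at scale M, to the finest, because the
  restriction lemmas want the label of an index to determine the labels of all smaller
  indices.\<close>

lemma bij_betw_scales: "bij_betw (\<lambda>i. int M - int i) {..<2 * M + 1} (ks M)"
  by (rule bij_betwI[where g = "\<lambda>k. nat (int M - k)"]) auto

lemma sum_scales: "(\<Sum>k\<in>ks M. f k) = (\<Sum>i<2 * M + 1. f (int M - int i))"
  by (rule sum.reindex_bij_betw[OF bij_betw_scales, symmetric])

lemma SUP_scales: "(SUP k\<in>ks M. f k) = (SUP i\<in>{..<2 * M + 1}. f (int M - int i))"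
  unfolding bij_betw_imp_surj_on[OF bij_betw_scales[of M], symmetric] image_image ..

text \<open>Enlarged coefficients are dominated by the original ones on \<open>enl_set\<close>, and
  restricting every scale to its set costs only a constant. The result is a form of the
  Fefferman-Stein inequality for all positive exponents.\<close>

lemma nn_integral_enl_sum:
  fixes b :: "int \<Rightarrow> 'a::euclidean_space \<Rightarrow> ennreal"
  assumes b: "\<And>k. cell_inv (cube k) (b k)" and p: "0 < p" and q: "0 < q"
  shows "(NN x. epow (\<Sum>k\<in>ks M. epow (enl B k (b k) x) q) p) \<le>
    ennreal ((max 1 p * big_ratio TYPE('a) / min 1 p) powr max 1 p) *
    (NN x. epow (\<Sum>k\<in>ks M. epow (b k x) q) p)"
proof -
  let ?k = "\<lambda>i. int M - int i"
  let ?E = "\<lambda>i. enl_set B (?k i) (b (?k i))"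
  have "(NN x. epow (\<Sum>i<2 * M + 1. epow (enl B (?k i) (b (?k i)) x) q) p) \<le>
    ennreal ((max 1 p * big_ratio TYPE('a) / min 1 p) powr max 1 p) *
    (NN x. epow (\<Sum>i<2 * M + 1. epow (enl B (?k i) (b (?k i)) x) q * indicator (?E i) x) p)"
  proof (rule sum_restrict_cells[where \<kappa> = "\<lambda>i. big_cube B (?k i)"])
    show "cell_inv (big_cube B (?k i)) (\<lambda>x. epow (enl B (?k i) (b (?k i)) x) q)" for i
      using enl_inv[of B "?k i" "b (?k i)"] unfolding cell_inv_def by metis
    show "big_cube B (?k i) x = big_cube B (?k i) y \<Longrightarrow> big_cube B (?k j) x = big_cube B (?k j) y"
      if "j \<le> i" for i j x y using that by (intro big_cube_nested[of "?k i" "?k j"]) auto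
  qed (use p enl_set_measurable[OF b] nn_integral_enl_set[OF b] in auto)
  also have "\<dots> \<le> ennreal ((max 1 p * big_ratio TYPE('a) / min 1 p) powr max 1 p) *
    (NN x. epow (\<Sum>i<2 * M + 1. epow (b (?k i) x) q) p)"
  proof (intro mult_left_mono nn_integral_mono epow_mono sum_mono)
    fix i x
    have "epow (enl B (?k i) (b (?k i)) x * indicator (?E i) x) q \<le> epow (b (?k i) x) q"
      using q by (intro epow_mono enl_le) auto
    then show "epow (enl B (?k i) (b (?k i)) x) q * indicator (?E i) x \<le> epow (b (?k i) x) q"
      by (auto simp: indicator_def)
  qed (use p in auto)
  finally show ?thesis unfolding sum_scales .
qed

lemma nn_integral_enl_SUP:
  fixes b :: "int \<Rightarrow> 'a::euclidean_space \<Rightarrow> ennreal"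
  assumes b: "\<And>k. cell_inv (cube k) (b k)" and p: "0 < p"
  shows "(NN x. epow (SUP k\<in>ks M. enl B k (b k) x) p) \<le>
    ennreal (big_ratio TYPE('a)) * (NN x. epow (SUP k\<in>ks M. b k x) p)"
proof -
  let ?k = "\<lambda>i. int M - int i"
  let ?E = "\<lambda>i. enl_set B (?k i) (b (?k i))"
  have "(NN x. (SUP i\<in>{..<2 * M + 1}. epow (enl B (?k i) (b (?k i)) x) p)) \<le>
    ennreal (big_ratio TYPE('a)) *
    (NN x. (SUP i\<in>{..<2 * M + 1}. epow (enl B (?k i) (b (?k i)) x) p * indicator (?E i) x))"
  proof (rule SUP_restrict_cells[where \<kappa> = "\<lambda>i. big_cube B (?k i)"])
    show "cell_inv (big_cube B (?k i)) (\<lambda>x. epow (enl B (?k i) (b (?k i)) x) p)" for i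
      using enl_inv[of B "?k i" "b (?k i)"] unfolding cell_inv_def by metis
    show "big_cube B (?k i) x = big_cube B (?k i) y \<Longrightarrow> big_cube B (?k j) x = big_cube B (?k j) y"
      if "j \<le> i" for i j x y using that by (intro big_cube_nested[of "?k i" "?k j"]) auto
  qed (use enl_set_measurable[OF b] nn_integral_enl_set[OF b] in auto)
  also have "\<dots> \<le> ennreal (big_ratio TYPE('a)) *
    (NN x. (SUP i\<in>{..<2 * M + 1}. epow (b (?k i) x) p))"
  proof (intro mult_left_mono nn_integral_mono SUP_mono' )
    fix i x
    have "epow (enl B (?k i) (b (?k i)) x * indicator (?E i) x) p \<le> epow (b (?k i) x) p"
      using p by (intro epow_mono enl_le) auto
    then show "epow (enl B (?k i) (b (?k i)) x) p * indicator (?E i) x \<le> epow (b (?k i) x) p"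
      by (auto simp: indicator_def)
  qed simp
  finally show ?thesis unfolding SUP_scales epow_SUP[OF p] .
qed

text \<open>The weight localises the estimate. At p = \<infinity> it will be the indicator of the
  big cubes that meet a given ball.\<close>

lemma nn_integral_enl_weighted:
  fixes b :: "'a::euclidean_space \<Rightarrow> ennreal"
  assumes b: "cell_inv (cube k) b" and q: "0 < q" and \<psi>: "cell_inv (big_cube B k) \<psi>"
  shows "(NN x. epow (enl B k b x) q * \<psi> x) \<le>
    ennreal (big_ratio TYPE('a)) * (NN x. epow (b x) q * \<psi> x)"
proof -
  have "(NN x. epow (enl B k b x) q * \<psi> x) \<le>
    ennreal (big_ratio TYPE('a)) * (NN x. epow (enl B k b x) q * \<psi> x * indicator (enl_set B k b) x)"
  proof (rule nn_integral_enl_set[OF b])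
    show "cell_inv (big_cube B k) (\<lambda>x. epow (enl B k b x) q * \<psi> x)"
      using enl_inv[of B k b] \<psi> unfolding cell_inv_def by metis
  qed
  also have "\<dots> \<le> ennreal (big_ratio TYPE('a)) * (NN x. epow (b x) q * \<psi> x)"
  proof (intro mult_left_mono nn_integral_mono)
    fix x
    have "epow (enl B k b x * indicator (enl_set B k b) x) q \<le> epow (b x) q"
      using q by (intro epow_mono enl_le) auto
    then show "epow (enl B k b x) q * \<psi> x * indicator (enl_set B k b) x \<le> epow (b x) q * \<psi> x"
      by (auto simp: indicator_def intro: mult_right_mono)
  qed simp
  finally show ?thesis .
qed

section \<open>Whitney boxes\<close>

text \<open>For r = \<infinity> the least essential bound is written out, so that monotonicity holds
  without measurability; on measurable functions it agrees with \<open>esssup\<close>.\<close>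

definition locnorm :: "ennreal \<Rightarrow> 'b::euclidean_space set \<Rightarrow> ('b \<Rightarrow> ennreal) \<Rightarrow> ennreal"
  where "locnorm r S h =
    (if r = \<infinity> then Inf {m. AE z\<in>S in lborel. h z \<le> m}
     else epow ((NN z. epow (h z) (enn2real r) * indicator S z) / emeasure lborel S) (1 / enn2real r))"

lemma enn2real_ge_1: "1 \<le> r \<Longrightarrow> r < top \<Longrightarrow> 1 \<le> enn2real r"
  using enn2real_mono[of 1 r] by simp

text \<open>The infimum is approached along a sequence of essential bounds, and the exceptional sets
  of a sequence still form a null set.\<close>

lemma locnorm_top_AE: "AE z\<in>S in lborel. h z \<le> locnorm \<infinity> S h"
proof -
  let ?A = "{m. AE z\<in>S in lborel. h z \<le> m}"
  have "top \<in> ?A" by simp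
  then obtain f :: "nat \<Rightarrow> ennreal" where f: "range f \<subseteq> ?A" "Inf ?A = (INF i. f i)"
    using ennreal_Inf_countable_INF[of ?A] by blast
  have "AE z in lborel. \<forall>i. z \<in> S \<longrightarrow> h z \<le> f i"
    using f(1) by (subst AE_all_countable) auto
  then show ?thesis unfolding locnorm_def f(2) by eventually_elim (auto intro: INF_greatest)
qed

lemma locnorm_top_le: "AE z\<in>S in lborel. h z \<le> m \<Longrightarrow> locnorm \<infinity> S h \<le> m"
  by (simp add: locnorm_def Inf_lower)

lemma locnorm_mono_AE:
  assumes "AE z\<in>S in lborel. h z \<le> h' z"
  shows "locnorm r S h \<le> locnorm r S h'"
proof (cases "r = \<infinity>")
  case True
  have "AE z\<in>S in lborel. h z \<le> locnorm \<infinity> S h'"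
    using assms locnorm_top_AE[of S h'] by eventually_elim auto
  then show ?thesis unfolding True by (rule locnorm_top_le)
next
  case False
  have "(NN z. epow (h z) (enn2real r) * indicator S z) \<le>
    (NN z. epow (h' z) (enn2real r) * indicator S z)"
    using assms by (intro nn_integral_mono_AE, eventually_elim) (auto simp: indicator_def intro: epow_mono)
  then show ?thesis using False by (auto simp: locnorm_def intro!: epow_mono divide_right_mono_ennreal)
qed

lemma locnorm_mono: "(\<And>z. z \<in> S \<Longrightarrow> h z \<le> h' z) \<Longrightarrow> locnorm r S h \<le> locnorm r S h'"
  by (rule locnorm_mono_AE) auto

lemma locnorm_cong_AE:
  assumes "AE z\<in>S in lborel. h z = h' z"
  shows "locnorm r S h = locnorm r S h'" using assms by (intro antisym locnorm_mono_AE; eventually_elim; simp)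

lemma epow_const_le:
  assumes "1 \<le> C" "0 < a" "a \<le> 1"
  shows "epow (ennreal C) a \<le> ennreal C"
  using assms powr_mono[of a 1 C] by (simp add: epow_ennreal ennreal_leI)

text \<open>Enlarging the domain increases the integral, and the normalisation loses at most the
  volume ratio \<open>C\<close>. The root of \<open>C\<close> that appears is at most
  \<open>C\<close>, because \<open>C\<close> and \<open>r\<close> are at least 1.\<close>

lemma locnorm_subset:
  fixes S S' :: "'b::euclidean_space set"
  assumes r: "1 \<le> r" and sub: "S \<subseteq> S'" and C: "1 \<le> C"
    and s: "emeasure lborel S = ennreal s" "emeasure lborel S' = ennreal s'" "0 < s" "s' \<le> C * s"
    and S: "S \<in> sets borel" "S' \<in> sets borel"
  shows "locnorm r S h \<le> ennreal C * locnorm r S' h"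
proof (cases "r = \<infinity>")
  case True
  have "AE z\<in>S in lborel. h z \<le> locnorm \<infinity> S' h"
    using locnorm_top_AE[of S' h] by eventually_elim (use sub in auto)
  then have "locnorm \<infinity> S h \<le> 1 * locnorm \<infinity> S' h" unfolding mult_1 by (rule locnorm_top_le)
  also have "\<dots> \<le> ennreal C * locnorm \<infinity> S' h"
    using C by (intro mult_right_mono) (auto simp: ennreal_1[symmetric] simp del: ennreal_1 intro: ennreal_leI)
  finally show ?thesis using True by simp
next
  case False
  define R where "R = enn2real r"
  have R: "1 \<le> R" unfolding R_def using r False by (intro enn2real_ge_1) (auto simp: less_top)
  have "ennreal s \<le> ennreal s'" using emeasure_mono[OF sub, of lborel] S s by simp
  then have s': "0 < s'" using s(3) by (auto simp: ennreal_le_iff2)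
  define I where "I = (NN z. epow (h z) R * indicator S z)"
  define I' where "I' = (NN z. epow (h z) R * indicator S' z)"
  have "I \<le> I'" unfolding I_def I'_def using sub by (intro nn_integral_mono) (auto simp: indicator_def)
  have "I / ennreal s = I * ennreal (1 / s)"
    using s(3) by (simp add: divide_ennreal_def inverse_ennreal inverse_eq_divide)
  also have "\<dots> \<le> I' * ennreal (C * (1 / s'))"
    using \<open>I \<le> I'\<close> s C s' by (intro mult_mono ennreal_leI) (auto simp: field_simps)
  also have "\<dots> = ennreal C * (I' / ennreal s')"
    using s' C by (subst ennreal_mult) (auto simp: divide_ennreal_def inverse_ennreal inverse_eq_divide ac_simps)
  finally have "epow (I / ennreal s) (1 / R) \<le> epow (ennreal C * (I' / ennreal s')) (1 / R)"
    using R by (intro epow_mono) auto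
  also have "\<dots> = epow (ennreal C) (1 / R) * epow (I' / ennreal s') (1 / R)" by (rule epow_mult)
  also have "\<dots> \<le> ennreal C * epow (I' / ennreal s') (1 / R)"
    using R C by (intro mult_right_mono epow_const_le) auto
  finally show ?thesis using False s by (simp add: locnorm_def I_def I'_def R_def)
qed

lemma conj_exponent_real:
  assumes "1 < r" "r < top"
  shows "conj_exponent r = ennreal (enn2real r / (enn2real r - 1))" "1 < enn2real r"
    "1 < enn2real r / (enn2real r - 1)" "1 / enn2real r + 1 / (enn2real r / (enn2real r - 1)) = 1"
proof -
  obtain x where x: "r = ennreal x" "0 \<le> x" using assms(2) by (cases r) auto
  have x1: "1 < x" using assms(1) x ennreal_less_iff[of 1 x] by (simp add: ennreal_1[symmetric] del: ennreal_1)
  have "r - 1 = ennreal (x - 1)" unfolding x(1) ennreal_1[symmetric] by (rule ennreal_minus) simp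
  then show "conj_exponent r = ennreal (enn2real r / (enn2real r - 1))"
    using assms x x1 by (auto simp: conj_exponent_def divide_ennreal)
  show "1 < enn2real r" "1 < enn2real r / (enn2real r - 1)" "1 / enn2real r + 1 / (enn2real r / (enn2real r - 1)) = 1"
    using x x1 by (auto simp: field_simps)
qed

lemma locnorm_Holder:
  assumes [measurable]: "bm f" "bm g" "S \<in> sets borel"
    and r: "1 \<le> r" "r < top" and s: "emeasure lborel S = ennreal s" "0 < s"
  shows "(NN z. f z * g z * indicator S z) / emeasure lborel S
    \<le> locnorm (conj_exponent r) S f * locnorm r S g"
proof (cases "r = 1")
  case True
  have "(NN z. f z * g z * indicator S z) \<le>
    (NN z. locnorm \<infinity> S f * (g z * indicator S z))" using locnorm_top_AE[of S f]
    by (intro nn_integral_mono_AE, eventually_elim) (auto simp: indicator_def intro: mult_right_mono)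
  also have "\<dots> = locnorm \<infinity> S f * (NN z. g z * indicator S z)"
    by (rule nn_integral_cmult) measurable
  finally have "(NN z. f z * g z * indicator S z) / emeasure lborel S \<le>
    locnorm \<infinity> S f * ((NN z. g z * indicator S z) / emeasure lborel S)"
    unfolding ennreal_times_divide by (rule divide_right_mono_ennreal)
  then show ?thesis using True by (simp add: locnorm_def[of 1] conj_exponent_def)
next
  case False
  then have r1: "1 < r" using r by simp
  note c = conj_exponent_real[OF r1 r(2)]
  define R where "R = enn2real r"
  define Q where "Q = R / (R - 1)"
  have RQ: "1 < R" "1 < Q" "1 / Q + 1 / R = 1" using c by (auto simp: R_def Q_def)
  have Q: "conj_exponent r = ennreal Q" using c by (simp add: Q_def R_def)
  have eq: "epow x (1 / Q) * epow y (1 / R) / ennreal s = epow (x / ennreal s) (1 / Q) * epow (y / ennreal s) (1 / R)"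
    for x y
  proof -
    have "epow (inverse (ennreal s)) (1 / Q) * epow (inverse (ennreal s)) (1 / R) = inverse (ennreal s)"
      using epow_add[of "inverse (ennreal s)" "1 / Q" "1 / R"] RQ by simp
    then show ?thesis
      by (simp add: divide_ennreal_def epow_mult) (metis (no_types, lifting) mult.assoc mult.commute)
  qed
  have "(NN z. f z * g z * indicator S z) = (NN z. (f z * indicator S z) * (g z * indicator S z))"
    by (intro nn_integral_cong) (auto simp: indicator_def)
  also have "\<dots> \<le> epow (NN z. epow (f z * indicator S z) Q) (1 / Q) *
      epow (NN z. epow (g z * indicator S z) R) (1 / R)" using RQ by (intro Holder_nn_integral) auto
  also have "(NN z. epow (f z * indicator S z) Q) = (NN z. epow (f z) Q * indicator S z)"
    by (intro nn_integral_cong) (auto simp: indicator_def)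
  also have "(NN z. epow (g z * indicator S z) R) = (NN z. epow (g z) R * indicator S z)"
    by (intro nn_integral_cong) (auto simp: indicator_def)
  finally have "(NN z. f z * g z * indicator S z) / ennreal s \<le>
    epow (NN z. epow (f z) Q * indicator S z) (1 / Q) *
    epow (NN z. epow (g z) R * indicator S z) (1 / R) / ennreal s" by (rule divide_right_mono_ennreal)
  also have "\<dots> = locnorm (conj_exponent r) S f * locnorm r S g"
    unfolding eq using RQ s less_imp_neq[OF r(2)] by (simp add: locnorm_def Q R_def)
  finally show ?thesis by (simp add: s)
qed

section \<open>Boxes on top of dyadic cubes\<close>

definition slab :: "int \<Rightarrow> real set"
  where "slab k = {sc (k - 1)<..sc k}"

definition wbox :: "int \<Rightarrow> 'a::euclidean_space \<Rightarrow> (real \<times> 'a) set"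
  where "wbox k x = slab k \<times> (cube k -` {cube k x})"

definition slab_len :: "int \<Rightarrow> real"
  where "slab_len k = sc k - sc (k - 1)"

lemma slab_len_bounds: "sc k / 4 \<le> slab_len k" "slab_len k \<le> sc k" "0 < slab_len k"
proof -
  have "sc k * (1 / sqrt 2) \<le> sc k * (3 / 4)"
  proof (intro mult_left_mono)
    have "4 / 3 \<le> sqrt 2" by (rule real_le_rsqrt) (simp add: power2_eq_square)
    then show "1 / sqrt 2 \<le> 3 / 4" by (simp add: field_simps)
  qed (simp add: less_imp_le)
  then show "sc k / 4 \<le> slab_len k" by (simp add: slab_len_def sc_minus_1)
  then show "0 < slab_len k" using sc_pos[of k] by linarith
  show "slab_len k \<le> sc k" using sc_pos[of "k - 1"] by (simp add: slab_len_def less_imp_le)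
qed

lemma slab_measurable [measurable]: "slab k \<in> sets borel" by (simp add: slab_def)

lemma emeasure_slab: "emeasure lborel (slab k) = ennreal (slab_len k)"
  using sc_mono[of "k - 1" k] by (simp add: slab_def slab_len_def)

lemma emeasure_lborel_Times:
  fixes A :: "'b::euclidean_space set" and B :: "'c::euclidean_space set"
  assumes "A \<in> sets borel" "B \<in> sets borel"
  shows "emeasure lborel (A \<times> B) = emeasure lborel A * emeasure lborel B"
  unfolding lborel_prod[symmetric] using assms by (intro lborel.emeasure_pair_measure_Times) auto

lemma Times_borel:
  fixes A :: "'b::euclidean_space set" and B :: "'c::euclidean_space set"
  shows "A \<in> sets borel \<Longrightarrow> B \<in> sets borel \<Longrightarrow> A \<times> B \<in> sets borel"
  unfolding borel_prod[symmetric] by (rule pair_measureI)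

lemma borel_measurable_compose_fst:
  fixes f :: "'b::second_countable_topology \<Rightarrow> 'd::topological_space"
  assumes [measurable]: "bm f"
  shows "bm (\<lambda>z :: 'b \<times> 'c::second_countable_topology. f (fst z))"
  unfolding borel_prod[symmetric] by measurable

lemma borel_measurable_compose_snd:
  fixes f :: "'c::second_countable_topology \<Rightarrow> 'd::topological_space"
  assumes [measurable]: "bm f"
  shows "bm (\<lambda>z :: 'b::second_countable_topology \<times> 'c. f (snd z))"
  unfolding borel_prod[symmetric] by measurable

lemma wbox_measurable [measurable]: "wbox k x \<in> sets borel"
  unfolding wbox_def by (intro Times_borel slab_measurable cells.cell_sets[OF cells_cube])

lemma emeasure_wbox:
  fixes x :: "'a::euclidean_space"
  shows "emeasure lborel (wbox k x) = ennreal (slab_len k * cube_vol TYPE('a) k)" unfolding wbox_def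
  by (simp add: emeasure_lborel_Times cells.cell_sets[OF cells_cube] cells.cell_measure[OF cells_cube]
      emeasure_slab ennreal_mult slab_len_bounds less_imp_le)

lemma whitney_box_measurable [measurable]: "whitney_box t x \<in> sets borel"
  unfolding whitney_box_def by (intro Times_borel) auto

definition whitney_vol :: "'a::euclidean_space itself \<Rightarrow> real \<Rightarrow> real"
  where "whitney_vol _ t = t / 2 * (unit_ball_vol DIM('a) * t ^ DIM('a))"

lemma emeasure_whitney_box:
  fixes x :: "'a::euclidean_space"
  shows "0 \<le> t \<Longrightarrow> emeasure lborel (whitney_box t x) = ennreal (whitney_vol TYPE('a) t)"
  unfolding whitney_box_def whitney_vol_def
  by (simp add: emeasure_lborel_Times emeasure_ball ennreal_mult[symmetric])

lemma whitney_vol_pos: "0 < t \<Longrightarrow> 0 < whitney_vol TYPE('a::euclidean_space) t"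
  by (simp add: whitney_vol_def)

definition mean :: "int \<Rightarrow> (real \<times> 'a::euclidean_space \<Rightarrow> ennreal) \<Rightarrow> 'a \<Rightarrow> ennreal"
  where "mean k \<phi> x = (NN z. \<phi> z * indicator (wbox k x) z) / emeasure lborel (wbox k x)"

definition wcoeff :: "ennreal \<Rightarrow> (real \<times> 'a::euclidean_space \<Rightarrow> ennreal) \<Rightarrow> int \<Rightarrow> 'a \<Rightarrow> ennreal"
  where "wcoeff r h k x = locnorm r (wbox k x) h"

lemma wbox_cong: "cube k x = cube k y \<Longrightarrow> wbox k x = wbox k y" by (simp add: wbox_def)

lemma mean_inv: "cell_inv (cube k) (mean k \<phi>)" by (rule cell_invI) (simp add: mean_def cong: wbox_cong)

lemma wcoeff_inv: "cell_inv (cube k) (wcoeff r h k)" by (rule cell_invI) (simp add: wcoeff_def cong: wbox_cong)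

lemma wcoeff_measurable [measurable]: "bm (wcoeff r h k)"
  by (rule cells.cell_inv_borel_measurable[OF cells_cube wcoeff_inv])

lemma mean_measurable [measurable]: "bm (mean k \<phi>)"
  by (rule cells.cell_inv_borel_measurable[OF cells_cube mean_inv])

text \<open>Integration in s over the slab leaves a function of y whose conditional expectation over
  cubes is the box mean times the slab length; symmetry of conditional expectation does the
  rest.\<close>

lemma nn_integral_mean:
  fixes \<phi> :: "real \<times> 'a::euclidean_space \<Rightarrow> ennreal"
  assumes \<phi>: "bm \<phi>" and \<psi>: "cell_inv (cube k) \<psi>"
  shows "(NN z. \<phi> z * indicator (slab k) (fst z) * \<psi> (snd z)) =
    ennreal (slab_len k) * (NN x. mean k \<phi> x * \<psi> x)"
proof -
  interpret c: cells "cube k :: 'a \<Rightarrow> _" "cube_vol TYPE('a) k" by (rule cells_cube)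
  have [measurable]: "bm \<psi>" by (rule c.cell_inv_borel_measurable[OF \<psi>])
  have [measurable]: "\<phi> \<in> borel_measurable (borel \<Otimes>\<^sub>M borel)"
    using \<phi> by (simp add: borel_prod)
  define \<Phi> where "\<Phi> y = (NN s. \<phi> (s, y) * indicator (slab k) s)" for y
  have [measurable]: "bm \<Phi>" unfolding \<Phi>_def by measurable
  have avg: "c.avg \<Phi> x = ennreal (slab_len k) * mean k \<phi> x" for x
  proof -
    have [measurable]: "cube k -` {cube k x} \<in> sets borel" by (rule c.cell_sets)
    have "(NN z. \<phi> z * indicator (wbox k x) z) =
      (\<integral>\<^sup>+z. \<phi> z * (indicator (slab k) (fst z) * indicator (cube k -` {cube k x}) (snd z)) \<partial>(lborel \<Otimes>\<^sub>M lborel))"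
      unfolding lborel_prod by (intro nn_integral_cong) (auto simp: wbox_def indicator_def)
    also have "\<dots> = (NN y. (NN s. \<phi> (s, y) * (indicator (slab k) s * indicator (cube k -` {cube k x}) y)))"
      by (subst lborel_pair.nn_integral_snd[symmetric]) auto
    also have "\<dots> = (NN y. \<Phi> y * indicator (cube k -` {cube k x}) y)"
      unfolding \<Phi>_def by (simp add: nn_integral_multc[symmetric] mult.assoc)
    finally have "mean k \<phi> x = (NN y. \<Phi> y * indicator (cube k -` {cube k x}) y) /
      (ennreal (slab_len k) * ennreal (cube_vol TYPE('a) k))"
      using slab_len_bounds(3)[of k] by (simp add: mean_def emeasure_wbox ennreal_mult less_imp_le)
    also have "\<dots> = c.avg \<Phi> x / ennreal (slab_len k)" using slab_len_bounds(3)[of k]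
      by (simp add: c.avg_def divide_ennreal_def ennreal_inverse_mult ac_simps)
    finally show ?thesis
      using slab_len_bounds(3)[of k] by (simp add: ennreal_times_divide mult.commute[of "ennreal (slab_len k)"] mult_divide_eq_ennreal)
  qed
  have "(NN z. \<phi> z * indicator (slab k) (fst z) * \<psi> (snd z)) =
    (\<integral>\<^sup>+z. \<phi> z * indicator (slab k) (fst z) * \<psi> (snd z) \<partial>(lborel \<Otimes>\<^sub>M lborel))"
    by (simp add: lborel_prod)
  also have "\<dots> = (NN y. (NN s. \<phi> (s, y) * indicator (slab k) s * \<psi> y))"
    by (subst lborel_pair.nn_integral_snd[symmetric]) auto
  also have "\<dots> = (NN y. \<Phi> y * \<psi> y)" unfolding \<Phi>_def by (simp add: nn_integral_multc)
  also have "\<dots> = (NN x. c.avg \<Phi> x * \<psi> x)" by (rule c.nn_integral_avg[OF _ \<psi>]) measurable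
  also have "\<dots> = ennreal (slab_len k) * (NN x. mean k \<phi> x * \<psi> x)"
    unfolding avg mult.assoc by (rule nn_integral_cmult) measurable
  finally show ?thesis .
qed

lemma mean_Holder:
  assumes "bm f" "bm g" "1 \<le> r" "r < top"
  shows "mean k (\<lambda>z. f z * g z) x \<le> wcoeff (conj_exponent r) f k x * wcoeff r g k x"
  unfolding mean_def wcoeff_def using assms slab_len_bounds(3)[of k]
  by (intro locnorm_Holder[OF _ _ _ _ _ emeasure_wbox]) auto

text \<open>The Whitney average of a nonnegative function. The factor
  \<open>s powr (- \<beta>)\<close> is thought of as absorbed into \<open>h\<close>, so that \<beta>
  disappears until complex functions return.\<close>

definition wt :: "ennreal \<Rightarrow> (real \<times> 'a::euclidean_space \<Rightarrow> ennreal) \<Rightarrow> real \<Rightarrow> 'a \<Rightarrow> ennreal"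
  where "wt r h t x = locnorm r (whitney_box t x) h"

text \<open>Bounds the volume of a Whitney box divided by that of the dyadic box inside it: 4 comes
  from the length of a slab, 2^d from t \<le> 2 \<open>sc k\<close>, the last factor from
  \<open>cube_vol_lower\<close>.\<close>

definition low_const :: "'a::euclidean_space itself \<Rightarrow> real"
  where "low_const _ = max 1 (4 * unit_ball_vol DIM('a) * 2 ^ DIM('a) * (2 ^ (DIM('a) + 1)) ^ DIM('a))"

text \<open>The dyadic box of scale k lies in the Whitney box for every t in the next slab: its
  points satisfy s > \<open>sc (k - 1)\<close> \<ge> t / 2, as \<open>sc (k + 1)\<close> is twice
  \<open>sc (k - 1)\<close>. With one scale per octave no common slab would fit below all these
  t.\<close>

lemma wcoeff_le_wt:
  fixes x :: "'a::euclidean_space"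
  assumes r: "1 \<le> r" and t: "sc k < t" "t \<le> sc (k + 1)"
  shows "wcoeff r h k x \<le> ennreal (low_const TYPE('a)) * wt r h t x" unfolding wcoeff_def wt_def
proof (rule locnorm_subset[OF r _ _ emeasure_wbox emeasure_whitney_box])
  have t0: "0 < t" using sc_pos[of k] t by linarith
  then show "0 \<le> t" by simp
  have t2: "t \<le> 2 * sc k" "t / 2 \<le> sc (k - 1)"
  proof -
    have "sc (k + 1) \<le> sc (k + 2)" by (intro sc_mono) simp
    then show "t \<le> 2 * sc k" using t sc_plus_2[of k] by simp
    show "t / 2 \<le> sc (k - 1)" using t sc_plus_2[of "k - 1"] by (simp add: add.commute)
  qed
  show "wbox k x \<subseteq> whitney_box t x"
  proof
    fix z assume "z \<in> wbox k x"
    then obtain s y where z: "z = (s, y)" "sc (k - 1) < s" "s \<le> sc k" "cube k y = cube k x"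
      by (auto simp: wbox_def slab_def)
    show "z \<in> whitney_box t x" using z t t2 cube_dist[OF z(4)] by (auto simp: whitney_box_def dist_commute)
  qed
  have "whitney_vol TYPE('a) t \<le> sc k * (unit_ball_vol DIM('a) * (2 * sc k) ^ DIM('a))"
    unfolding whitney_vol_def using t0 t2 by (intro mult_mono power_mono) auto
  also have "\<dots> = (4 * unit_ball_vol DIM('a) * 2 ^ DIM('a)) * (sc k / 4) * sc k ^ DIM('a)"
    by (simp add: power_mult_distrib)
  also have "\<dots> \<le> (4 * unit_ball_vol DIM('a) * 2 ^ DIM('a)) * slab_len k *
      ((2 ^ (DIM('a) + 1)) ^ DIM('a) * cube_vol TYPE('a) k)"
    using slab_len_bounds[of k] cube_vol_lower[where 'a='a, of k] by (intro mult_mono) (auto simp: less_imp_le)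
  also have "\<dots> = (4 * unit_ball_vol DIM('a) * 2 ^ DIM('a) * (2 ^ (DIM('a) + 1)) ^ DIM('a)) *
      (slab_len k * cube_vol TYPE('a) k)" by simp
  also have "\<dots> \<le> low_const TYPE('a) * (slab_len k * cube_vol TYPE('a) k)"
    unfolding low_const_def using slab_len_bounds[of k] by (intro mult_right_mono) (auto simp: less_imp_le)
  finally show "whitney_vol TYPE('a) t \<le> low_const TYPE('a) * (slab_len k * cube_vol TYPE('a) k)" .
  show "1 \<le> low_const TYPE('a)" by (simp add: low_const_def)
  show "0 < slab_len k * cube_vol TYPE('a) k" using slab_len_bounds(3) by simp
qed auto

lemma wcoeff_top_AE:
  fixes h :: "real \<times> 'a::euclidean_space \<Rightarrow> ennreal"
  shows "AE z in lborel. fst z \<in> slab k \<longrightarrow> h z \<le> wcoeff \<infinity> h k (snd z)"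
proof -
  have cnt: "countable (range (cube k :: 'a \<Rightarrow> _))" by (rule cells.countable_cells[OF cells_cube])
  have "AE z in lborel. \<forall>a\<in>range (cube k :: 'a \<Rightarrow> _). z \<in> slab k \<times> (cube k -` {a}) \<longrightarrow>
    h z \<le> locnorm \<infinity> (slab k \<times> (cube k -` {a})) h"
    using cnt by (intro AE_ball_countable[THEN iffD2] ballI locnorm_top_AE)
  then show ?thesis
  proof eventually_elim
    case (elim z)
    then show ?case by (cases z) (auto simp: wcoeff_def wbox_def)
  qed
qed

text \<open>Bounds the volume of a slab over a big cube divided by that of a Whitney box at height
  t, given that \<open>sc k\<close> \<le> 2 t.\<close>

definition up_const :: "'a::euclidean_space itself \<Rightarrow> real"
  where "up_const _ = max 1 (2 ^ (DIM('a) + 2) * big_ratio TYPE('a) / unit_ball_vol DIM('a))"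

lemma mean_epow_eq_wcoeff:
  "r < top \<Longrightarrow> 1 \<le> r \<Longrightarrow> mean k (\<lambda>z. epow (h z) (enn2real r)) x = epow (wcoeff r h k x) (enn2real r)"
  using enn2real_ge_1[of r] by (cases "r = top") (simp_all add: mean_def wcoeff_def locnorm_def epow_epow)

lemma slab_cover:
  assumes t: "sc j < t" "t \<le> sc (j + 1)" and s: "t / 2 < s" "s \<le> t"
  obtains k where "k \<in> {j - 1..j + 1}" "s \<in> slab k"
proof -
  have "sc (j - 2) < s" using t s sc_plus_2[of "j - 2"] by simp
  then consider "s \<in> slab (j - 1)" | "s \<in> slab j" | "s \<in> slab (j + 1)"
    using t s unfolding slab_def by force
  then show thesis
  proof cases
    case 1
    then show ?thesis by (intro that[of "j - 1"]) auto
  next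
    case 2
    then show ?thesis by (intro that[of j]) auto
  next
    case 3
    then show ?thesis by (intro that[of "j + 1"]) auto
  qed
qed

text \<open>The Whitney box is covered by three slabs, and at each of these scales its ball lies in
  the subcubes of one big cube for a suitable grid. Since that grid varies with the point and the
  scale, the sum over all grids is taken.\<close>

lemma wt_le_enl:
  fixes h :: "real \<times> 'a::euclidean_space \<Rightarrow> ennreal"
  assumes h: "bm h" and r: "1 \<le> r" and t: "sc j < t" "t \<le> sc (j + 1)"
  shows "wt r h t x \<le> ennreal (up_const TYPE('a)) *
    (\<Sum>k\<in>{j - 1..j + 1}. \<Sum>B\<in>Pow Basis. enl B k (wcoeff r h k) x)"
proof -
  note [measurable] = h
  define m where "m k = (\<Sum>B\<in>Pow Basis. enl B k (wcoeff r h k) x)" for k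
  have t0: "0 < t" using sc_pos[of j] t by linarith
  have t2: "t \<le> 2 * sc k" if "k \<in> {j - 1..j + 1}" for k
  proof -
    have "sc (j + 1) \<le> sc (k + 2)" using that by (intro sc_mono) simp
    then show ?thesis using t sc_plus_2[of k] by simp
  qed
  have cover: "\<exists>B. B \<subseteq> Basis \<and> ball x t \<subseteq> subcubes B k x" if k: "k \<in> {j - 1..j + 1}" for k
  proof -
    obtain B where B: "B \<subseteq> Basis" "\<And>y z. dist y x < 2 * sc k \<Longrightarrow> cube k z = cube k y \<Longrightarrow> big_cube B k z = big_cube B k x"
      using big_cube_covers[where k=k and x=x] by blast
    have "ball x t \<subseteq> subcubes B k x"
    proof
      fix y assume "y \<in> ball x t"
      then have "dist y x < 2 * sc k" using t2[OF k] by (simp add: dist_commute)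
      then show "y \<in> subcubes B k x" unfolding subcubes_def using B(2) by blast
    qed
    then show ?thesis using B(1) by blast
  qed
  have enl_m: "enl B k (wcoeff r h k) x \<le> m k" if "B \<subseteq> Basis" for B k
    unfolding m_def using that by (intro member_le_sum) (auto intro: finite_subset)
  show ?thesis
  proof (cases "r = \<infinity>")
    case True
    have "AE z in lborel. \<forall>k. fst z \<in> slab k \<longrightarrow> h z \<le> wcoeff r h k (snd z)"
      unfolding True by (subst AE_all_countable) (intro allI wcoeff_top_AE)
    then have "AE z in lborel. z \<in> whitney_box t x \<longrightarrow> h z \<le> (\<Sum>k\<in>{j - 1..j + 1}. m k)"
    proof eventually_elim
      case (elim z)
      show ?case
      proof
        assume "z \<in> whitney_box t x"
        then obtain s y where z: "z = (s, y)" "t / 2 < s" "s \<le> t" "y \<in> ball x t"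
          by (auto simp: whitney_box_def)
        obtain k where k: "k \<in> {j - 1..j + 1}" "s \<in> slab k" using slab_cover[OF t z(2,3)] .
        obtain B where B: "B \<subseteq> Basis" "ball x t \<subseteq> subcubes B k x" using cover[OF k(1)] by blast
        have "h z \<le> wcoeff r h k y" using elim k(2) z(1) by auto
        also have "\<dots> \<le> enl B k (wcoeff r h k) x"
          unfolding enl_def using B(2) z(4) by (intro SUP_upper) auto
        also have "\<dots> \<le> m k" by (rule enl_m[OF B(1)])
        also have "\<dots> \<le> (\<Sum>k\<in>{j - 1..j + 1}. m k)" using k(1) by (intro member_le_sum) auto
        finally show "h z \<le> (\<Sum>k\<in>{j - 1..j + 1}. m k)" .
      qed
    qed
    then have "wt r h t x \<le> 1 * (\<Sum>k\<in>{j - 1..j + 1}. m k)"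
      unfolding wt_def True mult_1 by (rule locnorm_top_le)
    also have "\<dots> \<le> ennreal (up_const TYPE('a)) * (\<Sum>k\<in>{j - 1..j + 1}. m k)"
      by (intro mult_right_mono) (auto simp: up_const_def ennreal_1[symmetric] simp del: ennreal_1 intro: ennreal_leI)
    finally show ?thesis by (simp add: m_def)
  next
    case False
    then have rt: "r < top" by (simp add: less_top)
    define R where "R = enn2real r"
    have R: "1 \<le> R" unfolding R_def using r rt by (rule enn2real_ge_1)
    define C where "C = 2 ^ (DIM('a) + 2) * big_ratio TYPE('a) / unit_ball_vol (real DIM('a))"
    have C: "0 < C" by (simp add: C_def)
    define V where "V = whitney_vol TYPE('a) t"
    have V: "0 < V" unfolding V_def by (rule whitney_vol_pos[OF t0])
    \<comment> \<open>On one slab the integral over the ball is at most that over the subcubes;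
      there the box means are bounded by the maximum \<open>enl\<close>, and the total volume by
      that of the big cube.\<close>
    have part: "(NN z. epow (h z) R * indicator (slab k) (fst z) * indicator (ball x t) (snd z))
        \<le> ennreal (C * V) * epow (m k) R" if k: "k \<in> {j - 1..j + 1}" for k
    proof -
      interpret big: cells "big_cube B k :: 'a \<Rightarrow> _" "big_ratio TYPE('a) * cube_vol TYPE('a) k" for B
        by (rule cells_big_cube)
      obtain B where B: "B \<subseteq> Basis" "ball x t \<subseteq> subcubes B k x" using cover[OF k] by blast
      have sub_inv: "cell_inv (cube k) (indicator (subcubes B k x) :: 'a \<Rightarrow> ennreal)"
        by (rule cell_invI) (simp add: subcubes_def indicator_def)
      have "(NN z. epow (h z) R * indicator (slab k) (fst z) * indicator (ball x t) (snd z)) \<le>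
        (NN z. epow (h z) R * indicator (slab k) (fst z) * indicator (subcubes B k x) (snd z))"
        using B(2) by (intro nn_integral_mono mult_left_mono) (auto simp: indicator_def)
      also have "\<dots> = ennreal (slab_len k) * (NN y. mean k (\<lambda>z. epow (h z) R) y * indicator (subcubes B k x) y)"
        by (rule nn_integral_mean[OF _ sub_inv]) measurable
      also have "\<dots> \<le> ennreal (slab_len k) * (NN y. epow (m k) R * indicator (big_cube B k -` {big_cube B k x}) y)"
      proof (intro mult_left_mono nn_integral_mono)
        fix y
        show "mean k (\<lambda>z. epow (h z) R) y * indicator (subcubes B k x) y \<le>
          epow (m k) R * indicator (big_cube B k -` {big_cube B k x}) y"
        proof (cases "y \<in> subcubes B k x")
          case True
          have "wcoeff r h k y \<le> enl B k (wcoeff r h k) x" unfolding enl_def using True by (rule SUP_upper)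
          also have "\<dots> \<le> m k" by (rule enl_m[OF B(1)])
          finally have "epow (wcoeff r h k y) R \<le> epow (m k) R" using R by (intro epow_mono) auto
          moreover have "y \<in> big_cube B k -` {big_cube B k x}" using True by (auto simp: subcubes_def)
          ultimately show ?thesis using True mean_epow_eq_wcoeff[OF rt r, of k h y] by (simp add: R_def)
        qed simp
      qed simp
      also have "\<dots> = ennreal (slab_len k) * (epow (m k) R * ennreal (big_ratio TYPE('a) * cube_vol TYPE('a) k))"
        by (simp add: nn_integral_cmult_indicator big.cell_sets big.cell_measure)
      also have "\<dots> = ennreal (slab_len k * (big_ratio TYPE('a) * cube_vol TYPE('a) k)) * epow (m k) R"
        using slab_len_bounds(3)[of k] by (simp add: ennreal_mult less_imp_le ac_simps)
      also have "\<dots> \<le> ennreal (C * V) * epow (m k) R"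
      proof (intro mult_right_mono ennreal_leI)
        have k2: "sc k \<le> 2 * t"
        proof -
          have "sc k \<le> sc (j + 2)" using k by (intro sc_mono) simp
          then show ?thesis using t sc_plus_2[of j] by simp
        qed
        have "slab_len k * (big_ratio TYPE('a) * cube_vol TYPE('a) k) \<le> sc k * (big_ratio TYPE('a) * sc k ^ DIM('a))"
          using slab_len_bounds[of k] cube_vol_upper[where 'a='a, of k]
          by (intro mult_mono) (auto simp: less_imp_le)
        also have "\<dots> \<le> (2 * t) * (big_ratio TYPE('a) * (2 * t) ^ DIM('a))"
          using k2 t0 by (intro mult_mono power_mono) (auto simp: less_imp_le)
        also have "\<dots> = C * V"
          using less_imp_neq[OF unit_ball_vol_pos[of "real DIM('a)"]] by (simp add: C_def V_def whitney_vol_def power_mult_distrib)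
        finally show "slab_len k * (big_ratio TYPE('a) * cube_vol TYPE('a) k) \<le> C * V" .
      qed simp
      finally show ?thesis .
    qed
    have "(NN z. epow (h z) R * indicator (whitney_box t x) z) \<le>
      (NN z. (\<Sum>k\<in>{j - 1..j + 1}. epow (h z) R * indicator (slab k) (fst z) * indicator (ball x t) (snd z)))"
    proof (intro nn_integral_mono)
      fix z
      show "epow (h z) R * indicator (whitney_box t x) z \<le>
        (\<Sum>k\<in>{j - 1..j + 1}. epow (h z) R * indicator (slab k) (fst z) * indicator (ball x t) (snd z))"
      proof (cases "z \<in> whitney_box t x")
        case True
        then obtain s y where z: "z = (s, y)" "t / 2 < s" "s \<le> t" "y \<in> ball x t"
          by (auto simp: whitney_box_def)
        obtain k where k: "k \<in> {j - 1..j + 1}" "s \<in> slab k" using slab_cover[OF t z(2,3)] .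
        have "epow (h z) R * indicator (whitney_box t x) z =
          epow (h z) R * indicator (slab k) (fst z) * indicator (ball x t) (snd z)" using k z True by simp
        also have "\<dots> \<le> (\<Sum>k\<in>{j - 1..j + 1}. epow (h z) R * indicator (slab k) (fst z) * indicator (ball x t) (snd z))"
          using k(1) by (intro member_le_sum[where f="\<lambda>k. epow (h z) R * indicator (slab k) (fst z) * indicator (ball x t) (snd z)"]) auto
        finally show ?thesis .
      qed simp
    qed
    also have "\<dots> = (\<Sum>k\<in>{j - 1..j + 1}. (NN z. epow (h z) R * indicator (slab k) (fst z) * indicator (ball x t) (snd z)))"
    proof (rule nn_integral_sum)
      have [measurable]: "bm (\<lambda>z :: real \<times> 'a. indicator (slab k) (fst z) :: ennreal)" for k
        by (rule borel_measurable_compose_fst) simp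
      have [measurable]: "bm (\<lambda>z :: real \<times> 'a. indicator (ball x t) (snd z) :: ennreal)"
        by (intro borel_measurable_compose_snd borel_measurable_indicator borel_open open_ball)
      show "(\<lambda>z. epow (h z) R * indicator (slab k) (fst z) * indicator (ball x t) (snd z)) \<in> borel_measurable lborel" for k
        by measurable
    qed
    also have "\<dots> \<le> (\<Sum>k\<in>{j - 1..j + 1}. ennreal (C * V) * epow (m k) R)"
      by (intro sum_mono part)
    also have "\<dots> = ennreal (C * V) * (\<Sum>k\<in>{j - 1..j + 1}. epow (m k) R)"
      by (simp add: sum_distrib_left)
    finally have "(NN z. epow (h z) R * indicator (whitney_box t x) z) / ennreal V \<le>
      ennreal (C * V) * (\<Sum>k\<in>{j - 1..j + 1}. epow (m k) R) / ennreal V"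
      by (rule divide_right_mono_ennreal)
    also have "\<dots> = ennreal C * (\<Sum>k\<in>{j - 1..j + 1}. epow (m k) R)"
    proof -
      have "ennreal (C * V) / ennreal V = ennreal C" using C V by (subst divide_ennreal) auto
      then show ?thesis by (metis ennreal_times_divide mult.commute)
    qed
    also have "\<dots> \<le> ennreal (up_const TYPE('a)) * (\<Sum>k\<in>{j - 1..j + 1}. epow (m k) R)"
      by (intro mult_right_mono ennreal_leI) (auto simp: up_const_def C_def)
    finally have "epow ((NN z. epow (h z) R * indicator (whitney_box t x) z) / ennreal V) (1 / R) \<le>
      epow (ennreal (up_const TYPE('a)) * (\<Sum>k\<in>{j - 1..j + 1}. epow (m k) R)) (1 / R)"
      using R by (intro epow_mono) auto
    also have "\<dots> = epow (ennreal (up_const TYPE('a))) (1 / R) * epow (\<Sum>k\<in>{j - 1..j + 1}. epow (m k) R) (1 / R)"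
      by (rule epow_mult)
    also have "\<dots> \<le> ennreal (up_const TYPE('a)) * (\<Sum>k\<in>{j - 1..j + 1}. m k)"
    proof (intro mult_mono epow_const_le)
      \<comment> \<open>As 1 / R \<le> 1, the l^R norm of the three terms is at most their
        sum.\<close>
      have "(\<Sum>k\<in>{j - 1..j + 1}. epow (m k) R) \<le> epow (\<Sum>k\<in>{j - 1..j + 1}. epow (epow (m k) R) (1 / R)) (1 / (1 / R))"
        using R by (intro sum_le_epow_sum) auto
      then show "epow (\<Sum>k\<in>{j - 1..j + 1}. epow (m k) R) (1 / R) \<le> (\<Sum>k\<in>{j - 1..j + 1}. m k)"
        using R by (subst epow_le_swap) (auto simp: epow_epow)
    qed (use R in \<open>auto simp: up_const_def\<close>)
    finally show ?thesis using False t0 by (simp add: wt_def locnorm_def emeasure_whitney_box R_def V_def m_def)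
  qed
qed

text \<open>For finite r this is measurability of parametrised integrals. For r = \<infinity> the
  average exceeds y exactly when the set where h > y meets the Whitney box in positive measure,
  which is again a condition on such an integral.\<close>

lemma wt_measurable:
  fixes h :: "real \<times> 'a::euclidean_space \<Rightarrow> ennreal"
  assumes [measurable]: "bm h"
  shows "(\<lambda>p. wt r h (fst p) (snd p)) \<in> borel_measurable (borel \<Otimes>\<^sub>M borel)"
proof -
  have ind: "indicator (whitney_box t x) z = (if t / 2 < fst z \<and> fst z \<le> t \<and> dist x (snd z) < t then 1 else 0 :: ennreal)"
    for t z and x :: 'a by (cases z) (auto simp: whitney_box_def indicator_def)
  have int: "(\<lambda>p. (NN z. \<phi> z * indicator (whitney_box (fst p) (snd p)) z)) \<in> borel_measurable (borel \<Otimes>\<^sub>M borel)"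
    if [measurable]: "bm \<phi>" for \<phi> :: "real \<times> 'a \<Rightarrow> ennreal"
  proof -
    have [measurable]: "\<phi> \<in> borel_measurable (borel \<Otimes>\<^sub>M borel)" using that by (simp add: borel_prod)
    show ?thesis unfolding ind lborel_prod[symmetric] by measurable
  qed
  show ?thesis
  proof (cases "r = \<infinity>")
    case False
    have [measurable]: "(\<lambda>p. emeasure lborel (whitney_box (fst p) (snd p) :: (real \<times> 'a) set)) \<in> borel_measurable (borel \<Otimes>\<^sub>M borel)"
      using int[of "\<lambda>_. 1"] by simp
    note [measurable] = int[of "\<lambda>z. epow (h z) (enn2real r)"]
    show ?thesis using False unfolding wt_def locnorm_def by simp measurable
  next
    case True
    show ?thesis
    proof (rule borel_measurableI_greater)
      fix y :: ennreal
      have [measurable]: "(\<lambda>p. (NN z. indicator {z. y < h z} z * indicator (whitney_box (fst p) (snd p)) z)) \<in> borel_measurable (borel \<Otimes>\<^sub>M borel)"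
        by (rule int) measurable
      have "y < wt r h t x \<longleftrightarrow> (NN z. indicator {z. y < h z} z * indicator (whitney_box t x) z) \<noteq> 0" for t x
      proof -
        have "wt r h t x \<le> y \<longleftrightarrow> (AE z in lborel. z \<in> whitney_box t x \<longrightarrow> h z \<le> y)"
        proof
          assume le: "wt r h t x \<le> y"
          show "AE z in lborel. z \<in> whitney_box t x \<longrightarrow> h z \<le> y"
            using locnorm_top_AE[of "whitney_box t x" h]
          proof eventually_elim
            case (elim z)
            then show ?case using le unfolding wt_def True by (blast intro: order_trans)
          qed
        next
          assume "AE z in lborel. z \<in> whitney_box t x \<longrightarrow> h z \<le> y"
          then show "wt r h t x \<le> y" unfolding wt_def True by (rule locnorm_top_le)
        qed
        also have "\<dots> \<longleftrightarrow> (NN z. indicator {z. y < h z} z * indicator (whitney_box t x) z) = 0"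
          by (subst nn_integral_0_iff_AE) (auto simp: indicator_def not_less intro!: AE_cong)
        finally show ?thesis by (simp add: not_le[symmetric])
      qed
      then have "{p \<in> space (borel \<Otimes>\<^sub>M borel). y < wt r h (fst p) (snd p)} =
        {p \<in> space (borel \<Otimes>\<^sub>M borel). (NN z. indicator {z. y < h z} z * indicator (whitney_box (fst p) (snd p)) z) \<noteq> 0}"
        by auto
      also have "\<dots> \<in> sets (borel \<Otimes>\<^sub>M borel)" by measurable
      finally show "{p \<in> space (borel \<Otimes>\<^sub>M borel). y < wt r h (fst p) (snd p)} \<in> sets (borel \<Otimes>\<^sub>M borel)" .
    qed
  qed
qed

section \<open>Tent norms and sequence norms\<close>

lemma space_dt_over_t [simp]: "space dt_over_t = {0<..}" by (simp add: dt_over_t_def space_restrict_space)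

lemma borel_measurable_dt_over_t: "bm f \<Longrightarrow> f \<in> borel_measurable dt_over_t"
  unfolding dt_over_t_def measurable_cong_sets[OF sets_density refl]
  by (intro measurable_restrict_space1 measurable_completion) simp

lemma sets_dt_over_t: "A \<in> sets borel \<Longrightarrow> A \<subseteq> {0<..} \<Longrightarrow> A \<in> sets dt_over_t"
  unfolding dt_over_t_def sets_density by (auto simp: sets_restrict_space_iff)

lemma nn_integral_dt_over_t:
  assumes "bm f"
  shows "(\<integral>\<^sup>+t. f t \<partial>dt_over_t) = (NN t. ennreal (1 / t) * f t * indicator {0<..} t)"
proof -
  have "f \<in> borel_measurable (lebesgue_on {0<..})" "(\<lambda>t. ennreal (1 / t)) \<in> borel_measurable (lebesgue_on {0<..})"
    using assms by (auto intro!: measurable_restrict_space1 measurable_completion)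
  then show ?thesis unfolding dt_over_t_def
    by (simp add: nn_integral_density nn_integral_restrict_space nn_integral_completion)
qed

lemma slab_subset: "slab k \<subseteq> {0<..}" by (auto simp: slab_def intro: less_trans[OF sc_pos])

lemma slab_exists: "0 < t \<Longrightarrow> \<exists>k. t \<in> slab (k + 1)"
  using scale_exists[of t] by (metis add_diff_cancel_right' greaterThanAtMost_iff slab_def)

lemma slab_disjoint: "t \<in> slab k \<Longrightarrow> t \<in> slab l \<Longrightarrow> k = l"
  unfolding slab_def
proof (rule ccontr)
  assume *: "t \<in> {sc (k - 1)<..sc k}" "t \<in> {sc (l - 1)<..sc l}" "k \<noteq> l"
  then have "k \<le> l - 1 \<or> l \<le> k - 1" by linarith
  then have "sc k \<le> sc (l - 1) \<or> sc l \<le> sc (k - 1)" using sc_mono by blast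
  with * show False by auto
qed

lemma slab_in_dt [measurable]: "slab k \<in> sets dt_over_t"
  by (intro sets_dt_over_t slab_measurable slab_subset)

text \<open>The exact measure is (ln 2) / 2; bounding 1 / t by its values at the endpoints already
  gives constants independent of k.\<close>

lemma emeasure_dt_slab: "ennreal (1 / 4) \<le> emeasure dt_over_t (slab k)" "emeasure dt_over_t (slab k) \<le> 1"
proof -
  have eq: "emeasure dt_over_t (slab k) = (NN t. ennreal (1 / t) * indicator (slab k) t)"
  proof -
    have "emeasure dt_over_t (slab k) = (\<integral>\<^sup>+t. indicator (slab k) t \<partial>dt_over_t)" by simp
    also have "\<dots> = (NN t. ennreal (1 / t) * indicator (slab k) t * indicator {0<..} t)"
      by (rule nn_integral_dt_over_t) simp
    also have "\<dots> = (NN t. ennreal (1 / t) * indicator (slab k) t)"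
      using slab_subset[of k] by (intro nn_integral_cong) (auto simp: indicator_def)
    finally show ?thesis .
  qed
  have "ennreal (1 / 4) \<le> ennreal (1 / sc k) * emeasure lborel (slab k)"
    using slab_len_bounds[of k] unfolding emeasure_slab
    by (subst ennreal_mult[symmetric]) (auto intro!: ennreal_leI simp: field_simps less_imp_le)
  also have "\<dots> = (NN t. ennreal (1 / sc k) * indicator (slab k) t)"
    by (simp add: nn_integral_cmult_indicator)
  also have "\<dots> \<le> (NN t. ennreal (1 / t) * indicator (slab k) t)" using sc_pos[of "k - 1"]
    by (intro nn_integral_mono) (auto simp: indicator_def slab_def intro!: ennreal_leI frac_le intro: less_trans[OF sc_pos])
  finally show "ennreal (1 / 4) \<le> emeasure dt_over_t (slab k)" by (simp add: eq)
  have "(NN t. ennreal (1 / t) * indicator (slab k) t) \<le> (NN t. ennreal (1 / sc (k - 1)) * indicator (slab k) t)"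
    using sc_pos[of "k - 1"]
    by (intro nn_integral_mono) (auto simp: indicator_def slab_def intro!: ennreal_leI frac_le intro: less_trans[OF sc_pos])
  also have "\<dots> = ennreal (1 / sc (k - 1)) * emeasure lborel (slab k)"
    by (simp add: nn_integral_cmult_indicator)
  also have "\<dots> \<le> ennreal 1"
  proof -
    have "slab_len k \<le> sc (k - 1)"
      using sc_mono[of k "k + 1"] sc_plus_2[of "k - 1"] by (simp add: slab_len_def add.commute)
    then show ?thesis unfolding emeasure_slab using sc_pos[of "k - 1"] slab_len_bounds(3)[of k]
      by (subst ennreal_mult[symmetric]) (auto intro!: ennreal_leI simp: field_simps less_imp_le simp del: ennreal_1)
  qed
  finally show "emeasure dt_over_t (slab k) \<le> 1" by (simp add: eq)
qed

definition tent :: "ennreal \<Rightarrow> ennreal \<Rightarrow> (real \<Rightarrow> 'a::euclidean_space \<Rightarrow> ennreal) \<Rightarrow> ennreal"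
  where "tent p q W =
    (if p < \<infinity> then Lp_norm lebesgue p (\<lambda>x. Lp_norm dt_over_t q (\<lambda>t. W t x))
     else if q < \<infinity> then
       (SUP \<tau>\<in>{0<..}. SUP y. epow
         (\<integral>\<^sup>+ t\<in>{0<..<\<tau>}. mean_value (ball y \<tau>) (\<lambda>x. epow (W t x) (enn2real q))
            \<partial>dt_over_t) (1 / enn2real q))
     else (SUP t\<in>{0<..}. SUP x. W t x))"

lemma tent_norm_eq_tent: "tent_norm p q r \<beta> f = tent p q (whitney r \<beta> f)"
  by (simp add: tent_norm_def tent_def)

text \<open>The l^q norm over the scales from - M to M only. Estimates are uniform in
  \<open>M\<close>, and the norm over all scales is the supremum over \<open>M\<close>.\<close>

definition seqn :: "ennreal \<Rightarrow> nat \<Rightarrow> (int \<Rightarrow> 'a \<Rightarrow> ennreal) \<Rightarrow> 'a \<Rightarrow> ennreal"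
  where "seqn q M v x = (if q = \<infinity> then (SUP k\<in>ks M. v k x)
     else epow (\<Sum>k\<in>ks M. epow (v k x) (enn2real q)) (1 / enn2real q))"

lemma seqn_measurable [measurable (raw)]:
  assumes [measurable]: "\<And>k. v k \<in> borel_measurable N"
  shows "seqn q M v \<in> borel_measurable N" unfolding seqn_def by (cases "q = \<infinity>"; simp)

lemma enn2real_pos: "0 < q \<Longrightarrow> q < top \<Longrightarrow> 0 < enn2real q"
  by (simp add: enn2real_positive_iff)

text \<open>A lower Riemann sum over disjoint slabs. The slab \<open>k + 1\<close> is the one
  matching \<open>wcoeff_le_wt\<close>, and 4 is the reciprocal of the lower bound for its
  measure.\<close>

lemma nn_integral_sum_slab_ge:
  assumes f: "\<And>t k. k \<in> S \<Longrightarrow> t \<in> slab (k + 1) \<Longrightarrow> c k \<le> f t" and "finite S"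
  shows "(\<Sum>k\<in>S. c k) \<le> 4 * (\<integral>\<^sup>+t. f t \<partial>dt_over_t)"
proof -
  have "ennreal (1 / 4) * (\<Sum>k\<in>S. c k) \<le> (\<Sum>k\<in>S. c k * emeasure dt_over_t (slab (k + 1)))"
    unfolding sum_distrib_left by (subst mult.commute, intro sum_mono mult_left_mono emeasure_dt_slab) simp
  also have "\<dots> = (\<integral>\<^sup>+t. (\<Sum>k\<in>S. c k * indicator (slab (k + 1)) t) \<partial>dt_over_t)"
    by (subst nn_integral_sum) (auto simp: nn_integral_cmult_indicator)
  also have "\<dots> \<le> (\<integral>\<^sup>+t. f t \<partial>dt_over_t)"
  proof (intro nn_integral_mono)
    fix t
    show "(\<Sum>k\<in>S. c k * indicator (slab (k + 1)) t) \<le> f t"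
    proof (cases "\<exists>k\<in>S. t \<in> slab (k + 1)")
      case True
      then obtain k where k: "k \<in> S" "t \<in> slab (k + 1)" by blast
      have "(\<Sum>l\<in>S. c l * indicator (slab (l + 1)) t) = (\<Sum>l\<in>S. if l = k then c k else 0)"
      proof (intro sum.cong refl)
        fix l
        have "t \<in> slab (l + 1) \<longleftrightarrow> l = k" using slab_disjoint[OF k(2), of "l + 1"] k(2) by auto
        then show "c l * indicator (slab (l + 1)) t = (if l = k then c k else 0)"
          using k(2) by (cases "l = k") simp_all
      qed
      also have "\<dots> = c k" using k(1) assms(2) by simp
      also have "\<dots> \<le> f t" using f k by blast
      finally show ?thesis .
    next
      case False
      then have "(\<Sum>k\<in>S. c k * indicator (slab (k + 1)) t) = 0" by (intro sum.neutral) auto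
      then show ?thesis by simp
    qed
  qed
  finally have "4 * (ennreal (1 / 4) * (\<Sum>k\<in>S. c k)) \<le> 4 * (\<integral>\<^sup>+t. f t \<partial>dt_over_t)"
    by (rule mult_left_mono) simp
  moreover have "4 * (ennreal (1 / 4) * (\<Sum>k\<in>S. c k)) = (4 * ennreal (1 / 4)) * (\<Sum>k\<in>S. c k)"
    by (rule mult.assoc[symmetric])
  moreover have "4 * ennreal (1 / 4) = 1"
    by (simp add: ennreal_numeral[symmetric] ennreal_mult[symmetric] del: ennreal_numeral)
  ultimately show ?thesis by simp
qed

lemma seqn_le_Lp_norm:
  assumes r: "1 \<le> r" and q: "0 < q"
  shows "\<exists>C>0. \<forall>(h :: real \<times> 'a::euclidean_space \<Rightarrow> ennreal) x M.
    seqn q M (wcoeff r h) x \<le> ennreal C * Lp_norm dt_over_t q (\<lambda>t. wt r h t x)"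
proof -
  let ?c = "low_const TYPE('a)"
  have c: "1 \<le> ?c" by (simp add: low_const_def)
  have le: "wcoeff r h k x \<le> ennreal ?c * wt r h t x" if "t \<in> slab (k + 1)"
    for h k t and x :: 'a using that by (intro wcoeff_le_wt[OF r]) (auto simp: slab_def)
  show ?thesis
  proof (cases "q = \<infinity>")
    case True
    have "seqn q M (wcoeff r h) x \<le> ennreal ?c * Lp_norm dt_over_t q (\<lambda>t. wt r h t x)" for h M and x :: 'a
    proof -
      have "wcoeff r h k x \<le> ennreal ?c * esssup dt_over_t (\<lambda>t. wt r h t x)" for k
      proof -
        \<comment> \<open>A slab has positive measure, hence contains a point at which the essential
          supremum is a true bound.\<close>
        have "\<exists>t\<in>slab (k + 1). wt r h t x \<le> esssup dt_over_t (\<lambda>t. wt r h t x)"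
        proof (rule ccontr)
          assume "\<not> ?thesis"
          then have "AE t in dt_over_t. t \<notin> slab (k + 1)"
            using esssup_AE[of "\<lambda>t. wt r h t x" dt_over_t] by (elim eventually_mono) auto
          then have "emeasure dt_over_t (slab (k + 1)) = 0"
            using AE_iff_null_sets[OF slab_in_dt[of "k + 1"]] by (auto simp: null_sets_def)
          then show False using emeasure_dt_slab(1)[of "k + 1"] by simp
        qed
        then obtain t where t: "t \<in> slab (k + 1)" "wt r h t x \<le> esssup dt_over_t (\<lambda>t. wt r h t x)" by blast
        show ?thesis by (rule order_trans[OF le[OF t(1)]], rule mult_left_mono[OF t(2)]) simp
      qed
      then show ?thesis unfolding seqn_def Lp_norm_def True by (auto intro: SUP_least)
    qed
    then show ?thesis using c by (intro exI[of _ ?c]) auto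
  next
    case False
    define Q where "Q = enn2real q"
    have Q: "0 < Q" unfolding Q_def using q False by (intro enn2real_pos) (auto simp: less_top)
    define C where "C = (4 * ?c powr Q) powr (1 / Q)"
    have "seqn q M (wcoeff r h) x \<le> ennreal C * Lp_norm dt_over_t q (\<lambda>t. wt r h t x)" for h M and x :: 'a
    proof -
      have bnd: "epow (wcoeff r h k x) Q \<le> ennreal (?c powr Q) * epow (wt r h t x) Q" if "t \<in> slab (k + 1)" for k t
        using epow_mono[OF le[OF that], of Q] Q c by (simp add: epow_mult epow_ennreal)
      have inv: "inverse (ennreal (?c powr Q)) * ennreal (?c powr Q) = 1"
        using c by (simp add: inverse_ennreal ennreal_mult[symmetric])
      have "(\<Sum>k\<in>ks M. inverse (ennreal (?c powr Q)) * epow (wcoeff r h k x) Q) \<le>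
          4 * (\<integral>\<^sup>+t. epow (wt r h t x) Q \<partial>dt_over_t)"
      proof (rule nn_integral_sum_slab_ge)
        fix t k assume "t \<in> slab (k + 1)"
        then have "inverse (ennreal (?c powr Q)) * epow (wcoeff r h k x) Q \<le>
          inverse (ennreal (?c powr Q)) * (ennreal (?c powr Q) * epow (wt r h t x) Q)"
          by (intro mult_left_mono bnd) auto
        also have "\<dots> = epow (wt r h t x) Q" using inv unfolding mult.assoc[symmetric] by simp
        finally show "inverse (ennreal (?c powr Q)) * epow (wcoeff r h k x) Q \<le> epow (wt r h t x) Q" .
      qed simp
      then have "ennreal (?c powr Q) * (inverse (ennreal (?c powr Q)) * (\<Sum>k\<in>ks M. epow (wcoeff r h k x) Q)) \<le>
          ennreal (?c powr Q) * (4 * (\<integral>\<^sup>+t. epow (wt r h t x) Q \<partial>dt_over_t))"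
        by (intro mult_left_mono) (auto simp: sum_distrib_left)
      moreover have "ennreal (?c powr Q) * (inverse (ennreal (?c powr Q)) * y) = y" for y
        using inv by (metis mult.assoc mult.commute mult_1)
      ultimately have "(\<Sum>k\<in>ks M. epow (wcoeff r h k x) Q) \<le>
          ennreal (?c powr Q) * (4 * (\<integral>\<^sup>+t. epow (wt r h t x) Q \<partial>dt_over_t))"
        by (simp only:)
      also have "\<dots> = ennreal (4 * ?c powr Q) * (\<integral>\<^sup>+t. epow (wt r h t x) Q \<partial>dt_over_t)"
        by (subst ennreal_mult) (auto simp: mult.assoc mult.left_commute)
      finally have "epow (\<Sum>k\<in>ks M. epow (wcoeff r h k x) Q) (1 / Q) \<le>
          epow (ennreal (4 * ?c powr Q) * (\<integral>\<^sup>+t. epow (wt r h t x) Q \<partial>dt_over_t)) (1 / Q)"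
        using Q by (intro epow_mono) auto
      then show ?thesis
        using False by (simp add: seqn_def Lp_norm_def Q_def[symmetric] epow_mult epow_ennreal C_def)
    qed
    moreover have "0 < C" using c by (simp add: C_def)
    ultimately show ?thesis by blast
  qed
qed

lemma tent_lower:
  assumes r: "1 \<le> r" and q: "0 < q" and p: "0 < p" "p < top"
  shows "\<exists>C>0. \<forall>(h :: real \<times> 'a::euclidean_space \<Rightarrow> ennreal) M.
    epow (NN x. epow (seqn q M (wcoeff r h) x) (enn2real p)) (1 / enn2real p) \<le> ennreal C * tent p q (wt r h)"
proof -
  obtain C where C: "C > 0" "\<And>(h :: real \<times> 'a \<Rightarrow> ennreal) x M.
    seqn q M (wcoeff r h) x \<le> ennreal C * Lp_norm dt_over_t q (\<lambda>t. wt r h t x)"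
    using seqn_le_Lp_norm[OF r q, where 'a='a] by blast
  define P where "P = enn2real p"
  have P: "0 < P" unfolding P_def using p by (intro enn2real_pos)
  have "epow (NN x. epow (seqn q M (wcoeff r h) x) P) (1 / P) \<le> ennreal C * tent p q (wt r h)"
    for h :: "real \<times> 'a \<Rightarrow> ennreal" and M
  proof -
    let ?L = "\<lambda>x. Lp_norm dt_over_t q (\<lambda>t. wt r h t x)"
    \<comment> \<open>The constant is moved to the side of \<open>seqn\<close>, which is known to be
      measurable, so that it can be pulled out of the integral.\<close>
    have "ennreal (1 / C) * seqn q M (wcoeff r h) x \<le> ?L x" for x
    proof -
      have "ennreal (1 / C) * seqn q M (wcoeff r h) x \<le> ennreal (1 / C) * (ennreal C * ?L x)"
        by (intro mult_left_mono C) simp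
      also have "\<dots> = ?L x" using C(1) by (simp add: mult.assoc[symmetric] ennreal_mult[symmetric])
      finally show ?thesis .
    qed
    then have "(NN x. epow (ennreal (1 / C) * seqn q M (wcoeff r h) x) P) \<le> (NN x. epow (?L x) P)"
      using P by (intro nn_integral_mono epow_mono) auto
    then have "ennreal ((1 / C) powr P) * (NN x. epow (seqn q M (wcoeff r h) x) P) \<le> (NN x. epow (?L x) P)"
      using C(1) by (simp add: epow_mult epow_ennreal nn_integral_cmult)
    then have "epow (ennreal ((1 / C) powr P) * (NN x. epow (seqn q M (wcoeff r h) x) P)) (1 / P) \<le> tent p q (wt r h)"
      using P p by (auto simp: tent_def Lp_norm_def P_def[symmetric] nn_integral_completion intro!: epow_mono)
    then have "ennreal C * (ennreal (1 / C) * epow (NN x. epow (seqn q M (wcoeff r h) x) P) (1 / P)) \<le> ennreal C * tent p q (wt r h)"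
      using P C(1) by (intro mult_left_mono) (auto simp: epow_mult epow_ennreal powr_powr)
    then show ?thesis using C(1) by (simp add: mult.assoc[symmetric] ennreal_mult[symmetric])
  qed
  then show ?thesis using C(1) unfolding P_def by blast
qed

definition upper_coeff :: "ennreal \<Rightarrow> (real \<times> 'a::euclidean_space \<Rightarrow> ennreal) \<Rightarrow> int \<Rightarrow> 'a \<Rightarrow> ennreal"
  where "upper_coeff r h k x = (\<Sum>B\<in>Pow Basis. enl B k (wcoeff r h k) x)"

lemma upper_coeff_measurable [measurable]: "bm (upper_coeff r h k)" unfolding upper_coeff_def by measurable

lemma wt_le_upper_coeff:
  fixes h :: "real \<times> 'a::euclidean_space \<Rightarrow> ennreal"
  assumes "bm h" "1 \<le> r" "t \<in> slab (j + 1)"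
  shows "wt r h t x \<le> ennreal (up_const TYPE('a)) * (\<Sum>k\<in>{j - 1..j + 1}. upper_coeff r h k x)"
  using wt_le_enl[OF assms(1,2), of j t x] assms(3) by (simp add: slab_def upper_coeff_def)

text \<open>The set of t for which scale k enters the bound of \<open>wt\<close>: t in slab j + 1
  involves the scales j - 1 to j + 1, so j + 1 runs from k to k + 2.\<close>

definition slab3 :: "int \<Rightarrow> real set"
  where "slab3 k = slab k \<union> slab (k + 1) \<union> slab (k + 2)"

lemma slab3_measurable [measurable]: "slab3 k \<in> sets borel" "slab3 k \<in> sets dt_over_t"
  unfolding slab3_def by measurable

lemma emeasure_slab3: "emeasure dt_over_t (slab3 k) \<le> 3"
proof -
  have "emeasure dt_over_t (slab3 k) \<le> emeasure dt_over_t (slab k) + emeasure dt_over_t (slab (k + 1)) + emeasure dt_over_t (slab (k + 2))"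
    unfolding slab3_def by (intro order_trans[OF emeasure_subadditive] add_mono) auto
  also have "\<dots> \<le> 1 + 1 + 1" by (intro add_mono emeasure_dt_slab)
  finally show ?thesis by simp
qed

lemma sum3_slab3:
  assumes "t \<in> slab (j + 1)" "{j - 1..j + 1} \<subseteq> S" "finite S"
  shows "(\<Sum>k\<in>{j - 1..j + 1}. c k) \<le> (\<Sum>k\<in>S. c k * indicator (slab3 k) t :: ennreal)"
proof -
  have "t \<in> slab3 k" if "k \<in> {j - 1..j + 1}" for k
  proof -
    have "k = j - 1 \<or> k = j \<or> k = j + 1" using that by auto
    then show ?thesis using assms(1) by (auto simp: slab3_def add.commute)
  qed
  then have "(\<Sum>k\<in>{j - 1..j + 1}. c k) = (\<Sum>k\<in>{j - 1..j + 1}. c k * indicator (slab3 k) t)"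
    by (intro sum.cong) auto
  also have "\<dots> \<le> (\<Sum>k\<in>S. c k * indicator (slab3 k) t)" using assms by (intro sum_mono2) auto
  finally show ?thesis .
qed

lemma nn_integral_le_SUP_slab3:
  assumes f: "\<And>t j. t \<in> slab (j + 1) \<Longrightarrow> f t \<le> (\<Sum>k\<in>{j - 1..j + 1}. c k)"
    and f0: "\<And>t. t \<le> 0 \<Longrightarrow> f t = 0"
  shows "(\<integral>\<^sup>+t. f t \<partial>dt_over_t) \<le> 3 * (SUP M. \<Sum>k\<in>ks M. c k)"
proof -
  define \<Phi> where "\<Phi> M t = (\<Sum>k\<in>ks M. c k * indicator (slab3 k) t)" for M t
  have mono: "incseq \<Phi>" unfolding incseq_def le_fun_def \<Phi>_def by (intro allI impI sum_mono2) auto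
  have "(\<integral>\<^sup>+t. f t \<partial>dt_over_t) \<le> (\<integral>\<^sup>+t. (SUP M. \<Phi> M t) \<partial>dt_over_t)"
  proof (rule nn_integral_mono)
    fix t assume "t \<in> space dt_over_t"
    then obtain j where j: "t \<in> slab (j + 1)" using slab_exists by auto
    have "f t \<le> (\<Sum>k\<in>{j - 1..j + 1}. c k)" by (rule f[OF j])
    also have "\<dots> \<le> \<Phi> (nat \<bar>j\<bar> + 1) t"
      unfolding \<Phi>_def by (rule sum3_slab3[OF j]) auto
    also have "\<dots> \<le> (SUP M. \<Phi> M t)" by (rule SUP_upper) simp
    finally show "f t \<le> (SUP M. \<Phi> M t)" .
  qed
  also have "\<dots> = (SUP M. \<integral>\<^sup>+t. \<Phi> M t \<partial>dt_over_t)"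
    by (rule nn_integral_monotone_convergence_SUP[OF mono]) (unfold \<Phi>_def, measurable)
  also have "\<dots> \<le> (SUP M. 3 * (\<Sum>k\<in>ks M. c k))"
  proof (intro SUP_mono')
    fix M
    have "(\<integral>\<^sup>+t. \<Phi> M t \<partial>dt_over_t) = (\<Sum>k\<in>ks M. c k * emeasure dt_over_t (slab3 k))"
      unfolding \<Phi>_def by (subst nn_integral_sum) (auto simp: nn_integral_cmult_indicator)
    also have "\<dots> \<le> (\<Sum>k\<in>ks M. c k * 3)" by (intro sum_mono mult_left_mono emeasure_slab3) simp
    finally show "(\<integral>\<^sup>+t. \<Phi> M t \<partial>dt_over_t) \<le> 3 * (\<Sum>k\<in>ks M. c k)"
      by (simp add: sum_distrib_right[symmetric] mult.commute)
  qed
  also have "\<dots> = 3 * (SUP M. \<Sum>k\<in>ks M. c k)" by (rule SUP_mult_left_ennreal[symmetric])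
  finally show ?thesis .
qed

lemma epow_wt_le:
  fixes h :: "real \<times> 'a::euclidean_space \<Rightarrow> ennreal"
  assumes h: "bm h" and r: "1 \<le> r" and Q: "0 < Q" and t: "t \<in> slab (j + 1)"
  shows "epow (wt r h t x) Q \<le> (\<Sum>k\<in>{j - 1..j + 1}. ennreal ((3 * up_const TYPE('a)) powr Q) * epow (upper_coeff r h k x) Q)"
proof -
  have u: "1 \<le> up_const TYPE('a)" by (simp add: up_const_def)
  have "epow (wt r h t x) Q \<le> epow (ennreal (up_const TYPE('a)) * (\<Sum>k\<in>{j - 1..j + 1}. upper_coeff r h k x)) Q"
    using Q by (intro epow_mono wt_le_upper_coeff[OF h r t]) auto
  also have "\<dots> \<le> ennreal (up_const TYPE('a) powr Q) * (ennreal (3 powr Q) * (\<Sum>k\<in>{j - 1..j + 1}. epow (upper_coeff r h k x) Q))"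
    using epow_sum_le[of "{j - 1..j + 1}" Q "\<lambda>k. upper_coeff r h k x"] Q u
    by (simp add: epow_mult epow_ennreal mult_left_mono)
  also have "\<dots> = (\<Sum>k\<in>{j - 1..j + 1}. ennreal ((3 * up_const TYPE('a)) powr Q) * epow (upper_coeff r h k x) Q)"
    using u by (simp add: powr_mult ennreal_mult sum_distrib_left[symmetric] ac_simps)
  finally show ?thesis .
qed

lemma Lp_norm_wt_le:
  assumes r: "1 \<le> r" and q: "0 < q"
  shows "\<exists>C>0. \<forall>(h :: real \<times> 'a::euclidean_space \<Rightarrow> ennreal) x. bm h \<longrightarrow>
    Lp_norm dt_over_t q (\<lambda>t. wt r h t x) \<le> ennreal C * (SUP M. seqn q M (upper_coeff r h) x)"
proof (cases "q = \<infinity>")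
  case True
  let ?C = "3 * up_const TYPE('a)"
  have u: "1 \<le> up_const TYPE('a)" by (simp add: up_const_def)
  have "Lp_norm dt_over_t q (\<lambda>t. wt r h t x) \<le> ennreal ?C * (SUP M. seqn q M (upper_coeff r h) x)"
    if h: "bm h" for h :: "real \<times> 'a \<Rightarrow> ennreal" and x
  proof -
    let ?S = "SUP M. seqn q M (upper_coeff r h) x"
    have "bm (\<lambda>t. wt r h t x)"
      using measurable_compose[OF _ wt_measurable[OF h, of r], of "\<lambda>t. (t, x)" borel] by simp
    then have "(\<lambda>t. wt r h t x) \<in> borel_measurable dt_over_t" by (rule borel_measurable_dt_over_t)
    moreover have "wt r h t x \<le> ennreal ?C * ?S" if "t \<in> space dt_over_t" for t
    proof -
      have "0 < t" using that by simp
      then obtain j where j: "t \<in> slab (j + 1)" using slab_exists by blast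
      have b: "upper_coeff r h k x \<le> ?S" for k
      proof -
        have "upper_coeff r h k x \<le> seqn q (nat \<bar>k\<bar>) (upper_coeff r h) x"
          unfolding seqn_def True by (auto intro!: SUP_upper2[of k])
        also have "\<dots> \<le> ?S" by (rule SUP_upper) simp
        finally show ?thesis .
      qed
      have "(\<Sum>k\<in>{j - 1..j + 1}. upper_coeff r h k x) \<le> of_nat (card {j - 1..j + 1}) * ?S"
        using b by (intro sum_bounded_above)
      then have "wt r h t x \<le> ennreal (up_const TYPE('a)) * (3 * ?S)"
        by (intro order_trans[OF wt_le_upper_coeff[OF h r j]] mult_left_mono) auto
      also have "\<dots> = ennreal ?C * ?S"
        using u by (simp add: ennreal_mult mult.assoc[symmetric] mult.commute)
      finally show ?thesis .
    qed
    ultimately show ?thesis unfolding Lp_norm_def using True by (auto intro!: esssup_I AE_I2)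
  qed
  then show ?thesis using u by (intro exI[of _ ?C]) auto
next
  case False
  define Q where "Q = enn2real q"
  have Q: "0 < Q" unfolding Q_def using q False by (intro enn2real_pos) (auto simp: less_top)
  have u: "1 \<le> up_const TYPE('a)" by (simp add: up_const_def)
  define c where "c = (3 * up_const TYPE('a)) powr Q"
  define C where "C = (3 * c) powr (1 / Q)"
  have c: "0 < c" using u by (simp add: c_def)
  have "Lp_norm dt_over_t q (\<lambda>t. wt r h t x) \<le> ennreal C * (SUP M. seqn q M (upper_coeff r h) x)"
    if h: "bm h" for h :: "real \<times> 'a \<Rightarrow> ennreal" and x
  proof -
    have "(\<integral>\<^sup>+t. epow (wt r h t x) Q * indicator {0<..} t \<partial>dt_over_t) \<le>
      3 * (SUP M. \<Sum>k\<in>ks M. ennreal c * epow (upper_coeff r h k x) Q)"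
    proof (rule nn_integral_le_SUP_slab3)
      show "epow (wt r h t x) Q * indicator {0<..} t \<le> (\<Sum>k\<in>{j - 1..j + 1}. ennreal c * epow (upper_coeff r h k x) Q)"
        if "t \<in> slab (j + 1)" for t j
        using epow_wt_le[OF h r Q that, of x] slab_subset[of "j + 1"] that by (auto simp: c_def)
    qed auto
    also have "(\<integral>\<^sup>+t. epow (wt r h t x) Q * indicator {0<..} t \<partial>dt_over_t) = (\<integral>\<^sup>+t. epow (wt r h t x) Q \<partial>dt_over_t)"
      by (intro nn_integral_cong) auto
    also have "3 * (SUP M. \<Sum>k\<in>ks M. ennreal c * epow (upper_coeff r h k x) Q) =
      ennreal (3 * c) * (SUP M. \<Sum>k\<in>ks M. epow (upper_coeff r h k x) Q)"
      using c by (simp add: sum_distrib_left[symmetric] SUP_mult_left_ennreal[symmetric] ennreal_mult mult.assoc)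
    finally have "epow (\<integral>\<^sup>+t. epow (wt r h t x) Q \<partial>dt_over_t) (1 / Q) \<le>
      epow (ennreal (3 * c) * (SUP M. \<Sum>k\<in>ks M. epow (upper_coeff r h k x) Q)) (1 / Q)"
      using Q by (intro epow_mono) auto
    also have "\<dots> = ennreal C * (SUP M. epow (\<Sum>k\<in>ks M. epow (upper_coeff r h k x) Q) (1 / Q))"
      using c Q by (simp add: epow_mult epow_ennreal C_def epow_SUP)
    finally show ?thesis using False by (simp add: Lp_norm_def seqn_def Q_def[symmetric])
  qed
  moreover have "0 < C" using c by (simp add: C_def)
  ultimately show ?thesis by blast
qed

lemma incseq_seqn: "0 < q \<Longrightarrow> incseq (\<lambda>M. seqn q M v x)"
proof (cases "q = \<infinity>")
  case True
  then show ?thesis unfolding seqn_def by (auto simp: incseq_def intro!: SUP_subset_mono)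
next
  case False
  then show ?thesis unfolding seqn_def by (auto simp: incseq_def intro!: epow_mono sum_mono2)
qed

text \<open>Here the enlargement is undone, one grid at a time; the number N of grids enters through
  \<open>epow_sum_le\<close>. For finite q the restriction lemma is applied to q-th powers, with
  exponent \<theta> = P / Q, which may lie on either side of 1.\<close>

lemma nn_integral_seqn_upper_coeff:
  assumes q: "0 < q" and P: "0 < P"
  shows "\<exists>C>0. \<forall>(h :: real \<times> 'a::euclidean_space \<Rightarrow> ennreal) M.
    (NN x. epow (seqn q M (upper_coeff r h) x) P) \<le>
    ennreal C * (NN x. epow (seqn q M (wcoeff r h) x) P)"
proof (cases "q = \<infinity>")
  case True
  define N where "N = card (Pow (Basis :: 'a set))"
  have N: "0 < N" by (simp add: N_def card_gt_0_iff Pow_not_empty)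
  define C where "C = real N powr P * (real N * big_ratio TYPE('a))"
  have "(NN x. epow (seqn q M (upper_coeff r h) x) P) \<le>
    ennreal C * (NN x. epow (seqn q M (wcoeff r h) x) P)" for h :: "real \<times> 'a \<Rightarrow> ennreal" and M
  proof -
    let ?I = "NN x. epow (seqn q M (wcoeff r h) x) P"
    have "(NN x. epow (seqn q M (upper_coeff r h) x) P) \<le>
      (NN x. ennreal (real N powr P) * (\<Sum>B\<in>Pow Basis. epow (SUP k\<in>ks M. enl B k (wcoeff r h k) x) P))"
    proof (intro nn_integral_mono)
      fix x
      have "seqn q M (upper_coeff r h) x \<le> (\<Sum>B\<in>Pow Basis. SUP k\<in>ks M. enl B k (wcoeff r h k) x)"
        unfolding seqn_def upper_coeff_def using True by (auto intro!: SUP_least sum_mono SUP_upper)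
      then have "epow (seqn q M (upper_coeff r h) x) P \<le> epow (\<Sum>B\<in>Pow Basis. SUP k\<in>ks M. enl B k (wcoeff r h k) x) P"
        using P by (intro epow_mono) auto
      also have "\<dots> \<le> ennreal (real N powr P) * (\<Sum>B\<in>Pow Basis. epow (SUP k\<in>ks M. enl B k (wcoeff r h k) x) P)"
        unfolding N_def using P by (intro epow_sum_le) auto
      finally show "epow (seqn q M (upper_coeff r h) x) P \<le> \<dots>" .
    qed
    also have "\<dots> = ennreal (real N powr P) * (\<Sum>B\<in>Pow Basis. (NN x. epow (SUP k\<in>ks M. enl B k (wcoeff r h k) x) P))"
      by (subst nn_integral_cmult, measurable) (subst nn_integral_sum, auto)
    also have "\<dots> \<le> ennreal (real N powr P) * (\<Sum>B\<in>Pow (Basis :: 'a set). ennreal (big_ratio TYPE('a)) * ?I)"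
    proof (intro mult_left_mono sum_mono)
      fix B :: "'a set"
      show "(NN x. epow (SUP k\<in>ks M. enl B k (wcoeff r h k) x) P) \<le> ennreal (big_ratio TYPE('a)) * ?I"
        using nn_integral_enl_SUP[where B = B and M = M and b = "wcoeff r h", OF wcoeff_inv P] True by (simp add: seqn_def)
    qed simp
    also have "\<dots> = ennreal C * ?I"
      by (simp add: C_def N_def[symmetric] ennreal_mult less_imp_le ennreal_of_nat_eq_real_of_nat mult.assoc)
    finally show ?thesis .
  qed
  moreover have "0 < C" using N by (simp add: C_def)
  ultimately show ?thesis by blast
next
  case False
  define Q where "Q = enn2real q"
  have Q: "0 < Q" unfolding Q_def using q False by (intro enn2real_pos) (auto simp: less_top)
  define N where "N = card (Pow (Basis :: 'a set))"
  have N: "0 < N" by (simp add: N_def card_gt_0_iff Pow_not_empty)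
  define \<theta> where "\<theta> = P / Q"
  have \<theta>: "0 < \<theta>" using P Q by (simp add: \<theta>_def)
  define K where "K = (max 1 \<theta> * big_ratio TYPE('a) / min 1 \<theta>) powr max 1 \<theta>"
  have K: "0 < K" using \<theta> by (auto simp: K_def max_def min_def less_imp_neq[OF big_ratio_pos, symmetric])
  define C where "C = real N powr P * (real N powr \<theta> * (real N * K))"
  have "(NN x. epow (seqn q M (upper_coeff r h) x) P) \<le>
    ennreal C * (NN x. epow (seqn q M (wcoeff r h) x) P)" for h :: "real \<times> 'a \<Rightarrow> ennreal" and M
  proof -
    let ?S = "(ks M)"
    let ?I = "NN x. epow (seqn q M (wcoeff r h) x) P"
    have sq: "epow (seqn q M v x) P = epow (\<Sum>k\<in>?S. epow (v k x) Q) \<theta>" for v :: "int \<Rightarrow> 'a \<Rightarrow> ennreal" and x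
      using False by (simp add: seqn_def epow_epow \<theta>_def Q_def[symmetric])
    have "(NN x. epow (seqn q M (upper_coeff r h) x) P) \<le>
      (NN x. ennreal (real N powr P) * (ennreal (real N powr \<theta>) * (\<Sum>B\<in>Pow Basis. epow (\<Sum>k\<in>?S. epow (enl B k (wcoeff r h k) x) Q) \<theta>)))"
    proof (intro nn_integral_mono)
      fix x
      have "(\<Sum>k\<in>?S. epow (upper_coeff r h k x) Q) \<le> (\<Sum>k\<in>?S. ennreal (real N powr Q) * (\<Sum>B\<in>Pow Basis. epow (enl B k (wcoeff r h k) x) Q))"
        unfolding upper_coeff_def N_def using Q by (intro sum_mono epow_sum_le) auto
      also have "\<dots> = ennreal (real N powr Q) * (\<Sum>B\<in>Pow Basis. \<Sum>k\<in>?S. epow (enl B k (wcoeff r h k) x) Q)"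
        by (subst sum.swap) (simp add: sum_distrib_left)
      finally have "epow (\<Sum>k\<in>?S. epow (upper_coeff r h k x) Q) \<theta> \<le>
        epow (ennreal (real N powr Q) * (\<Sum>B\<in>Pow Basis. \<Sum>k\<in>?S. epow (enl B k (wcoeff r h k) x) Q)) \<theta>"
        using \<theta> by (intro epow_mono) auto
      also have "\<dots> = ennreal (real N powr P) * epow (\<Sum>B\<in>Pow Basis. \<Sum>k\<in>?S. epow (enl B k (wcoeff r h k) x) Q) \<theta>"
        using Q by (simp add: epow_mult epow_ennreal powr_powr \<theta>_def)
      also have "\<dots> \<le> ennreal (real N powr P) * (ennreal (real N powr \<theta>) * (\<Sum>B\<in>Pow Basis. epow (\<Sum>k\<in>?S. epow (enl B k (wcoeff r h k) x) Q) \<theta>))"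
        unfolding N_def using \<theta> by (intro mult_left_mono epow_sum_le) auto
      finally show "epow (seqn q M (upper_coeff r h) x) P \<le> \<dots>" unfolding sq .
    qed
    also have "\<dots> = ennreal (real N powr P) * (ennreal (real N powr \<theta>) * (\<Sum>B\<in>Pow Basis. (NN x. epow (\<Sum>k\<in>?S. epow (enl B k (wcoeff r h k) x) Q) \<theta>)))"
      by (subst nn_integral_cmult, measurable)+ (subst nn_integral_sum, auto)
    also have "\<dots> \<le> ennreal (real N powr P) * (ennreal (real N powr \<theta>) * (\<Sum>B\<in>Pow (Basis :: 'a set). ennreal K * ?I))"
    proof (intro mult_left_mono sum_mono)
      fix B :: "'a set"
      show "(NN x. epow (\<Sum>k\<in>?S. epow (enl B k (wcoeff r h k) x) Q) \<theta>) \<le> ennreal K * ?I"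
        using nn_integral_enl_sum[where B = B and M = M and b = "wcoeff r h", OF wcoeff_inv \<theta> Q] unfolding sq K_def .
    qed auto
    also have "\<dots> = ennreal C * ?I"
      using K by (simp add: C_def N_def[symmetric] ennreal_mult less_imp_le ennreal_of_nat_eq_real_of_nat mult.assoc)
    finally show ?thesis .
  qed
  moreover have "0 < C" using N K by (simp add: C_def)
  ultimately show ?thesis by blast
qed

text \<open>Monotone convergence in \<open>M\<close> passes from truncated sequences to all scales,
  so a uniform bound for the truncated norms is a sufficient hypothesis.\<close>

lemma tent_upper:
  assumes r: "1 \<le> r" and q: "0 < q" and p: "0 < p" "p < top"
  shows "\<exists>C>0. \<forall>(h :: real \<times> 'a::euclidean_space \<Rightarrow> ennreal) D. bm h \<longrightarrow>
    (\<forall>M. epow (NN x. epow (seqn q M (wcoeff r h) x) (enn2real p)) (1 / enn2real p) \<le> D) \<longrightarrow>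
    tent p q (wt r h) \<le> ennreal C * D"
proof -
  define P where "P = enn2real p"
  have P: "0 < P" unfolding P_def using p by (intro enn2real_pos)
  obtain C1 where C1: "C1 > 0" "\<And>(h :: real \<times> 'a \<Rightarrow> ennreal) x. bm h \<Longrightarrow>
    Lp_norm dt_over_t q (\<lambda>t. wt r h t x) \<le> ennreal C1 * (SUP M. seqn q M (upper_coeff r h) x)"
    using Lp_norm_wt_le[OF r q, where 'a='a] by blast
  obtain C2 where C2: "C2 > 0" "\<And>(h :: real \<times> 'a \<Rightarrow> ennreal) M.
    (NN x. epow (seqn q M (upper_coeff r h) x) P) \<le>
    ennreal C2 * (NN x. epow (seqn q M (wcoeff r h) x) P)"
    using nn_integral_seqn_upper_coeff[OF q P, where 'a='a] by blast
  define C where "C = C1 * C2 powr (1 / P)"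
  have "tent p q (wt r h) \<le> ennreal C * D" if h: "bm h"
    and D: "\<And>M. epow (NN x. epow (seqn q M (wcoeff r h) x) P) (1 / P) \<le> D"
    for h :: "real \<times> 'a \<Rightarrow> ennreal" and D
  proof -
    have "(NN x. epow (Lp_norm dt_over_t q (\<lambda>t. wt r h t x)) P) \<le>
      (NN x. epow (ennreal C1 * (SUP M. seqn q M (upper_coeff r h) x)) P)"
      using P by (intro nn_integral_mono epow_mono C1 h) auto
    also have "\<dots> = (NN x. ennreal (C1 powr P) * (SUP M. epow (seqn q M (upper_coeff r h) x) P))"
      using C1(1) P by (simp add: epow_mult epow_ennreal epow_SUP)
    also have "\<dots> = ennreal (C1 powr P) * (NN x. (SUP M. epow (seqn q M (upper_coeff r h) x) P))"
      by (rule nn_integral_cmult) measurable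
    also have "(NN x. (SUP M. epow (seqn q M (upper_coeff r h) x) P)) =
      (SUP M. (NN x. epow (seqn q M (upper_coeff r h) x) P))" using incseqD[OF incseq_seqn[OF q]] P
      by (intro nn_integral_monotone_convergence_SUP) (auto simp: incseq_def le_fun_def intro!: epow_mono)
    also have "\<dots> \<le> ennreal C2 * epow D P"
    proof (rule SUP_least)
      fix M
      have "(NN x. epow (seqn q M (wcoeff r h) x) P) \<le> epow D P"
        using D[of M] P by (subst (asm) epow_le_swap) auto
      then show "(NN x. epow (seqn q M (upper_coeff r h) x) P) \<le> ennreal C2 * epow D P"
        by (intro order_trans[OF C2(2)] mult_left_mono) auto
    qed
    finally have "(NN x. epow (Lp_norm dt_over_t q (\<lambda>t. wt r h t x)) P) \<le> ennreal (C1 powr P) * (ennreal C2 * epow D P)"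
      using mult_left_mono by fastforce
    then have "epow (NN x. epow (Lp_norm dt_over_t q (\<lambda>t. wt r h t x)) P) (1 / P) \<le>
      epow (ennreal (C1 powr P) * (ennreal C2 * epow D P)) (1 / P)" using P by (intro epow_mono) auto
    also have "\<dots> = ennreal C * D"
      using C1(1) C2(1) P by (simp add: epow_mult epow_ennreal epow_epow powr_powr C_def ennreal_mult mult.assoc)
    finally show ?thesis
      using p less_imp_neq[OF p(2)] by (simp add: tent_def Lp_norm_def P_def[symmetric] nn_integral_completion)
  qed
  moreover have "0 < C" using C1 C2 by (simp add: C_def)
  ultimately show ?thesis unfolding P_def by blast
qed

section \<open>The endpoint \<open>p = \<infinity>\<close>\<close>

lemma wt_section_measurable:
  assumes h: "bm h"
  shows "bm (\<lambda>x. wt r h t x)" "bm (\<lambda>t. wt r h t x)"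
  using measurable_compose[OF _ wt_measurable[OF h, of r], of "\<lambda>x. (t, x)" borel]
    measurable_compose[OF _ wt_measurable[OF h, of r], of "\<lambda>t. (t, x)" borel] by simp_all

lemma emeasure_lebesgue_ball: "emeasure lebesgue (ball x t) = emeasure lborel (ball x t)" by simp

lemma mean_value_measurable:
  fixes h :: "real \<times> 'a::euclidean_space \<Rightarrow> ennreal"
  assumes [measurable]: "bm h"
  shows "bm (\<lambda>t. mean_value (ball y \<tau>) (\<lambda>x. epow (wt r h t x) Q))"
proof -
  have [measurable]: "(\<lambda>p. wt r h (fst p) (snd p)) \<in> borel_measurable (borel \<Otimes>\<^sub>M borel)"
    by (rule wt_measurable) measurable
  have [measurable]: "ball y \<tau> \<in> sets borel" by simp
  have "bm (\<lambda>t. (NN x. epow (wt r h (fst (t, x)) (snd (t, x))) Q * indicator (ball y \<tau>) x))"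
    by measurable
  then show ?thesis unfolding mean_value_def by (simp add: nn_integral_completion)
qed

lemma ball_sc_vol:
  fixes x :: "'a::euclidean_space"
  shows "emeasure lborel (ball x (sc (k + 2))) \<le>
    ennreal (unit_ball_vol DIM('a) * 2 ^ DIM('a) * (2 ^ (DIM('a) + 1)) ^ DIM('a)) * ennreal (cube_vol TYPE('a) k)"
proof -
  have "unit_ball_vol DIM('a) * sc (k + 2) ^ DIM('a) = unit_ball_vol DIM('a) * 2 ^ DIM('a) * sc k ^ DIM('a)"
    by (simp add: sc_plus_2 power_mult_distrib)
  also have "\<dots> \<le> unit_ball_vol DIM('a) * 2 ^ DIM('a) * ((2 ^ (DIM('a) + 1)) ^ DIM('a) * cube_vol TYPE('a) k)"
    by (intro mult_left_mono cube_vol_lower) auto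
  finally show ?thesis by (simp add: emeasure_ball ennreal_mult[symmetric] less_imp_le ennreal_leI mult.assoc)
qed

text \<open>Each cube is covered by a ball of comparable volume, so a single ball in the supremum
  defining the norm dominates the Carleson sum over that cube.\<close>

lemma tent_infinity_lower:
  assumes r: "1 \<le> r" and q: "0 < q" "q < top"
  shows "\<exists>C>0. \<forall>(h :: real \<times> 'a::euclidean_space \<Rightarrow> ennreal) k x M. bm h \<longrightarrow>
    (\<Sum>j\<in>{- int M..k}. (NN y. epow (wcoeff r h j y) (enn2real q) * indicator (cube k -` {cube k x}) y))
    \<le> ennreal C * ennreal (cube_vol TYPE('a) k) * epow (tent \<infinity> q (wt r h)) (enn2real q)"
proof -
  define Q where "Q = enn2real q"
  have Q: "0 < Q" unfolding Q_def using q by (rule enn2real_pos)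
  define c where "c = low_const TYPE('a) powr Q"
  have c: "0 < c" by (simp add: c_def low_const_def)
  define b where "b = unit_ball_vol DIM('a) * 2 ^ DIM('a) * (2 ^ (DIM('a) + 1)) ^ DIM('a)"
  have b: "0 < b" by (simp add: b_def)
  have "(\<Sum>j\<in>{- int M..k}. (NN y. epow (wcoeff r h j y) Q * indicator (cube k -` {cube k x}) y))
    \<le> ennreal (4 * c * b) * ennreal (cube_vol TYPE('a) k) * epow (tent \<infinity> q (wt r h)) Q"
    if h [measurable]: "bm h" for h :: "real \<times> 'a \<Rightarrow> ennreal" and k x M
  proof -
    \<comment> \<open>The ball of this radius contains the cube, and \<tau> exceeds
      \<open>sc (k + 1)\<close>, hence the upper end of the slab j + 1 from which t is taken, for
      every j \<le> k.\<close>
    define \<tau> where "\<tau> = sc (k + 2)"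
    define V where "V = emeasure lborel (ball x \<tau>)"
    have \<tau>: "0 < \<tau>" by (simp add: \<tau>_def)
    have V: "V \<noteq> 0" "V \<noteq> top" using \<tau> by (auto simp: V_def emeasure_ball less_imp_le ennreal_eq_0_iff not_le)
    note [measurable] = wt_section_measurable[OF h] cells.cell_sets[OF cells_cube, of k]
    have [measurable]: "ball x \<tau> \<in> sets borel" by simp
    let ?m = "\<lambda>t. mean_value (ball x \<tau>) (\<lambda>x. epow (wt r h t x) Q)"
    define X where "X = (\<integral>\<^sup>+t\<in>{0<..<\<tau>}. ?m t \<partial>dt_over_t)"
    have X: "X \<le> epow (tent \<infinity> q (wt r h)) Q"
    proof -
      have "epow X (1 / Q) \<le> tent \<infinity> q (wt r h)" unfolding tent_def X_def Q_def using q \<tau>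
        by (simp add: less_top[symmetric]) (intro SUP_upper2[of \<tau>] SUP_upper2[of x] order_refl; simp)
      then show ?thesis using Q by (subst (asm) epow_le_swap) auto
    qed
    have "(\<Sum>j\<in>{- int M..k}. (NN y. epow (wcoeff r h j y) Q * indicator (cube k -` {cube k x}) y)) \<le>
      4 * (\<integral>\<^sup>+t. ennreal c * V * (?m t * indicator {0<..<\<tau>} t) \<partial>dt_over_t)"
    proof (rule nn_integral_sum_slab_ge)
      fix t j assume j: "j \<in> {- int M..k}" and t: "t \<in> slab (j + 1)"
      have "t \<le> sc (j + 1)" using t by (simp add: slab_def)
      also have "\<dots> < \<tau>" unfolding \<tau>_def using j by (simp add: sc_less_iff)
      finally have t\<tau>: "t \<in> {0<..<\<tau>}" using t slab_subset by auto
      have "(NN y. epow (wcoeff r h j y) Q * indicator (cube k -` {cube k x}) y) \<le>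
        (NN y. ennreal c * (epow (wt r h t y) Q * indicator (ball x \<tau>) y))"
      proof (intro nn_integral_mono)
        fix y
        show "epow (wcoeff r h j y) Q * indicator (cube k -` {cube k x}) y \<le>
          ennreal c * (epow (wt r h t y) Q * indicator (ball x \<tau>) y)"
        proof (cases "cube k y = cube k x")
          case True
          have "dist y x < \<tau>" using cube_dist[OF True] sc_mono[of k "k + 2"] by (simp add: \<tau>_def)
          moreover have "wcoeff r h j y \<le> ennreal (low_const TYPE('a)) * wt r h t y"
            using t by (intro wcoeff_le_wt[OF r]) (auto simp: slab_def)
          then have "epow (wcoeff r h j y) Q \<le> ennreal c * epow (wt r h t y) Q"
            using epow_mono[of "wcoeff r h j y" _ Q] Q by (fastforce simp: epow_mult epow_ennreal c_def low_const_def)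
          ultimately show ?thesis using True by (simp add: dist_commute)
        qed simp
      qed
      also have "\<dots> = ennreal c * (NN y. epow (wt r h t y) Q * indicator (ball x \<tau>) y)"
        by (rule nn_integral_cmult) measurable
      also have "(NN y. epow (wt r h t y) Q * indicator (ball x \<tau>) y) = V * ?m t"
        unfolding mean_value_def nn_integral_completion emeasure_lebesgue_ball V_def[symmetric]
        using V by (simp add: ennreal_times_divide mult.commute[of V] mult_divide_eq_ennreal)
      finally show "(NN y. epow (wcoeff r h j y) Q * indicator (cube k -` {cube k x}) y) \<le>
          ennreal c * V * (?m t * indicator {0<..<\<tau>} t)" using t\<tau> by (simp add: mult.assoc)
    qed simp
    also have "(\<integral>\<^sup>+t. ennreal c * V * (?m t * indicator {0<..<\<tau>} t) \<partial>dt_over_t) = ennreal c * V * X"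
      unfolding X_def
      by (intro nn_integral_cmult borel_measurable_dt_over_t borel_measurable_times_ennreal mean_value_measurable) auto
    also have "4 * (ennreal c * V * X) \<le> 4 * (ennreal c * (ennreal b * ennreal (cube_vol TYPE('a) k)) * epow (tent \<infinity> q (wt r h)) Q)"
      using X ball_sc_vol[of x k] by (intro mult_mono) (auto simp: V_def \<tau>_def b_def)
    also have "\<dots> = ennreal (4 * c * b) * ennreal (cube_vol TYPE('a) k) * epow (tent \<infinity> q (wt r h)) Q"
      using c b by (simp add: ennreal_mult ac_simps)
    finally show ?thesis .
  qed
  moreover have "0 < 4 * c * b" using b c by simp
  ultimately show ?thesis unfolding Q_def by blast
qed

lemma tent_infinity_infinity_lower:
  fixes h :: "real \<times> 'a::euclidean_space \<Rightarrow> ennreal"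
  assumes r: "1 \<le> r"
  shows "wcoeff r h k x \<le> ennreal (low_const TYPE('a)) * tent \<infinity> \<infinity> (wt r h)"
proof -
  have "wcoeff r h k x \<le> ennreal (low_const TYPE('a)) * wt r h (sc (k + 1)) x"
    by (rule wcoeff_le_wt[OF r]) (auto simp: sc_less_iff)
  also have "\<dots> \<le> ennreal (low_const TYPE('a)) * tent \<infinity> \<infinity> (wt r h)"
    unfolding tent_def by (intro mult_left_mono) (auto intro!: SUP_upper2[of "sc (k + 1)"] SUP_upper2[of x])
  finally show ?thesis .
qed

text \<open>Three scales and 2^d grids contribute at a given point, each of them by at most
  \<open>D\<close>.\<close>

lemma tent_infinity_infinity_upper:
  fixes h :: "real \<times> 'a::euclidean_space \<Rightarrow> ennreal"
  assumes h: "bm h" and r: "1 \<le> r" and D: "\<And>k x. wcoeff r h k x \<le> D"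
  shows "tent \<infinity> \<infinity> (wt r h) \<le> ennreal (up_const TYPE('a) * (3 * 2 ^ DIM('a))) * D"
proof -
  have u: "1 \<le> up_const TYPE('a)" by (simp add: up_const_def)
  have "wt r h t x \<le> ennreal (up_const TYPE('a) * (3 * 2 ^ DIM('a))) * D" if t: "0 < t" for t x
  proof -
    obtain j where j: "t \<in> slab (j + 1)" using slab_exists[OF t] by blast
    have e: "enl B k (wcoeff r h k) x \<le> D" for B k unfolding enl_def by (intro SUP_least D)
    have "(\<Sum>k\<in>{j - 1..j + 1}. upper_coeff r h k x) \<le> (\<Sum>k\<in>{j - 1..j + 1}. \<Sum>B\<in>Pow (Basis :: 'a set). D)"
      unfolding upper_coeff_def by (intro sum_mono e)
    also have "\<dots> = ennreal (3 * 2 ^ DIM('a)) * D"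
      by (simp add: card_Pow ennreal_mult mult.assoc ennreal_power[symmetric] flip: ennreal_numeral)
    finally have "wt r h t x \<le> ennreal (up_const TYPE('a)) * (ennreal (3 * 2 ^ DIM('a)) * D)"
      by (intro order_trans[OF wt_le_upper_coeff[OF h r j]] mult_left_mono) auto
    also have "\<dots> = ennreal (up_const TYPE('a) * (3 * 2 ^ DIM('a))) * D"
      using u by (subst ennreal_mult[of "up_const TYPE('a)"]) (auto simp: mult.assoc)
    finally show ?thesis .
  qed
  then show ?thesis unfolding tent_def by (auto intro!: SUP_least)
qed

text \<open>Whitney averages over a ball at heights below \<tau> see only scales up to K + 1. The
  big cubes of these scales that meet the ball have diameter less than 32 d \<open>sc k\<close>
  \<le> 64 d \<tau>, which explains the enlarged radius.\<close>

lemma tent_infinity_upper: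
  assumes r: "1 \<le> r" and q: "0 < q" "q < top"
  shows "\<exists>C>0. \<forall>(h :: real \<times> 'a::euclidean_space \<Rightarrow> ennreal) D. bm h \<longrightarrow>
    (\<forall>\<tau>>0. \<forall>y M K. sc K < \<tau> \<longrightarrow> \<tau> \<le> sc (K + 1) \<longrightarrow>
      (\<Sum>k\<in>{- int M..K + 1}. (NN x. epow (wcoeff r h k x) (enn2real q) * indicator (ball y ((1 + 64 * real DIM('a)) * \<tau>)) x))
      \<le> D * ennreal (\<tau> ^ DIM('a))) \<longrightarrow>
    epow (tent \<infinity> q (wt r h)) (enn2real q) \<le> ennreal C * D"
proof -
  define Q where "Q = enn2real q"
  have Q: "0 < Q" unfolding Q_def using q by (rule enn2real_pos)
  define R where "R = 1 + 64 * real DIM('a)"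
  define N where "N = card (Pow (Basis :: 'a set))"
  have N: "0 < N" by (simp add: N_def card_gt_0_iff Pow_not_empty)
  define c where "c = (3 * up_const TYPE('a)) powr Q * (real N powr Q * (real N * big_ratio TYPE('a)))"
  have u: "1 \<le> up_const TYPE('a)" by (simp add: up_const_def)
  have c: "0 < c" using u N by (simp add: c_def)
  define w where "w = unit_ball_vol (real DIM('a))"
  have w: "0 < w" by (simp add: w_def)
  have claim: "epow (tent \<infinity> q (wt r h)) Q \<le> ennreal (3 * c / w) * D"
    if h [measurable]: "bm h"
    and D: "\<And>\<tau> y M K. 0 < \<tau> \<Longrightarrow> sc K < \<tau> \<Longrightarrow> \<tau> \<le> sc (K + 1) \<Longrightarrow>
      (\<Sum>k\<in>{- int M..K + 1}. (NN x. epow (wcoeff r h k x) Q * indicator (ball y (R * \<tau>)) x)) \<le> D * ennreal (\<tau> ^ DIM('a))"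
    for h :: "real \<times> 'a \<Rightarrow> ennreal" and D
  proof -
    have main: "(\<integral>\<^sup>+t. mean_value (ball y \<tau>) (\<lambda>x. epow (wt r h t x) Q) * indicator {0<..<\<tau>} t \<partial>dt_over_t) \<le> ennreal (3 * c / w) * D"
      if \<tau>: "0 < \<tau>" for y and \<tau>
    proof -
      obtain K where K: "sc K < \<tau>" "\<tau> \<le> sc (K + 1)" using scale_exists[OF \<tau>] .
      have [measurable]: "ball y \<tau> \<in> sets borel" "ball y (R * \<tau>) \<in> sets borel" by simp_all
      define V where "V = emeasure lborel (ball y \<tau>)"
      define G where "G k = (NN x. epow (wcoeff r h k x) Q * indicator (ball y (R * \<tau>)) x)" for k
      have ball_enl: "(NN x. epow (enl B k (wcoeff r h k) x) Q * indicator (ball y \<tau>) x) \<le> ennreal (big_ratio TYPE('a)) * G k"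
        if k: "k \<le> K + 1" for B k
      proof -
        \<comment> \<open>The indicator of the union of all big cubes that meet the ball. It is
          constant on big cubes, hence an admissible weight for undoing the enlargement.\<close>
        define \<psi> :: "'a \<Rightarrow> ennreal" where "\<psi> = indicator {x. \<exists>z\<in>ball y \<tau>. big_cube B k z = big_cube B k x}"
        have \<psi>_inv: "cell_inv (big_cube B k) \<psi>"
          unfolding \<psi>_def by (rule cell_invI) (simp add: indicator_def)
        have "(NN x. epow (enl B k (wcoeff r h k) x) Q * indicator (ball y \<tau>) x) \<le>
          (NN x. epow (enl B k (wcoeff r h k) x) Q * \<psi> x)"
          by (intro nn_integral_mono mult_left_mono) (auto simp: \<psi>_def indicator_def)
        also have "\<dots> \<le> ennreal (big_ratio TYPE('a)) * (NN x. epow (wcoeff r h k x) Q * \<psi> x)"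
          by (rule nn_integral_enl_weighted[OF wcoeff_inv Q \<psi>_inv])
        also have "\<dots> \<le> ennreal (big_ratio TYPE('a)) * G k" unfolding G_def
        proof (intro mult_left_mono nn_integral_mono)
          fix x
          have "x \<in> ball y (R * \<tau>)" if "z \<in> ball y \<tau>" "big_cube B k z = big_cube B k x" for z
          proof -
            have "sc k \<le> 2 * \<tau>" using sc_mono[OF k] K(1) sc_plus_1[of K] sqrt2_bounds
                mult_strict_mono[of "sqrt 2" "3 / 2" "sc K" \<tau>] \<tau> by (simp add: less_imp_le)
            then have "32 * real DIM('a) * sc k \<le> 32 * real DIM('a) * (2 * \<tau>)" by (intro mult_left_mono) auto
            then have "dist z x < 64 * real DIM('a) * \<tau>" using big_cube_dist[OF that(2)] by linarith
            then show ?thesis using that(1) dist_triangle[of y x z] by (simp add: R_def algebra_simps)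
          qed
          then show "\<psi> x \<le> indicator (ball y (R * \<tau>)) x"
            unfolding \<psi>_def by (auto simp: indicator_def)
        qed auto
        finally show ?thesis .
      qed
      \<comment> \<open>For t < \<tau> in slab j + 1 one has j \<le> K, so the scales j - 1 to j + 1
        stay within the cut at K + 1.\<close>
      define d where "d k = (if k \<le> K + 1 then ennreal c * G k / V else 0)" for k
      have "(\<integral>\<^sup>+t. mean_value (ball y \<tau>) (\<lambda>x. epow (wt r h t x) Q) * indicator {0<..<\<tau>} t \<partial>dt_over_t) \<le>
        3 * (SUP M. \<Sum>k\<in>ks M. d k)"
      proof (rule nn_integral_le_SUP_slab3)
        fix t j assume t: "t \<in> slab (j + 1)"
        show "mean_value (ball y \<tau>) (\<lambda>x. epow (wt r h t x) Q) * indicator {0<..<\<tau>} t \<le> (\<Sum>k\<in>{j - 1..j + 1}. d k)"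
        proof (cases "t < \<tau>")
          case True
          then have "sc j < sc (K + 1)" using t K by (simp add: slab_def)
          then have jK: "j \<le> K" by (simp add: sc_less_iff)
          have "(NN x. epow (wt r h t x) Q * indicator (ball y \<tau>) x) \<le>
            (NN x. (\<Sum>k\<in>{j - 1..j + 1}. ennreal ((3 * up_const TYPE('a)) powr Q) * (ennreal (real N powr Q) *
              (\<Sum>B\<in>Pow Basis. epow (enl B k (wcoeff r h k) x) Q * indicator (ball y \<tau>) x))))"
          proof (intro nn_integral_mono)
            fix x
            have "epow (wt r h t x) Q \<le> (\<Sum>k\<in>{j - 1..j + 1}. ennreal ((3 * up_const TYPE('a)) powr Q) * epow (upper_coeff r h k x) Q)"
              by (rule epow_wt_le[OF h r Q t])
            also have "\<dots> \<le> (\<Sum>k\<in>{j - 1..j + 1}. ennreal ((3 * up_const TYPE('a)) powr Q) * (ennreal (real N powr Q) *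
              (\<Sum>B\<in>Pow Basis. epow (enl B k (wcoeff r h k) x) Q)))"
              unfolding upper_coeff_def N_def using Q by (intro sum_mono mult_left_mono epow_sum_le) auto
            finally have "epow (wt r h t x) Q * indicator (ball y \<tau>) x \<le>
              (\<Sum>k\<in>{j - 1..j + 1}. ennreal ((3 * up_const TYPE('a)) powr Q) * (ennreal (real N powr Q) *
              (\<Sum>B\<in>Pow Basis. epow (enl B k (wcoeff r h k) x) Q))) * indicator (ball y \<tau>) x"
              by (rule mult_right_mono) simp
            then show "epow (wt r h t x) Q * indicator (ball y \<tau>) x \<le>
              (\<Sum>k\<in>{j - 1..j + 1}. ennreal ((3 * up_const TYPE('a)) powr Q) * (ennreal (real N powr Q) *
              (\<Sum>B\<in>Pow Basis. epow (enl B k (wcoeff r h k) x) Q * indicator (ball y \<tau>) x)))"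
              by (simp add: sum_distrib_right mult.assoc)
          qed
          also have "\<dots> = (\<Sum>k\<in>{j - 1..j + 1}. ennreal ((3 * up_const TYPE('a)) powr Q) * (ennreal (real N powr Q) *
              (\<Sum>B\<in>Pow Basis. (NN x. epow (enl B k (wcoeff r h k) x) Q * indicator (ball y \<tau>) x))))"
          proof (subst nn_integral_sum)
            show "(\<Sum>k\<in>{j - 1..j + 1}. (NN x. ennreal ((3 * up_const TYPE('a)) powr Q) * (ennreal (real N powr Q) *
              (\<Sum>B\<in>Pow Basis. epow (enl B k (wcoeff r h k) x) Q * indicator (ball y \<tau>) x)))) =
              (\<Sum>k\<in>{j - 1..j + 1}. ennreal ((3 * up_const TYPE('a)) powr Q) * (ennreal (real N powr Q) *
              (\<Sum>B\<in>Pow Basis. (NN x. epow (enl B k (wcoeff r h k) x) Q * indicator (ball y \<tau>) x))))"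
              by (intro sum.cong refl, subst nn_integral_cmult, measurable, subst nn_integral_cmult, measurable,
                subst nn_integral_sum) auto
          qed measurable
          also have "\<dots> \<le> (\<Sum>k\<in>{j - 1..j + 1}. ennreal ((3 * up_const TYPE('a)) powr Q) * (ennreal (real N powr Q) *
              (\<Sum>B\<in>Pow (Basis :: 'a set). ennreal (big_ratio TYPE('a)) * G k)))"
            using jK by (intro sum_mono mult_left_mono ball_enl) auto
          also have "\<dots> = (\<Sum>k\<in>{j - 1..j + 1}. ennreal c * G k)"
            using u by (simp add: c_def N_def[symmetric] ennreal_mult less_imp_le ennreal_of_nat_eq_real_of_nat mult.assoc)
          finally have "mean_value (ball y \<tau>) (\<lambda>x. epow (wt r h t x) Q) \<le> (\<Sum>k\<in>{j - 1..j + 1}. ennreal c * G k) / V"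
            unfolding mean_value_def nn_integral_completion emeasure_lebesgue_ball V_def[symmetric]
            by (rule divide_right_mono_ennreal)
          also have "\<dots> = (\<Sum>k\<in>{j - 1..j + 1}. d k)"
            using jK by (simp add: d_def divide_ennreal_def sum_distrib_right)
          finally show ?thesis by (auto simp: indicator_def)
        qed simp
      qed simp
      also have "\<dots> \<le> 3 * (ennreal (c / w) * D)"
      proof (intro mult_left_mono SUP_least)
        fix M
        have "(\<Sum>k\<in>ks M. d k) = (\<Sum>k\<in>ks M \<inter> {k. k \<le> K + 1}. ennreal c * G k / V)"
          unfolding d_def by (simp add: sum.inter_restrict)
        also have "\<dots> \<le> (\<Sum>k\<in>{- int M..K + 1}. ennreal c * G k / V)" by (intro sum_mono2) auto
        also have "\<dots> = ennreal c * (\<Sum>k\<in>{- int M..K + 1}. G k) / V"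
          by (simp add: divide_ennreal_def sum_distrib_right sum_distrib_left)
        also have "\<dots> \<le> ennreal c * (D * ennreal (\<tau> ^ DIM('a))) / V"
          unfolding G_def using \<tau> K by (intro divide_right_mono_ennreal mult_left_mono D) auto
        also have "\<dots> = ennreal (c / w) * D"
        proof -
          have "V = ennreal (w * \<tau> ^ DIM('a))" using \<tau> by (simp add: V_def emeasure_ball w_def less_imp_le)
          then have "ennreal c * (D * ennreal (\<tau> ^ DIM('a))) / V = ennreal (c * \<tau> ^ DIM('a)) / ennreal (w * \<tau> ^ DIM('a)) * D"
            using c \<tau> by (simp add: divide_ennreal_def ennreal_mult less_imp_le ac_simps)
          also have "ennreal (c * \<tau> ^ DIM('a)) / ennreal (w * \<tau> ^ DIM('a)) = ennreal (c / w)"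
            using c w \<tau> by (subst divide_ennreal) auto
          finally show ?thesis .
        qed
        finally show "(\<Sum>k\<in>ks M. d k) \<le> ennreal (c / w) * D" .
      qed simp
      also have "\<dots> = ennreal (3 * c / w) * D"
      proof -
        have "ennreal (3 * c / w) = ennreal 3 * ennreal (c / w)"
          using c w by (subst ennreal_mult[symmetric]) auto
        then show ?thesis by (simp add: mult.assoc)
      qed
      finally show ?thesis .
    qed
    have "tent \<infinity> q (wt r h) \<le> epow (ennreal (3 * c / w) * D) (1 / Q)"
      unfolding tent_def Q_def[symmetric] using q Q
      by (simp add: less_imp_neq) (intro SUP_least epow_mono main; simp)
    then show ?thesis using Q by (subst epow_le_swap) auto
  qed
  show ?thesis unfolding Q_def[symmetric] R_def[symmetric]
  proof (intro exI[of _ "3 * c / w"] conjI allI impI)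
    fix h :: "real \<times> 'a \<Rightarrow> ennreal" and D
    assume h: "bm h" and
      D: "\<forall>\<tau>>0. \<forall>y M K. sc K < \<tau> \<longrightarrow> \<tau> \<le> sc (K + 1) \<longrightarrow>
      (\<Sum>k\<in>{- int M..K + 1}. (NN x. epow (wcoeff r h k x) Q * indicator (ball y (R * \<tau>)) x)) \<le> D * ennreal (\<tau> ^ DIM('a))"
    show "epow (tent \<infinity> q (wt r h)) Q \<le> ennreal (3 * c / w) * D"
      by (rule claim[OF h]) (use D in simp)
  qed (use c w in simp)
qed

section \<open>The inequality\<close>

definition hs_int :: "(real \<times> 'a::euclidean_space \<Rightarrow> ennreal) \<Rightarrow> ennreal"
  where "hs_int \<phi> = (NN z. \<phi> z * (ennreal (1 / fst z) * indicator half_space z))"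

text \<open>The dual estimate on nonnegative functions; phases and the weight in s are put back only
  when functionals are considered.\<close>

abbreviation tested :: "ennreal \<Rightarrow> ennreal \<Rightarrow> ennreal \<Rightarrow> ennreal \<Rightarrow> (real \<times> 'a::euclidean_space \<Rightarrow> ennreal) \<Rightarrow> bool"
  where "tested p q r D F \<equiv> \<forall>G\<in>borel_measurable borel. hs_int (\<lambda>z. F z * G z) \<le> D * tent p q (wt r G)"

lemma fst_measurable_borel [measurable]:
  "bm (\<lambda>z :: real \<times> 'a::euclidean_space. ennreal (1 / fst z))"
  by (rule borel_measurable_compose_fst) simp

lemma slab_fst_measurable [measurable]:
  "bm (\<lambda>z :: real \<times> 'a::euclidean_space. indicator (slab k) (fst z) :: ennreal)"
  by (rule borel_measurable_compose_fst) simp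

lemma half_space_borel [measurable]: "half_space \<in> sets borel"
  unfolding half_space_def by (intro Times_borel) auto

lemma conj_exponent_ge_1: "1 \<le> conj_exponent r" if "0 < r" "r < top"
proof (cases "r \<le> 1")
  case False
  then have r: "1 < r" by simp
  show ?thesis unfolding conj_exponent_real(1)[OF r that(2)] using conj_exponent_real(3)[OF r that(2)]
    by (simp add: ennreal_1[symmetric] ennreal_leI del: ennreal_1)
qed (simp add: conj_exponent_def)

lemma slab_weight_bounds:
  fixes z :: "real \<times> 'a::euclidean_space"
  assumes "fst z \<in> slab k"
  shows "ennreal (1 / fst z) \<le> ennreal (1 / sc (k - 1))" "ennreal (1 / sc k) \<le> ennreal (1 / fst z)"
    "z \<in> half_space" using assms sc_pos[of "k - 1"] slab_subset[of k]
  by (auto simp: slab_def half_space_def intro!: ennreal_leI frac_le intro: less_trans[OF sc_pos])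
    (cases z, auto)

lemma slab_len_le: "slab_len k \<le> sc (k - 1)"
  using sc_mono[of k "k + 1"] sc_plus_2[of "k - 1"] by (simp add: slab_len_def add.commute)

lemma hs_slab_upper:
  fixes \<phi> :: "real \<times> 'a::euclidean_space \<Rightarrow> ennreal"
  assumes [measurable]: "bm \<phi>"
  shows "(NN z. \<phi> z * ennreal (1 / sc (k - 1)) * indicator (slab k) (fst z)) \<le> (NN x. mean k \<phi> x)"
proof -
  have "(NN z. \<phi> z * ennreal (1 / sc (k - 1)) * indicator (slab k) (fst z)) =
    (NN z. ennreal (1 / sc (k - 1)) * (\<phi> z * indicator (slab k) (fst z) * 1))"
    by (intro nn_integral_cong) (simp add: ac_simps)
  also have "\<dots> = ennreal (1 / sc (k - 1)) * (NN z. \<phi> z * indicator (slab k) (fst z) * 1)"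
    by (rule nn_integral_cmult) measurable
  also have "(NN z. \<phi> z * indicator (slab k) (fst z) * 1) = ennreal (slab_len k) * (NN x. mean k \<phi> x * 1)"
    by (rule nn_integral_mean) (auto simp: cell_inv_def)
  also have "ennreal (1 / sc (k - 1)) * (ennreal (slab_len k) * (NN x. mean k \<phi> x * 1)) =
    ennreal (slab_len k / sc (k - 1)) * (NN x. mean k \<phi> x)"
    using slab_len_bounds(3)[of k] by (simp add: mult.assoc[symmetric] ennreal_mult[symmetric] less_imp_le)
  also have "\<dots> \<le> ennreal 1 * (NN x. mean k \<phi> x)"
    using slab_len_le[of k] by (intro mult_right_mono ennreal_leI) auto
  finally show ?thesis by simp
qed

lemma hs_slab_lower:
  fixes \<phi> :: "real \<times> 'a::euclidean_space \<Rightarrow> ennreal"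
  assumes [measurable]: "bm \<phi>" and \<psi>: "cell_inv (cube k) \<psi>"
  shows "ennreal (1 / 4) * (NN x. mean k \<phi> x * \<psi> x) \<le>
    (NN z. \<phi> z * (ennreal (1 / fst z) * indicator (slab k) (fst z)) * \<psi> (snd z))"
proof -
  have [measurable]: "bm \<psi>" by (rule cells.cell_inv_borel_measurable[OF cells_cube \<psi>])
  have [measurable]: "bm (\<lambda>z :: real \<times> 'a. \<psi> (snd z))"
    by (rule borel_measurable_compose_snd) measurable
  have "ennreal (1 / 4) * (NN x. mean k \<phi> x * \<psi> x) \<le> ennreal (slab_len k / sc k) * (NN x. mean k \<phi> x * \<psi> x)"
    using slab_len_bounds(1)[of k] by (intro mult_right_mono ennreal_leI) (auto simp: field_simps)
  also have "\<dots> = ennreal (1 / sc k) * (ennreal (slab_len k) * (NN x. mean k \<phi> x * \<psi> x))"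
    using slab_len_bounds(3)[of k] by (simp add: mult.assoc[symmetric] ennreal_mult[symmetric] less_imp_le)
  also have "ennreal (slab_len k) * (NN x. mean k \<phi> x * \<psi> x) =
    (NN z. \<phi> z * indicator (slab k) (fst z) * \<psi> (snd z))"
    by (rule nn_integral_mean[symmetric, OF _ \<psi>]) measurable
  also have "ennreal (1 / sc k) * \<dots> = (NN z. ennreal (1 / sc k) * (\<phi> z * indicator (slab k) (fst z) * \<psi> (snd z)))"
    by (rule nn_integral_cmult[symmetric]) measurable
  also have "\<dots> \<le> (NN z. \<phi> z * (ennreal (1 / fst z) * indicator (slab k) (fst z)) * \<psi> (snd z))"
  proof (intro nn_integral_mono)
    fix z :: "real \<times> 'a"
    show "ennreal (1 / sc k) * (\<phi> z * indicator (slab k) (fst z) * \<psi> (snd z)) \<le>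
      \<phi> z * (ennreal (1 / fst z) * indicator (slab k) (fst z)) * \<psi> (snd z)"
    proof (cases "fst z \<in> slab k")
      case True
      have "ennreal (1 / sc k) * (\<phi> z * \<psi> (snd z)) \<le> ennreal (1 / fst z) * (\<phi> z * \<psi> (snd z))"
        by (intro mult_right_mono slab_weight_bounds(2)[OF True]) simp
      then show ?thesis using True by (simp add: ac_simps)
    qed simp
  qed
  finally show ?thesis .
qed

lemma hs_int_le_SUP:
  fixes f g :: "real \<times> 'a::euclidean_space \<Rightarrow> ennreal"
  assumes [measurable]: "bm f" "bm g" and r: "1 \<le> r" "r < top"
  shows "hs_int (\<lambda>z. f z * g z) \<le>
    (SUP M. (NN x. (\<Sum>k\<in>ks M. wcoeff (conj_exponent r) f k x * wcoeff r g k x)))"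
proof -
  define \<Phi> where "\<Phi> M z = (\<Sum>k\<in>ks M. f z * g z * ennreal (1 / sc (k - 1)) * indicator (slab k) (fst z))"
    for M and z :: "real \<times> 'a"
  have mono: "incseq \<Phi>" unfolding incseq_def le_fun_def \<Phi>_def by (intro allI impI sum_mono2) auto
  have "hs_int (\<lambda>z. f z * g z) \<le> (NN z. (SUP M. \<Phi> M z))" unfolding hs_int_def
  proof (intro nn_integral_mono)
    fix z :: "real \<times> 'a"
    show "f z * g z * (ennreal (1 / fst z) * indicator half_space z) \<le> (SUP M. \<Phi> M z)"
    proof (cases "z \<in> half_space")
      case True
      then have "0 < fst z" by (auto simp: half_space_def)
      then obtain j where "fst z \<in> slab (j + 1)" using slab_exists by blast
      then obtain k where k: "fst z \<in> slab k" by blast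
      have "f z * g z * (ennreal (1 / fst z) * indicator half_space z) \<le> f z * g z * (ennreal (1 / sc (k - 1)) * 1)"
        using True by (intro mult_left_mono mult_mono slab_weight_bounds(1)[OF k]) auto
      also have "\<dots> = f z * g z * ennreal (1 / sc (k - 1)) * indicator (slab k) (fst z)" using k by simp
      also have "\<dots> \<le> \<Phi> (nat \<bar>k\<bar>) z"
        unfolding \<Phi>_def by (rule member_le_sum[where i = k]) auto
      also have "\<dots> \<le> (SUP M. \<Phi> M z)" by (rule SUP_upper) simp
      finally show ?thesis .
    qed simp
  qed
  also have "\<dots> = (SUP M. (NN z. \<Phi> M z))"
    by (rule nn_integral_monotone_convergence_SUP[OF mono]) (unfold \<Phi>_def, measurable)
  also have "\<dots> \<le> (SUP M. (NN x. (\<Sum>k\<in>ks M. wcoeff (conj_exponent r) f k x * wcoeff r g k x)))"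
  proof (intro SUP_mono')
    fix M
    have "(NN z. \<Phi> M z) =
      (\<Sum>k\<in>ks M. (NN z. f z * g z * ennreal (1 / sc (k - 1)) * indicator (slab k) (fst z)))"
      unfolding \<Phi>_def by (rule nn_integral_sum) measurable
    also have "\<dots> \<le> (\<Sum>k\<in>ks M. (NN x. mean k (\<lambda>z. f z * g z) x))"
      by (intro sum_mono hs_slab_upper) measurable
    also have "\<dots> \<le> (\<Sum>k\<in>ks M. (NN x. wcoeff (conj_exponent r) f k x * wcoeff r g k x))"
      by (intro sum_mono nn_integral_mono mean_Holder r assms)
    also have "\<dots> = (NN x. (\<Sum>k\<in>ks M. wcoeff (conj_exponent r) f k x * wcoeff r g k x))"
      by (rule nn_integral_sum[symmetric]) measurable
    finally show "(NN z. \<Phi> M z) \<le> \<dots>" .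
  qed
  finally show ?thesis .
qed

text \<open>For q \<le> 1 the pairing is bounded by the supremum of \<open>a\<close> times the l^1
  norm of \<open>b\<close>, and the latter by the l^q norm; for q > 1 this is Hoelder's
  inequality.\<close>

lemma sum_le_seqn:
  assumes q: "0 < q" "q < top"
  shows "(\<Sum>k\<in>ks M. a k x * b k x) \<le> seqn (conj_exponent q) M a x * seqn q M b x"
proof (cases "q \<le> 1")
  case True
  then have c: "conj_exponent q = \<infinity>" by (simp add: conj_exponent_def)
  define Q where "Q = enn2real q"
  have Q: "0 < Q" "Q \<le> 1" unfolding Q_def using enn2real_pos[OF q] True enn2real_mono[of q 1] by auto
  have "(\<Sum>k\<in>ks M. a k x * b k x) \<le> (\<Sum>k\<in>ks M. seqn \<infinity> M a x * b k x)"
    by (intro sum_mono mult_right_mono) (auto simp: seqn_def intro: SUP_upper)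
  also have "\<dots> = seqn \<infinity> M a x * (\<Sum>k\<in>ks M. b k x)" by (simp add: sum_distrib_left)
  also have "\<dots> \<le> seqn \<infinity> M a x * seqn q M b x"
    using sum_le_epow_sum[of "(ks M)" Q "\<lambda>k. b k x"] Q q
    by (intro mult_left_mono) (auto simp: seqn_def Q_def)
  finally show ?thesis unfolding c .
next
  case False
  then have q1: "1 < q" by simp
  note c = conj_exponent_real[OF q1 q(2)]
  show ?thesis
    using Holder_sum_ennreal[of "(ks M)" "enn2real q / (enn2real q - 1)" "enn2real q" "\<lambda>k. a k x" "\<lambda>k. b k x"] c q
    by (simp add: seqn_def less_imp_neq add.commute)
qed

text \<open>
  Stopping times: \<open>E k\<close> is the set where the part of the square function of \<open>a\<close> below scale \<open>k\<close>
  is at most twice its Carleson bound; by Chebyshev it fills half of every cube of generation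
  \<open>k\<close>, so the sum may be restricted to these sets.
\<close>

lemma carleson_duality:
  fixes a b :: "int \<Rightarrow> 'a::euclidean_space \<Rightarrow> ennreal"
  assumes a: "\<And>k. cell_inv (cube k) (a k)" and b: "\<And>k. cell_inv (cube k) (b k)"
    and q: "1 < q" "q < top" and N: "0 < N"
    and car: "\<And>k x. (\<Sum>j\<in>{- int M..k}. (NN y. epow (a j y) (enn2real (conj_exponent q)) * indicator (cube k -` {cube k x}) y))
      \<le> ennreal N * ennreal (cube_vol TYPE('a) k)"
  shows "(NN x. (\<Sum>k\<in>ks M. a k x * b k x)) \<le>
    ennreal (2 * (2 * N) powr (1 / enn2real (conj_exponent q))) * (NN x. seqn q M b x)"
proof -
  define S where "S = (ks M)"
  define Q where "Q = enn2real q"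
  define Q' where "Q' = Q / (Q - 1)"
  note c = conj_exponent_real[OF q]
  have Q: "1 < Q" "1 < Q'" "1 / Q' + 1 / Q = 1" using c by (auto simp: Q_def Q'_def)
  have cQ: "enn2real (conj_exponent q) = Q'" using c Q by (simp add: Q_def Q'_def)
  have [measurable]: "bm (a k)" "bm (b k)" for k
    using a b by (auto intro: cells.cell_inv_borel_measurable[OF cells_cube])
  define s where "s k x = (\<Sum>j\<in>{- int M..k}. epow (a j x) Q')" for k x
  have [measurable]: "bm (s k)" for k unfolding s_def by measurable
  define E where "E k = {x. s k x \<le> ennreal (2 * N)}" for k
  have E_meas [measurable]: "E k \<in> sets borel" for k unfolding E_def by measurable
  have half: "ennreal (1 / 2) \<le> cells.avg (cube k) (cube_vol TYPE('a) k) (indicator (E k)) x" for k x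
  proof -
    interpret c: cells "cube k :: 'a \<Rightarrow> _" "cube_vol TYPE('a) k" by (rule cells_cube)
    note [measurable] = c.cell_sets
    have "c.avg (s k) x \<le> ennreal N"
    proof -
      have "(NN y. s k y * indicator (cube k -` {cube k x}) y) =
        (\<Sum>j\<in>{- int M..k}. (NN y. epow (a j y) Q' * indicator (cube k -` {cube k x}) y))"
        unfolding s_def sum_distrib_right by (rule nn_integral_sum) measurable
      also have "\<dots> \<le> ennreal N * ennreal (cube_vol TYPE('a) k)" using car[of k x] unfolding cQ .
      finally have "c.avg (s k) x \<le> ennreal N * ennreal (cube_vol TYPE('a) k) / ennreal (cube_vol TYPE('a) k)"
        unfolding c.avg_def by (rule divide_right_mono_ennreal)
      then show ?thesis by (subst (asm) mult_divide_eq_ennreal) (auto simp: ennreal_eq_0_iff not_le)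
    qed
    have "c.avg (indicator (- E k)) x \<le> c.avg (\<lambda>y. ennreal (1 / (2 * N)) * s k y) x"
    proof (rule c.avg_mono)
      fix y
      show "indicator (- E k) y \<le> ennreal (1 / (2 * N)) * s k y"
      proof (cases "y \<in> E k")
        case False
        then have "ennreal (2 * N) \<le> s k y" by (auto simp: E_def)
        then have "ennreal (1 / (2 * N)) * ennreal (2 * N) \<le> ennreal (1 / (2 * N)) * s k y"
          by (rule mult_left_mono) simp
        then show ?thesis using N False by (simp add: ennreal_mult[symmetric])
      qed simp
    qed
    also have "\<dots> = ennreal (1 / (2 * N)) * c.avg (s k) x"
      by (rule c.avg_cmult_inv) (auto simp: cell_inv_def)
    also have "\<dots> \<le> ennreal (1 / (2 * N)) * ennreal N"
      by (intro mult_left_mono \<open>c.avg (s k) x \<le> ennreal N\<close>) simp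
    also have "\<dots> = ennreal (1 / 2)" using N by (simp add: ennreal_mult[symmetric])
    finally have compl: "c.avg (indicator (- E k)) x \<le> ennreal (1 / 2)" .
    have "1 = c.avg (\<lambda>y. indicator (E k) y + indicator (- E k) y) x"
    proof -
      have "(\<lambda>y. indicator (E k) y + indicator (- E k) y) = (\<lambda>y. 1 :: ennreal)"
        by (auto simp: indicator_def)
      then show ?thesis by (simp add: c.avg_one)
    qed
    also have "\<dots> = c.avg (indicator (E k)) x + c.avg (indicator (- E k)) x" by (rule c.avg_add) auto
    also have "\<dots> \<le> c.avg (indicator (E k)) x + ennreal (1 / 2)" by (intro add_left_mono compl)
    finally have le: "1 \<le> c.avg (indicator (E k)) x + ennreal (1 / 2)" .
    show ?thesis
    proof (cases "c.avg (indicator (E k)) x")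
      case (real v)
      then have "ennreal 1 \<le> ennreal (v + 1 / 2)"
        using le by (simp only: real ennreal_1[symmetric] ennreal_plus[symmetric])
      then have "1 \<le> v + 1 / 2" using real by (subst (asm) ennreal_le_iff) auto
      then have "ennreal (1 / 2) \<le> ennreal v" by (intro ennreal_leI) simp
      then show ?thesis by (simp only: real)
    qed simp
  qed
  have restr: "(NN x. a k x * b k x) \<le> 2 * (NN x. indicator (E k) x * (a k x * b k x))" for k
  proof -
    interpret c: cells "cube k :: 'a \<Rightarrow> _" "cube_vol TYPE('a) k" by (rule cells_cube)
    have inv: "cell_inv (cube k) (\<lambda>x. a k x * b k x)"
      using a[of k] b[of k] unfolding cell_inv_def by metis
    have "(NN x. a k x * b k x) = (NN x. 2 * (ennreal (1 / 2) * (a k x * b k x)))"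
    proof -
      have "2 * ennreal (1 / 2) = ennreal (2 * (1 / 2))" by (subst ennreal_mult) auto
      then have "2 * ennreal (1 / 2) = 1" by simp
      then show ?thesis by (simp add: mult.assoc[symmetric])
    qed
    also have "\<dots> \<le> (NN x. 2 * (c.avg (indicator (E k)) x * (a k x * b k x)))"
      by (intro nn_integral_mono mult_left_mono mult_right_mono half) auto
    also have "\<dots> = 2 * (NN x. c.avg (indicator (E k)) x * (a k x * b k x))"
      by (rule nn_integral_cmult) measurable
    also have "(NN x. c.avg (indicator (E k)) x * (a k x * b k x)) = (NN x. indicator (E k) x * (a k x * b k x))"
      by (rule c.nn_integral_avg[symmetric, OF _ inv]) measurable
    finally show ?thesis .
  qed
  have pt: "(\<Sum>k\<in>S. indicator (E k) x * (a k x * b k x)) \<le> ennreal ((2 * N) powr (1 / Q')) * seqn q M b x" for x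
  proof -
    have bound: "(\<Sum>k\<in>S. epow (indicator (E k) x * a k x) Q') \<le> ennreal (2 * N)"
    proof (cases "\<exists>k\<in>S. x \<in> E k")
      case True
      \<comment> \<open>The largest scale surviving at \<open>x\<close>. All surviving terms are
        part of the sum up to K, which the definition of \<open>E K\<close> bounds by 2 N.\<close>
      define K where "K = Max {k\<in>S. x \<in> E k}"
      have fin: "finite {k\<in>S. x \<in> E k}" by (rule finite_subset[of _ S]) (auto simp: S_def)
      have K: "K \<in> {k\<in>S. x \<in> E k}" unfolding K_def using True by (intro Max_in fin) auto
      have "(\<Sum>k\<in>S. epow (indicator (E k) x * a k x) Q') = (\<Sum>k\<in>{k\<in>S. x \<in> E k}. epow (a k x) Q')"
        unfolding sum.inter_filter[of S, OF finite_atLeastAtMost_int[of "- int M" "int M", folded S_def]]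
        by (intro sum.cong) auto
      also have "\<dots> \<le> s K x"
        unfolding s_def using Max_ge[OF fin] by (intro sum_mono2) (auto simp: S_def K_def)
      also have "\<dots> \<le> ennreal (2 * N)" using K by (simp add: E_def)
      finally show ?thesis .
    next
      case False
      then have "(\<Sum>k\<in>S. epow (indicator (E k) x * a k x) Q') = 0" by (intro sum.neutral) auto
      then show ?thesis by simp
    qed
    have "(\<Sum>k\<in>S. indicator (E k) x * (a k x * b k x)) = (\<Sum>k\<in>S. (indicator (E k) x * a k x) * b k x)"
      by (simp add: mult.assoc)
    also have "\<dots> \<le> epow (\<Sum>k\<in>S. epow (indicator (E k) x * a k x) Q') (1 / Q') * epow (\<Sum>k\<in>S. epow (b k x) Q) (1 / Q)"
      using Q by (intro Holder_sum_ennreal) (auto simp: S_def)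
    also have "\<dots> \<le> epow (ennreal (2 * N)) (1 / Q') * epow (\<Sum>k\<in>S. epow (b k x) Q) (1 / Q)"
      using Q by (intro mult_right_mono epow_mono bound) auto
    also have "\<dots> = ennreal ((2 * N) powr (1 / Q')) * seqn q M b x"
      using N q by (simp add: seqn_def S_def Q_def epow_ennreal less_imp_neq)
    finally show ?thesis .
  qed
  have "(NN x. (\<Sum>k\<in>S. a k x * b k x)) = (\<Sum>k\<in>S. (NN x. a k x * b k x))"
    by (rule nn_integral_sum) measurable
  also have "\<dots> \<le> (\<Sum>k\<in>S. 2 * (NN x. indicator (E k) x * (a k x * b k x)))"
    by (intro sum_mono restr)
  also have "\<dots> = 2 * (NN x. (\<Sum>k\<in>S. indicator (E k) x * (a k x * b k x)))"
    by (subst nn_integral_sum) (auto simp: sum_distrib_left)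
  also have "\<dots> \<le> 2 * (NN x. ennreal ((2 * N) powr (1 / Q')) * seqn q M b x)"
    by (intro mult_left_mono nn_integral_mono pt) auto
  also have "\<dots> = 2 * (ennreal ((2 * N) powr (1 / Q')) * (NN x. seqn q M b x))"
    by (subst nn_integral_cmult) auto
  also have "\<dots> = ennreal (2 * (2 * N) powr (1 / Q')) * (NN x. seqn q M b x)"
    by (subst ennreal_mult) (auto simp: mult.assoc)
  finally show ?thesis by (simp add: S_def cQ)
qed

text \<open>For p > 1 Hoelder's inequality is used in the scales and then in space. For p = 1 and q
  \<le> 1 the coefficients of \<open>f\<close> are uniformly bounded. For p = 1 < q they satisfy
  only a Carleson condition, and stopping times take over.\<close>

lemma tent_Holder:
  assumes p: "1 \<le> p" "p < top" and r: "1 \<le> r" "r < top" and q: "0 < q" "q < top"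
  shows "\<exists>C>0. \<forall>(f :: real \<times> 'a::euclidean_space \<Rightarrow> ennreal) g.
    bm f \<longrightarrow> bm g \<longrightarrow>
    hs_int (\<lambda>z. f z * g z) \<le> ennreal C *
      tent (conj_exponent p) (conj_exponent q) (wt (conj_exponent r) f) * tent p q (wt r g)"
proof -
  define p' q' r' where "p' = conj_exponent p" and "q' = conj_exponent q" and "r' = conj_exponent r"
  define P where "P = enn2real p"
  have p0: "0 < p" using less_le_trans[OF zero_less_one p(1)] .
  have r0: "0 < r" using less_le_trans[OF zero_less_one r(1)] .
  have P: "1 \<le> P" unfolding P_def using p by (rule enn2real_ge_1)
  have r': "1 \<le> r'" unfolding r'_def by (rule conj_exponent_ge_1[OF r0 r(2)])
  have q': "0 < q'" unfolding q'_def using less_le_trans[OF zero_less_one conj_exponent_ge_1[OF q]] .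
  obtain C1 where C1: "C1 > 0" "\<And>(h :: real \<times> 'a \<Rightarrow> ennreal) M.
    epow (NN x. epow (seqn q M (wcoeff r h) x) P) (1 / P) \<le> ennreal C1 * tent p q (wt r h)"
    using tent_lower[OF r(1) q(1) p0 p(2), where 'a='a] unfolding P_def by blast
  have "\<exists>C>0. \<forall>(f :: real \<times> 'a \<Rightarrow> ennreal) g M. bm f \<longrightarrow> bm g \<longrightarrow>
    (NN x. (\<Sum>k\<in>ks M. wcoeff r' f k x * wcoeff r g k x)) \<le>
    ennreal C * tent p' q' (wt r' f) * tent p q (wt r g)"
  proof (cases "p = 1")
    case False
    then have p1: "1 < p" using p(1) by simp
    note c = conj_exponent_real[OF p1 p(2)]
    define P' where "P' = P / (P - 1)"
    have PP: "1 < P" "1 < P'" "1 / P' + 1 / P = 1" using c by (auto simp: P_def P'_def)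
    have p'P: "p' = ennreal P'" using c by (simp add: p'_def P'_def P_def)
    have p': "0 < p'" "p' < top" "enn2real p' = P'" using PP p'P by auto
    obtain C2 where C2: "C2 > 0" "\<And>(h :: real \<times> 'a \<Rightarrow> ennreal) M.
      epow (NN x. epow (seqn q' M (wcoeff r' h) x) P') (1 / P') \<le> ennreal C2 * tent p' q' (wt r' h)"
      using tent_lower[OF r' q' p'(1,2), where 'a='a] unfolding p'(3) by blast
    have "(NN x. (\<Sum>k\<in>ks M. wcoeff r' f k x * wcoeff r g k x)) \<le>
      ennreal (C1 * C2) * tent p' q' (wt r' f) * tent p q (wt r g)" for f g :: "real \<times> 'a \<Rightarrow> ennreal" and M
    proof -
      have "(NN x. (\<Sum>k\<in>ks M. wcoeff r' f k x * wcoeff r g k x)) \<le>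
        (NN x. seqn q' M (wcoeff r' f) x * seqn q M (wcoeff r g) x)"
        unfolding q'_def by (intro nn_integral_mono sum_le_seqn q)
      also have "\<dots> \<le> epow (NN x. epow (seqn q' M (wcoeff r' f) x) P') (1 / P') *
        epow (NN x. epow (seqn q M (wcoeff r g) x) P) (1 / P)" using PP by (intro Holder_nn_integral) auto
      also have "\<dots> \<le> (ennreal C2 * tent p' q' (wt r' f)) * (ennreal C1 * tent p q (wt r g))"
        by (intro mult_mono C1 C2) auto
      also have "\<dots> = ennreal (C1 * C2) * tent p' q' (wt r' f) * tent p q (wt r g)"
        using C1(1) C2(1) by (simp add: ennreal_mult less_imp_le ac_simps)
      finally show ?thesis .
    qed
    moreover have "0 < C1 * C2" using C1 C2 by simp
    ultimately show ?thesis by blast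
  next
    case True
    then have p': "p' = \<infinity>" by (simp add: p'_def conj_exponent_def)
    have P1: "P = 1" using True by (simp add: P_def)
    have C1': "(NN x. seqn q M (wcoeff r h) x) \<le> ennreal C1 * tent p q (wt r h)"
      for h :: "real \<times> 'a \<Rightarrow> ennreal" and M using C1(2)[of M h] by (simp add: P1)
    show ?thesis
    proof (cases "q \<le> 1")
      case True
      then have q'i: "q' = \<infinity>" by (simp add: q'_def conj_exponent_def)
      let ?c = "low_const TYPE('a)"
      have c0: "0 < ?c" by (simp add: low_const_def)
      have "(NN x. (\<Sum>k\<in>ks M. wcoeff r' f k x * wcoeff r g k x)) \<le>
        ennreal (C1 * ?c) * tent p' q' (wt r' f) * tent p q (wt r g)" for f g :: "real \<times> 'a \<Rightarrow> ennreal" and M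
      proof -
        have s: "seqn q' M (wcoeff r' f) x \<le> ennreal ?c * tent p' q' (wt r' f)" for x
          unfolding seqn_def q'i p' using tent_infinity_infinity_lower[OF r', of f] by (auto intro: SUP_least)
        have "(NN x. (\<Sum>k\<in>ks M. wcoeff r' f k x * wcoeff r g k x)) \<le>
          (NN x. (ennreal ?c * tent p' q' (wt r' f)) * seqn q M (wcoeff r g) x)"
        proof (intro nn_integral_mono)
          fix x
          have "(\<Sum>k\<in>ks M. wcoeff r' f k x * wcoeff r g k x) \<le> seqn q' M (wcoeff r' f) x * seqn q M (wcoeff r g) x"
            unfolding q'_def by (rule sum_le_seqn[OF q])
          also have "\<dots> \<le> (ennreal ?c * tent p' q' (wt r' f)) * seqn q M (wcoeff r g) x"
            by (intro mult_right_mono s) simp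
          finally show "(\<Sum>k\<in>ks M. wcoeff r' f k x * wcoeff r g k x) \<le> \<dots>" .
        qed
        also have "\<dots> = (ennreal ?c * tent p' q' (wt r' f)) * (NN x. seqn q M (wcoeff r g) x)"
          by (rule nn_integral_cmult) measurable
        also have "\<dots> \<le> (ennreal ?c * tent p' q' (wt r' f)) * (ennreal C1 * tent p q (wt r g))"
          by (intro mult_left_mono C1') simp
        also have "\<dots> = ennreal (C1 * ?c) * tent p' q' (wt r' f) * tent p q (wt r g)"
          using C1(1) c0 by (simp add: ennreal_mult less_imp_le ac_simps)
        finally show ?thesis .
      qed
      moreover have "0 < C1 * ?c" using C1 c0 by simp
      ultimately show ?thesis by blast
    next
      case False
      then have q1: "1 < q" by simp
      note c = conj_exponent_real[OF q1 q(2)]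
      define Q' where "Q' = enn2real q'"
      have Q': "1 < Q'" "q' < top" using c by (auto simp: Q'_def q'_def)
      obtain C3 where C3: "C3 > 0" "\<And>(h :: real \<times> 'a \<Rightarrow> ennreal) k x M. bm h \<Longrightarrow>
        (\<Sum>j\<in>{- int M..k}. (NN y. epow (wcoeff r' h j y) Q' * indicator (cube k -` {cube k x}) y))
        \<le> ennreal C3 * ennreal (cube_vol TYPE('a) k) * epow (tent \<infinity> q' (wt r' h)) Q'"
        using tent_infinity_lower[OF r' q' Q'(2), where 'a='a] unfolding Q'_def by blast
      define C where "C = C1 * (2 * (2 * C3) powr (1 / Q'))"
      have "(NN x. (\<Sum>k\<in>ks M. wcoeff r' f k x * wcoeff r g k x)) \<le>
        ennreal C * tent p' q' (wt r' f) * tent p q (wt r g)"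
        if f: "bm f" and g: "bm g" for f g :: "real \<times> 'a \<Rightarrow> ennreal" and M
      proof -
        let ?T = "tent \<infinity> q' (wt r' f)"
        \<comment> \<open>The Carleson argument needs a positive finite constant, so degenerate
          norms come first: a zero norm forces the coefficients of \<open>f\<close>, or the sequence
          norm of \<open>g\<close> almost everywhere, to vanish.\<close>
        consider "?T = 0" | "tent p q (wt r g) = 0" | "?T = top" "tent p q (wt r g) \<noteq> 0" | t where "?T = ennreal t" "0 < t"
          by (cases ?T) (auto simp: less_le)
        then show ?thesis
        proof cases
          case 1
          have "wcoeff r' f k x = 0" if "k \<in> ks M" for k x
          proof -
            have "(NN y. epow (wcoeff r' f k y) Q' * indicator (cube k -` {cube k x}) y) \<le>
              (\<Sum>j\<in>{- int M..k}. (NN y. epow (wcoeff r' f j y) Q' * indicator (cube k -` {cube k x}) y))"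
              using that by (intro member_le_sum[where f = "\<lambda>j. (NN y. epow (wcoeff r' f j y) Q' * indicator (cube k -` {cube k x}) y)"]) auto
            also have "\<dots> \<le> 0" using C3(2)[where M = M and k = k and x = x, OF f] 1 by simp
            finally have "(NN y. epow (wcoeff r' f k y) Q' * indicator (cube k -` {cube k x}) y) = 0" by simp
            moreover have "(NN y. epow (wcoeff r' f k y) Q' * indicator (cube k -` {cube k x}) y) =
              (NN y. epow (wcoeff r' f k x) Q' * indicator (cube k -` {cube k x}) y)"
              by (intro nn_integral_cong) (auto simp: indicator_def intro!: arg_cong[where f = "\<lambda>u. epow u Q'"] cell_invD[OF wcoeff_inv])
            ultimately show ?thesis using cube_vol_pos[where 'a = 'a, of k]
              by (simp add: nn_integral_cmult_indicator cells.cell_sets[OF cells_cube] cells.cell_measure[OF cells_cube] not_le ennreal_eq_0_iff)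
          qed
          then show ?thesis by simp
        next
          case 2
          then have "(NN x. seqn q M (wcoeff r g) x) = 0" using C1'[of M g] by simp
          then have "AE x in lborel. seqn q M (wcoeff r g) x = 0" by (subst (asm) nn_integral_0_iff_AE) auto
          then have "AE x in lborel. (\<Sum>k\<in>ks M. wcoeff r' f k x * wcoeff r g k x) = 0"
          proof eventually_elim
            case (elim x)
            have "(\<Sum>k\<in>ks M. wcoeff r' f k x * wcoeff r g k x) \<le> seqn (conj_exponent q) M (wcoeff r' f) x * seqn q M (wcoeff r g) x"
              by (rule sum_le_seqn[OF q])
            then show ?case using elim by simp
          qed
          then have "(NN x. (\<Sum>k\<in>ks M. wcoeff r' f k x * wcoeff r g k x)) = 0"
            by (subst nn_integral_0_iff_AE) auto
          then show ?thesis by simp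
        next
          case 3
          have "0 < C" using C1 C3 by (simp add: C_def)
          then show ?thesis using 3 by (simp add: p' ennreal_mult_eq_top_iff ennreal_mult_top ennreal_top_mult)
        next
          case 4
          have "(NN x. (\<Sum>k\<in>ks M. wcoeff r' f k x * wcoeff r g k x)) \<le>
            ennreal (2 * (2 * (C3 * t powr Q')) powr (1 / enn2real (conj_exponent q))) * (NN x. seqn q M (wcoeff r g) x)"
          proof (rule carleson_duality[OF wcoeff_inv wcoeff_inv q1 q(2)])
            show "0 < C3 * t powr Q'" using C3 4 by simp
            show "(\<Sum>j\<in>{- int M..k}. (NN y. epow (wcoeff r' f j y) (enn2real (conj_exponent q)) * indicator (cube k -` {cube k x}) y))
              \<le> ennreal (C3 * t powr Q') * ennreal (cube_vol TYPE('a) k)" for k x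
              using C3(2)[where M = M and k = k and x = x, OF f] 4 C3(1) by (simp add: Q'_def q'_def epow_ennreal ennreal_mult ac_simps)
          qed
          also have "\<dots> \<le> ennreal (2 * (2 * (C3 * t powr Q')) powr (1 / Q')) * (ennreal C1 * tent p q (wt r g))"
            unfolding Q'_def q'_def by (intro mult_left_mono C1') simp
          \<comment> \<open>The root of order Q' restores homogeneity of degree one in the norm t of
            \<open>f\<close>.\<close>
          also have "(2 * (C3 * t powr Q')) powr (1 / Q') = (2 * C3) powr (1 / Q') * t"
            using 4 C3(1) Q' by (simp add: powr_mult powr_powr)
          also have "ennreal (2 * ((2 * C3) powr (1 / Q') * t)) * (ennreal C1 * tent p q (wt r g)) = ennreal C * ?T * tent p q (wt r g)"
          proof -
            have "ennreal (2 * ((2 * C3) powr (1 / Q') * t)) * ennreal C1 = ennreal C * ennreal t"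
              using 4 C1(1) by (simp add: C_def ennreal_mult[symmetric] ac_simps)
            then show ?thesis using 4 by (simp add: mult.assoc[symmetric])
          qed
          finally show ?thesis by (simp add: p')
        qed
      qed
      moreover have "0 < C" using C1 C3 by (simp add: C_def)
      ultimately show ?thesis by blast
    qed
  qed
  then obtain C where C: "C > 0" "\<And>(f :: real \<times> 'a \<Rightarrow> ennreal) g M. bm f \<Longrightarrow> bm g \<Longrightarrow>
    (NN x. (\<Sum>k\<in>ks M. wcoeff r' f k x * wcoeff r g k x)) \<le>
    ennreal C * tent p' q' (wt r' f) * tent p q (wt r g)" by blast
  have "hs_int (\<lambda>z. f z * g z) \<le> ennreal C * tent p' q' (wt r' f) * tent p q (wt r g)"
    if f: "bm f" and g: "bm g" for f g :: "real \<times> 'a \<Rightarrow> ennreal"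
    unfolding r'_def by (rule order_trans[OF hs_int_le_SUP[OF f g r]]) (intro SUP_least C(2)[OF f g, unfolded r'_def])
  then show ?thesis using C(1) unfolding p'_def q'_def r'_def by blast
qed

section \<open>Test functions\<close>

lemma locnorm_cmult:
  assumes [measurable]: "bm h" "S \<in> sets borel" and r: "1 \<le> r" "r < top"
  shows "locnorm r S (\<lambda>z. c * h z) = c * locnorm r S h"
proof -
  define R where "R = enn2real r"
  have R: "1 \<le> R" unfolding R_def using r by (rule enn2real_ge_1)
  have "(NN z. epow (c * h z) R * indicator S z) = epow c R * (NN z. epow (h z) R * indicator S z)"
    unfolding epow_mult mult.assoc by (rule nn_integral_cmult) measurable
  then have "epow ((NN z. epow (c * h z) R * indicator S z) / emeasure lborel S) (1 / R) =
    epow (epow c R * ((NN z. epow (h z) R * indicator S z) / emeasure lborel S)) (1 / R)"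
    by (simp add: ennreal_times_divide)
  also have "\<dots> = c * epow ((NN z. epow (h z) R * indicator S z) / emeasure lborel S) (1 / R)"
    using R by (simp add: epow_mult epow_epow)
  finally show ?thesis using r by (simp add: locnorm_def R_def less_imp_neq)
qed

lemma mean_cmult_inv:
  fixes \<phi> :: "real \<times> 'a::euclidean_space \<Rightarrow> ennreal"
  assumes [measurable]: "bm \<phi>" and \<psi>: "cell_inv (cube k) \<psi>"
  shows "mean k (\<lambda>z. \<phi> z * \<psi> (snd z)) x = mean k \<phi> x * \<psi> x"
proof -
  have "(NN z. \<phi> z * \<psi> (snd z) * indicator (wbox k x) z) = (NN z. \<psi> x * (\<phi> z * indicator (wbox k x) z))"
  proof (intro nn_integral_cong)
    fix z :: "real \<times> 'a"
    have "\<psi> (snd z) = \<psi> x" if "z \<in> wbox k x"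
      using that by (intro cell_invD[OF \<psi>]) (auto simp: wbox_def)
    then show "\<phi> z * \<psi> (snd z) * indicator (wbox k x) z = \<psi> x * (\<phi> z * indicator (wbox k x) z)"
      by (cases "z \<in> wbox k x") (auto simp: mult.commute)
  qed
  also have "\<dots> = \<psi> x * (NN z. \<phi> z * indicator (wbox k x) z)"
    by (rule nn_integral_cmult) measurable
  finally show ?thesis by (simp add: mean_def ennreal_times_divide mult.commute)
qed

lemma snd_inv_measurable:
  assumes "cell_inv (cube k) \<psi>"
  shows "bm (\<lambda>z :: real \<times> 'a::euclidean_space. \<psi> (snd z))"
  by (rule borel_measurable_compose_snd[OF cells.cell_inv_borel_measurable[OF cells_cube assms]])

text \<open>Extremal functions of the local duality can be glued over all boxes of one slab, because
  their normalising factors are constant on cubes. For r = 1 the essential supremum need not be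
  attained, and \<open>H\<close> is the normalised indicator of the part of the box where
  \<open>F\<close> exceeds half of it; hence the factor 2. For r > 1 it is the conjugate power of
  \<open>F\<close> divided by the same power of the norm.\<close>

lemma norming_function:
  fixes F :: "real \<times> 'a::euclidean_space \<Rightarrow> ennreal"
  assumes F [measurable]: "bm F" and r: "1 \<le> r" "r < top"
    and fin: "\<And>x. wcoeff (conj_exponent r) F k x < top"
  shows "\<exists>H \<in> borel_measurable borel. \<forall>x. wcoeff (conj_exponent r) F k x \<le> 2 * mean k (\<lambda>z. F z * H z) x \<and> wcoeff r H k x \<le> 1"
proof (cases "r = 1")
  case True
  then have c: "conj_exponent r = \<infinity>" by (simp add: conj_exponent_def)
  define w where "w = wcoeff \<infinity> F k"
  have w_inv: "cell_inv (cube k) w" unfolding w_def by (rule wcoeff_inv)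
  note [measurable] = snd_inv_measurable[OF w_inv]
  define \<eta> :: "real \<times> 'a \<Rightarrow> ennreal" where "\<eta> = indicator {z. w (snd z) < 2 * F z}"
  have \<eta>_meas [measurable]: "bm \<eta>" unfolding \<eta>_def by measurable
  define m where "m = mean k \<eta>"
  have m_inv: "cell_inv (cube k) (\<lambda>x. inverse (m x))"
    using mean_inv[of k \<eta>] unfolding m_def cell_inv_def by metis
  note [measurable] = snd_inv_measurable[OF m_inv]
  define H where "H z = \<eta> z * inverse (m (snd z))" for z
  have [measurable]: "bm H" unfolding H_def by measurable
  have m_top: "m x < top" for x
  proof -
    have "(NN z. \<eta> z * indicator (wbox k x) z) \<le> (NN z. indicator (wbox k x) z)"
      by (intro nn_integral_mono) (auto simp: \<eta>_def indicator_def)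
    also have "\<dots> < top" by (simp add: emeasure_wbox)
    finally show ?thesis using slab_len_bounds(3)[of k]
      by (simp add: m_def mean_def ennreal_divide_eq_top_iff less_top[symmetric] emeasure_wbox not_le ennreal_eq_0_iff)
  qed
  \<comment> \<open>Otherwise half of \<open>w x\<close> would be an essential bound for
    \<open>F\<close> on the box, contradicting minimality since \<open>w x\<close> is finite and not
    0.\<close>
  have m0: "0 < m x" if "w x \<noteq> 0" for x
  proof (rule ccontr)
    assume "\<not> 0 < m x"
    then have "(NN z. \<eta> z * indicator (wbox k x) z) = 0"
      by (simp add: m_def mean_def ennreal_divide_eq_0_iff emeasure_wbox not_less)
    then have "AE z in lborel. \<eta> z * indicator (wbox k x) z = 0" by (subst (asm) nn_integral_0_iff_AE) auto
    then have "AE z in lborel. z \<in> wbox k x \<longrightarrow> F z \<le> w x / 2"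
    proof eventually_elim
      case (elim z)
      show ?case
      proof
        assume z: "z \<in> wbox k x"
        then have "w (snd z) = w x" by (intro cell_invD[OF w_inv]) (auto simp: wbox_def)
        then have "F z * 2 \<le> w x" using elim z by (auto simp: \<eta>_def indicator_def not_less mult.commute split: if_splits)
        then have "F z * 2 / 2 \<le> w x / 2" by (rule divide_right_mono_ennreal)
        then show "F z \<le> w x / 2" by (subst (asm) mult_divide_eq_ennreal) auto
      qed
    qed
    then have "w x \<le> w x / 2" unfolding w_def wcoeff_def by (rule locnorm_top_le)
    moreover obtain v where "w x = ennreal v" "0 \<le> v" using fin[of x] unfolding c w_def[symmetric] by (cases "w x") auto
    ultimately have "ennreal v \<le> ennreal (v / 2)"
      by (metis divide_ennreal ennreal_numeral zero_less_numeral)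
    then show False using \<open>w x = ennreal v\<close> \<open>0 \<le> v\<close> that by (auto simp: ennreal_le_iff2)
  qed
  have mH: "mean k H x = m x * inverse (m x)" for x
    unfolding H_def m_def by (rule mean_cmult_inv) (use m_inv in \<open>auto simp: m_def\<close>)
  have "wcoeff (conj_exponent r) F k x \<le> 2 * mean k (\<lambda>z. F z * H z) x \<and> wcoeff r H k x \<le> 1" for x
  proof
    have "wcoeff r H k x = mean k H x" unfolding True wcoeff_def by (simp add: locnorm_def mean_def)
    also have "\<dots> \<le> 1" unfolding mH using m_top[of x] by (cases "m x"; cases "m x = 0")
        (auto simp: inverse_ennreal ennreal_mult[symmetric])
    finally show "wcoeff r H k x \<le> 1" .
    show "wcoeff (conj_exponent r) F k x \<le> 2 * mean k (\<lambda>z. F z * H z) x"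
    proof (cases "w x = 0")
      case False
      have "w x = w x * (m x * inverse (m x))"
        using m0[OF False] m_top[of x] by (cases "m x") (auto simp: inverse_ennreal ennreal_mult[symmetric])
      also have "\<dots> = mean k H x * w x" unfolding mH by (rule mult.commute)
      also have "\<dots> = mean k (\<lambda>z. H z * w (snd z)) x"
        by (rule mean_cmult_inv[symmetric, OF _ w_inv]) measurable
      also have "\<dots> \<le> mean k (\<lambda>z. 2 * (F z * H z)) x" unfolding mean_def
      proof (intro divide_right_mono_ennreal nn_integral_mono mult_right_mono)
        fix z
        show "H z * w (snd z) \<le> 2 * (F z * H z)"
        proof (cases "w (snd z) < 2 * F z")
          case True
          then have "H z * w (snd z) \<le> H z * (2 * F z)" by (intro mult_left_mono) auto
          then show ?thesis by (simp add: ac_simps)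
        qed (simp add: H_def \<eta>_def)
      qed simp
      also have "\<dots> = 2 * mean k (\<lambda>z. F z * H z) x"
        unfolding mean_def by (simp add: mult.assoc nn_integral_cmult ennreal_times_divide)
      finally show ?thesis unfolding c w_def .
    next
      case True
      then have "wcoeff (conj_exponent r) F k x = 0" unfolding w_def c .
      then show ?thesis by simp
    qed
  qed
  then show ?thesis by (intro bexI[of _ H]) auto
next
  case False
  then have r1: "1 < r" using r by simp
  note c = conj_exponent_real[OF r1 r(2)]
  define R where "R = enn2real r"
  define R' where "R' = R / (R - 1)"
  have RR: "1 < R" "1 < R'" "1 / R' + 1 / R = 1" using c by (auto simp: R_def R'_def)
  have Rm: "(R' - 1) * R = R'" using RR(1) by (simp add: R'_def field_simps)
  have r': "conj_exponent r = ennreal R'" using c by (simp add: R'_def R_def)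
  have r'0: "1 \<le> conj_exponent r" "conj_exponent r < top" "enn2real (conj_exponent r) = R'"
    using RR conj_exponent_ge_1[OF _ r(2)] r1 r' by (auto intro: less_trans[OF zero_less_one])
  define w where "w = wcoeff (conj_exponent r) F k"
  have w_inv: "cell_inv (cube k) w" unfolding w_def by (rule wcoeff_inv)
  have wa_inv: "cell_inv (cube k) (\<lambda>x. epow (w x) a)" for a using w_inv unfolding cell_inv_def by metis
  note [measurable] = snd_inv_measurable[OF wa_inv]
  have mF: "mean k (\<lambda>z. epow (F z) R') x = epow (w x) R'" for x
    unfolding w_def using mean_epow_eq_wcoeff[OF r'0(2,1), of k F x] by (simp add: r'0(3))
  \<comment> \<open>Where \<open>w\<close> vanishes, so does its negative power by the convention
    for \<open>epow\<close>, and \<open>H\<close> is 0. An infinite \<open>w\<close> would spoil the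
    bound of the coefficient of \<open>H\<close> by 1; the assumption \<open>fin\<close> rules it
    out.\<close>
  define H where "H z = epow (F z) (R' - 1) * epow (w (snd z)) (- (R' - 1))" for z
  have [measurable]: "bm H" unfolding H_def by measurable
  have wfin: "w x \<noteq> top" for x using fin[of x] by (simp add: w_def less_top)
  have "wcoeff (conj_exponent r) F k x \<le> 2 * mean k (\<lambda>z. F z * H z) x \<and> wcoeff r H k x \<le> 1" for x
  proof
    have "mean k (\<lambda>z. F z * H z) x = mean k (\<lambda>z. epow (F z) R' * epow (w (snd z)) (- (R' - 1))) x"
    proof -
      have "F z * H z = epow (F z) R' * epow (w (snd z)) (- (R' - 1))" for z
        using epow_add[of "F z" 1 "R' - 1"] by (simp add: H_def mult.assoc)
      then show ?thesis by simp
    qed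
    also have "\<dots> = epow (w x) R' * epow (w x) (- (R' - 1))"
      unfolding mF[symmetric] by (rule mean_cmult_inv[OF _ wa_inv]) measurable
    also have "\<dots> = w x" using epow_add[of "w x" R' "- (R' - 1)"] by simp
    finally have "mean k (\<lambda>z. F z * H z) x = w x" .
    moreover have "1 * w x \<le> 2 * w x" by (intro mult_right_mono) auto
    ultimately show "wcoeff (conj_exponent r) F k x \<le> 2 * mean k (\<lambda>z. F z * H z) x"
      by (simp add: w_def)
    have "epow (wcoeff r H k x) R = mean k (\<lambda>z. epow (H z) R) x"
      using mean_epow_eq_wcoeff[OF r(2,1), of k H x] by (simp add: R_def)
    also have "\<dots> = mean k (\<lambda>z. epow (F z) R' * epow (w (snd z)) (- R')) x"
    proof -
      have "- ((R' - 1) * R) = - R'" using Rm by simp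
      then show ?thesis unfolding H_def epow_mult epow_epow Rm minus_mult_left[symmetric] by simp
    qed
    also have "\<dots> = epow (w x) R' * epow (w x) (- R')"
      unfolding mF[symmetric] by (rule mean_cmult_inv[OF _ wa_inv]) measurable
    also have "\<dots> \<le> 1" using wfin[of x] unfolding epow_add[symmetric]
      by (cases "w x"; cases "w x = 0") (auto simp: epow_ennreal)
    finally show "wcoeff r H k x \<le> 1" using RR(1) by (subst (asm) epow_le_swap) auto
  qed
  then show ?thesis by (intro bexI[of _ H]) auto
qed

text \<open>Monotone convergence for finite r, and a countable union of null sets for r =
  \<infinity>. It serves to pass from truncations of a function to the function itself.\<close>

lemma locnorm_SUP:
  fixes F :: "nat \<Rightarrow> 'b::euclidean_space \<Rightarrow> ennreal"
  assumes [measurable]: "\<And>j. bm (F j)" "S \<in> sets borel" and r: "1 \<le> r" and inc: "incseq F"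
  shows "locnorm r S (\<lambda>z. SUP j. F j z) = (SUP j. locnorm r S (F j))"
proof (rule antisym)
  show "(SUP j. locnorm r S (F j)) \<le> locnorm r S (\<lambda>z. SUP j. F j z)"
    by (intro SUP_least locnorm_mono SUP_upper) auto
  show "locnorm r S (\<lambda>z. SUP j. F j z) \<le> (SUP j. locnorm r S (F j))"
  proof (cases "r = \<infinity>")
    case True
    have "AE z in lborel. \<forall>j. z \<in> S \<longrightarrow> F j z \<le> locnorm r S (F j)"
      unfolding True by (subst AE_all_countable) (intro allI locnorm_top_AE)
    then have "AE z\<in>S in lborel. (SUP j. F j z) \<le> (SUP j. locnorm r S (F j))"
      by eventually_elim (auto intro!: SUP_mono')
    then show ?thesis unfolding True by (rule locnorm_top_le)
  next
    case False
    define R where "R = enn2real r"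
    have R: "1 \<le> R" unfolding R_def using r False by (intro enn2real_ge_1) (auto simp: less_top)
    have "(NN z. epow (SUP j. F j z) R * indicator S z) =
      (NN z. (SUP j. epow (F j z) R * indicator S z))"
      using R by (intro nn_integral_cong) (simp add: epow_SUP SUP_mult_right_ennreal)
    also have "\<dots> = (SUP j. (NN z. epow (F j z) R * indicator S z))"
      using inc R by (intro nn_integral_monotone_convergence_SUP)
        (auto simp: incseq_def le_fun_def intro!: mult_right_mono epow_mono)
    finally have "locnorm r S (\<lambda>z. SUP j. F j z) = epow ((SUP j. (NN z. epow (F j z) R * indicator S z)) / emeasure lborel S) (1 / R)"
      using False by (simp add: locnorm_def R_def)
    also have "\<dots> = (SUP j. epow ((NN z. epow (F j z) R * indicator S z) / emeasure lborel S) (1 / R))"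
      using R by (simp add: epow_SUP[symmetric] divide_ennreal_def SUP_mult_right_ennreal)
    finally show ?thesis using False by (simp add: locnorm_def R_def)
  qed
qed

lemma seqn_zero_outside:
  assumes q: "q < top" and u: "\<And>k. k \<in> ks M \<Longrightarrow> v k x \<le> u k x" "\<And>k. k \<notin> (ks M) \<Longrightarrow> v k x = 0"
  shows "seqn q M' v x \<le> seqn q M u x"
proof -
  have "(\<Sum>k\<in>{- int M'..int M'}. epow (v k x) (enn2real q)) =
    (\<Sum>k\<in>{- int M'..int M'} \<inter> (ks M). epow (v k x) (enn2real q))"
    using u(2) by (intro sum.mono_neutral_right) auto
  also have "\<dots> \<le> (\<Sum>k\<in>ks M. epow (v k x) (enn2real q))" by (intro sum_mono2) auto
  also have "\<dots> \<le> (\<Sum>k\<in>ks M. epow (u k x) (enn2real q))"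
    using u(1) by (intro sum_mono epow_mono) auto
  finally show ?thesis using q by (simp add: seqn_def less_imp_neq epow_mono)
qed

text \<open>
  Testing with \<open>G = (\<Sum>k. indicator (slab k) * u k * H k)\<close>, where \<open>H k\<close> norms \<open>F\<close> on the
  boxes of scale \<open>k\<close>, reduces the converse of the inequality of Hoelder to sequences.
\<close>

lemma test_sequences_finite:
  assumes p: "1 \<le> p" "p < top" and r: "1 \<le> r" "r < top" and q: "0 < q" "q < top"
  shows "\<exists>C>0. \<forall>(F :: real \<times> 'a::euclidean_space \<Rightarrow> ennreal) D u M.
    bm F \<longrightarrow> (\<forall>k x. wcoeff (conj_exponent r) F k x < top) \<longrightarrow>
    tested p q r D F \<longrightarrow>
    (\<forall>k. cell_inv (cube k) (u k)) \<longrightarrow>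
    (NN x. (\<Sum>k\<in>ks M. u k x * wcoeff (conj_exponent r) F k x)) \<le>
    ennreal C * D * epow (NN x. epow (seqn q M u x) (enn2real p)) (1 / enn2real p)"
proof -
  define P where "P = enn2real p"
  have p0: "0 < p" using less_le_trans[OF zero_less_one p(1)] .
  have P: "1 \<le> P" unfolding P_def using p by (rule enn2real_ge_1)
  obtain C where C: "C > 0" "\<And>(h :: real \<times> 'a \<Rightarrow> ennreal) D. bm h \<Longrightarrow>
    (\<And>M. epow (NN x. epow (seqn q M (wcoeff r h) x) P) (1 / P) \<le> D) \<Longrightarrow>
    tent p q (wt r h) \<le> ennreal C * D"
    using tent_upper[OF r(1) q(1) p0 p(2), where 'a='a] unfolding P_def by blast
  have claim: "(NN x. (\<Sum>k\<in>ks M. u k x * wcoeff (conj_exponent r) F k x)) \<le>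
    ennreal (8 * C) * D * epow (NN x. epow (seqn q M u x) P) (1 / P)"
    if F [measurable]: "bm F" and fin: "\<And>k x. wcoeff (conj_exponent r) F k x < top"
      and D: "\<And>G. bm G \<Longrightarrow> hs_int (\<lambda>z. F z * G z) \<le> D * tent p q (wt r G)"
      and u: "\<And>k. cell_inv (cube k) (u k)"
    for F :: "real \<times> 'a \<Rightarrow> ennreal" and D u M
  proof -
    let ?S = "(ks M)"
    let ?w = "wcoeff (conj_exponent r) F"
    have "\<forall>k. \<exists>H \<in> borel_measurable borel. \<forall>x. ?w k x \<le> 2 * mean k (\<lambda>z. F z * H z) x \<and> wcoeff r H k x \<le> 1"
      using norming_function[OF F r fin] by blast
    then obtain H where H [measurable]: "\<And>k. bm (H k)"
      and H1: "\<And>k x. ?w k x \<le> 2 * mean k (\<lambda>z. F z * H k z) x" and H2: "\<And>k x. wcoeff r (H k) k x \<le> 1"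
      by metis
    note [measurable] = snd_inv_measurable[OF u] cells.cell_inv_borel_measurable[OF cells_cube u]
    define G where "G z = (\<Sum>k\<in>?S. indicator (slab k) (fst z) * u k (snd z) * H k z)" for z
    have G [measurable]: "bm G" unfolding G_def by measurable
    have wG: "wcoeff r G k x \<le> u k x" if "k \<in> ?S" for k x
    proof -
      have "wcoeff r G k x \<le> wcoeff r (\<lambda>z. u k x * H k z) k x" unfolding wcoeff_def
      proof (rule locnorm_mono)
        fix z assume z: "z \<in> wbox k x"
        then have zk: "fst z \<in> slab k" by (auto simp: wbox_def)
        have "u k (snd z) = u k x" using z by (intro cell_invD[OF u]) (auto simp: wbox_def)
        moreover have "G z = (\<Sum>l\<in>?S. if l = k then u k (snd z) * H k z else 0)" unfolding G_def
        proof (intro sum.cong refl)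
          fix l
          have "fst z \<in> slab l \<longleftrightarrow> l = k" using slab_disjoint[OF zk, of l] zk by blast
          then show "indicator (slab l) (fst z) * u l (snd z) * H l z = (if l = k then u k (snd z) * H k z else 0)"
            by (cases "l = k") simp_all
        qed
        ultimately show "G z \<le> u k x * H k z" using that by simp
      qed
      also have "\<dots> = u k x * wcoeff r (H k) k x"
        unfolding wcoeff_def by (rule locnorm_cmult[OF _ _ r]) measurable
      also have "\<dots> \<le> u k x * 1" by (intro mult_left_mono H2) simp
      finally show ?thesis by simp
    qed
    have wG0: "wcoeff r G k x = 0" if "k \<notin> ?S" for k x
    proof -
      have "wcoeff r G k x \<le> wcoeff r (\<lambda>z. 0 * 0) k x" unfolding wcoeff_def
      proof (rule locnorm_mono)
        fix z assume z: "z \<in> wbox k x"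
        then have zk: "fst z \<in> slab k" by (auto simp: wbox_def)
        show "G z \<le> 0 * 0"
        proof -
          have "fst z \<notin> slab l" if "l \<in> ?S" for l using slab_disjoint[OF zk, of l] that \<open>k \<notin> ?S\<close> by blast
          then show ?thesis unfolding G_def by (simp add: sum.neutral)
        qed
      qed
      also have "\<dots> = 0 * wcoeff r (\<lambda>z. 0) k x"
        unfolding wcoeff_def by (rule locnorm_cmult[OF _ _ r]) measurable
      finally show ?thesis by simp
    qed
    have tG: "tent p q (wt r G) \<le> ennreal C * epow (NN x. epow (seqn q M u x) P) (1 / P)"
    proof (rule C(2)[OF G])
      fix M'
      show "epow (NN x. epow (seqn q M' (wcoeff r G) x) P) (1 / P) \<le> epow (NN x. epow (seqn q M u x) P) (1 / P)"
        using P by (intro epow_mono nn_integral_mono seqn_zero_outside q wG wG0) auto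
    qed
    have "(NN x. (\<Sum>k\<in>?S. u k x * ?w k x)) = (\<Sum>k\<in>?S. (NN x. u k x * ?w k x))"
      by (rule nn_integral_sum) measurable
    also have "\<dots> \<le> (\<Sum>k\<in>?S. (NN x. 2 * (mean k (\<lambda>z. F z * H k z) x * u k x)))"
    proof (intro sum_mono nn_integral_mono)
      fix k x
      have "u k x * ?w k x \<le> u k x * (2 * mean k (\<lambda>z. F z * H k z) x)" by (intro mult_left_mono H1) simp
      then show "u k x * ?w k x \<le> 2 * (mean k (\<lambda>z. F z * H k z) x * u k x)" by (simp add: ac_simps)
    qed
    \<comment> \<open>The constant 8 is the 2 of \<open>norming_function\<close> times the 4 of
      \<open>hs_slab_lower\<close>.\<close>
    also have "\<dots> = (\<Sum>k\<in>?S. 8 * (ennreal (1 / 4) * (NN x. mean k (\<lambda>z. F z * H k z) x * u k x)))"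
    proof (intro sum.cong refl)
      fix k
      have "8 * ennreal (1 / 4) = ennreal (8 * (1 / 4))" by (subst ennreal_mult) auto
      then have "8 * (ennreal (1 / 4) * y) = 2 * y" for y by (simp add: mult.assoc[symmetric])
      then show "(NN x. 2 * (mean k (\<lambda>z. F z * H k z) x * u k x)) =
        8 * (ennreal (1 / 4) * (NN x. mean k (\<lambda>z. F z * H k z) x * u k x))"
        by (simp add: nn_integral_cmult)
    qed
    also have "\<dots> \<le> (\<Sum>k\<in>?S. 8 * (NN z. F z * H k z * (ennreal (1 / fst z) * indicator (slab k) (fst z)) * u k (snd z)))"
      by (intro sum_mono mult_left_mono hs_slab_lower u) auto
    also have "\<dots> = 8 * (NN z. (\<Sum>k\<in>?S. F z * H k z * (ennreal (1 / fst z) * indicator (slab k) (fst z)) * u k (snd z)))"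
      by (subst nn_integral_sum) (auto simp: sum_distrib_left)
    also have "\<dots> = 8 * hs_int (\<lambda>z. F z * G z)"
    proof -
      have "(\<Sum>k\<in>?S. F z * H k z * (ennreal (1 / fst z) * indicator (slab k) (fst z)) * u k (snd z)) =
        F z * G z * (ennreal (1 / fst z) * indicator half_space z)" for z
      proof (cases "z \<in> half_space")
        case True
        then show ?thesis by (simp add: G_def sum_distrib_left sum_distrib_right ac_simps)
      next
        case False
        then have "fst z \<notin> slab k" for k using slab_weight_bounds(3) by blast
        then show ?thesis using False by simp
      qed
      then show ?thesis by (simp add: hs_int_def)
    qed
    also have "\<dots> \<le> 8 * (D * (ennreal C * epow (NN x. epow (seqn q M u x) P) (1 / P)))"
      by (intro mult_left_mono order_trans[OF D[OF G]] tG) auto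
    also have "\<dots> = ennreal (8 * C) * D * epow (NN x. epow (seqn q M u x) P) (1 / P)"
      using C(1) by (simp add: ennreal_mult ac_simps)
    finally show ?thesis .
  qed
  show ?thesis unfolding P_def[symmetric]
  proof (intro exI[of _ "8 * C"] conjI allI impI)
    fix F :: "real \<times> 'a \<Rightarrow> ennreal" and D and u :: "int \<Rightarrow> 'a \<Rightarrow> ennreal" and M
    assume 1: "bm F" and 2: "\<forall>k x. wcoeff (conj_exponent r) F k x < top"
      and 3: "tested p q r D F"
      and 4: "\<forall>k. cell_inv (cube k) (u k)"
    show "(NN x. (\<Sum>k\<in>ks M. u k x * wcoeff (conj_exponent r) F k x)) \<le>
      ennreal (8 * C) * D * epow (NN x. epow (seqn q M u x) P) (1 / P)"
      by (rule claim[OF 1]) (use 2 3 4 in simp_all)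
  qed (use C(1) in simp)
qed

text \<open>The truncations \<open>min (F z) (of_nat j)\<close> have finite coefficients and inherit
  the dual estimate from \<open>F\<close> by monotonicity; the left-hand sides increase to the one
  for \<open>F\<close>.\<close>

lemma test_sequences:
  assumes p: "1 \<le> p" "p < top" and r: "1 \<le> r" "r < top" and q: "0 < q" "q < top"
  shows "\<exists>C>0. \<forall>(F :: real \<times> 'a::euclidean_space \<Rightarrow> ennreal) D u M.
    bm F \<longrightarrow>
    tested p q r D F \<longrightarrow>
    (\<forall>k. cell_inv (cube k) (u k)) \<longrightarrow>
    (NN x. (\<Sum>k\<in>ks M. u k x * wcoeff (conj_exponent r) F k x)) \<le>
    ennreal C * D * epow (NN x. epow (seqn q M u x) (enn2real p)) (1 / enn2real p)"
proof -
  define r' where "r' = conj_exponent r"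
  have r': "1 \<le> r'" unfolding r'_def
    by (rule conj_exponent_ge_1[OF less_le_trans[OF zero_less_one r(1)] r(2)])
  define P where "P = enn2real p"
  obtain C where C: "C > 0" "\<And>(F :: real \<times> 'a \<Rightarrow> ennreal) D u M.
    bm F \<Longrightarrow> (\<forall>k x. wcoeff r' F k x < top) \<Longrightarrow>
    tested p q r D F \<Longrightarrow>
    (\<forall>k. cell_inv (cube k) (u k)) \<Longrightarrow>
    (NN x. (\<Sum>k\<in>ks M. u k x * wcoeff r' F k x)) \<le>
    ennreal C * D * epow (NN x. epow (seqn q M u x) P) (1 / P)"
    using test_sequences_finite[OF p r q, where 'a='a] unfolding P_def r'_def by blast
  have claim: "(NN x. (\<Sum>k\<in>ks M. u k x * wcoeff r' F k x)) \<le>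
    ennreal C * D * epow (NN x. epow (seqn q M u x) P) (1 / P)"
    if F [measurable]: "bm F"
      and D: "tested p q r D F"
      and u: "\<forall>k. cell_inv (cube k) (u k)"
    for F :: "real \<times> 'a \<Rightarrow> ennreal" and D u M
  proof -
    have [measurable]: "bm (u k)" for k using u by (auto intro: cells.cell_inv_borel_measurable[OF cells_cube])
    define Fj where "Fj j z = min (F z) (of_nat j)" for j :: nat and z
    have Fj [measurable]: "bm (Fj j)" for j unfolding Fj_def by measurable
    have inc: "incseq Fj" unfolding Fj_def incseq_def le_fun_def by (auto simp: min.coboundedI2 intro: min.mono)
    have SUP: "(SUP j. Fj j z) = F z" for z
    proof -
      have "(SUP j. Fj j z) = inf (F z) (SUP j::nat. of_nat j)"
        unfolding Fj_def inf_min[symmetric] by (rule inf_SUP[symmetric])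
      then show ?thesis by (simp add: ennreal_SUP_of_nat_eq_top)
    qed
    have w_SUP: "wcoeff r' F k x = (SUP j. wcoeff r' (Fj j) k x)" for k x
      unfolding wcoeff_def SUP[symmetric, abs_def] by (rule locnorm_SUP[OF _ _ r' inc]) measurable
    have w_mono: "wcoeff r' (Fj i) k x \<le> wcoeff r' (Fj j) k x" if "i \<le> j" for i j k x
      unfolding wcoeff_def using incseqD[OF inc that] by (intro locnorm_mono) (auto simp: le_fun_def)
    have fin: "wcoeff r' (Fj j) k x < top" for j k x
    proof -
      have "wcoeff r' (Fj j) k x \<le> of_nat j * 1"
      proof (cases "r' = \<infinity>")
        case True
        have "locnorm \<infinity> (wbox k x) (Fj j) \<le> of_nat j" by (rule locnorm_top_le) (simp add: Fj_def)
        then show ?thesis unfolding wcoeff_def True by simp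
      next
        case False
        define R where "R = enn2real r'"
        have R: "1 \<le> R" unfolding R_def using r' False by (intro enn2real_ge_1) (auto simp: less_top)
        have "epow (wcoeff r' (Fj j) k x) R = mean k (\<lambda>z. epow (Fj j z) R) x"
          unfolding R_def using r' False by (intro mean_epow_eq_wcoeff[symmetric]) (auto simp: less_top)
        also have "\<dots> \<le> (NN z. epow (of_nat j) R * indicator (wbox k x) z) / emeasure lborel (wbox k x)"
          unfolding mean_def using R
          by (intro divide_right_mono_ennreal nn_integral_mono mult_right_mono epow_mono) (auto simp: Fj_def)
        also have "\<dots> = epow (of_nat j) R" using slab_len_bounds(3)[of k]
          by (simp add: nn_integral_cmult_indicator emeasure_wbox mult_divide_eq_ennreal ennreal_eq_0_iff not_le)
        finally show ?thesis using R by (simp add: epow_le_iff)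
      qed
      also have "\<dots> < top" by (simp add: ennreal_of_nat_eq_real_of_nat)
      finally show ?thesis .
    qed
    have "(NN x. (\<Sum>k\<in>ks M. u k x * wcoeff r' F k x)) =
      (NN x. (SUP j. \<Sum>k\<in>ks M. u k x * wcoeff r' (Fj j) k x))"
    proof (intro nn_integral_cong)
      fix x
      have "(\<Sum>k\<in>ks M. u k x * wcoeff r' F k x) = (\<Sum>k\<in>ks M. SUP j. u k x * wcoeff r' (Fj j) k x)"
        by (simp add: w_SUP SUP_mult_left_ennreal)
      also have "\<dots> = (SUP j. \<Sum>k\<in>ks M. u k x * wcoeff r' (Fj j) k x)"
        by (intro ennreal_SUP_sum[symmetric]) (auto simp: incseq_def intro!: mult_left_mono w_mono)
      finally show "(\<Sum>k\<in>ks M. u k x * wcoeff r' F k x) = \<dots>" .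
    qed
    also have "\<dots> = (SUP j. (NN x. (\<Sum>k\<in>ks M. u k x * wcoeff r' (Fj j) k x)))"
      by (intro nn_integral_monotone_convergence_SUP)
        (auto simp: incseq_def le_fun_def intro!: sum_mono mult_left_mono w_mono)
    also have "\<dots> \<le> ennreal C * D * epow (NN x. epow (seqn q M u x) P) (1 / P)"
    proof (intro SUP_least C(2)[OF Fj _ _ u] ballI)
      fix j and G :: "real \<times> 'a \<Rightarrow> ennreal" assume G: "bm G"
      have "hs_int (\<lambda>z. Fj j z * G z) \<le> hs_int (\<lambda>z. F z * G z)"
        unfolding hs_int_def by (intro nn_integral_mono mult_right_mono) (auto simp: Fj_def)
      also have "\<dots> \<le> D * tent p q (wt r G)" using D G by blast
      finally show "hs_int (\<lambda>z. Fj j z * G z) \<le> D * tent p q (wt r G)" .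
    qed (use fin in blast)
    finally show ?thesis .
  qed
  show ?thesis unfolding P_def[symmetric] r'_def[symmetric]
    by (intro exI[of _ C] conjI allI impI C(1)) (rule claim)
qed

section \<open>Extremal sequences\<close>

text \<open>A real-valued copy of the sequence norm, indexed from coarse to fine, because the
  multipliers below involve logarithms and possibly negative powers. Inserting 0 gives the maximum
  of no terms its value.\<close>

definition seq_norm :: "ennreal \<Rightarrow> nat \<Rightarrow> (nat \<Rightarrow> real) \<Rightarrow> real"
  where "seq_norm q n \<omega> = (if q = \<infinity> then Max (insert 0 (\<omega> ` {..<n}))
    else (\<Sum>i<n. \<omega> i powr enn2real q) powr (1 / enn2real q))"

lemma seq_norm_nonneg: "0 \<le> seq_norm q n \<omega>" unfolding seq_norm_def by (auto intro!: Max_ge)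

lemma seqn_eq_seq_norm:
  assumes w: "\<And>i. i < 2 * M + 1 \<Longrightarrow> v (int M - int i) x = ennreal (\<omega> i)" "\<And>i. 0 \<le> \<omega> i"
  shows "seqn q M v x = ennreal (seq_norm q (2 * M + 1) \<omega>)"
proof (cases "q = \<infinity>")
  case True
  have "seqn q M v x = (SUP i\<in>{..<2 * M + 1}. ennreal (\<omega> i))"
    unfolding seqn_def SUP_scales using True w(1) by (auto intro!: SUP_cong)
  also have "\<dots> = ennreal (Max (insert 0 (\<omega> ` {..<2 * M + 1})))"
  proof (rule antisym)
    show "(SUP i\<in>{..<2 * M + 1}. ennreal (\<omega> i)) \<le> ennreal (Max (insert 0 (\<omega> ` {..<2 * M + 1})))"
      by (intro SUP_least ennreal_leI Max_ge) auto
    have "Max (insert 0 (\<omega> ` {..<2 * M + 1})) \<in> insert 0 (\<omega> ` {..<2 * M + 1})"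
      by (intro Max_in) auto
    then show "ennreal (Max (insert 0 (\<omega> ` {..<2 * M + 1}))) \<le> (SUP i\<in>{..<2 * M + 1}. ennreal (\<omega> i))"
      by (auto intro: SUP_upper)
  qed
  finally show ?thesis using True by (simp add: seq_norm_def)
next
  case False
  define s where "s = (\<Sum>i<2 * M + 1. \<omega> i powr enn2real q)"
  have s: "0 \<le> s" unfolding s_def by (intro sum_nonneg) simp
  have "(\<Sum>k\<in>ks M. epow (v k x) (enn2real q)) = (\<Sum>i<2 * M + 1. ennreal (\<omega> i powr enn2real q))"
    unfolding sum_scales using w by (intro sum.cong) (auto simp: epow_ennreal)
  also have "\<dots> = ennreal s" unfolding s_def by (rule sum_ennreal) simp
  finally have "seqn q M v x = epow (ennreal s) (1 / enn2real q)" using False by (simp only: seqn_def if_False)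
  moreover have "seq_norm q (2 * M + 1) \<omega> = s powr (1 / enn2real q)"
    using False by (simp only: seq_norm_def s_def if_False)
  ultimately show ?thesis using s by (simp only: epow_ennreal)
qed

text \<open>For positive \<open>a\<close> this is the largest power of two not above it. A
  nondecreasing sequence rounded in this way at least doubles whenever it jumps, so that positive
  powers of its values at jumps sum geometrically.\<close>

definition round2 :: "real \<Rightarrow> real"
  where "round2 a = (if a \<le> 0 then 0 else 2 powr \<lfloor>log 2 a\<rfloor>)"

lemma round2_nonneg: "0 \<le> round2 a" by (simp add: round2_def)

lemma round2_le: "0 \<le> a \<Longrightarrow> round2 a \<le> a"
proof -
  assume "0 \<le> a"
  have "2 powr \<lfloor>log 2 a\<rfloor> \<le> 2 powr log 2 a" by (intro powr_mono) auto
  then have "0 < a \<Longrightarrow> 2 powr \<lfloor>log 2 a\<rfloor> \<le> a" by simp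
  then show ?thesis using \<open>0 \<le> a\<close> by (auto simp: round2_def)
qed

lemma le_round2: "a \<le> 2 * round2 a"
proof (cases "a \<le> 0")
  case False
  have "2 powr log 2 a \<le> 2 powr (\<lfloor>log 2 a\<rfloor> + 1)" by (intro powr_mono) linarith+
  then show ?thesis using False by (simp add: round2_def powr_add)
qed (simp add: round2_def)

lemma round2_mono: "a \<le> b \<Longrightarrow> round2 a \<le> round2 b"
  unfolding round2_def by (auto intro!: floor_mono)

lemma round2_jump: "round2 a < round2 b \<Longrightarrow> 2 * round2 a \<le> round2 b"
proof (cases "a \<le> 0 \<or> b \<le> 0")
  case False
  assume "round2 a < round2 b"
  then have "\<lfloor>log 2 a\<rfloor> + 1 \<le> \<lfloor>log 2 b\<rfloor>" using False by (simp add: round2_def)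
  then have "2 powr (\<lfloor>log 2 a\<rfloor> + 1) \<le> 2 powr \<lfloor>log 2 b\<rfloor>" by (intro powr_mono) linarith+
  then show ?thesis using False by (simp add: round2_def powr_add)
qed (auto simp: round2_def)

text \<open>
  The extremal sequences of the converse Hoelder inequality. The multiplier at index \<open>i\<close> may only
  depend on the entries up to \<open>i\<close>, so that it stays constant on cubes; hence the norm of the whole
  sequence is replaced by that of the initial segment.
\<close>

definition extremal :: "ennreal \<Rightarrow> real \<Rightarrow> real \<Rightarrow> real \<Rightarrow> real \<Rightarrow> ((nat \<Rightarrow> real) \<Rightarrow> nat \<Rightarrow> real) \<Rightarrow> bool"
  where "extremal q P P' c1 c2 U \<longleftrightarrow> 0 < c1 \<and> 0 < c2 \<and>
    (\<forall>\<omega> i. 0 \<le> U \<omega> i) \<and> (\<forall>\<omega> \<omega>' i. (\<forall>j\<le>i. \<omega> j = \<omega>' j) \<longrightarrow> U \<omega> i = U \<omega>' i) \<and>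
    (\<forall>\<omega> n. (\<forall>i. 0 \<le> \<omega> i) \<longrightarrow>
      c1 * seq_norm (conj_exponent q) n \<omega> powr P' \<le> (\<Sum>i<n. \<omega> i * U \<omega> i) \<and>
      (\<Sum>i<n. U \<omega> i powr enn2real q) powr (P / enn2real q) \<le> c2 * seq_norm (conj_exponent q) n \<omega> powr P')"

text \<open>For q \<le> 1 the multiplier lives on the indices where the running maximum, rounded to
  powers of two, jumps, and is the power P' - 1 of the new rounded maximum. The last jump alone
  gives the lower bound, while the sum of q-th powers is geometric and comparable with its last
  term. For q > 1 it is the usual extremiser, the power Q' - 1 of the entry times a power of the
  norm, with the norm of the initial segment; \<open>sum_powr_partial_sums\<close> compares the
  sums.\<close>

lemma extremal_sequence:
  fixes q :: ennreal and P P' :: real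
  assumes P: "1 < P" "1 < P'" "1 / P' + 1 / P = 1" and q: "0 < q" "q < top"
  shows "\<exists>c1 c2 U. extremal q P P' c1 c2 U"
proof (cases "q \<le> 1")
  case True
  then have q': "conj_exponent q = \<infinity>" by (simp add: conj_exponent_def)
  define Q where "Q = enn2real q"
  have Q: "0 < Q" unfolding Q_def using q by (rule enn2real_pos)
  define A where "A \<omega> n = seq_norm \<infinity> n \<omega>" for \<omega> n
  have A0: "A \<omega> 0 = 0" for \<omega> by (simp add: A_def seq_norm_def)
  have A_Suc: "A \<omega> (Suc n) = max (A \<omega> n) (\<omega> n)" for \<omega> n
    by (simp add: A_def seq_norm_def lessThan_Suc insert_commute[of 0] max.commute)
  have A_nonneg: "0 \<le> A \<omega> n" for \<omega> n unfolding A_def by (rule seq_norm_nonneg)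
  define \<eta> where "\<eta> = P' - 1"
  have \<eta>: "0 < \<eta>" using P by (simp add: \<eta>_def)
  define U where "U \<omega> i = (if round2 (A \<omega> i) < round2 (A \<omega> (Suc i)) then round2 (A \<omega> (Suc i)) powr \<eta> else 0)" for \<omega> i
  define t where "t = 2 powr (- (\<eta> * Q))"
  have "2 powr (- (\<eta> * Q)) < 2 powr 0" using \<eta> Q by (subst powr_less_cancel_iff) auto
  then have t: "0 < t" "t < 1" by (simp_all add: t_def)
  \<comment> \<open>The sum of the geometric series of ratio t, where t is what halving the maximum
    gains; the induction uses it in the form \<open>c * t + 1 = c\<close>.\<close>
  define c where "c = 1 / (1 - t)"
  have c: "0 < c" "c * t + 1 = c" using t by (simp_all add: c_def field_simps)
  have up: "(\<Sum>i<n. U \<omega> i powr Q) \<le> c * round2 (A \<omega> n) powr (\<eta> * Q)" for \<omega> n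
  proof (induction n)
    case (Suc n)
    show ?case
    proof (cases "round2 (A \<omega> n) < round2 (A \<omega> (Suc n))")
      case True
      have "round2 (A \<omega> n) powr (\<eta> * Q) \<le> (round2 (A \<omega> (Suc n)) / 2) powr (\<eta> * Q)"
        using round2_jump[OF True] round2_nonneg \<eta> Q by (intro powr_mono2) auto
      also have "\<dots> = t * round2 (A \<omega> (Suc n)) powr (\<eta> * Q)"
        using round2_nonneg by (simp add: powr_divide t_def powr_minus_divide)
      finally have "c * round2 (A \<omega> n) powr (\<eta> * Q) \<le> c * (t * round2 (A \<omega> (Suc n)) powr (\<eta> * Q))"
        using c(1) by (intro mult_left_mono) auto
      then have "(\<Sum>i<Suc n. U \<omega> i powr Q) \<le> c * (t * round2 (A \<omega> (Suc n)) powr (\<eta> * Q)) + round2 (A \<omega> (Suc n)) powr (\<eta> * Q)"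
        using Suc True by (simp add: U_def powr_powr)
      also have "\<dots> = (c * t + 1) * round2 (A \<omega> (Suc n)) powr (\<eta> * Q)" by (simp add: algebra_simps)
      finally show ?thesis unfolding c(2) .
    next
      case False
      moreover have "round2 (A \<omega> n) \<le> round2 (A \<omega> (Suc n))" by (intro round2_mono) (simp add: A_Suc)
      ultimately show ?thesis using Suc by (simp add: U_def)
    qed
  qed (use c(1) in \<open>simp add: A0 less_imp_le\<close>)
  have low: "round2 (A \<omega> n) powr P' \<le> (\<Sum>i<n. \<omega> i * U \<omega> i)" if \<omega>: "\<forall>i. 0 \<le> \<omega> i" for \<omega> n
  proof (induction n)
    case (Suc n)
    show ?case
    proof (cases "round2 (A \<omega> n) < round2 (A \<omega> (Suc n))")
      case True
      then have "A \<omega> (Suc n) = \<omega> n" by (auto simp: A_Suc max_def split: if_splits)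
      then have "round2 (A \<omega> (Suc n)) \<le> \<omega> n" using round2_le[OF A_nonneg, of \<omega> "Suc n"] by simp
      then have "round2 (A \<omega> (Suc n)) * round2 (A \<omega> (Suc n)) powr \<eta> \<le> \<omega> n * U \<omega> n"
        using True by (simp add: U_def mult_right_mono)
      moreover have "round2 (A \<omega> (Suc n)) * round2 (A \<omega> (Suc n)) powr \<eta> = round2 (A \<omega> (Suc n)) powr P'"
        using True round2_nonneg[of "A \<omega> n"] by (simp add: \<eta>_def powr_mult_base)
      moreover have "0 \<le> (\<Sum>i<n. \<omega> i * U \<omega> i)" using \<omega> by (intro sum_nonneg) (auto simp: U_def)
      ultimately show ?thesis by simp
    next
      case False
      moreover have "round2 (A \<omega> n) \<le> round2 (A \<omega> (Suc n))" by (intro round2_mono) (simp add: A_Suc)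
      ultimately show ?thesis using Suc by (simp add: U_def)
    qed
  qed (simp add: A0 round2_def)
  have eP: "\<eta> * P = P'" using P by (simp add: \<eta>_def field_simps)
  show ?thesis unfolding extremal_def
  proof (rule exI[of _ "(1 / 2) powr P'"], rule exI[of _ "c powr (P / Q)"], rule exI[of _ U], intro conjI allI impI)
    show "0 < (1 / 2) powr P'" "0 < c powr (P / Q)" using c by simp_all
    show "0 \<le> U \<omega> i" for \<omega> i by (simp add: U_def)
    show "U \<omega> i = U \<omega>' i" if "\<forall>j\<le>i. \<omega> j = \<omega>' j" for \<omega> \<omega>' i
    proof -
      have "\<omega> ` {..<n} = \<omega>' ` {..<n}" if "n \<le> Suc i" for n
        using that \<open>\<forall>j\<le>i. \<omega> j = \<omega>' j\<close> by (intro image_cong) auto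
      then have "A \<omega> n = A \<omega>' n" if "n \<le> Suc i" for n using that by (simp add: A_def seq_norm_def)
      then show ?thesis by (simp add: U_def)
    qed
    fix \<omega> :: "nat \<Rightarrow> real" and n assume \<omega>: "\<forall>i. 0 \<le> \<omega> i"
    have "(1 / 2) powr P' * A \<omega> n powr P' = (A \<omega> n / 2) powr P'"
      using A_nonneg by (simp add: powr_divide)
    also have "\<dots> \<le> round2 (A \<omega> n) powr P'"
      using le_round2[of "A \<omega> n"] A_nonneg[of \<omega> n] P by (intro powr_mono2) auto
    also note low[OF \<omega>]
    finally show "(1 / 2) powr P' * seq_norm (conj_exponent q) n \<omega> powr P' \<le> (\<Sum>i<n. \<omega> i * U \<omega> i)"
      unfolding q' A_def .
    have "(\<Sum>i<n. U \<omega> i powr Q) powr (P / Q) \<le> (c * round2 (A \<omega> n) powr (\<eta> * Q)) powr (P / Q)"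
      using P Q by (intro powr_mono2 up) (auto intro!: sum_nonneg)
    also have "\<dots> = c powr (P / Q) * round2 (A \<omega> n) powr P'"
      using c Q by (simp add: powr_mult powr_powr eP)
    also have "\<dots> \<le> c powr (P / Q) * A \<omega> n powr P'"
      using P by (intro mult_left_mono powr_mono2 round2_le A_nonneg round2_nonneg) auto
    finally show "(\<Sum>i<n. U \<omega> i powr enn2real q) powr (P / enn2real q) \<le> c powr (P / Q) * seq_norm (conj_exponent q) n \<omega> powr P'"
      unfolding q' A_def Q_def .
  qed
next
  case False
  then have q1: "1 < q" by simp
  note c = conj_exponent_real[OF q1 q(2)]
  define Q where "Q = enn2real q"
  define Q' where "Q' = Q / (Q - 1)"
  have Q: "1 < Q" "1 < Q'" "1 / Q' + 1 / Q = 1" using c by (auto simp: Q_def Q'_def)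
  have q': "conj_exponent q = ennreal Q'" using c by (simp add: Q'_def Q_def)
  have QQ: "(Q' - 1) * Q = Q'" using Q(1) by (simp add: Q'_def field_simps)
  define \<theta> where "\<theta> = P' / Q'"
  have \<theta>: "0 < \<theta>" using P Q by (simp add: \<theta>_def)
  \<comment> \<open>Chosen so that the Q-th power of \<open>U\<close> is the entry to the power Q'
    times the power \<theta>' - 1 of its partial sum. That \<theta>' is positive rests on P' >
    1.\<close>
  define \<theta>' where "\<theta>' = 1 + (\<theta> - 1) * Q"
  have \<theta>'_eq: "\<theta>' = (Q - 1) * (P' - 1)"
    using Q(1) by (simp add: \<theta>'_def \<theta>_def Q'_def field_simps)
  have \<theta>': "0 < \<theta>'" unfolding \<theta>'_eq using P Q by simp
  have \<theta>'P: "\<theta>' * (P / Q) = \<theta>"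
  proof -
    have "(P' - 1) * P = P'" using P by (simp add: field_simps)
    then have "\<theta>' * P = (Q - 1) * P'" by (simp add: \<theta>'_eq mult.assoc)
    then show ?thesis using Q(1) by (simp add: \<theta>_def Q'_def field_simps)
  qed
  define U where "U \<omega> i = \<omega> i powr (Q' - 1) * (\<Sum>j\<le>i. \<omega> j powr Q') powr (\<theta> - 1)" for \<omega> :: "nat \<Rightarrow> real" and i
  have nrm: "seq_norm (conj_exponent q) n \<omega> powr P' = (\<Sum>i<n. \<omega> i powr Q') powr \<theta>" for n \<omega>
    using Q by (simp add: seq_norm_def q' powr_powr \<theta>_def)
  show ?thesis unfolding extremal_def
  proof (rule exI[of _ "1 / max 1 \<theta>"], rule exI[of _ "(1 / min 1 \<theta>') powr (P / Q)"], rule exI[of _ U], intro conjI allI impI)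
    show "0 < 1 / max 1 \<theta>" "0 < (1 / min 1 \<theta>') powr (P / Q)" using \<theta>' by (auto simp: min_def)
    show "0 \<le> U \<omega> i" for \<omega> i by (simp add: U_def)
    show "U \<omega> i = U \<omega>' i" if "\<forall>j\<le>i. \<omega> j = \<omega>' j" for \<omega> \<omega>' i
      using that by (simp add: U_def)
    fix \<omega> :: "nat \<Rightarrow> real" and n assume \<omega>: "\<forall>i. 0 \<le> \<omega> i"
    have "\<omega> i * U \<omega> i = \<omega> i powr Q' * (\<Sum>j\<le>i. \<omega> j powr Q') powr (\<theta> - 1)" for i
    proof (cases "\<omega> i = 0")
      case False
      then have "\<omega> i * \<omega> i powr (Q' - 1) = \<omega> i powr Q'" using \<omega>[rule_format, of i] by (simp add: powr_mult_base)
      then show ?thesis by (simp add: U_def mult.assoc[symmetric])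
    qed (simp add: U_def)
    then show "1 / max 1 \<theta> * seq_norm (conj_exponent q) n \<omega> powr P' \<le> (\<Sum>i<n. \<omega> i * U \<omega> i)"
      using sum_powr_partial_sums(1)[of n "\<lambda>i. \<omega> i powr Q'" \<theta>] \<theta> unfolding nrm by (simp add: field_simps)
    have "U \<omega> i powr Q = \<omega> i powr Q' * (\<Sum>j\<le>i. \<omega> j powr Q') powr (\<theta>' - 1)" for i
      by (simp add: U_def powr_mult powr_powr QQ \<theta>'_def sum_nonneg)
    then have "(\<Sum>i<n. U \<omega> i powr Q) \<le> 1 / min 1 \<theta>' * (\<Sum>i<n. \<omega> i powr Q') powr \<theta>'"
      using sum_powr_partial_sums(2)[of n "\<lambda>i. \<omega> i powr Q'" \<theta>'] \<theta>' by (simp add: field_simps min_def)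
    then have "(\<Sum>i<n. U \<omega> i powr Q) powr (P / Q) \<le> (1 / min 1 \<theta>' * (\<Sum>i<n. \<omega> i powr Q') powr \<theta>') powr (P / Q)"
      using P Q by (intro powr_mono2) (auto intro!: sum_nonneg)
    also have "\<dots> = (1 / min 1 \<theta>') powr (P / Q) * (\<Sum>i<n. \<omega> i powr Q') powr \<theta>"
      using \<theta>' by (subst powr_mult) (use \<theta>'P in \<open>auto simp: powr_powr min_def\<close>)
    finally show "(\<Sum>i<n. U \<omega> i powr enn2real q) powr (P / enn2real q) \<le> (1 / min 1 \<theta>') powr (P / Q) * seq_norm (conj_exponent q) n \<omega> powr P'"
      unfolding nrm Q_def .
  qed
qed

lemma le_powr_cancel:
  fixes i c :: real
  assumes i: "0 \<le> i" "i \<le> c * i powr (1 / P)" and c: "0 \<le> c" and P: "1 < P" "1 < P'" "1 / P' + 1 / P = 1"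
  shows "i \<le> c powr P'"
proof (cases "i = 0")
  case False
  then have ip: "0 < i" using i by simp
  have "i = i powr (1 / P') * i powr (1 / P)" using P(3) ip by (simp add: powr_add[symmetric])
  then have "i powr (1 / P') * i powr (1 / P) \<le> c * i powr (1 / P)" using i(2) by simp
  then have "i powr (1 / P') \<le> c" using ip by simp
  then have "(i powr (1 / P')) powr P' \<le> c powr P'" using P by (intro powr_mono2) auto
  then show ?thesis using P ip by (simp add: powr_powr)
qed simp

section \<open>Coefficients satisfying the sequence form of the dual estimate\<close>

locale tested_sequence =
  fixes w :: "int \<Rightarrow> 'a::euclidean_space \<Rightarrow> ennreal" and p q :: ennreal and D :: real
  assumes w_inv: "cell_inv (cube k) (w k)"
    and p: "1 \<le> p" "p < top" and q: "0 < q" "q < top" and D: "0 \<le> D"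
    and test: "(\<And>k. cell_inv (cube k) (u k)) \<Longrightarrow>
      (NN x. (\<Sum>k\<in>ks M. u k x * w k x)) \<le>
      ennreal D * epow (NN x. epow (seqn q M u x) (enn2real p)) (1 / enn2real p)"
begin

abbreviation "P \<equiv> enn2real p"

lemma w_measurable [measurable]: "bm (w k)" by (rule cells.cell_inv_borel_measurable[OF cells_cube w_inv])

text \<open>Testing with the indicator of a single cube of volume v bounds \<open>w k x * v\<close>
  by \<open>D * v powr (1 / P)\<close>. For P > 1 this depends on the scale and serves only to make
  absorbed quantities finite; for P = 1 it is uniform, and with q \<le> 1 it is already the bound
  sought.\<close>

lemma w_le: "w k x \<le> ennreal (D * cube_vol TYPE('a) k powr (1 / P - 1))"
proof -
  interpret c: cells "cube k :: 'a \<Rightarrow> _" "cube_vol TYPE('a) k" by (rule cells_cube)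
  let ?v = "cube_vol TYPE('a) k"
  define e :: "'a \<Rightarrow> ennreal" where "e = indicator (cube k -` {cube k x})"
  define u where "u l = (if l = k then e else (\<lambda>_. 0))" for l
  define M where "M = nat \<bar>k\<bar>"
  have k: "k \<in> ks M" by (auto simp: M_def)
  have e_inv: "cell_inv (cube k) e" by (rule cell_invI) (simp add: e_def indicator_def)
  have u_inv: "cell_inv (cube l) (u l)" for l
  proof (cases "l = k")
    case False
    then show ?thesis by (intro cell_invI) (simp add: u_def)
  qed (simp add: u_def e_inv)
  have "(\<Sum>l\<in>ks M. u l y * w l y) = e y * w k y" for y
  proof -
    have "(\<Sum>l\<in>ks M. u l y * w l y) = (\<Sum>l\<in>ks M. if l = k then e y * w k y else 0)"
      by (intro sum.cong refl) (simp add: u_def)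
    then show ?thesis using k by simp
  qed
  moreover have "e y * w k y = w k x * e y" for y
    using cell_invD[OF w_inv, of k y x] by (auto simp: e_def indicator_def)
  ultimately have lhs: "(NN y. (\<Sum>l\<in>ks M. u l y * w l y)) = w k x * ennreal ?v"
    by (simp add: e_def nn_integral_cmult_indicator c.cell_sets c.cell_measure)
  have Q: "0 < enn2real q" using q by (rule enn2real_pos)
  have "seqn q M u y = e y" for y
  proof -
    have "(\<Sum>l\<in>ks M. epow (u l y) (enn2real q)) = (\<Sum>l\<in>ks M. if l = k then epow (e y) (enn2real q) else 0)"
      by (intro sum.cong refl) (simp add: u_def)
    then show ?thesis using k q Q by (simp add: seqn_def less_imp_neq epow_epow)
  qed
  moreover have "epow (e y) P = e y" for y by (simp add: e_def indicator_def)
  ultimately have "w k x * ennreal ?v \<le> ennreal D * epow (ennreal ?v) (1 / P)"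
    using test[OF u_inv, of M] unfolding lhs by (simp add: e_def c.cell_sets c.cell_measure)
  also have "\<dots> = ennreal (D * ?v powr (1 / P))"
    using D by (simp add: epow_ennreal less_imp_le ennreal_mult)
  finally have *: "w k x * ennreal ?v \<le> ennreal (D * ?v powr (1 / P))" .
  have "w k x = w k x * ennreal ?v / ennreal ?v"
    by (subst mult_divide_eq_ennreal) (auto simp: ennreal_eq_0_iff not_le)
  also have "\<dots> \<le> ennreal (D * ?v powr (1 / P)) / ennreal ?v" by (rule divide_right_mono_ennreal[OF *])
  also have "\<dots> = ennreal (D * ?v powr (1 / P) / ?v)" using D by (subst divide_ennreal) auto
  also have "D * ?v powr (1 / P) / ?v = D * ?v powr (1 / P - 1)" by (simp add: powr_diff less_imp_le)
  finally show ?thesis .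
qed

lemma w_finite: "w k x < top" using w_le[of k x] by (auto intro: le_less_trans)

lemma w_enn2real: "w k x = ennreal (enn2real (w k x))" using w_finite[of k x] by simp

text \<open>With the extremal multiplier of \<open>w\<close> as test sequence, both sides of the
  dual estimate become powers of one integral, and the smaller power can be absorbed once the
  integral is finite. A cutoff secures finiteness and is removed by monotone convergence.\<close>

lemma nn_integral_seqn_le:
  assumes P1: "1 < P" and P': "P' = P / (P - 1)"
    and ext: "extremal q P P' c1 c2 U"
  shows "(NN x. epow (seqn (conj_exponent q) M w x) P') \<le> ennreal ((c2 powr (1 / P) / c1 * D) powr P')"
proof -
  have c: "0 < c1" "0 < c2" and U: "\<And>\<omega> i. 0 \<le> U \<omega> i" "\<And>\<omega> \<omega>' i. (\<And>j. j \<le> i \<Longrightarrow> \<omega> j = \<omega>' j) \<Longrightarrow> U \<omega> i = U \<omega>' i"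
      "\<And>\<omega> n. (\<And>i. 0 \<le> \<omega> i) \<Longrightarrow> c1 * seq_norm (conj_exponent q) n \<omega> powr P' \<le> (\<Sum>i<n. \<omega> i * U \<omega> i)"
      "\<And>\<omega> n. (\<And>i. 0 \<le> \<omega> i) \<Longrightarrow> (\<Sum>i<n. U \<omega> i powr enn2real q) powr (P / enn2real q) \<le> c2 * seq_norm (conj_exponent q) n \<omega> powr P'"
    using ext unfolding extremal_def by blast+
  define n where "n = 2 * M + 1"
  define Q where "Q = enn2real q"
  have Q: "0 < Q" unfolding Q_def using q by (rule enn2real_pos)
  have PP: "1 < P'" "1 / P' + 1 / P = 1" using P1 by (auto simp: P' field_simps)
  \<comment> \<open>The cutoff consists of whole cubes of the coarsest generation M, so that it is
    constant on the cubes of every generation involved; a ball itself would not be.\<close>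
  define T :: "nat \<Rightarrow> 'a set" where "T \<rho> = {x. \<exists>z\<in>ball 0 (real \<rho>). cube (int M) z = cube (int M) x}" for \<rho>
  have T_inv: "cell_inv (cube (int M)) (\<lambda>x. x \<in> T \<rho>)" for \<rho>
    by (rule cell_invI) (simp add: T_def)
  have [measurable]: "Measurable.pred borel (\<lambda>x. x \<in> T \<rho>)" for \<rho>
    by (rule cells.cell_inv_measurable[OF cells_cube T_inv]) simp
  have T_borel [measurable]: "T \<rho> \<in> sets borel" for \<rho>
  proof -
    have "{x \<in> space borel. x \<in> T \<rho>} \<in> sets borel" by measurable
    then show ?thesis by simp
  qed
  have T_sub: "T \<rho> \<subseteq> ball 0 (real \<rho> + sc (int M))" for \<rho>
  proof
    fix x assume "x \<in> T \<rho>"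
    then obtain z where "z \<in> ball 0 (real \<rho>)" "cube (int M) z = cube (int M) x" by (auto simp: T_def)
    then show "x \<in> ball 0 (real \<rho> + sc (int M))"
      using cube_dist[of "int M" z x] dist_triangle[of 0 x z] by simp
  qed
  define \<omega> where "\<omega> \<rho> x i = (if x \<in> T \<rho> then enn2real (w (int M - int i) x) else 0)" for \<rho> x i
  have \<omega>0: "0 \<le> \<omega> \<rho> x i" for \<rho> x i by (simp add: \<omega>_def)
  let ?N = "\<lambda>\<rho> x. seq_norm (conj_exponent q) n (\<omega> \<rho> x)"
  have N_eq: "ennreal (?N \<rho> x) = seqn (conj_exponent q) M w x * indicator (T \<rho>) x" for \<rho> x
  proof (cases "x \<in> T \<rho>")
    case True
    then show ?thesis
      unfolding n_def using w_enn2real by (subst seqn_eq_seq_norm[where \<omega> = "\<omega> \<rho> x"]) (auto simp: \<omega>_def)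
  next
    case False
    then have "\<omega> \<rho> x = (\<lambda>_. 0)" by (auto simp: \<omega>_def)
    then show ?thesis using False by (auto simp: seq_norm_def image_constant_conv)
  qed
  have bound: "(NN x. ennreal (?N \<rho> x powr P')) \<le> ennreal ((c2 powr (1 / P) / c1 * D) powr P')" for \<rho>
  proof -
    define I where "I = (NN x. ennreal (?N \<rho> x powr P'))"
    have N_meas [measurable]: "bm (\<lambda>x. ennreal (?N \<rho> x powr P'))"
    proof -
      have "ennreal (?N \<rho> x powr P') = epow (seqn (conj_exponent q) M w x * indicator (T \<rho>) x) P'" for x
        unfolding N_eq[symmetric] by (simp add: epow_ennreal seq_norm_nonneg)
      then show ?thesis by simp
    qed
    have I_fin: "I < top"
    proof -
      define m where "m = seq_norm (conj_exponent q) n (\<lambda>i. D * cube_vol TYPE('a) (int M - int i) powr (1 / P - 1))"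
      have "?N \<rho> x \<le> m" for x
      proof -
        have le: "\<omega> \<rho> x i \<le> D * cube_vol TYPE('a) (int M - int i) powr (1 / P - 1)" for i
          using enn2real_mono[OF w_le[of "int M - int i" x]] D by (auto simp: \<omega>_def)
        show ?thesis
        proof (cases "conj_exponent q = \<infinity>")
          case True
          have "\<omega> \<rho> x i \<le> m" if "i < n" for i
            unfolding m_def seq_norm_def using True that le[of i] by (auto intro!: Max_ge order_trans[OF le] )
          then show ?thesis
            using seq_norm_nonneg[of "conj_exponent q" n] True unfolding m_def by (subst seq_norm_def) auto
        next
          case False
          then show ?thesis unfolding m_def seq_norm_def using le \<omega>0
            by (auto intro!: powr_mono2 sum_mono sum_nonneg)
        qed
      qed
      then have "I \<le> (NN x. ennreal (m powr P') * indicator (T \<rho>) x)" unfolding I_def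
      proof (intro nn_integral_mono)
        fix x assume le: "\<And>x. ?N \<rho> x \<le> m"
        show "ennreal (?N \<rho> x powr P') \<le> ennreal (m powr P') * indicator (T \<rho>) x"
        proof (cases "x \<in> T \<rho>")
          case True
          then show ?thesis using le[of x] PP by (auto intro!: ennreal_leI powr_mono2 seq_norm_nonneg)
        next
          case False
          then have "ennreal (?N \<rho> x) = 0" by (simp add: N_eq)
          then have "?N \<rho> x = 0" using seq_norm_nonneg[of "conj_exponent q" n "\<omega> \<rho> x"] by (simp add: ennreal_eq_0_iff)
          then show ?thesis by simp
        qed
      qed
      also have "\<dots> = ennreal (m powr P') * emeasure lborel (T \<rho>)"
        by (rule nn_integral_cmult_indicator) simp
      also have "\<dots> \<le> ennreal (m powr P') * emeasure lborel (ball (0 :: 'a) (real \<rho> + sc (int M)))"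
        by (intro mult_left_mono emeasure_mono T_sub) auto
      also have "\<dots> < top" by (simp add: emeasure_ball ennreal_mult[symmetric] less_imp_le)
      finally show ?thesis .
    qed
    define u where "u k x = (if k \<in> ks M then ennreal (U (\<omega> \<rho> x) (nat (int M - k))) else 0)" for k x
    have u_inv: "cell_inv (cube k) (u k)" for k
    proof (cases "k \<in> ks M")
      case True
      show ?thesis
      proof (rule cell_invI)
        fix x y :: 'a assume xy: "cube k x = cube k y"
        have "U (\<omega> \<rho> x) (nat (int M - k)) = U (\<omega> \<rho> y) (nat (int M - k))"
        proof (rule U(2))
          fix j assume "j \<le> nat (int M - k)"
          \<comment> \<open>Indices up to M - k belong to scales not smaller than k, and
            coefficients of those scales are constant on cubes of generation k. Hence the multiplier
            is an admissible test sequence.\<close>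
          then have "k \<le> int M - int j" using True by (simp add: le_nat_iff)
          then have "w (int M - int j) x = w (int M - int j) y"
            by (intro cell_invD[OF w_inv] cube_nested[OF _ xy])
          moreover have "(x \<in> T \<rho>) = (y \<in> T \<rho>)"
            by (rule cell_invD[OF T_inv]) (rule cube_nested[OF _ xy], use True in simp)
          ultimately show "\<omega> \<rho> x j = \<omega> \<rho> y j" by (simp add: \<omega>_def)
        qed
        then show "u k x = u k y" by (simp add: u_def)
      qed
    next
      case False
      then show ?thesis by (intro cell_invI) (simp only: u_def if_False)
    qed
    have u_i: "u (int M - int i) x = ennreal (U (\<omega> \<rho> x) i)" if "i < n" for i x
      using that by (simp add: u_def n_def)
    have "ennreal c1 * I = (NN x. ennreal c1 * ennreal (?N \<rho> x powr P'))"
      unfolding I_def by (rule nn_integral_cmult[symmetric]) (simp only: measurable_lborel2 N_meas)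
    also have "\<dots> \<le> (NN x. (\<Sum>k\<in>ks M. u k x * w k x))"
    proof (intro nn_integral_mono)
      fix x
      have "ennreal c1 * ennreal (?N \<rho> x powr P') = ennreal (c1 * ?N \<rho> x powr P')"
        using c by (simp add: ennreal_mult)
      also have "\<dots> \<le> ennreal (\<Sum>i<n. \<omega> \<rho> x i * U (\<omega> \<rho> x) i)"
        by (intro ennreal_leI U(3) \<omega>0)
      also have "\<dots> = (\<Sum>i<n. ennreal (\<omega> \<rho> x i * U (\<omega> \<rho> x) i))"
        using \<omega>0 U(1) by (intro sum_ennreal[symmetric]) auto
      also have "\<dots> \<le> (\<Sum>i<n. u (int M - int i) x * w (int M - int i) x)"
      proof (intro sum_mono)
        fix i assume "i \<in> {..<n}"
        then have i: "i < n" by simp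
        have "ennreal (\<omega> \<rho> x i) \<le> w (int M - int i) x"
          using w_enn2real[of "int M - int i" x] by (auto simp: \<omega>_def)
        then have "ennreal (U (\<omega> \<rho> x) i) * ennreal (\<omega> \<rho> x i) \<le> u (int M - int i) x * w (int M - int i) x"
          unfolding u_i[OF i] by (intro mult_left_mono) auto
        then show "ennreal (\<omega> \<rho> x i * U (\<omega> \<rho> x) i) \<le> u (int M - int i) x * w (int M - int i) x"
          using \<omega>0 U(1) by (simp add: ennreal_mult[symmetric] mult.commute)
      qed
      also have "\<dots> = (\<Sum>k\<in>ks M. u k x * w k x)" unfolding n_def by (rule sum_scales[symmetric])
      finally show "ennreal c1 * ennreal (?N \<rho> x powr P') \<le> \<dots>" .
    qed
    also have "\<dots> \<le> ennreal D * epow (NN x. epow (seqn q M u x) P) (1 / P)" by (rule test[OF u_inv])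
    also have "\<dots> \<le> ennreal D * epow (ennreal c2 * I) (1 / P)"
    proof (intro mult_left_mono epow_mono)
      have "(NN x. epow (seqn q M u x) P) \<le> (NN x. ennreal c2 * ennreal (?N \<rho> x powr P'))"
      proof (intro nn_integral_mono)
        fix x
        have "seqn q M u x = ennreal (seq_norm q n (U (\<omega> \<rho> x)))"
          unfolding n_def using u_i U(1) by (intro seqn_eq_seq_norm) (auto simp: n_def)
        then have "epow (seqn q M u x) P = ennreal ((\<Sum>i<n. U (\<omega> \<rho> x) i powr Q) powr (P / Q))"
          using q by (simp add: seq_norm_nonneg epow_ennreal) (simp add: seq_norm_def less_imp_neq Q_def powr_powr)
        also have "\<dots> \<le> ennreal (c2 * ?N \<rho> x powr P')"
          unfolding Q_def by (intro ennreal_leI U(4) \<omega>0)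
        finally show "epow (seqn q M u x) P \<le> ennreal c2 * ennreal (?N \<rho> x powr P')"
          using c by (simp add: ennreal_mult)
      qed
      also have "\<dots> = ennreal c2 * I"
        unfolding I_def by (rule nn_integral_cmult) (simp only: measurable_lborel2 N_meas)
      finally show "(NN x. epow (seqn q M u x) P) \<le> ennreal c2 * I" .
    qed auto
    finally have le: "ennreal c1 * I \<le> ennreal D * epow (ennreal c2 * I) (1 / P)" .
    obtain i where i: "I = ennreal i" "0 \<le> i" using I_fin by (cases I) auto
    have "c1 * i \<le> D * (c2 powr (1 / P) * i powr (1 / P))"
      using le i c D by (simp add: epow_mult epow_ennreal ennreal_mult[symmetric] powr_mult)
    then have "i \<le> (c2 powr (1 / P) / c1 * D) * i powr (1 / P)" using c by (simp add: field_simps)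
    then have "i \<le> (c2 powr (1 / P) / c1 * D) powr P'"
      using i c D P1 PP by (intro le_powr_cancel[where P = P]) auto
    then show ?thesis using i by (simp add: I_def[symmetric] ennreal_leI)
  qed
  have inc: "incseq (\<lambda>\<rho> x. epow (seqn (conj_exponent q) M w x * indicator (T \<rho>) x) P')"
    unfolding incseq_def le_fun_def using PP
    by (auto intro!: epow_mono mult_left_mono simp: indicator_def T_def)
  have "(NN x. epow (seqn (conj_exponent q) M w x) P') =
    (NN x. (SUP \<rho>. epow (seqn (conj_exponent q) M w x * indicator (T \<rho>) x) P'))"
  proof (intro nn_integral_cong antisym)
    fix x :: 'a
    obtain \<rho> :: nat where "norm x < real \<rho>" using reals_Archimedean2 by blast
    then have "x \<in> T \<rho>" by (auto simp: T_def intro!: bexI[of _ x])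
    then show "epow (seqn (conj_exponent q) M w x) P' \<le> (SUP \<rho>. epow (seqn (conj_exponent q) M w x * indicator (T \<rho>) x) P')"
      by (intro SUP_upper2[of \<rho>]) auto
    show "(SUP \<rho>. epow (seqn (conj_exponent q) M w x * indicator (T \<rho>) x) P') \<le> epow (seqn (conj_exponent q) M w x) P'"
      using PP by (intro SUP_least epow_mono) (auto simp: indicator_def)
  qed
  also have "\<dots> = (SUP \<rho>. (NN x. epow (seqn (conj_exponent q) M w x * indicator (T \<rho>) x) P'))"
    by (rule nn_integral_monotone_convergence_SUP[OF inc]) measurable
  also have "\<dots> \<le> ennreal ((c2 powr (1 / P) / c1 * D) powr P')"
    using bound by (intro SUP_least) (simp add: N_eq[symmetric] epow_ennreal seq_norm_nonneg)
  finally show ?thesis .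
qed

text \<open>For p = 1 the plain power Q' - 1 of \<open>w\<close> on the cubes meeting the ball can
  serve as test sequence, because the enlarged ball has finite volume b: Hoelder's inequality on it
  leads to \<open>I \<le> D * b powr (1 / Q') * I powr (1 / Q)\<close>, and the last factor is
  absorbed.\<close>

lemma carleson_le:
  assumes p1: "p = 1" and q1: "1 < q" and \<tau>: "0 < \<tau>" "sc K < \<tau>" "\<tau> \<le> sc (K + 1)" and R: "0 < R"
  shows "(\<Sum>k\<in>{- int M..K + 1}. (NN x. epow (w k x) (enn2real (conj_exponent q)) * indicator (ball y (R * \<tau>)) x))
    \<le> ennreal (D powr enn2real (conj_exponent q)) * ennreal (unit_ball_vol DIM('a) * (R + 2) ^ DIM('a)) * ennreal (\<tau> ^ DIM('a))"
proof -
  define Q where "Q = enn2real q"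
  define Q' where "Q' = Q / (Q - 1)"
  note c = conj_exponent_real[OF q1 q(2)]
  have Q: "1 < Q" "1 < Q'" "1 / Q' + 1 / Q = 1" using c by (auto simp: Q_def Q'_def)
  have cQ: "enn2real (conj_exponent q) = Q'" using c Q by (simp add: Q_def Q'_def)
  have QQ: "(Q' - 1) * Q = Q'" using Q(1) by (simp add: Q'_def field_simps)
  have P1: "P = 1" using p1 by simp
  define N where "N = max M (nat \<bar>K + 1\<bar>)"
  define S where "S = {- int M..K + 1}"
  have SN: "S \<subseteq> {- int N..int N}" by (auto simp: S_def N_def)
  define T where "T k = {x :: 'a. \<exists>z\<in>ball y (R * \<tau>). cube k z = cube k x}" for k
  have T_inv: "cell_inv (cube k) (indicator (T k) :: 'a \<Rightarrow> ennreal)" for k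
    by (rule cell_invI) (simp add: T_def indicator_def)
  note [measurable] = cells.cell_inv_borel_measurable[OF cells_cube T_inv]
  \<comment> \<open>Cubes meeting the smaller ball have scale at most K + 1, hence diameter at most
    \<open>sc (K + 1)\<close> \<le> 2 \<tau>; this accounts for the 2.\<close>
  define B where "B = ball y ((R + 2) * \<tau>)"
  have [measurable]: "B \<in> sets borel" by (simp add: B_def)
  have T_sub: "T k \<subseteq> B" if "k \<in> S" for k
  proof
    fix x assume "x \<in> T k"
    then obtain z where z: "z \<in> ball y (R * \<tau>)" "cube k z = cube k x" by (auto simp: T_def)
    have "sc k \<le> sc (K + 1)" using that by (intro sc_mono) (simp add: S_def)
    also have "\<dots> = sqrt 2 * sc K" by (rule sc_plus_1)
    also have "\<dots> \<le> 2 * \<tau>" using \<tau> sqrt2_bounds by (intro mult_mono) (auto simp: less_imp_le)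
    finally show "x \<in> B"
      using z(1) cube_dist[OF z(2)] dist_triangle[of y x z] by (simp add: B_def algebra_simps)
  qed
  define v where "v k x = epow (w k x) Q' * indicator (T k) x" for k x
  have [measurable]: "bm (v k)" for k unfolding v_def by measurable
  define I where "I = (NN x. (\<Sum>k\<in>S. v k x))"
  have B_eq: "emeasure lborel B = ennreal (unit_ball_vol DIM('a) * (R + 2) ^ DIM('a) * \<tau> ^ DIM('a))"
    using R \<tau> by (simp add: B_def emeasure_ball less_imp_le power_mult_distrib mult.assoc)
  define b where "b = unit_ball_vol DIM('a) * (R + 2) ^ DIM('a) * \<tau> ^ DIM('a)"
  have b: "0 \<le> b" using R \<tau> by (simp add: b_def less_imp_le)
  have I_fin: "I < top"
  proof -
    have "I \<le> (NN x. (\<Sum>k\<in>S. ennreal (D powr Q') * indicator B x))" unfolding I_def v_def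
    proof (intro nn_integral_mono sum_mono mult_mono)
      fix k x assume k: "k \<in> S"
      have "w k x \<le> ennreal D" using w_le[of k x] by (simp add: P1 less_imp_neq[OF cube_vol_pos, symmetric])
      then have "epow (w k x) Q' \<le> epow (ennreal D) Q'" using Q by (intro epow_mono) auto
      then show "epow (w k x) Q' \<le> ennreal (D powr Q')" using D by (simp add: epow_ennreal)
      show "indicator (T k) x \<le> (indicator B x :: ennreal)" using T_sub[OF k] by (auto simp: indicator_def)
    qed auto
    also have "\<dots> = (\<Sum>k\<in>S. ennreal (D powr Q') * emeasure lborel B)"
      by (subst nn_integral_sum) (auto simp: nn_integral_cmult_indicator)
    also have "\<dots> < top"
      unfolding B_eq by (simp add: ennreal_mult_less_top less_top[symmetric] of_nat_less_top ennreal_mult_eq_top_iff ennreal_of_nat_eq_real_of_nat)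
    finally show ?thesis .
  qed
  define u where "u k x = (if k \<in> S then epow (w k x) (Q' - 1) * indicator (T k) x else 0)" for k x
  have u_inv: "cell_inv (cube k) (u k)" for k
    using w_inv[of k] T_inv[of k] unfolding u_def cell_inv_def by metis
  have "I \<le> (NN x. (\<Sum>k\<in>{- int N..int N}. u k x * w k x))" unfolding I_def
  proof (intro nn_integral_mono)
    fix x
    have "v k x = u k x * w k x" if "k \<in> S" for k
      using that epow_add[of "w k x" "Q' - 1" 1] by (simp add: u_def v_def ac_simps)
    then have "(\<Sum>k\<in>S. v k x) = (\<Sum>k\<in>S. u k x * w k x)" by simp
    also have "\<dots> \<le> (\<Sum>k\<in>{- int N..int N}. u k x * w k x)" using SN by (intro sum_mono2) auto
    finally show "(\<Sum>k\<in>S. v k x) \<le> \<dots>" .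
  qed
  also have "\<dots> \<le> ennreal D * (NN x. seqn q N u x)" using test[OF u_inv, of N] by (simp add: P1)
  also have "(NN x. seqn q N u x) \<le> (NN x. indicator B x * epow (\<Sum>k\<in>S. v k x) (1 / Q))"
  proof (intro nn_integral_mono)
    fix x
    have "(\<Sum>k\<in>{- int N..int N}. epow (u k x) Q) = (\<Sum>k\<in>S. epow (u k x) Q)"
      using SN by (intro sum.mono_neutral_right) (auto simp: u_def)
    also have "\<dots> = (\<Sum>k\<in>S. v k x)"
      by (intro sum.cong refl) (auto simp: u_def v_def epow_mult epow_epow QQ indicator_def)
    finally have eq: "seqn q N u x = epow (\<Sum>k\<in>S. v k x) (1 / Q)"
      using q by (simp add: seqn_def less_imp_neq Q_def)
    show "seqn q N u x \<le> indicator B x * epow (\<Sum>k\<in>S. v k x) (1 / Q)"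
    proof (cases "x \<in> B")
      case False
      then have "v k x = 0" if "k \<in> S" for k using T_sub[OF that] by (auto simp: v_def indicator_def)
      then show ?thesis unfolding eq by simp
    qed (simp add: eq)
  qed
  also have "(NN x. indicator B x * epow (\<Sum>k\<in>S. v k x) (1 / Q)) \<le>
    epow (NN x. epow (indicator B x) Q') (1 / Q') * epow (NN x. epow (epow (\<Sum>k\<in>S. v k x) (1 / Q)) Q) (1 / Q)"
    using Q by (intro Holder_nn_integral) auto
  also have "\<dots> = epow (ennreal b) (1 / Q') * epow I (1 / Q)"
  proof -
    have "epow (indicator B x) Q' = indicator B x" for x by (simp add: indicator_def)
    then have "(NN x. epow (indicator B x) Q') = ennreal b" by (simp add: B_eq b_def)
    then show ?thesis using Q by (simp add: epow_epow I_def)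
  qed
  finally have le: "I \<le> ennreal D * (epow (ennreal b) (1 / Q') * epow I (1 / Q))"
    using mult_left_mono by fastforce
  obtain i where i: "I = ennreal i" "0 \<le> i" using I_fin by (cases I) auto
  have "i \<le> (D * b powr (1 / Q')) * i powr (1 / Q)"
    using le i b D by (simp add: epow_ennreal ennreal_mult[symmetric] mult.assoc)
  then have "i \<le> (D * b powr (1 / Q')) powr Q'" using i D Q by (intro le_powr_cancel[where P = Q]) auto
  also have "\<dots> = D powr Q' * b" using D b Q by (simp add: powr_mult powr_powr)
  finally have iD: "i \<le> D powr Q' * b" .
  have "(\<Sum>k\<in>S. (NN x. epow (w k x) Q' * indicator (ball y (R * \<tau>)) x)) \<le> (\<Sum>k\<in>S. (NN x. v k x))"
    unfolding v_def by (intro sum_mono nn_integral_mono mult_left_mono) (auto simp: indicator_def T_def)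
  also have "\<dots> = I" unfolding I_def by (rule nn_integral_sum[symmetric]) measurable
  also have "\<dots> \<le> ennreal (D powr Q' * b)" using iD i by (simp add: ennreal_leI)
  also have "\<dots> = ennreal (D powr Q') * ennreal (unit_ball_vol DIM('a) * (R + 2) ^ DIM('a)) * ennreal (\<tau> ^ DIM('a))"
    using R \<tau> by (simp add: b_def ennreal_mult less_imp_le mult.assoc)
  finally show ?thesis by (simp add: cQ S_def)
qed

end

text \<open>By \<open>test_sequences\<close> the coefficients of \<open>F\<close> satisfy the
  sequence form of the dual estimate. The cases mirror those of \<open>tent_Holder\<close>: extremal
  sequences for p > 1, single cubes for p = 1 and q \<le> 1, the Carleson estimate for p = 1 <
  q.\<close>

lemma tent_converse_Holder:
  assumes p: "1 \<le> p" "p < top" and r: "1 \<le> r" "r < top" and q: "0 < q" "q < top"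
  shows "\<exists>C>0. \<forall>(F :: real \<times> 'a::euclidean_space \<Rightarrow> ennreal) D::real. bm F \<longrightarrow> 0 \<le> D \<longrightarrow>
    tested p q r (ennreal D) F \<longrightarrow>
    tent (conj_exponent p) (conj_exponent q) (wt (conj_exponent r) F) \<le> ennreal (C * D)"
proof -
  define p' q' r' where "p' = conj_exponent p" and "q' = conj_exponent q" and "r' = conj_exponent r"
  have r': "1 \<le> r'" unfolding r'_def
    by (rule conj_exponent_ge_1[OF less_le_trans[OF zero_less_one r(1)] r(2)])
  have q': "0 < q'" unfolding q'_def using less_le_trans[OF zero_less_one conj_exponent_ge_1[OF q]] .
  define P where "P = enn2real p"
  obtain C0 where C0: "C0 > 0" "\<And>(F :: real \<times> 'a \<Rightarrow> ennreal) D u M.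
    bm F \<Longrightarrow>
    tested p q r D F \<Longrightarrow>
    (\<forall>k. cell_inv (cube k) (u k)) \<Longrightarrow>
    (NN x. (\<Sum>k\<in>ks M. u k x * wcoeff r' F k x)) \<le>
    ennreal C0 * D * epow (NN x. epow (seqn q M u x) P) (1 / P)"
    using test_sequences[OF p r q, where 'a='a] unfolding P_def r'_def by blast
  have tested: "tested_sequence (wcoeff r' F) p q (C0 * D)"
    if "bm F" "0 \<le> D" "tested p q r (ennreal D) F"
    for F :: "real \<times> 'a \<Rightarrow> ennreal" and D
  proof
    show "cell_inv (cube k) (wcoeff r' F k)" for k by (rule wcoeff_inv)
    show "0 \<le> C0 * D" using C0(1) that(2) by simp
    show "(NN x. (\<Sum>k\<in>ks M. u k x * wcoeff r' F k x)) \<le>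
      ennreal (C0 * D) * epow (NN x. epow (seqn q M u x) (enn2real p)) (1 / enn2real p)"
      if "\<And>k. cell_inv (cube k) (u k)" for u M
      using C0(2)[OF \<open>bm F\<close> \<open>tested p q r _ _\<close>, of u M] that C0(1) \<open>0 \<le> D\<close>
      by (simp add: P_def ennreal_mult)
  qed (use p q in auto)
  show ?thesis
  proof (cases "p = 1")
    case False
    then have p1: "1 < p" using p(1) by simp
    note c = conj_exponent_real[OF p1 p(2)]
    define P' where "P' = P / (P - 1)"
    have PP: "1 < P" "1 < P'" "1 / P' + 1 / P = 1" using c by (auto simp: P_def P'_def)
    have p'P: "p' = ennreal P'" using c by (simp add: p'_def P'_def P_def)
    have p': "0 < p'" "p' < top" "enn2real p' = P'" using PP p'P by auto
    obtain c1 c2 U where ext: "extremal q P P' c1 c2 U" using extremal_sequence[OF PP q] by blast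
    then have cU: "0 < c1" "0 < c2" unfolding extremal_def by blast+
    obtain C1 where C1: "C1 > 0" "\<And>(h :: real \<times> 'a \<Rightarrow> ennreal) D. bm h \<Longrightarrow>
      (\<And>M. epow (NN x. epow (seqn q' M (wcoeff r' h) x) P') (1 / P') \<le> D) \<Longrightarrow>
      tent p' q' (wt r' h) \<le> ennreal C1 * D"
      using tent_upper[OF r' q' p'(1,2), where 'a='a] unfolding p'(3) by blast
    define C where "C = C1 * (c2 powr (1 / P) / c1 * C0)"
    have C: "0 < C" using C0 C1 cU by (simp add: C_def)
    have claim: "tent p' q' (wt r' F) \<le> ennreal (C * D)" if F: "bm F" and D: "0 \<le> D"
      and G: "tested p q r (ennreal D) F"
      for F :: "real \<times> 'a \<Rightarrow> ennreal" and D
    proof -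
      interpret tested_sequence "wcoeff r' F" p q "C0 * D" by (rule tested[OF F D G])
      let ?c = "c2 powr (1 / P) / c1 * (C0 * D)"
      have c0: "0 \<le> ?c" using C0 cU D by simp
      have "tent p' q' (wt r' F) \<le> ennreal C1 * ennreal ?c"
      proof (rule C1(2)[OF F])
        fix M
        have "(NN x. epow (seqn (conj_exponent q) M (wcoeff r' F) x) P') \<le> ennreal (?c powr P')"
          unfolding P_def using PP ext by (intro nn_integral_seqn_le[where U = U]) (auto simp: P_def P'_def)
        then have "epow (NN x. epow (seqn q' M (wcoeff r' F) x) P') (1 / P') \<le> epow (ennreal (?c powr P')) (1 / P')"
          unfolding q'_def using PP by (intro epow_mono) auto
        also have "\<dots> = ennreal ?c"
        proof -
          have "epow (ennreal (e powr P')) (1 / P') = ennreal e" if "0 \<le> e" for e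
            using that PP by (simp add: epow_ennreal powr_powr)
          then show ?thesis using c0 .
        qed
        finally show "epow (NN x. epow (seqn q' M (wcoeff r' F) x) P') (1 / P') \<le> ennreal ?c" .
      qed
      also have "\<dots> = ennreal (C1 * ?c)" using C1(1) c0 by (intro ennreal_mult[symmetric]) auto
      also have "C1 * ?c = C * D" by (simp add: C_def)
      finally show ?thesis .
    qed
    show ?thesis unfolding p'_def[symmetric] q'_def[symmetric] r'_def[symmetric]
        by (intro exI[of _ C] conjI C allI impI) (rule claim)
  next
    case True
    then have p': "p' = \<infinity>" by (simp add: p'_def conj_exponent_def)
    have P1: "P = 1" using True by (simp add: P_def)
    show ?thesis
    proof (cases "q \<le> 1")
      case True
      then have q'i: "q' = \<infinity>" by (simp add: q'_def conj_exponent_def)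
      let ?u = "up_const TYPE('a) * (3 * 2 ^ DIM('a))"
      have u: "0 < ?u" by (simp add: up_const_def)
      define C where "C = ?u * C0"
      have C: "0 < C" unfolding C_def by (rule mult_pos_pos[OF u C0(1)])
      have claim: "tent p' q' (wt r' F) \<le> ennreal (C * D)" if F: "bm F" and D: "0 \<le> D"
        and G: "tested p q r (ennreal D) F"
        for F :: "real \<times> 'a \<Rightarrow> ennreal" and D
      proof -
        interpret tested_sequence "wcoeff r' F" p q "C0 * D" by (rule tested[OF F D G])
        have "tent \<infinity> \<infinity> (wt r' F) \<le> ennreal ?u * ennreal (C0 * D)"
        proof (rule tent_infinity_infinity_upper[OF F r'])
          show "wcoeff r' F k x \<le> ennreal (C0 * D)" for k x using w_le[of k x] P1 by (simp add: P_def less_imp_neq[OF cube_vol_pos, symmetric])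
        qed
        also have "\<dots> = ennreal (?u * (C0 * D))" using u C0 D by (intro ennreal_mult[symmetric]) auto
        finally show ?thesis by (simp add: p' q'i C_def mult.assoc)
      qed
      show ?thesis unfolding p'_def[symmetric] q'_def[symmetric] r'_def[symmetric]
        by (intro exI[of _ C] conjI C allI impI) (rule claim)
    next
      case False
      then have q1: "1 < q" by simp
      note c = conj_exponent_real[OF q1 q(2)]
      define Q' where "Q' = enn2real q'"
      have Q': "1 < Q'" "q' < top" using c by (auto simp: Q'_def q'_def)
      let ?R = "1 + 64 * real DIM('a)"
      define b where "b = unit_ball_vol DIM('a) * (?R + 2) ^ DIM('a)"
      have b: "0 < b" by (simp add: b_def add_pos_nonneg)
      obtain C1 where C1: "C1 > 0" "\<And>(h :: real \<times> 'a \<Rightarrow> ennreal) D. bm h \<Longrightarrow>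
        (\<forall>\<tau>>0. \<forall>y M K. sc K < \<tau> \<longrightarrow> \<tau> \<le> sc (K + 1) \<longrightarrow>
        (\<Sum>k\<in>{- int M..K + 1}. (NN x. epow (wcoeff r' h k x) Q' * indicator (ball y (?R * \<tau>)) x))
        \<le> D * ennreal (\<tau> ^ DIM('a))) \<Longrightarrow> epow (tent \<infinity> q' (wt r' h)) Q' \<le> ennreal C1 * D"
        using tent_infinity_upper[OF r' q' Q'(2), where 'a='a] unfolding Q'_def by blast
      define C where "C = (C1 * b) powr (1 / Q') * C0"
      have C: "0 < C" using C0 C1 b by (simp add: C_def)
      have claim: "tent p' q' (wt r' F) \<le> ennreal (C * D)" if F: "bm F" and D: "0 \<le> D"
        and G: "tested p q r (ennreal D) F"
        for F :: "real \<times> 'a \<Rightarrow> ennreal" and D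
      proof -
        note D0 = D
        interpret tested_sequence "wcoeff r' F" p q "C0 * D" by (rule tested[OF F D G])
        have "epow (tent \<infinity> q' (wt r' F)) Q' \<le> ennreal C1 * (ennreal ((C0 * D) powr Q') * ennreal b)"
        proof (rule C1(2)[OF F], intro allI impI)
          fix \<tau> :: real and y :: 'a and M K assume \<tau>: "0 < \<tau>" "sc K < \<tau>" "\<tau> \<le> sc (K + 1)"
          show "(\<Sum>k\<in>{- int M..K + 1}. (NN x. epow (wcoeff r' F k x) Q' * indicator (ball y (?R * \<tau>)) x))
            \<le> ennreal ((C0 * D) powr Q') * ennreal b * ennreal (\<tau> ^ DIM('a))"
            unfolding Q'_def q'_def b_def by (rule carleson_le[OF \<open>p = 1\<close> q1 \<tau>]) simp
        qed
        also have "\<dots> = ennreal (C1 * b * (C0 * D) powr Q')"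
          using C1(1) b by (simp add: ennreal_mult[symmetric] ac_simps)
        finally have "tent \<infinity> q' (wt r' F) \<le> epow (ennreal (C1 * b * (C0 * D) powr Q')) (1 / Q')"
          using Q' by (subst (asm) epow_le_swap) auto
        also have "\<dots> = ennreal (C * D)"
          using C1(1) b C0(1) D0 Q' by (simp add: epow_ennreal powr_mult powr_powr C_def mult.assoc)
        finally show ?thesis by (simp add: p')
      qed
      show ?thesis unfolding p'_def[symmetric] q'_def[symmetric] r'_def[symmetric]
        by (intro exI[of _ C] conjI C allI impI) (rule claim)
    qed
  qed
qed

section \<open>Tent norms of complex functions\<close>

lemma Lp_norm_finite: "q < top \<Longrightarrow> Lp_norm M q u = epow (\<integral>\<^sup>+x. epow (u x) (enn2real q) \<partial>M) (1 / enn2real q)"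
  by (simp add: Lp_norm_def less_imp_neq)

lemma Lp_norm_mono_AE:
  assumes "q < top" "AE x in M. u x \<le> v x"
  shows "Lp_norm M q u \<le> Lp_norm M q v"
proof -
  have "(\<integral>\<^sup>+x. epow (u x) (enn2real q) \<partial>M) \<le> (\<integral>\<^sup>+x. epow (v x) (enn2real q) \<partial>M)"
    using assms(2) by (intro nn_integral_mono_AE) (auto elim!: eventually_mono intro!: epow_mono)
  then show ?thesis unfolding Lp_norm_finite[OF assms(1)] by (rule epow_mono) simp
qed

lemma Lp_norm_cmult:
  assumes q: "0 < q" "q < top" and [measurable]: "u \<in> borel_measurable M"
  shows "Lp_norm M q (\<lambda>x. c * u x) = c * Lp_norm M q u"
  using enn2real_pos[OF q] unfolding Lp_norm_finite[OF q(2)]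
  by (simp add: epow_mult nn_integral_cmult epow_epow)

lemma Lp_norm_add_le:
  assumes q: "0 < q" "q < top" and [measurable]: "u \<in> borel_measurable M" "v \<in> borel_measurable M"
  shows "Lp_norm M q (\<lambda>x. u x + v x) \<le> ennreal (2 * 2 powr (1 / enn2real q)) * (Lp_norm M q u + Lp_norm M q v)"
proof -
  define Q where "Q = enn2real q"
  have Q: "0 < Q" unfolding Q_def by (rule enn2real_pos[OF q])
  have "(\<integral>\<^sup>+x. epow (u x + v x) Q \<partial>M) \<le> (\<integral>\<^sup>+x. ennreal (2 powr Q) * (epow (u x) Q + epow (v x) Q) \<partial>M)"
    using Q by (intro nn_integral_mono epow_add_le) auto
  also have "\<dots> = ennreal (2 powr Q) * ((\<integral>\<^sup>+x. epow (u x) Q \<partial>M) + (\<integral>\<^sup>+x. epow (v x) Q \<partial>M))"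
    by (simp add: nn_integral_cmult nn_integral_add)
  finally have "epow (\<integral>\<^sup>+x. epow (u x + v x) Q \<partial>M) (1 / Q) \<le>
    epow (ennreal (2 powr Q) * ((\<integral>\<^sup>+x. epow (u x) Q \<partial>M) + (\<integral>\<^sup>+x. epow (v x) Q \<partial>M))) (1 / Q)"
    using Q by (intro epow_mono) auto
  also have "\<dots> = 2 * epow ((\<integral>\<^sup>+x. epow (u x) Q \<partial>M) + (\<integral>\<^sup>+x. epow (v x) Q \<partial>M)) (1 / Q)"
    using Q by (simp add: epow_mult epow_ennreal powr_powr)
  also have "\<dots> \<le> 2 * (ennreal (2 powr (1 / Q)) * (epow (\<integral>\<^sup>+x. epow (u x) Q \<partial>M) (1 / Q) + epow (\<integral>\<^sup>+x. epow (v x) Q \<partial>M) (1 / Q)))"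
    using Q by (intro mult_left_mono epow_add_le) auto
  also have "\<dots> = ennreal (2 * 2 powr (1 / Q)) * (epow (\<integral>\<^sup>+x. epow (u x) Q \<partial>M) (1 / Q) + epow (\<integral>\<^sup>+x. epow (v x) Q \<partial>M) (1 / Q))"
    by (subst ennreal_mult) (auto simp: mult.assoc)
  finally show ?thesis unfolding Lp_norm_finite[OF q(2)] Q_def .
qed

lemma epow_tendsto_0:
  assumes a: "0 < a" and "(f \<longlongrightarrow> 0) F"
  shows "((\<lambda>x. epow (f x) a) \<longlongrightarrow> 0) F"
proof (rule order_tendstoI)
  fix e :: ennreal assume e: "0 < e"
  then have "0 < epow e (1 / a)" by (metis epow_eq_0_iff not_gr_zero)
  then have "eventually (\<lambda>x. f x < epow e (1 / a)) F"
    using assms(2) by (rule order_tendstoD(2)[rotated])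
  then show "eventually (\<lambda>x. epow (f x) a < e) F" by eventually_elim (metis a epow_ge_swap not_le)
qed simp

lemma Lp_norm_tendsto_0:
  assumes q: "0 < q" "q < top" and [measurable]: "\<And>j. u j \<in> borel_measurable M" "v \<in> borel_measurable M"
    and dom: "\<And>j. AE x in M. u j x \<le> v x" and lim: "AE x in M. (\<lambda>j. u j x) \<longlonglongrightarrow> 0"
    and fin: "Lp_norm M q v < top"
  shows "(\<lambda>j. Lp_norm M q (u j)) \<longlonglongrightarrow> 0"
proof -
  define Q where "Q = enn2real q"
  have Q: "0 < Q" unfolding Q_def by (rule enn2real_pos[OF q])
  have "(\<lambda>j. \<integral>\<^sup>+x. epow (u j x) Q \<partial>M) \<longlonglongrightarrow> (\<integral>\<^sup>+x. 0 \<partial>M)"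
  proof (rule nn_integral_dominated_convergence[where w = "\<lambda>x. epow (v x) Q"])
    show "AE x in M. epow (u j x) Q \<le> epow (v x) Q" for j
      using dom[of j] Q by (auto elim!: eventually_mono intro!: epow_mono)
    show "(\<integral>\<^sup>+x. epow (v x) Q \<partial>M) < \<infinity>"
      using fin unfolding Lp_norm_finite[OF q(2)] Q_def by simp
    show "AE x in M. (\<lambda>j. epow (u j x) Q) \<longlonglongrightarrow> 0"
      using lim by eventually_elim (rule epow_tendsto_0[OF Q])
  qed measurable
  then show ?thesis unfolding Lp_norm_finite[OF q(2)] Q_def[symmetric] using Q by (intro epow_tendsto_0) auto
qed

lemma Lp_norm_finite_AE:
  assumes q: "0 < q" "q < top" and [measurable]: "u \<in> borel_measurable M" and fin: "Lp_norm M q u < top"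
  shows "AE x in M. u x < top"
proof -
  have "(\<integral>\<^sup>+x. epow (u x) (enn2real q) \<partial>M) \<noteq> \<infinity>"
    using fin unfolding Lp_norm_finite[OF q(2)] by simp
  then have "AE x in M. epow (u x) (enn2real q) \<noteq> \<infinity>" by (intro nn_integral_PInf_AE) auto
  then show ?thesis by eventually_elim (simp add: less_top)
qed

text \<open>A local mean is an \<open>Lp_norm\<close> for a normalised measure, so a tent norm with
  finite exponents consists of three nested instances of \<open>Lp_norm\<close>. The linear
  structure and convergence of tent norms follow by applying the facts for \<open>Lp_norm\<close>
  three times.\<close>

lemma locnorm_eq_Lp_norm:
  assumes [measurable]: "bm h" "S \<in> sets borel" and r: "r < top"
  shows "locnorm r S h = Lp_norm (density lborel (\<lambda>z. indicator S z / emeasure lborel S)) r h"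
proof -
  have "(\<integral>\<^sup>+z. epow (h z) (enn2real r) \<partial>density lborel (\<lambda>z. indicator S z / emeasure lborel S)) =
    (NN z. indicator S z / emeasure lborel S * epow (h z) (enn2real r))"
    by (rule nn_integral_density) measurable
  also have "\<dots> = (NN z. epow (h z) (enn2real r) * indicator S z / emeasure lborel S)"
    by (intro nn_integral_cong) (simp add: divide_ennreal_def ac_simps)
  also have "\<dots> = (NN z. epow (h z) (enn2real r) * indicator S z) / emeasure lborel S"
    by (rule nn_integral_divide) measurable
  finally show ?thesis using r by (simp add: locnorm_def Lp_norm_finite less_imp_neq)
qed

lemma Lp_norm_wt_measurable:
  assumes [measurable]: "bm h" and q: "q < top"
  shows "bm (\<lambda>x. Lp_norm dt_over_t q (\<lambda>t. wt r h t x))"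
proof -
  have [measurable]: "(\<lambda>p. wt r h (fst p) (snd p)) \<in> borel_measurable (borel \<Otimes>\<^sub>M borel)"
    by (rule wt_measurable) measurable
  have "(\<integral>\<^sup>+t. epow (wt r h t x) (enn2real q) \<partial>dt_over_t) =
    (NN t. ennreal (1 / t) * epow (wt r h (fst (t, x)) (snd (t, x))) (enn2real q) * indicator {0<..} t)" for x
    using wt_section_measurable(2)[OF assms(1)] by (subst nn_integral_dt_over_t) auto
  moreover have "bm (\<lambda>x. (NN t. ennreal (1 / t) * epow (wt r h (fst (t, x)) (snd (t, x))) (enn2real q) * indicator {0<..} t))"
    by measurable
  ultimately have "bm (\<lambda>x. \<integral>\<^sup>+t. epow (wt r h t x) (enn2real q) \<partial>dt_over_t)"
    by (simp only:)
  then show ?thesis unfolding Lp_norm_finite[OF q] by (rule borel_measurable_epow)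
qed

lemma wt_measurable_dt:
  "bm h \<Longrightarrow> (\<lambda>t. wt r h t x) \<in> borel_measurable dt_over_t"
  by (intro borel_measurable_dt_over_t wt_section_measurable)

lemma AE_density_lborel:
  "bm h \<Longrightarrow> AE z in lborel. P z \<Longrightarrow> AE z in density lborel h. P z"
  by (subst AE_density) auto

lemma tent_mono_AE:
  assumes pqr: "p < top" "q < top" and "AE z in lborel. h z \<le> h' z"
  shows "tent p q (wt r h) \<le> tent p q (wt r h')"
proof -
  have "wt r h t x \<le> wt r h' t x" for t x
    unfolding wt_def using assms(3) by (intro locnorm_mono_AE) (auto elim!: eventually_mono)
  then show ?thesis unfolding tent_def using pqr by (simp add: Lp_norm_mono_AE)
qed

lemma tent_finite_eq: "p < top \<Longrightarrow> tent p q W = Lp_norm lborel p (\<lambda>x. Lp_norm dt_over_t q (\<lambda>t. W t x))"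
  by (simp add: tent_def Lp_norm_finite nn_integral_completion)

lemma tent_cmult:
  assumes p: "0 < p" "p < top" and q: "0 < q" "q < top" and r: "1 \<le> r" "r < top"
    and h: "bm h"
  shows "tent p q (wt r (\<lambda>z. c * h z)) = c * tent p q (wt r h)"
proof -
  have "wt r (\<lambda>z. c * h z) t x = c * wt r h t x" for t x
    unfolding wt_def by (rule locnorm_cmult[OF h _ r]) measurable
  then show ?thesis using p q h
    by (simp add: tent_finite_eq Lp_norm_cmult wt_measurable_dt Lp_norm_wt_measurable)
qed

text \<open>Below exponent 1 the triangle inequality holds only up to a constant at each of the
  three levels; finiteness of the sum is what makes the tent space a vector space.\<close>

lemma tent_add_finite:
  assumes p: "0 < p" "p < top" and q: "0 < q" "q < top" and r: "1 \<le> r" "r < top"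
    and h [measurable]: "bm h" "bm h'"
    and fin: "tent p q (wt r h) < top" "tent p q (wt r h') < top"
  shows "tent p q (wt r (\<lambda>z. h z + h' z)) < top"
proof -
  have r0: "0 < r" using less_le_trans[OF zero_less_one r(1)] .
  define K where "K s = ennreal (2 * 2 powr (1 / enn2real s))" for s
  have hh: "bm (\<lambda>z. h z + h' z)" by measurable
  note wm = wt_measurable_dt[OF h(1)] wt_measurable_dt[OF h(2)] wt_measurable_dt[OF hh]
  note Lm = Lp_norm_wt_measurable[OF h(1) q(2)] Lp_norm_wt_measurable[OF h(2) q(2)]
  let ?L = "\<lambda>h x. Lp_norm dt_over_t q (\<lambda>t. wt r h t x)"
  have "wt r (\<lambda>z. h z + h' z) t x \<le> K r * (wt r h t x + wt r h' t x)" for t x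
    unfolding wt_def K_def using r r0 by (simp add: locnorm_eq_Lp_norm Lp_norm_add_le)
  then have "?L (\<lambda>z. h z + h' z) x \<le> Lp_norm dt_over_t q (\<lambda>t. K r * (wt r h t x + wt r h' t x))" for x
    by (intro Lp_norm_mono_AE q) auto
  also have "\<dots> x = K r * Lp_norm dt_over_t q (\<lambda>t. wt r h t x + wt r h' t x)" for x
    using wm by (intro Lp_norm_cmult q) measurable
  also have "\<dots> x \<le> K r * (K q * (?L h x + ?L h' x))" for x
    unfolding K_def using wm by (intro mult_left_mono Lp_norm_add_le q) auto
  finally have "tent p q (wt r (\<lambda>z. h z + h' z)) \<le> Lp_norm lborel p (\<lambda>x. K r * (K q * (?L h x + ?L h' x)))"
    unfolding tent_finite_eq[OF p(2)] by (intro Lp_norm_mono_AE p) auto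
  also have "\<dots> = K r * (K q * Lp_norm lborel p (\<lambda>x. ?L h x + ?L h' x))"
    using p Lm by (simp add: Lp_norm_cmult)
  also have "\<dots> \<le> K r * (K q * (K p * (tent p q (wt r h) + tent p q (wt r h'))))"
    unfolding tent_finite_eq[OF p(2)] K_def[of p] using Lm by (intro mult_left_mono Lp_norm_add_le p) auto
  also have "\<dots> < top" using fin by (simp add: ennreal_mult_less_top K_def)
  finally show ?thesis .
qed

text \<open>Dominated convergence is passed from the Whitney averages to the integral in t and then
  to that in x; at each level finiteness of the dominating norm at almost every point of the next
  one suffices. With an exponent \<infinity> the norm would not be order continuous, and this is
  where finite p, q and r matter.\<close>

lemma tent_tendsto_0:
  fixes h :: "nat \<Rightarrow> real \<times> 'a::euclidean_space \<Rightarrow> ennreal"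
  assumes p: "0 < p" "p < top" and q: "0 < q" "q < top" and r: "1 \<le> r" "r < top"
    and h [measurable]: "\<And>j. bm (h j)" "bm H"
    and dom: "\<And>j. AE z in lborel. h j z \<le> H z" and lim: "AE z in lborel. (\<lambda>j. h j z) \<longlonglongrightarrow> 0"
    and fin: "tent p q (wt r H) < top"
  shows "(\<lambda>j. tent p q (wt r (h j))) \<longlonglongrightarrow> 0"
proof -
  have r0: "0 < r" using less_le_trans[OF zero_less_one r(1)] .
  let ?L = "\<lambda>h x. Lp_norm dt_over_t q (\<lambda>t. wt r h t x)"
  note wm = wt_measurable_dt[OF h(1)] wt_measurable_dt[OF h(2)]
  note Lm = Lp_norm_wt_measurable[OF h(1) q(2)] Lp_norm_wt_measurable[OF h(2) q(2)]
  have wt_le: "wt r (h j) t x \<le> wt r H t x" for j t x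
    unfolding wt_def using dom[of j] by (intro locnorm_mono_AE) (auto elim!: eventually_mono)
  have wt_lim: "(\<lambda>j. wt r (h j) t x) \<longlonglongrightarrow> 0" if "wt r H t x < top" for t x
    using that r unfolding wt_def by (simp add: locnorm_eq_Lp_norm)
      (intro Lp_norm_tendsto_0[OF r0, where v = H] AE_density_lborel dom lim; simp)
  have L_le: "?L (h j) x \<le> ?L H x" for j x by (intro Lp_norm_mono_AE q AE_I2 wt_le)
  have L_lim: "(\<lambda>j. ?L (h j) x) \<longlonglongrightarrow> 0" if x: "?L H x < top" for x
  proof (rule Lp_norm_tendsto_0[OF q, where v = "\<lambda>t. wt r H t x"])
    have "AE t in dt_over_t. wt r H t x < top" using wm(2) by (intro Lp_norm_finite_AE[OF q] x) auto
    then show "AE t in dt_over_t. (\<lambda>j. wt r (h j) t x) \<longlonglongrightarrow> 0"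
      by eventually_elim (rule wt_lim)
  qed (use wm wt_le x in auto)
  show ?thesis unfolding tent_finite_eq[OF p(2)]
  proof (rule Lp_norm_tendsto_0[OF p, where v = "?L H"])
    have "AE x in lborel. ?L H x < top"
      using fin Lm(2) unfolding tent_finite_eq[OF p(2)] by (intro Lp_norm_finite_AE[OF p]) auto
    then show "AE x in lborel. (\<lambda>j. ?L (h j) x) \<longlonglongrightarrow> 0"
      by eventually_elim (rule L_lim)
  qed (use Lm L_le fin in \<open>auto simp: tent_finite_eq[OF p(2)]\<close>)
qed

section \<open>Reduction of complex functions to nonnegative Borel functions\<close>

definition wabs :: "real \<Rightarrow> (real \<times> 'a::euclidean_space \<Rightarrow> complex) \<Rightarrow> real \<times> 'a \<Rightarrow> ennreal"
  where "wabs \<beta> f z = ennreal (norm (fst z powr (- \<beta>) *\<^sub>R f z))"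

lemma whitney_box_half_space: "whitney_box t x \<subseteq> half_space"
proof
  fix z assume "z \<in> whitney_box t x"
  then obtain s y where z: "z = (s, y)" "t / 2 < s" "dist x y < t" by (auto simp: whitney_box_def)
  then have "0 < t" using zero_le_dist[of x y] by linarith
  then show "z \<in> half_space" using z by (simp add: half_space_def)
qed

lemma borel_imp_half_space_measurable:
  "bm f \<Longrightarrow> f \<in> borel_measurable (lebesgue_on half_space)"
  by (intro measurable_restrict_space1 measurable_completion) simp

lemma wabs_half_space_measurable:
  assumes "half_space_measurable f"
  shows "wabs \<beta> f \<in> borel_measurable (lebesgue_on half_space)"
proof -
  have "bm (\<lambda>z :: real \<times> 'a. fst z powr (- \<beta>))"
    by (rule borel_measurable_compose_fst[where f = "\<lambda>s. s powr (- \<beta>)"]) simp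
  note [measurable] = assms borel_imp_half_space_measurable[OF this]
  show ?thesis unfolding wabs_def by measurable
qed

lemma wabs_borel_measurable:
  assumes [measurable]: "bm f"
  shows "bm (wabs \<beta> f)"
proof -
  have [measurable]: "bm (\<lambda>z :: real \<times> 'a. fst z powr (- \<beta>))"
    by (rule borel_measurable_compose_fst[where f = "\<lambda>s. s powr (- \<beta>)"]) simp
  show ?thesis unfolding wabs_def by measurable
qed

text \<open>Whitney boxes lie in the half-space, so values elsewhere do not count. Completing
  \<open>lborel\<close> changes neither the integrals nor the essential bounds, and for r =
  \<infinity> measurability identifies \<open>esssup\<close> with the least essential bound.\<close>

lemma whitney_eq_wt:
  fixes f :: "real \<times> 'a::euclidean_space \<Rightarrow> complex"
  assumes f: "half_space_measurable f" and h: "AE z\<in>half_space in lborel. wabs \<beta> f z = h z"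
  shows "whitney r \<beta> f t x = wt r h t x"
proof -
  have eq: "(\<lambda>(s, y). ennreal (norm (s powr (- \<beta>) *\<^sub>R f (s, y)))) = wabs \<beta> f"
    by (auto simp: wabs_def)
  have "whitney r \<beta> f t x = locnorm r (whitney_box t x) (wabs \<beta> f)"
  proof (cases "r = \<infinity>")
    case True
    have "wabs \<beta> f \<in> borel_measurable (lebesgue_on (whitney_box t x))"
      by (rule measurable_restrict_mono[OF wabs_half_space_measurable[OF f] whitney_box_half_space])
    then have "esssup (lebesgue_on (whitney_box t x)) (wabs \<beta> f) = Inf {m. AE z in lebesgue_on (whitney_box t x). wabs \<beta> f z \<le> m}"
      by (rule esssup_eq_AE)
    moreover have "(AE z in lebesgue_on (whitney_box t x). wabs \<beta> f z \<le> m) \<longleftrightarrow>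
      (AE z in lborel. z \<in> whitney_box t x \<longrightarrow> wabs \<beta> f z \<le> m)" for m
      by (subst AE_restrict_space_iff) (auto simp: AE_completion_iff)
    ultimately show ?thesis unfolding whitney_def Let_def eq locnorm_def using True by simp
  next
    case False
    then show ?thesis
      unfolding whitney_def Let_def eq locnorm_def by (simp add: mean_value_def nn_integral_completion)
  qed
  also have "\<dots> = locnorm r (whitney_box t x) h"
    using h whitney_box_half_space[of t x] by (intro locnorm_cong_AE) (auto elim!: eventually_mono)
  finally show ?thesis by (simp add: wt_def)
qed

lemma tent_norm_eq:
  assumes "half_space_measurable f" "AE z\<in>half_space in lborel. wabs \<beta> f z = h z"
  shows "tent_norm p q r \<beta> f = tent p q (wt r h)"
proof -
  have "whitney r \<beta> f = wt r h" using whitney_eq_wt[OF assms] by blast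
  then show ?thesis by (simp add: tent_norm_eq_tent)
qed

text \<open>Elements of the spaces are merely Lebesgue measurable, but norms and pairings see only
  classes modulo null sets of the half-space. Borel representatives give access to product
  measures.\<close>

lemma half_space_borel_version:
  fixes f :: "real \<times> 'a::euclidean_space \<Rightarrow> complex"
  assumes f: "half_space_measurable f"
  obtains f' where "bm f'" "AE z\<in>half_space in lborel. f z = f' z"
proof -
  have ex: "\<exists>u' \<in> borel_measurable borel. AE z\<in>half_space in lborel. u z = u' z"
    if "u \<in> borel_measurable (lebesgue_on half_space)" for u :: "real \<times> 'a \<Rightarrow> real"
  proof -
    have "(\<lambda>z. indicator half_space z *\<^sub>R u z) \<in> borel_measurable lebesgue"
      using that borel_measurable_restrict_space_iff[of half_space lebesgue u] by simp
    then obtain u' where "u' \<in> borel_measurable lborel" "AE z in lborel. indicator half_space z *\<^sub>R u z = u' z"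
      using completion_ex_borel_measurable_real[of "\<lambda>z. indicator half_space z *\<^sub>R u z" lborel] by blast
    then show ?thesis by (intro bexI[of _ u']) (auto elim!: eventually_mono)
  qed
  have "(\<lambda>z. Re (f z)) \<in> borel_measurable (lebesgue_on half_space)" "(\<lambda>z. Im (f z)) \<in> borel_measurable (lebesgue_on half_space)"
    using f by measurable
  then obtain u v where [measurable]: "bm u" "bm v"
    and ae: "AE z\<in>half_space in lborel. Re (f z) = u z" "AE z\<in>half_space in lborel. Im (f z) = v z"
    using ex by meson
  show thesis
  proof (rule that[of "\<lambda>z. Complex (u z) (v z)"])
    show "bm (\<lambda>z. Complex (u z) (v z))" unfolding borel_measurable_complex_iff by simp
    show "AE z\<in>half_space in lborel. f z = Complex (u z) (v z)"
      using ae by eventually_elim (auto simp: complex_eq_iff)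
  qed
qed

lemma tent_norm_cong_AE:
  assumes "half_space_measurable f" "half_space_measurable g" "AE z\<in>half_space in lborel. f z = g z"
  shows "tent_norm p q r \<beta> f = tent_norm p q r \<beta> g"
proof -
  have "AE z\<in>half_space in lborel. wabs \<beta> f z = wabs \<beta> g z"
    using assms(3) by eventually_elim (auto simp: wabs_def)
  then have "tent_norm p q r \<beta> f = tent p q (wt r (wabs \<beta> g))" by (rule tent_norm_eq[OF assms(1)])
  also have "\<dots> = tent_norm p q r \<beta> g" by (rule tent_norm_eq[OF assms(2), symmetric]) simp
  finally show ?thesis .
qed

lemma tent_norm_borel:
  "bm f \<Longrightarrow> tent_norm p q r \<beta> f = tent p q (wt r (wabs \<beta> f))"
  by (rule tent_norm_eq) (auto intro: borel_imp_half_space_measurable)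

lemma weight_half_space_measurable:
  "(\<lambda>(s, y). ennreal (1 / s)) \<in> borel_measurable (lebesgue_on (half_space :: (real \<times> 'a::euclidean_space) set))"
proof -
  have "bm (\<lambda>z :: real \<times> 'a. ennreal (1 / fst z))" by measurable
  from borel_imp_half_space_measurable[OF this] show ?thesis by (simp add: case_prod_beta')
qed

lemma measurable_dyds_iff:
  fixes f :: "real \<times> 'a::euclidean_space \<Rightarrow> 'b"
  shows "f \<in> measurable dyds_over_s N \<longleftrightarrow> f \<in> measurable (lebesgue_on half_space) N"
proof -
  have "measurable (dyds_over_s :: (real \<times> 'a) measure) N = measurable (lebesgue_on half_space) N"
    unfolding dyds_over_s_def by (rule measurable_cong_sets) simp_all
  then show ?thesis by simp
qed

lemma nn_integral_dyds:
  assumes "\<phi> \<in> borel_measurable (lebesgue_on half_space)"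
  shows "(\<integral>\<^sup>+z. \<phi> z \<partial>dyds_over_s) = hs_int \<phi>"
proof -
  have "(\<integral>\<^sup>+z. \<phi> z \<partial>dyds_over_s) = (\<integral>\<^sup>+z. (case z of (s, y) \<Rightarrow> ennreal (1 / s)) * \<phi> z \<partial>lebesgue_on half_space)"
    unfolding dyds_over_s_def by (rule nn_integral_density[OF weight_half_space_measurable assms])
  also have "\<dots> = (NN z. (case z of (s, y) \<Rightarrow> ennreal (1 / s)) * \<phi> z * indicator half_space z)"
    by (subst nn_integral_restrict_space) (auto simp: nn_integral_completion)
  also have "\<dots> = hs_int \<phi>"
    unfolding hs_int_def by (intro nn_integral_cong) (auto simp: case_prod_beta' ac_simps)
  finally show ?thesis .
qed

lemma AE_dyds_iff: "(AE z in dyds_over_s. P z) \<longleftrightarrow> (AE z\<in>half_space in lborel. P z)"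
proof -
  have "(AE z in dyds_over_s. P z) \<longleftrightarrow> (AE z in lebesgue_on half_space. 0 < (case z of (s, y) \<Rightarrow> ennreal (1 / s)) \<longrightarrow> P z)"
    unfolding dyds_over_s_def by (rule AE_density[OF weight_half_space_measurable])
  also have "\<dots> \<longleftrightarrow> (AE z\<in>half_space in lborel. 0 < (case z of (s, y) \<Rightarrow> ennreal (1 / s)) \<longrightarrow> P z)"
    by (subst AE_restrict_space_iff) (auto simp: AE_completion_iff)
  also have "\<dots> \<longleftrightarrow> (AE z\<in>half_space in lborel. P z)"
    by (intro AE_cong) (auto simp: half_space_def)
  finally show ?thesis .
qed

lemma AE_half_space_iff: "(AE z in lebesgue_on half_space. P z) \<longleftrightarrow> (AE z\<in>half_space in lborel. P z)"
  by (subst AE_restrict_space_iff) (auto simp: AE_completion_iff)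

lemma hs_int_cong_AE:
  assumes "AE z\<in>half_space in lborel. \<phi> z = \<psi> z"
  shows "hs_int \<phi> = hs_int \<psi>"
  unfolding hs_int_def using assms by (intro nn_integral_cong_AE) (auto elim!: eventually_mono simp: indicator_def)

lemma integral_dyds:
  fixes F :: "real \<times> 'a::euclidean_space \<Rightarrow> complex"
  assumes F [measurable]: "bm F"
  shows "(\<integral>z. F z \<partial>dyds_over_s) = (\<integral>z. indicator half_space z *\<^sub>R (1 / fst z) *\<^sub>R F z \<partial>lborel)"
proof -
  have inv: "bm (\<lambda>z :: real \<times> 'a. 1 / fst z)" by (rule borel_measurable_compose_fst) simp
  note [measurable] = this
  have dyds: "(dyds_over_s :: (real \<times> 'a) measure) = density (lebesgue_on half_space) (\<lambda>z. ennreal (1 / fst z))"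
    by (simp add: dyds_over_s_def case_prod_beta')
  have "(\<integral>z. F z \<partial>dyds_over_s) = (\<integral>z. (1 / fst z) *\<^sub>R F z \<partial>lebesgue_on half_space)"
    unfolding dyds by (intro integral_density borel_imp_half_space_measurable F inv AE_I2, simp add: space_restrict_space half_space_def mem_Times_iff)
  also have "\<dots> = (\<integral>z. indicator half_space z *\<^sub>R (1 / fst z) *\<^sub>R F z \<partial>lebesgue)"
    by (rule integral_restrict_space) simp
  also have "\<dots> = (\<integral>z. indicator half_space z *\<^sub>R (1 / fst z) *\<^sub>R F z \<partial>lborel)"
    by (rule integral_completion) measurable
  finally show ?thesis .
qed

section \<open>A strictly positive function of finite tent norm\<close>

lemma suminf_inverse_square_finite:
  assumes "0 \<le> c"
  shows "(\<Sum>n. ennreal (c / real (Suc n) ^ 2)) < top"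
proof -
  have "summable (\<lambda>n. c * inverse (real (Suc n) ^ 2))"
    using summable_Suc_iff[of "\<lambda>n. inverse (real n ^ 2)"] inverse_power_summable[of 2, where 'a = real]
    by (intro summable_mult) simp
  then have "summable (\<lambda>n. c / real (Suc n) ^ 2)" by (simp add: divide_inverse)
  then have "(\<Sum>n. ennreal (c / real (Suc n) ^ 2)) \<noteq> top"
    using assms by (intro ennreal_suminf_neq_top) auto
  then show ?thesis by (simp add: less_top)
qed

text \<open>On the shell between the radii n and n + 1 the integrand has order (n + 1)^(- d - 2),
  and the ball of radius n + 1 has volume of order (n + 1)^d; what remains is a sum of inverse
  squares.\<close>

lemma nn_integral_decay_finite:
  "(\<integral>\<^sup>+x. ennreal ((1 + norm x) powr - (real DIM('a) + 2)) \<partial>(lborel :: 'a::euclidean_space measure)) < top"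
proof -
  define w where "w = unit_ball_vol (real DIM('a))"
  have w: "0 < w" by (simp add: w_def)
  define c where "c n = (1 + real n) powr - (real DIM('a) + 2)" for n
  have "(\<integral>\<^sup>+x. ennreal ((1 + norm x) powr - (real DIM('a) + 2)) \<partial>(lborel :: 'a measure)) \<le>
    (\<integral>\<^sup>+x. (\<Sum>n. ennreal (c n) * indicator (ball 0 (real n + 1)) x) \<partial>(lborel :: 'a measure))"
  proof (intro nn_integral_mono)
    fix x :: 'a
    define n where "n = nat \<lfloor>norm x\<rfloor>"
    have n: "real n \<le> norm x" "norm x < real n + 1" by (simp_all add: n_def)
    have "ennreal ((1 + norm x) powr - (real DIM('a) + 2)) \<le> ennreal (c n) * indicator (ball 0 (real n + 1)) x"
      unfolding c_def using n by (auto intro!: ennreal_leI powr_mono2')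
    also have "\<dots> = (\<Sum>i\<in>{n}. ennreal (c i) * indicator (ball 0 (real i + 1)) x)"
      by (simp only: sum.insert finite.emptyI empty_iff not_False_eq_True sum.empty add_0_right)
    also have "\<dots> \<le> (\<Sum>n. ennreal (c n) * indicator (ball 0 (real n + 1)) x)"
      by (rule sum_le_suminf) auto
    finally show "ennreal ((1 + norm x) powr - (real DIM('a) + 2)) \<le> \<dots>" .
  qed
  also have "\<dots> = (\<Sum>n. \<integral>\<^sup>+x. ennreal (c n) * indicator (ball 0 (real n + 1)) x \<partial>(lborel :: 'a measure))"
    by (rule nn_integral_suminf) (auto intro!: borel_measurable_times_ennreal borel_measurable_indicator)
  also have "\<dots> = (\<Sum>n. ennreal (w / real (Suc n) ^ 2))"
  proof (rule arg_cong[where f = suminf], rule ext)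
    fix n
    have "(\<integral>\<^sup>+x. ennreal (c n) * indicator (ball 0 (real n + 1)) x \<partial>(lborel :: 'a measure)) = ennreal (c n * (w * (real n + 1) ^ DIM('a)))"
      by (subst nn_integral_cmult_indicator) (auto simp: emeasure_ball w_def ennreal_mult c_def)
    also have "c n * (w * (real n + 1) ^ DIM('a)) = w / real (Suc n) ^ 2"
    proof -
      have "(real n + 1) powr - (real DIM('a) + 2) * (real n + 1) powr real DIM('a) = (real n + 1) powr - 2"
        unfolding powr_add[symmetric] by simp
      then have "c n * (real n + 1) ^ DIM('a) = (real n + 1) powr - 2"
        by (simp add: c_def powr_realpow add.commute)
      also have "\<dots> = 1 / real (Suc n) ^ 2"
        using powr_realpow[of "real n + 1" 2] by (simp add: powr_minus_divide add.commute)
      finally show ?thesis by (simp add: mult.left_commute)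
    qed
    finally show "(\<integral>\<^sup>+x. ennreal (c n) * indicator (ball 0 (real n + 1)) x \<partial>(lborel :: 'a measure)) = ennreal (w / real (Suc n) ^ 2)" .
  qed
  also have "\<dots> < top" using w by (intro suminf_inverse_square_finite) simp
  finally show ?thesis .
qed

lemma locnorm_le_const:
  assumes [measurable]: "S \<in> sets borel" and r: "1 \<le> r" "r < top"
    and S: "emeasure lborel S = ennreal s" "0 < s" and h: "\<And>z. z \<in> S \<Longrightarrow> h z \<le> c"
  shows "locnorm r S h \<le> c"
proof -
  define R where "R = enn2real r"
  have R: "1 \<le> R" unfolding R_def using r by (rule enn2real_ge_1)
  have "locnorm r S h \<le> locnorm r S (\<lambda>_. c)" using h by (rule locnorm_mono)
  also have "\<dots> = epow (epow c R * ennreal s / ennreal s) (1 / R)"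
    using r S by (simp add: locnorm_def R_def less_imp_neq nn_integral_cmult_indicator)
  also have "\<dots> = c" using S R by (subst mult_divide_eq_ennreal) (auto simp: epow_epow ennreal_eq_0_iff not_le)
  finally show ?thesis .
qed

text \<open>The weight is a power of \<open>min s (1 / s)\<close>, decaying at both ends of the
  scale, times a negative power of \<open>1 + s + norm y\<close>, decaying in space. The summand s
  ensures \<open>1 + norm x \<le> 3 * (1 + s + norm y)\<close> on Whitney boxes at x, so that
  Whitney averages are bounded by a function of t times a function of x.\<close>

lemma positive_weight_exists:
  assumes p: "0 < p" "p < top" and q: "0 < q" "q < top" and r: "1 \<le> r" "r < top"
  shows "\<exists>\<rho> :: real \<times> 'a::euclidean_space \<Rightarrow> real. bm \<rho> \<and> (\<forall>z\<in>half_space. 0 < \<rho> z) \<and>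
    (\<forall>z. z \<notin> half_space \<longrightarrow> \<rho> z = 0) \<and> tent p q (wt r (\<lambda>z. ennreal (\<rho> z))) < top"
proof -
  define P Q where "P = enn2real p" and "Q = enn2real q"
  have PQ: "0 < P" "0 < Q" unfolding P_def Q_def using enn2real_pos p q by auto
  \<comment> \<open>Large enough for both integrals: \<open>a * Q \<ge> 2\<close> makes the one in t
    converge at 0 and at \<infinity>, and \<open>a * P\<close> \<ge> d + 2 the one in x.\<close>
  define a where "a = 2 / Q + (real DIM('a) + 2) / P"
  have a: "2 \<le> a * Q" "real DIM('a) + 2 \<le> a * P" "0 < a"
    using PQ by (auto simp: a_def field_simps add_pos_pos)
  define A :: "real \<Rightarrow> real" where "A t = min t (1 / t) powr a" for t
  define B :: "'a \<Rightarrow> real" where "B x = (1 + norm x) powr - a" for x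
  define \<rho> :: "real \<times> 'a \<Rightarrow> real" where
    "\<rho> z = indicator half_space z * (A (fst z) * (1 + fst z + norm (snd z)) powr - a)" for z
  have \<rho>_meas: "bm \<rho>"
  proof -
    have [measurable]: "bm (\<lambda>z :: real \<times> 'a. fst z)" "bm (\<lambda>z :: real \<times> 'a. norm (snd z))"
      by (intro borel_measurable_compose_fst borel_measurable_compose_snd; simp)+
    show ?thesis unfolding \<rho>_def A_def by measurable
  qed
  have A_meas [measurable]: "bm A" unfolding A_def by measurable
  have [measurable]: "bm B" unfolding B_def by measurable
  have \<rho>_le: "\<rho> z \<le> 6 powr a * B x * A t" if t: "0 < t" and z: "z \<in> whitney_box t x" for t x z
  proof -
    obtain s y where sy: "z = (s, y)" "t / 2 < s" "s \<le> t" "dist x y < t" using z by (auto simp: whitney_box_def)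
    have s: "0 < s" using t sy by linarith
    have "1 / s \<le> 2 / t" using sy s t by (simp add: field_simps)
    then have "min s (1 / s) \<le> 2 * min t (1 / t)" using sy t by (auto simp: min_def)
    then have "A s \<le> (2 * min t (1 / t)) powr a" unfolding A_def using s a by (intro powr_mono2) auto
    also have "\<dots> = 2 powr a * A t" using t by (simp add: A_def powr_mult)
    finally have 1: "A s \<le> 2 powr a * A t" .
    have "norm x \<le> norm y + dist x y" by (metis add.commute dist_norm norm_triangle_sub)
    then have "norm x \<le> norm y + 2 * s" using sy(2,4) by linarith
    moreover have "3 * (1 + s + norm y) = 3 + 3 * s + 3 * norm y" by (simp add: algebra_simps)
    ultimately have "1 + norm x \<le> 3 * (1 + s + norm y)" using norm_ge_zero[of y] s by linarith
    then have "(1 + norm x) / 3 \<le> 1 + s + norm y" by simp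
    then have "(1 + s + norm y) powr - a \<le> ((1 + norm x) / 3) powr - a"
      using a by (intro powr_mono2') (auto intro: add_pos_nonneg)
    also have "\<dots> = 3 powr a * B x" by (simp add: B_def powr_divide powr_minus_divide)
    finally have 2: "(1 + s + norm y) powr - a \<le> 3 powr a * B x" .
    have "\<rho> z = A s * (1 + s + norm y) powr - a" using sy s by (simp add: \<rho>_def half_space_def)
    also have "\<dots> \<le> (2 powr a * A t) * (3 powr a * B x)"
      using 1 2 by (intro mult_mono) (auto simp: A_def)
    also have "\<dots> = (2 * 3) powr a * B x * A t" by (simp only: powr_mult) simp
    finally show ?thesis by simp
  qed
  have wt_le: "wt r (\<lambda>z. ennreal (\<rho> z)) t x \<le> ennreal (6 powr a * B x) * ennreal (A t)" if t: "0 < t" for t x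
    unfolding wt_def
  proof (rule locnorm_le_const[OF _ r emeasure_whitney_box whitney_vol_pos[OF t]])
    fix z assume "z \<in> whitney_box t x"
    then show "ennreal (\<rho> z) \<le> ennreal (6 powr a * B x) * ennreal (A t)"
      using \<rho>_le[OF t] by (subst ennreal_mult[symmetric]) (auto intro!: ennreal_leI simp: A_def B_def)
  qed (use t in auto)
  define KA where "KA = Lp_norm dt_over_t q (\<lambda>t. ennreal (A t))"
  have KA: "KA < top"
  proof -
    have "(\<integral>\<^sup>+t. epow (ennreal (A t)) Q \<partial>dt_over_t) = (NN t. ennreal (1 / t) * epow (ennreal (A t)) Q * indicator {0<..} t)"
      by (rule nn_integral_dt_over_t) measurable
    \<comment> \<open>The exponent 3 is the dimension of the line plus 2, so the decay lemma also
      serves the integral in t. The factor 8 is 2^3, from comparing 1 + t with 2 for t \<le> 1 and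
      with 2 t for t > 1.\<close>
    also have "\<dots> \<le> (\<integral>\<^sup>+t. ennreal 8 * ennreal ((1 + norm t) powr - (real DIM(real) + 2)) \<partial>(lborel :: real measure))"
    proof (intro nn_integral_mono)
      fix t :: real
      show "ennreal (1 / t) * epow (ennreal (A t)) Q * indicator {0<..} t \<le> ennreal 8 * ennreal ((1 + norm t) powr - (real DIM(real) + 2))"
      proof (cases "0 < t")
        case True
        have m: "0 < min t (1 / t)" "min t (1 / t) \<le> 1"
          using True by (auto simp: min_le_iff_disj field_simps)
        have "A t powr Q = min t (1 / t) powr (a * Q)" by (simp add: A_def powr_powr)
        also have "\<dots> \<le> min t (1 / t) powr 2" using m a by (intro powr_mono') auto
        finally have "1 / t * A t powr Q \<le> 1 / t * (min t (1 / t))\<^sup>2"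
          using True m by (intro mult_left_mono) auto
        also have "\<dots> \<le> 8 * (1 + t) powr - 3"
        proof (cases "t \<le> 1")
          case t1: True
          have "1 / t * (min t (1 / t))\<^sup>2 \<le> 1 / t * t\<^sup>2" using m True by (intro mult_left_mono power_mono) auto
          also have "\<dots> \<le> 1" using True t1 by (simp add: power2_eq_square)
          also have "1 \<le> 8 * (1 + t) powr - 3"
          proof -
            have "(1 + t) powr 3 \<le> 2 powr 3" using True t1 by (intro powr_mono2) auto
            then show ?thesis using True by (simp add: powr_minus_divide field_simps)
          qed
          finally show ?thesis .
        next
          case t1: False
          have "1 / t * (min t (1 / t))\<^sup>2 \<le> 1 / t * (1 / t)\<^sup>2" using m True by (intro mult_left_mono power_mono) auto
          also have "\<dots> = 8 * (2 * t) powr - 3"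
            using True by (simp add: powr_minus_divide power2_eq_square power3_eq_cube)
          also have "\<dots> \<le> 8 * (1 + t) powr - 3" using t1 by (intro mult_left_mono powr_mono2') auto
          finally show ?thesis .
        qed
        finally have "ennreal (1 / t * A t powr Q) \<le> ennreal (8 * (1 + t) powr - 3)" by (rule ennreal_leI)
        moreover have "0 \<le> A t" by (simp add: A_def)
        ultimately show ?thesis using True by (simp add: epow_ennreal ennreal_mult[symmetric] del: ennreal_numeral)
      qed simp
    qed
    also have "\<dots> = ennreal 8 * (\<integral>\<^sup>+t. ennreal ((1 + norm t) powr - (real DIM(real) + 2)) \<partial>(lborel :: real measure))"
      by (rule nn_integral_cmult) measurable
    also have "\<dots> < top"
      using nn_integral_decay_finite[where 'a = real] by (simp add: ennreal_mult_less_top)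
    finally show ?thesis unfolding KA_def Lp_norm_finite[OF q(2)] Q_def by simp
  qed
  have "Lp_norm dt_over_t q (\<lambda>t. wt r (\<lambda>z. ennreal (\<rho> z)) t x) \<le> ennreal (6 powr a) * KA * ennreal (B x)" for x
  proof -
    have "Lp_norm dt_over_t q (\<lambda>t. wt r (\<lambda>z. ennreal (\<rho> z)) t x) \<le>
      Lp_norm dt_over_t q (\<lambda>t. ennreal (6 powr a * B x) * ennreal (A t))"
      by (intro Lp_norm_mono_AE q AE_I2 wt_le) simp
    also have "\<dots> = ennreal (6 powr a * B x) * KA"
      unfolding KA_def by (intro Lp_norm_cmult q borel_measurable_dt_over_t) measurable
    also have "\<dots> = ennreal (6 powr a) * KA * ennreal (B x)" by (simp add: ennreal_mult B_def ac_simps)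
    finally show ?thesis .
  qed
  then have "tent p q (wt r (\<lambda>z. ennreal (\<rho> z))) \<le> Lp_norm lborel p (\<lambda>x. ennreal (6 powr a) * KA * ennreal (B x))"
    unfolding tent_finite_eq[OF p(2)] by (intro Lp_norm_mono_AE p AE_I2)
  also have "\<dots> = ennreal (6 powr a) * KA * Lp_norm lborel p (\<lambda>x. ennreal (B x))"
    by (intro Lp_norm_cmult p) measurable
  also have "\<dots> < top"
  proof -
    have "(NN x. epow (ennreal (B x)) P) \<le> (\<integral>\<^sup>+x. ennreal ((1 + norm x) powr - (real DIM('a) + 2)) \<partial>(lborel :: 'a measure))"
    proof (intro nn_integral_mono)
      fix x :: 'a
      have "B x powr P = (1 + norm x) powr - (a * P)" by (simp add: B_def powr_powr)
      also have "\<dots> \<le> (1 + norm x) powr - (real DIM('a) + 2)" using a by (intro powr_mono) auto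
      finally show "epow (ennreal (B x)) P \<le> ennreal ((1 + norm x) powr - (real DIM('a) + 2))"
        by (subst epow_ennreal) (auto simp: B_def intro: ennreal_leI)
    qed
    also have "\<dots> < top" by (rule nn_integral_decay_finite)
    finally have "Lp_norm lborel p (\<lambda>x. ennreal (B x)) < top"
      unfolding Lp_norm_finite[OF p(2)] P_def by simp
    then show ?thesis using KA by (simp add: ennreal_mult_less_top)
  qed
  finally have "tent p q (wt r (\<lambda>z. ennreal (\<rho> z))) < top" .
  moreover have "0 < \<rho> z" if z: "z \<in> half_space" for z
  proof -
    have f: "0 < fst z" using z by (auto simp: half_space_def)
    have "0 < 1 + fst z + norm (snd z)" using f norm_ge_zero[of "snd z"] by linarith
    moreover have "0 < A (fst z)" using f by (auto simp: A_def min_def)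
    ultimately show ?thesis using z unfolding \<rho>_def by simp
  qed
  moreover have "\<rho> z = 0" if "z \<notin> half_space" for z using that by (simp add: \<rho>_def)
  ultimately show ?thesis using \<rho>_meas by blast
qed

section \<open>Densities of bounded charges\<close>

locale bounded_charge = sigma_finite_measure M for M :: "'b measure" +
  fixes \<nu> :: "'b set \<Rightarrow> real" and b :: real
  assumes additive: "range A \<subseteq> sets M \<Longrightarrow> disjoint_family A \<Longrightarrow> (\<lambda>i::nat. \<nu> (A i)) sums \<nu> (\<Union>i. A i)"
    and bounded: "S \<in> sets M \<Longrightarrow> \<bar>\<nu> S\<bar> \<le> b"
    and null: "S \<in> null_sets M \<Longrightarrow> \<nu> S = 0"
begin

lemma charge_empty: "\<nu> {} = 0" by (rule null) simp

lemma charge_Un: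
  assumes "A \<in> sets M" "B \<in> sets M" "A \<inter> B = {}"
  shows "\<nu> (A \<union> B) = \<nu> A + \<nu> B"
proof -
  have "(\<lambda>n. \<nu> (binaryset A B n)) sums (\<nu> A + \<nu> B)"
    by (rule binaryset_sums) (rule charge_empty)
  moreover have "(\<lambda>n. \<nu> (binaryset A B n)) sums \<nu> (\<Union>n. binaryset A B n)"
    using assms by (intro additive) (auto simp: binaryset_def disjoint_family_on_def)
  ultimately show ?thesis using sums_unique2 by (metis UN_binaryset_eq)
qed

text \<open>The positive part in the Jordan decomposition: \<open>ennreal\<close> sends negative
  values to 0, the value contributed by the empty set.\<close>

definition variation :: "'b set \<Rightarrow> ennreal"
  where "variation E = (SUP S\<in>{S\<in>sets M. S \<subseteq> E}. ennreal (\<nu> S))"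

lemma variation_upper: "S \<in> sets M \<Longrightarrow> S \<subseteq> E \<Longrightarrow> ennreal (\<nu> S) \<le> variation E"
  unfolding variation_def by (rule SUP_upper) simp

lemma variation_mono: "E \<subseteq> E' \<Longrightarrow> variation E \<le> variation E'"
  unfolding variation_def by (rule SUP_subset_mono) auto

lemma variation_finite: "variation E < top"
proof -
  have "variation E \<le> ennreal b"
    unfolding variation_def by (intro SUP_least ennreal_leI) (use bounded in \<open>force simp: abs_le_iff\<close>)
  then show ?thesis by (rule le_less_trans) simp
qed

text \<open>Subsets of disjoint sets can be united, and their charges add. A subset of negative
  charge is replaced by the empty set first, because truncation to nonnegative values is not
  additive.\<close>

lemma variation_superadditive:
  assumes AB: "A \<inter> B = {}"
  shows "variation A + variation B \<le> variation (A \<union> B)"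
proof -
  have le: "ennreal (\<nu> S) + ennreal (\<nu> T) \<le> variation (A \<union> B)"
    if S: "S \<in> sets M" "S \<subseteq> A" and T: "T \<in> sets M" "T \<subseteq> B" for S T
  proof -
    define S' where "S' = (if 0 \<le> \<nu> S then S else {})"
    define T' where "T' = (if 0 \<le> \<nu> T then T else {})"
    have pos: "0 \<le> \<nu> S'" "0 \<le> \<nu> T'" "ennreal (\<nu> S) = ennreal (\<nu> S')" "ennreal (\<nu> T) = ennreal (\<nu> T')"
      by (auto simp: S'_def T'_def charge_empty ennreal_neg)
    have sub: "S' \<in> sets M" "T' \<in> sets M" "S' \<subseteq> A" "T' \<subseteq> B" using S T by (auto simp: S'_def T'_def)
    then have "\<nu> (S' \<union> T') = \<nu> S' + \<nu> T'" using AB by (intro charge_Un) auto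
    then have "ennreal (\<nu> S) + ennreal (\<nu> T) = ennreal (\<nu> (S' \<union> T'))" using pos by simp
    also have "\<dots> \<le> variation (A \<union> B)" using sub by (intro variation_upper) auto
    finally show ?thesis .
  qed
  have ne: "{S\<in>sets M. S \<subseteq> A} \<noteq> {}" "{S\<in>sets M. S \<subseteq> B} \<noteq> {}" by auto
  have "variation A + variation B = (SUP S\<in>{S\<in>sets M. S \<subseteq> A}. (SUP T\<in>{S\<in>sets M. S \<subseteq> B}. ennreal (\<nu> S) + ennreal (\<nu> T)))"
    unfolding variation_def
    by (subst ennreal_SUP_add_left[OF ne(1), symmetric], subst ennreal_SUP_add_right[OF ne(2), symmetric]) (rule refl)
  also have "\<dots> \<le> variation (A \<union> B)" by (intro SUP_least le) auto
  finally show ?thesis .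
qed

text \<open>One inequality is superadditivity along finite unions. For the other, a subset of the
  union is cut along the sets of the family, and the charge of each piece is bounded by the
  variation of its set.\<close>

lemma variation_countably_additive: "countably_additive (sets M) variation" unfolding countably_additive_def
proof (intro allI impI antisym)
  fix A :: "nat \<Rightarrow> 'b set" assume A: "range A \<subseteq> sets M" "disjoint_family A"
  have fin: "(\<Sum>i<n. variation (A i)) \<le> variation (\<Union>i<n. A i)" for n
  proof (induction n)
    case (Suc n)
    have disj: "(\<Union>i<n. A i) \<inter> A n = {}"
      using A(2) by (auto simp: disjoint_family_on_def) (metis IntI empty_iff less_irrefl)
    have "(\<Sum>i<Suc n. variation (A i)) \<le> variation (\<Union>i<n. A i) + variation (A n)"
      using Suc by (simp add: add_right_mono)
    also have "\<dots> \<le> variation ((\<Union>i<n. A i) \<union> A n)" by (rule variation_superadditive[OF disj])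
    also have "(\<Union>i<n. A i) \<union> A n = (\<Union>i<Suc n. A i)" by (auto simp: lessThan_Suc)
    finally show ?case .
  qed simp
  show "(\<Sum>i. variation (A i)) \<le> variation (\<Union> (range A))"
    unfolding suminf_eq_SUP by (intro SUP_least order_trans[OF fin] variation_mono) auto
  show "variation (\<Union> (range A)) \<le> (\<Sum>i. variation (A i))"
    unfolding variation_def[of "\<Union> (range A)"]
  proof (intro SUP_least)
    fix S assume "S \<in> {S\<in>sets M. S \<subseteq> \<Union> (range A)}"
    then have S: "S \<in> sets M" "S \<subseteq> \<Union> (range A)" by auto
    have "disjoint_family (\<lambda>i. S \<inter> A i)" using A(2) unfolding disjoint_family_on_def by blast
    then have "(\<lambda>i. \<nu> (S \<inter> A i)) sums \<nu> (\<Union>i. S \<inter> A i)"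
      using S A by (intro additive) auto
    moreover have "(\<Union>i. S \<inter> A i) = S" using S by auto
    ultimately have "(\<lambda>n. \<Sum>i<n. \<nu> (S \<inter> A i)) \<longlonglongrightarrow> \<nu> S" by (simp add: sums_def)
    then have "(\<lambda>n. ennreal (\<Sum>i<n. \<nu> (S \<inter> A i))) \<longlonglongrightarrow> ennreal (\<nu> S)"
      by (rule tendsto_ennrealI)
    moreover have "ennreal (\<Sum>i<n. \<nu> (S \<inter> A i)) \<le> (\<Sum>i. variation (A i))" for n
    proof -
      have "ennreal (\<Sum>i<n. \<nu> (S \<inter> A i)) \<le> ennreal (\<Sum>i<n. max 0 (\<nu> (S \<inter> A i)))"
        by (intro ennreal_leI sum_mono) simp
      also have "\<dots> = (\<Sum>i<n. ennreal (max 0 (\<nu> (S \<inter> A i))))" by (rule sum_ennreal[symmetric]) simp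
      also have "\<dots> \<le> (\<Sum>i<n. variation (A i))"
      proof (intro sum_mono)
        fix i
        have "ennreal (max 0 (\<nu> (S \<inter> A i))) = ennreal (\<nu> (S \<inter> A i))" by (simp add: max_def ennreal_neg)
        also have "\<dots> \<le> variation (A i)" using S A by (intro variation_upper) auto
        finally show "ennreal (max 0 (\<nu> (S \<inter> A i))) \<le> variation (A i)" .
      qed
      also have "\<dots> \<le> (\<Sum>i. variation (A i))" by (rule sum_le_suminf) auto
      finally show ?thesis .
    qed
    ultimately show "ennreal (\<nu> S) \<le> (\<Sum>i. variation (A i))" by (intro LIMSEQ_le_const2) auto
  qed
qed

lemma variation_density:
  "\<exists>\<phi> \<in> borel_measurable M. \<forall>E\<in>sets M. variation E = (\<integral>\<^sup>+x. \<phi> x * indicator E x \<partial>M)"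
proof -
  define N where "N = measure_of (space M) (sets M) variation"
  have v0: "variation {} = 0"
    unfolding variation_def by (rule antisym) (auto intro!: SUP_least simp: charge_empty)
  have emN: "emeasure N E = variation E" if "E \<in> sets M" for E
    unfolding N_def using that variation_countably_additive v0
    by (intro emeasure_measure_of_sigma sets.sigma_algebra_axioms) (auto simp: positive_def)
  have sN: "sets N = sets M" by (simp add: N_def)
  have "absolutely_continuous M N" unfolding absolutely_continuous_def
  proof
    fix E assume E: "E \<in> null_sets M"
    have "ennreal (\<nu> S) = 0" if "S \<in> sets M" "S \<subseteq> E" for S
      using null[OF null_sets_subset[OF E that]] by simp
    then have "variation E = 0" unfolding variation_def by (intro antisym SUP_least) auto
    then show "E \<in> null_sets N" using E emN sN by (auto simp: null_sets_def)
  qed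
  then obtain \<phi> where \<phi>: "\<phi> \<in> borel_measurable M" "density M \<phi> = N"
    using Radon_Nikodym[OF _ sN] by blast
  then have "variation E = (\<integral>\<^sup>+x. \<phi> x * indicator E x \<partial>M)" if "E \<in> sets M" for E
    using emN[OF that] that by (metis emeasure_density)
  then show ?thesis using \<phi> by blast
qed

end

text \<open>The Jordan decomposition: the charge is the difference of its own variation and that of
  its negative, both finite measures absolutely continuous with respect to \<open>M\<close>, so that
  each has a density.\<close>

lemma bounded_charge_density:
  assumes "bounded_charge M \<nu> b"
  shows "\<exists>\<phi> :: 'b \<Rightarrow> real. integrable M \<phi> \<and> (\<forall>E\<in>sets M. \<nu> E = (\<integral>x. indicator E x *\<^sub>R \<phi> x \<partial>M))"
proof -
  interpret v: bounded_charge M \<nu> b by (rule assms)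
  have neg: "bounded_charge M (\<lambda>E. - \<nu> E) b"
    by unfold_locales (use v.bounded v.null in \<open>auto intro!: sums_minus v.additive\<close>)
  interpret w: bounded_charge M "\<lambda>E. - \<nu> E" b by (rule neg)
  obtain f where f: "f \<in> borel_measurable M" "\<And>E. E \<in> sets M \<Longrightarrow> v.variation E = (\<integral>\<^sup>+x. f x * indicator E x \<partial>M)"
    using v.variation_density by blast
  obtain g where g: "g \<in> borel_measurable M" "\<And>E. E \<in> sets M \<Longrightarrow> w.variation E = (\<integral>\<^sup>+x. g x * indicator E x \<partial>M)"
    using w.variation_density by blast
  have real: "integrable M (\<lambda>x. enn2real (u x)) \<and> (\<forall>E\<in>sets M. (\<integral>x. indicator E x *\<^sub>R enn2real (u x) \<partial>M) = enn2real (\<integral>\<^sup>+x. u x * indicator E x \<partial>M))"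
    if u [measurable]: "u \<in> borel_measurable M" and fin: "(\<integral>\<^sup>+x. u x * indicator (space M) x \<partial>M) < top" for u
  proof -
    have "(\<integral>\<^sup>+x. u x \<partial>M) < top"
      using fin by (metis (no_types, lifting) indicator_simps(1) mult.right_neutral nn_integral_cong)
    then have AE: "AE x in M. u x = ennreal (enn2real (u x))"
      using nn_integral_PInf_AE[OF u] by (auto elim!: eventually_mono simp: less_top)
    have "(\<integral>\<^sup>+x. ennreal (enn2real (u x)) \<partial>M) = (\<integral>\<^sup>+x. u x \<partial>M)"
      using AE by (intro nn_integral_cong_AE) (auto elim!: eventually_mono)
    then have int: "integrable M (\<lambda>x. enn2real (u x))"
      using \<open>(\<integral>\<^sup>+x. u x \<partial>M) < top\<close> by (intro integrableI_nonneg) auto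
    moreover have "(\<integral>x. indicator E x *\<^sub>R enn2real (u x) \<partial>M) = enn2real (\<integral>\<^sup>+x. u x * indicator E x \<partial>M)" if E [measurable]: "E \<in> sets M" for E
    proof -
      have "(\<integral>x. indicator E x *\<^sub>R enn2real (u x) \<partial>M) = enn2real (\<integral>\<^sup>+x. ennreal (indicator E x *\<^sub>R enn2real (u x)) \<partial>M)"
        by (rule integral_eq_nn_integral) (auto simp: indicator_def)
      also have "(\<integral>\<^sup>+x. ennreal (indicator E x *\<^sub>R enn2real (u x)) \<partial>M) = (\<integral>\<^sup>+x. u x * indicator E x \<partial>M)"
        using AE by (intro nn_integral_cong_AE, eventually_elim) (auto simp: indicator_def)
      finally show ?thesis .
    qed
    ultimately show ?thesis by blast
  qed
  have fr: "integrable M (\<lambda>x. enn2real (f x))" "\<And>E. E \<in> sets M \<Longrightarrow> (\<integral>x. indicator E x *\<^sub>R enn2real (f x) \<partial>M) = enn2real (v.variation E)"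
    using real[OF f(1)] f(2) v.variation_finite[of "space M"] by auto
  have gr: "integrable M (\<lambda>x. enn2real (g x))" "\<And>E. E \<in> sets M \<Longrightarrow> (\<integral>x. indicator E x *\<^sub>R enn2real (g x) \<partial>M) = enn2real (w.variation E)"
    using real[OF g(1)] g(2) w.variation_finite[of "space M"] by auto
  \<comment> \<open>For S inside E the charge of S is that of E minus that of E - S, hence at most
    that of E plus the negative variation. The statement quantifies over \<nu> so that it can be
    used with both signs, which yields equality.\<close>
  have le: "enn2real (bounded_charge.variation M \<nu> E) \<le> \<nu> E + enn2real (bounded_charge.variation M (\<lambda>E. - \<nu> E) E)"
    if "bounded_charge M \<nu> b" "bounded_charge M (\<lambda>E. - \<nu> E) b" and E: "E \<in> sets M" for \<nu> E
  proof -
    interpret v1: bounded_charge M \<nu> b by fact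
    interpret w1: bounded_charge M "\<lambda>E. - \<nu> E" b by fact
    obtain c where c: "w1.variation E = ennreal c" "0 \<le> c" using w1.variation_finite[of E] by (cases "w1.variation E") auto
    have bound: "\<nu> S \<le> \<nu> E + c" if S: "S \<in> sets M" "S \<subseteq> E" for S
    proof -
      have "\<nu> (S \<union> (E - S)) = \<nu> S + \<nu> (E - S)" using S E by (intro v1.charge_Un) auto
      moreover have "S \<union> (E - S) = E" using S by auto
      moreover have "ennreal (- \<nu> (E - S)) \<le> ennreal c" unfolding c(1)[symmetric] using S E by (intro w1.variation_upper) auto
      then have "- \<nu> (E - S) \<le> c" using c(2) by (auto simp: ennreal_le_iff2)
      ultimately show ?thesis by simp
    qed
    have "0 \<le> \<nu> E + c" using bound[of "{}"] v1.charge_empty by simp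
    have "v1.variation E \<le> ennreal (\<nu> E + c)"
      unfolding v1.variation_def by (intro SUP_least ennreal_leI) (use bound in auto)
    then have "enn2real (v1.variation E) \<le> \<nu> E + c"
      using \<open>0 \<le> \<nu> E + c\<close> by (simp add: enn2real_leI)
    then show ?thesis using c by simp
  qed
  have "\<nu> E = (\<integral>x. indicator E x *\<^sub>R (enn2real (f x) - enn2real (g x)) \<partial>M)" if E: "E \<in> sets M" for E
  proof -
    have "\<nu> E = enn2real (v.variation E) - enn2real (w.variation E)"
    proof -
      have mm: "(\<lambda>E. - (- \<nu> E)) = \<nu>" by simp
      have "enn2real (w.variation E) \<le> - \<nu> E + enn2real (bounded_charge.variation M (\<lambda>E. - (- \<nu> E)) E)"
        by (rule le[OF neg _ E]) (use assms in \<open>simp add: mm\<close>)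
      then have "enn2real (w.variation E) \<le> - \<nu> E + enn2real (v.variation E)" unfolding mm .
      then show ?thesis using le[OF assms neg E] by linarith
    qed
    also have "\<dots> = (\<integral>x. indicator E x *\<^sub>R enn2real (f x) \<partial>M) - (\<integral>x. indicator E x *\<^sub>R enn2real (g x) \<partial>M)"
      using fr(2)[OF E] gr(2)[OF E] by simp
    also have "\<dots> = (\<integral>x. indicator E x *\<^sub>R enn2real (f x) - indicator E x *\<^sub>R enn2real (g x) \<partial>M)"
      using fr(1) gr(1) E by (intro Bochner_Integration.integral_diff[symmetric] integrable_mult_indicator)
    finally show ?thesis by (simp add: right_diff_distrib)
  qed
  then show ?thesis using fr(1) gr(1) by (intro exI[of _ "\<lambda>x. enn2real (f x) - enn2real (g x)"]) auto
qed

section \<open>The anti-dual\<close>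

lemma fst_powr_measurable:
  "bm (\<lambda>z :: real \<times> 'a::euclidean_space. fst z powr a)"
  by (rule borel_measurable_compose_fst[where f = "\<lambda>s. s powr a"]) simp

lemma cnj_measurable [measurable]: "bm cnj" by (intro borel_measurable_continuous_onI continuous_intros)

lemma mult_cnj_sgn: "z * cnj (sgn z) = of_real (norm z)"
  by (cases "z = 0") (auto simp: sgn_div_norm scaleR_conv_of_real complex_norm_square[symmetric] power2_eq_square field_simps)

lemma wabs_mult:
  assumes "z \<in> half_space"
  shows "wabs (- \<beta>) f z * wabs \<beta> g z = ennreal (norm (f z) * norm (g z))"
proof -
  have "0 < fst z" using assms by (auto simp: half_space_def)
  then have "fst z powr \<beta> * fst z powr - \<beta> = 1" by (simp add: powr_minus)
  then have "norm (fst z powr \<beta> *\<^sub>R f z) * norm (fst z powr - \<beta> *\<^sub>R g z) = norm (f z) * norm (g z)"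
    by (simp add: mult_ac)
  then show ?thesis by (simp add: wabs_def ennreal_mult[symmetric] del: norm_scaleR)
qed

lemma tent_norm_Holder:
  assumes p: "1 \<le> p" "p < top" and r: "1 \<le> r" "r < top" and q: "0 < q" "q < top"
  shows "\<exists>C>0. \<forall>f g :: real \<times> 'a::euclidean_space \<Rightarrow> complex.
    half_space_measurable f \<longrightarrow> half_space_measurable g \<longrightarrow>
    (\<integral>\<^sup>+ z. ennreal (norm (f z) * norm (g z)) \<partial>dyds_over_s)
      \<le> ennreal C * tent_norm (conj_exponent p) (conj_exponent q) (conj_exponent r) (- \<beta>) f * tent_norm p q r \<beta> g"
proof -
  obtain C where C: "C > 0" "\<And>(f :: real \<times> 'a \<Rightarrow> ennreal) g. bm f \<Longrightarrow> bm g \<Longrightarrow>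
    hs_int (\<lambda>z. f z * g z) \<le> ennreal C * tent (conj_exponent p) (conj_exponent q) (wt (conj_exponent r) f) * tent p q (wt r g)"
    using tent_Holder[OF p r q, where 'a='a] by blast
  have "(\<integral>\<^sup>+ z. ennreal (norm (f z) * norm (g z)) \<partial>dyds_over_s)
      \<le> ennreal C * tent_norm (conj_exponent p) (conj_exponent q) (conj_exponent r) (- \<beta>) f * tent_norm p q r \<beta> g"
    if f: "half_space_measurable f" and g: "half_space_measurable g" for f g :: "real \<times> 'a \<Rightarrow> complex"
  proof -
    obtain f' where f': "bm f'" "AE z\<in>half_space in lborel. f z = f' z"
      using half_space_borel_version[OF f] .
    obtain g' where g': "bm g'" "AE z\<in>half_space in lborel. g z = g' z"
      using half_space_borel_version[OF g] .
    have "(\<lambda>z. ennreal (norm (f z) * norm (g z))) \<in> borel_measurable (lebesgue_on half_space)"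
      using f g by measurable
    then have "(\<integral>\<^sup>+ z. ennreal (norm (f z) * norm (g z)) \<partial>dyds_over_s) = hs_int (\<lambda>z. ennreal (norm (f z) * norm (g z)))"
      by (rule nn_integral_dyds)
    also have "\<dots> = hs_int (\<lambda>z. wabs (- \<beta>) f' z * wabs \<beta> g' z)"
    proof (rule hs_int_cong_AE)
      show "AE z\<in>half_space in lborel. ennreal (norm (f z) * norm (g z)) = wabs (- \<beta>) f' z * wabs \<beta> g' z"
        using f'(2) g'(2) by eventually_elim (auto simp: wabs_mult)
    qed
    also have "\<dots> \<le> ennreal C * tent (conj_exponent p) (conj_exponent q) (wt (conj_exponent r) (wabs (- \<beta>) f')) * tent p q (wt r (wabs \<beta> g'))"
      by (intro C wabs_borel_measurable f' g')
    also have "tent (conj_exponent p) (conj_exponent q) (wt (conj_exponent r) (wabs (- \<beta>) f')) = tent_norm (conj_exponent p) (conj_exponent q) (conj_exponent r) (- \<beta>) f"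
      using f'(2) by (intro tent_norm_eq[symmetric] f) (auto elim!: eventually_mono simp: wabs_def)
    also have "tent p q (wt r (wabs \<beta> g')) = tent_norm p q r \<beta> g"
      using g'(2) by (intro tent_norm_eq[symmetric] g) (auto elim!: eventually_mono simp: wabs_def)
    finally show ?thesis .
  qed
  then show ?thesis using C(1) by blast
qed

section \<open>Test functions dominated by a positive weight\<close>

locale weighted_tent =
  fixes p q r :: ennreal and \<beta> :: real and \<rho> :: "real \<times> 'a::euclidean_space \<Rightarrow> real"
  assumes p: "1 \<le> p" "p < top" and r: "1 \<le> r" "r < top" and q: "0 < q" "q < top"
    and \<rho>_measurable [measurable]: "bm \<rho>"
    and \<rho>_pos: "z \<in> half_space \<Longrightarrow> 0 < \<rho> z" and \<rho>_zero: "z \<notin> half_space \<Longrightarrow> \<rho> z = 0"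
    and \<rho>_finite: "tent p q (wt r (\<lambda>z. ennreal (\<rho> z))) < top"
begin

abbreviation "V \<equiv> tent_space p q r \<beta> :: (real \<times> 'a \<Rightarrow> complex) set"
abbreviation "N \<equiv> tent_norm p q r \<beta> :: (real \<times> 'a \<Rightarrow> complex) \<Rightarrow> ennreal"
abbreviation "N' \<equiv> tent_norm (conj_exponent p) (conj_exponent q) (conj_exponent r) (- \<beta>) :: (real \<times> 'a \<Rightarrow> complex) \<Rightarrow> ennreal"
abbreviation "V' \<equiv> tent_space (conj_exponent p) (conj_exponent q) (conj_exponent r) (- \<beta>) :: (real \<times> 'a \<Rightarrow> complex) set"

text \<open>Undoes the factor \<open>s powr (- \<beta>)\<close> hidden in \<open>wabs\<close>, so
  that \<omega> has the tent norm that \<rho> has without weight.\<close>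

definition \<omega> :: "real \<times> 'a \<Rightarrow> real"
  where "\<omega> z = fst z powr \<beta> * \<rho> z"

lemma p0: "0 < p" using less_le_trans[OF zero_less_one p(1)] .

lemma \<omega>_measurable [measurable]: "bm \<omega>"
proof -
  note [measurable] = fst_powr_measurable[where 'a = 'a, of \<beta>]
  show ?thesis unfolding \<omega>_def by measurable
qed

lemma \<omega>_pos: "z \<in> half_space \<Longrightarrow> 0 < \<omega> z"
  using \<rho>_pos[of z] by (auto simp: \<omega>_def half_space_def)

lemma \<omega>_zero: "z \<notin> half_space \<Longrightarrow> \<omega> z = 0"
  by (simp add: \<omega>_def \<rho>_zero)

lemma \<rho>_nonneg: "0 \<le> \<rho> z"
  using \<rho>_pos[of z] \<rho>_zero[of z] by (cases "z \<in> half_space") auto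

lemma \<omega>_nonneg: "0 \<le> \<omega> z" by (simp add: \<omega>_def \<rho>_nonneg)

lemma wabs_\<omega>: "wabs \<beta> (\<lambda>z. of_real (\<omega> z) * b z) z = ennreal (\<rho> z * norm (b z))"
proof (cases "z \<in> half_space")
  case True
  then have "0 < fst z" by (auto simp: half_space_def)
  then have "fst z powr - \<beta> * fst z powr \<beta> = 1" by (simp add: powr_minus)
  then show ?thesis
    using \<rho>_nonneg[of z] by (simp add: wabs_def \<omega>_def norm_mult mult.assoc[symmetric])
qed (simp add: wabs_def \<omega>_zero \<rho>_zero)

lemma N_\<omega>: "bm b \<Longrightarrow>
  N (\<lambda>z. of_real (\<omega> z) * b z) = tent p q (wt r (\<lambda>z. ennreal (\<rho> z * norm (b z))))"
  by (subst tent_norm_borel) (auto simp: wabs_\<omega>[abs_def])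

lemma V_iff: "g \<in> V \<longleftrightarrow> half_space_measurable g \<and> N g < top"
  by (simp add: tent_space_def)

lemma N_\<omega>_le:
  assumes [measurable]: "bm b" and b: "\<And>z. norm (b z) \<le> c"
  shows "N (\<lambda>z. of_real (\<omega> z) * b z) \<le> ennreal c * tent p q (wt r (\<lambda>z. ennreal (\<rho> z)))"
proof -
  have c: "0 \<le> c" using b norm_ge_zero order_trans by blast
  have "N (\<lambda>z. of_real (\<omega> z) * b z) \<le> tent p q (wt r (\<lambda>z. ennreal c * ennreal (\<rho> z)))"
    unfolding N_\<omega>[OF assms(1)] using c b \<rho>_nonneg by (intro tent_mono_AE p q AE_I2)
      (auto simp: ennreal_mult[symmetric] mult.commute[of "\<rho> _"] intro!: ennreal_leI mult_right_mono)
  also have "\<dots> = ennreal c * tent p q (wt r (\<lambda>z. ennreal (\<rho> z)))"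
    by (intro tent_cmult p0 p q r) measurable
  finally show ?thesis .
qed

lemma \<omega>_in_V:
  assumes [measurable]: "bm b" and b: "\<And>z. norm (b z) \<le> c"
  shows "(\<lambda>z. of_real (\<omega> z) * b z) \<in> V"
proof -
  have "N (\<lambda>z. of_real (\<omega> z) * b z) < top"
    using N_\<omega>_le[OF assms] \<rho>_finite by (auto intro: le_less_trans simp: ennreal_mult_less_top)
  then show ?thesis unfolding V_iff by (auto intro!: borel_imp_half_space_measurable)
qed

lemma N_cmult:
  assumes g: "half_space_measurable g"
  shows "N (\<lambda>z. c * g z) = ennreal (norm c) * N g"
proof -
  obtain g' where g' [measurable]: "bm g'" and ae: "AE z\<in>half_space in lborel. g z = g' z"
    using half_space_borel_version[OF g] .
  have eq: "wabs \<beta> (\<lambda>z. c * u z) z = ennreal (norm c) * wabs \<beta> u z" for u :: "real \<times> 'a \<Rightarrow> complex" and z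
    by (simp add: wabs_def norm_mult ennreal_mult[symmetric] ac_simps)
  have cg: "half_space_measurable (\<lambda>z. c * g z)" using g by measurable
  have "N (\<lambda>z. c * g z) = tent p q (wt r (\<lambda>z. ennreal (norm c) * wabs \<beta> g' z))"
    using ae by (intro tent_norm_eq cg) (auto elim!: eventually_mono simp: wabs_def norm_mult ennreal_mult[symmetric] ac_simps)
  also have "\<dots> = ennreal (norm c) * tent p q (wt r (wabs \<beta> g'))"
    by (intro tent_cmult p0 p q r wabs_borel_measurable g')
  also have "tent p q (wt r (wabs \<beta> g')) = N g"
    using ae by (intro tent_norm_eq[symmetric] g) (auto elim!: eventually_mono simp: wabs_def)
  finally show ?thesis .
qed

lemma V_cmult: "g \<in> V \<Longrightarrow> (\<lambda>z. c * g z) \<in> V"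
  unfolding V_iff by (auto simp: N_cmult ennreal_mult_less_top)

lemma V_add:
  assumes "g \<in> V" "h \<in> V"
  shows "(\<lambda>z. g z + h z) \<in> V"
proof -
  have m: "half_space_measurable g" "half_space_measurable h" using assms by (auto simp: V_iff)
  then have gh: "half_space_measurable (\<lambda>z. g z + h z)" by measurable
  obtain g' where g' [measurable]: "bm g'" and ae: "AE z\<in>half_space in lborel. g z = g' z"
    using half_space_borel_version[OF m(1)] .
  obtain h' where h' [measurable]: "bm h'" and ae': "AE z\<in>half_space in lborel. h z = h' z"
    using half_space_borel_version[OF m(2)] .
  have Ng: "tent p q (wt r (wabs \<beta> g')) = N g"
    using ae by (intro tent_norm_eq[symmetric] m) (auto elim!: eventually_mono simp: wabs_def)
  have Nh: "tent p q (wt r (wabs \<beta> h')) = N h"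
    using ae' by (intro tent_norm_eq[symmetric] m) (auto elim!: eventually_mono simp: wabs_def)
  have "N (\<lambda>z. g z + h z) = tent p q (wt r (wabs \<beta> (\<lambda>z. g' z + h' z)))"
  proof (rule tent_norm_eq[OF gh])
    show "AE z\<in>half_space in lborel. wabs \<beta> (\<lambda>z. g z + h z) z = wabs \<beta> (\<lambda>z. g' z + h' z) z"
      using ae ae' by eventually_elim (auto simp: wabs_def)
  qed measurable
  also have "\<dots> \<le> tent p q (wt r (\<lambda>z. wabs \<beta> g' z + wabs \<beta> h' z))"
  proof (intro tent_mono_AE p q AE_I2)
    fix z :: "real \<times> 'a"
    have "norm (fst z powr - \<beta> *\<^sub>R (g' z + h' z)) \<le> norm (fst z powr - \<beta> *\<^sub>R g' z) + norm (fst z powr - \<beta> *\<^sub>R h' z)"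
      unfolding scaleR_add_right by (rule norm_triangle_ineq)
    then show "wabs \<beta> (\<lambda>z. g' z + h' z) z \<le> wabs \<beta> g' z + wabs \<beta> h' z"
      unfolding wabs_def by (subst ennreal_plus[symmetric]) (auto intro!: ennreal_leI simp del: norm_scaleR ennreal_plus)
  qed
  also have "\<dots> < top"
    using assms by (intro tent_add_finite p0 p q r wabs_borel_measurable g' h') (auto simp: Ng Nh V_iff)
  finally show ?thesis using gh by (simp add: V_iff)
qed

lemma V_diff: "g \<in> V \<Longrightarrow> h \<in> V \<Longrightarrow> (\<lambda>z. g z - h z) \<in> V"
  using V_add[of g "\<lambda>z. (- 1) * h z"] V_cmult[of h "- 1"] by simp

lemma pairing_integrable:
  assumes f: "f \<in> V'" and g: "g \<in> V"
  shows "integrable dyds_over_s (\<lambda>z. f z * cnj (g z))"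
proof (rule integrableI_bounded)
  have m: "half_space_measurable f" "half_space_measurable g" using f g by (auto simp: tent_space_def)
  then show "(\<lambda>z. f z * cnj (g z)) \<in> borel_measurable dyds_over_s"
    unfolding measurable_dyds_iff by measurable
  obtain C where "(\<integral>\<^sup>+ z. ennreal (norm (f z) * norm (g z)) \<partial>dyds_over_s) \<le> ennreal C * N' f * N g"
    using tent_norm_Holder[OF p r q] m by blast
  also have "\<dots> < \<infinity>" using f g by (simp add: tent_space_def ennreal_mult_less_top)
  finally show "(\<integral>\<^sup>+ z. ennreal (norm (f z * cnj (g z))) \<partial>dyds_over_s) < \<infinity>" by (simp add: norm_mult)
qed

text \<open>As \<rho> is positive on the half-space, truncations at \<open>j * \<rho>\<close>
  increase to \<open>G\<close> there; each is the modulus of a bounded multiple of \<omega>, up to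
  the weight in s, and thus leads to an element of the space.\<close>

lemma hs_int_min_SUP:
  assumes [measurable]: "bm F" "bm G"
  shows "hs_int (\<lambda>z. F z * G z) = (SUP j::nat. hs_int (\<lambda>z. F z * min (G z) (ennreal (real j * \<rho> z))))"
proof -
  have mono: "min (G z) (ennreal (real i * \<rho> z)) \<le> min (G z) (ennreal (real j * \<rho> z))" if "i \<le> j" for i j z
    using that \<rho>_nonneg[of z] by (intro min.mono ennreal_leI mult_right_mono) auto
  have SUP: "(SUP j::nat. min (G z) (ennreal (real j * \<rho> z))) = G z" if "z \<in> half_space" for z
  proof -
    have "(SUP j::nat. min (G z) (ennreal (real j * \<rho> z))) = inf (G z) (SUP j::nat. ennreal (real j * \<rho> z))"
      unfolding inf_min[symmetric] by (rule inf_SUP[symmetric])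
    also have "(SUP j::nat. ennreal (real j * \<rho> z)) = (SUP j::nat. of_nat j) * ennreal (\<rho> z)"
      using \<rho>_nonneg[of z] by (simp add: SUP_mult_right_ennreal ennreal_mult ennreal_of_nat_eq_real_of_nat)
    also have "\<dots> = top"
      using \<rho>_pos[OF that] by (simp add: ennreal_SUP_of_nat_eq_top ennreal_top_mult)
    finally show ?thesis by simp
  qed
  have "hs_int (\<lambda>z. F z * G z) =
    (NN z. (SUP j::nat. F z * min (G z) (ennreal (real j * \<rho> z)) * (ennreal (1 / fst z) * indicator half_space z)))"
    unfolding hs_int_def
  proof (intro nn_integral_cong)
    fix z
    show "F z * G z * (ennreal (1 / fst z) * indicator half_space z) =
      (SUP j::nat. F z * min (G z) (ennreal (real j * \<rho> z)) * (ennreal (1 / fst z) * indicator half_space z))"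
    proof (cases "z \<in> half_space")
      case True
      show ?thesis unfolding SUP_mult_right_ennreal[symmetric] SUP_mult_left_ennreal[symmetric] SUP[OF True] ..
    qed simp
  qed
  also have "\<dots> = (SUP j::nat. hs_int (\<lambda>z. F z * min (G z) (ennreal (real j * \<rho> z))))"
    unfolding hs_int_def by (intro nn_integral_monotone_convergence_SUP)
      (auto simp: incseq_def le_fun_def intro!: mult_right_mono mult_left_mono mono)
  finally show ?thesis .
qed

text \<open>Once the phase of \<open>f\<close> is put into the test function, the complex pairing is
  the integral of a nonnegative function. An estimate on bounded multiples of \<omega> therefore
  yields \<open>tested\<close> for the weighted modulus of \<open>f\<close>. Integrability of
  \<open>norm (f z) * \<omega> z\<close> makes these pairings genuine integrals and not default
  values.\<close>

lemma converse_norm: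
  "\<exists>C>0. \<forall>(f :: real \<times> 'a \<Rightarrow> complex) D::real. bm f \<longrightarrow> 0 \<le> D \<longrightarrow>
    hs_int (\<lambda>z. ennreal (norm (f z) * \<omega> z)) < top \<longrightarrow>
    (\<forall>b\<in>borel_measurable borel. \<forall>j::nat. (\<forall>z. norm (b z) \<le> real j) \<longrightarrow>
      ennreal (norm (\<integral>z. f z * cnj (of_real (\<omega> z) * b z) \<partial>dyds_over_s)) \<le> ennreal D * N (\<lambda>z. of_real (\<omega> z) * b z)) \<longrightarrow>
    N' f \<le> ennreal (C * D)"
proof -
  obtain C where C: "C > 0" "\<And>(F :: real \<times> 'a \<Rightarrow> ennreal) D::real. bm F \<Longrightarrow> 0 \<le> D \<Longrightarrow>
    tested p q r (ennreal D) F \<Longrightarrow>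
    tent (conj_exponent p) (conj_exponent q) (wt (conj_exponent r) F) \<le> ennreal (C * D)"
    using tent_converse_Holder[OF p r q, where 'a='a] by blast
  have claim: "N' f \<le> ennreal (C * D)" if f [measurable]: "bm f" and D: "0 \<le> D"
    and fin: "hs_int (\<lambda>z. ennreal (norm (f z) * \<omega> z)) < top"
    and test: "\<And>b j. bm b \<Longrightarrow> (\<And>z. norm (b z) \<le> real (j::nat)) \<Longrightarrow>
      ennreal (norm (\<integral>z. f z * cnj (of_real (\<omega> z) * b z) \<partial>dyds_over_s)) \<le> ennreal D * N (\<lambda>z. of_real (\<omega> z) * b z)"
    for f D unfolding tent_norm_borel[OF f]
  proof (rule C(2)[OF wabs_borel_measurable[OF f] D], intro ballI)
    fix G :: "real \<times> 'a \<Rightarrow> ennreal" assume G [measurable]: "bm G"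
    have "hs_int (\<lambda>z. wabs (- \<beta>) f z * min (G z) (ennreal (real j * \<rho> z))) \<le> ennreal D * tent p q (wt r G)" for j :: nat
    proof -
      define g where "g z = enn2real (min (G z) (ennreal (real j * \<rho> z)))" for z
      have g_eq: "ennreal (g z) = min (G z) (ennreal (real j * \<rho> z))" for z
        unfolding g_def by (rule ennreal_enn2real) (auto simp: min_less_iff_disj)
      have g: "0 \<le> g z" "g z \<le> real j * \<rho> z" for z
        using \<rho>_nonneg[of z] by (auto simp: g_def intro!: enn2real_leI)
      have [measurable]: "bm g" unfolding g_def by measurable
      \<comment> \<open>The quotient is bounded by j, and its product with \<rho> recovers the
        truncation \<open>g\<close>; off the half-space both are 0.\<close>
      define b where "b z = of_real (g z / \<rho> z) * sgn (f z)" for z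
      have [measurable]: "bm b" unfolding b_def sgn_div_norm by measurable
      have gr: "g z / \<rho> z \<le> real j" "0 \<le> g z / \<rho> z" "\<rho> z * (g z / \<rho> z) = g z" for z
        using g[of z] \<rho>_nonneg[of z] by (cases "\<rho> z = 0"; simp add: divide_le_eq)+
      have b_le: "norm (b z) \<le> g z / \<rho> z" for z
      proof -
        have "norm (b z) = \<bar>g z / \<rho> z\<bar> * norm (sgn (f z))" unfolding b_def norm_mult norm_of_real ..
        then show ?thesis using gr(2)[of z] by (auto simp: norm_sgn)
      qed
      have bj: "norm (b z) \<le> real j" for z using b_le[of z] gr(1)[of z] by linarith
      define u where "u z = norm (f z) * (fst z powr \<beta> * g z)" for z
      have u_eq: "f z * cnj (of_real (\<omega> z) * b z) = of_real (u z)" for z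
      proof -
        have "f z * cnj (of_real (\<omega> z) * b z) = of_real (norm (f z)) * of_real (\<omega> z * (g z / \<rho> z))"
          using mult_cnj_sgn[of "f z"] by (simp add: b_def ac_simps)
        also have "\<omega> z * (g z / \<rho> z) = fst z powr \<beta> * g z"
          unfolding \<omega>_def mult.assoc gr(3) ..
        finally show ?thesis by (simp add: u_def)
      qed
      have u0: "0 \<le> u z" for z using g by (simp add: u_def)
      note [measurable] = fst_powr_measurable[where 'a = 'a]
      have u_borel [measurable]: "bm u" unfolding u_def by measurable
      have u_dyds: "u \<in> borel_measurable dyds_over_s"
        unfolding measurable_dyds_iff by (rule borel_imp_half_space_measurable) measurable
      have nn_u: "(\<integral>\<^sup>+z. ennreal (u z) \<partial>dyds_over_s) = hs_int (\<lambda>z. ennreal (u z))"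
        by (rule nn_integral_dyds[OF borel_imp_half_space_measurable]) measurable
      have "hs_int (\<lambda>z. ennreal (u z)) \<le> (NN z. ennreal (real j) * (ennreal (norm (f z) * \<omega> z) * (ennreal (1 / fst z) * indicator half_space z)))"
        unfolding hs_int_def
      proof (intro nn_integral_mono)
        fix z
        have "fst z powr \<beta> * g z \<le> fst z powr \<beta> * (real j * \<rho> z)" using g by (intro mult_left_mono) auto
        then have "u z \<le> norm (f z) * (fst z powr \<beta> * (real j * \<rho> z))"
          unfolding u_def by (rule mult_left_mono) simp
        then have "u z \<le> real j * (norm (f z) * \<omega> z)" by (simp add: \<omega>_def ac_simps)
        then have "ennreal (u z) \<le> ennreal (real j) * ennreal (norm (f z) * \<omega> z)"
          using \<omega>_nonneg by (simp add: ennreal_mult[symmetric] ennreal_leI)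
        then have "ennreal (u z) * (ennreal (1 / fst z) * indicator half_space z) \<le>
          ennreal (real j) * ennreal (norm (f z) * \<omega> z) * (ennreal (1 / fst z) * indicator half_space z)"
          by (rule mult_right_mono) simp
        then show "ennreal (u z) * (ennreal (1 / fst z) * indicator half_space z) \<le>
          ennreal (real j) * (ennreal (norm (f z) * \<omega> z) * (ennreal (1 / fst z) * indicator half_space z))"
          by (simp only: mult.assoc)
      qed
      also have "\<dots> = ennreal (real j) * hs_int (\<lambda>z. ennreal (norm (f z) * \<omega> z))"
        unfolding hs_int_def by (rule nn_integral_cmult) measurable
      also have "\<dots> < top" using fin by (simp add: ennreal_mult_less_top)
      finally have u_fin: "hs_int (\<lambda>z. ennreal (u z)) < top" .
      have "integrable dyds_over_s u" by (rule integrableI_nonneg[OF u_dyds]) (simp_all add: nn_u u_fin u0)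
      then have "ennreal (\<integral>z. u z \<partial>dyds_over_s) = hs_int (\<lambda>z. ennreal (u z))"
        using u0 nn_u by (subst nn_integral_eq_integral[symmetric]) auto
      moreover have "(\<integral>z. f z * cnj (of_real (\<omega> z) * b z) \<partial>dyds_over_s) = of_real (\<integral>z. u z \<partial>dyds_over_s)"
        unfolding u_eq by (rule integral_complex_of_real)
      moreover have "0 \<le> (\<integral>z. u z \<partial>dyds_over_s)" using u0 by (intro Bochner_Integration.integral_nonneg) auto
      ultimately have "hs_int (\<lambda>z. ennreal (u z)) = ennreal (norm (\<integral>z. f z * cnj (of_real (\<omega> z) * b z) \<partial>dyds_over_s))"
        by simp
      also have "\<dots> \<le> ennreal D * N (\<lambda>z. of_real (\<omega> z) * b z)"
        by (rule test[OF _ bj]) measurable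
      also have "N (\<lambda>z. of_real (\<omega> z) * b z) \<le> tent p q (wt r G)"
      proof -
        have "ennreal (\<rho> z * norm (b z)) \<le> G z" for z
        proof -
          have "\<rho> z * norm (b z) \<le> \<rho> z * (g z / \<rho> z)" by (intro mult_left_mono b_le \<rho>_nonneg)
          then have "ennreal (\<rho> z * norm (b z)) \<le> ennreal (g z)" unfolding gr(3) by (rule ennreal_leI)
          also have "\<dots> \<le> G z" unfolding g_eq by simp
          finally show ?thesis .
        qed
        then show ?thesis by (subst N_\<omega>) (auto intro!: tent_mono_AE p q)
      qed
      finally have "hs_int (\<lambda>z. ennreal (u z)) \<le> ennreal D * tent p q (wt r G)"
        using mult_left_mono by fastforce
      moreover have "wabs (- \<beta>) f z * min (G z) (ennreal (real j * \<rho> z)) = ennreal (u z)" for z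
        unfolding g_eq[symmetric] using g(1)[of z] by (simp add: wabs_def u_def ennreal_mult[symmetric] ac_simps)
      ultimately show ?thesis by simp
    qed
    then show "hs_int (\<lambda>z. wabs (- \<beta>) f z * G z) \<le> ennreal D * tent p q (wt r G)"
      by (subst hs_int_min_SUP) (auto intro!: SUP_least wabs_borel_measurable)
  qed
  show ?thesis
  proof (intro exI[of _ C] conjI C(1) allI impI)
    fix f :: "real \<times> 'a \<Rightarrow> complex" and D :: real
    assume 1: "bm f" and 2: "0 \<le> D" and 3: "hs_int (\<lambda>z. ennreal (norm (f z) * \<omega> z)) < top"
      and 4: "\<forall>b\<in>borel_measurable borel. \<forall>j::nat. (\<forall>z. norm (b z) \<le> real j) \<longrightarrow>
      ennreal (norm (\<integral>z. f z * cnj (of_real (\<omega> z) * b z) \<partial>dyds_over_s)) \<le> ennreal D * N (\<lambda>z. of_real (\<omega> z) * b z)"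
    show "N' f \<le> ennreal (C * D)" by (rule claim[OF 1 2 3]) (use 4 in blast)
  qed
qed

text \<open>Since \<omega> vanishes off the half-space, a representative vanishing there is a limit
  of multiples of \<omega> at every point, as the pointwise hypotheses of
  \<open>N_diff_tendsto_0\<close> demand.\<close>

lemma borel_version_zero:
  assumes f: "half_space_measurable f"
  obtains f' where "bm f'" "AE z\<in>half_space in lborel. f z = f' z"
    "\<And>z. z \<notin> half_space \<Longrightarrow> f' z = (0 :: complex)"
proof -
  obtain f' where f': "bm f'" "AE z\<in>half_space in lborel. f z = f' z"
    using half_space_borel_version[OF f] .
  show thesis
  proof (rule that[of "\<lambda>z. indicator half_space z *\<^sub>R f' z"])
    show "bm (\<lambda>z. indicator half_space z *\<^sub>R f' z)" using f'(1) by measurable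
    show "AE z\<in>half_space in lborel. f z = indicator half_space z *\<^sub>R f' z"
      using f'(2) by eventually_elim auto
  qed simp
qed

lemma N_diff_tendsto_0:
  fixes g :: "real \<times> 'a \<Rightarrow> complex"
  assumes g: "g \<in> V" and g': "bm g'" "AE z\<in>half_space in lborel. g z = g' z"
    and h [measurable]: "\<And>j. bm (h j)" "bm H" and H: "tent p q (wt r H) < top"
    and dom: "\<And>j z. wabs \<beta> (\<lambda>z. g' z - h j z) z \<le> H z"
    and lim: "\<And>z. (\<lambda>j. h j z) \<longlonglongrightarrow> g' z"
  shows "(\<lambda>j. N (\<lambda>z. g z - h j z)) \<longlonglongrightarrow> 0"
proof -
  have m: "half_space_measurable g" using g by (simp add: V_iff)
  have [measurable]: "bm g'" by fact
  have eq: "N (\<lambda>z. g z - h j z) = tent p q (wt r (wabs \<beta> (\<lambda>z. g' z - h j z)))" for j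
    using g'(2) m borel_imp_half_space_measurable[OF h(1), of j]
    by (intro tent_norm_eq) (auto elim!: eventually_mono simp: wabs_def)
  show ?thesis unfolding eq
  proof (rule tent_tendsto_0[OF p0 p(2) q r _ h(2) _ _ H])
    show "wabs \<beta> (\<lambda>z. g' z - h j z) \<in> borel_measurable borel" for j
      by (rule wabs_borel_measurable) measurable
    show "AE z in lborel. wabs \<beta> (\<lambda>z. g' z - h j z) z \<le> H z" for j using dom by simp
    have "(\<lambda>j. wabs \<beta> (\<lambda>z. g' z - h j z) z) \<longlonglongrightarrow> ennreal (norm (fst z powr - \<beta> *\<^sub>R (g' z - g' z)))" for z
      unfolding wabs_def by (intro tendsto_ennrealI tendsto_norm tendsto_scaleR tendsto_diff tendsto_const lim)
    then show "AE z in lborel. (\<lambda>j. wabs \<beta> (\<lambda>z. g' z - h j z) z) \<longlonglongrightarrow> 0" by simp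
  qed
qed

end

section \<open>Representation of bounded conjugate-linear functionals\<close>

locale tent_functional = weighted_tent p q r \<beta> \<rho> for p q r \<beta> and \<rho> :: "real \<times> 'a::euclidean_space \<Rightarrow> real" +
  fixes \<Lambda> :: "(real \<times> 'a \<Rightarrow> complex) \<Rightarrow> complex" and K :: real
  assumes \<Lambda>_add: "g \<in> V \<Longrightarrow> h \<in> V \<Longrightarrow> \<Lambda> (\<lambda>z. g z + h z) = \<Lambda> g + \<Lambda> h"
    and \<Lambda>_cmult: "g \<in> V \<Longrightarrow> \<Lambda> (\<lambda>z. c * g z) = cnj c * \<Lambda> g"
    and \<Lambda>_bounded: "g \<in> V \<Longrightarrow> ennreal (norm (\<Lambda> g)) \<le> ennreal K * N g" and K: "0 \<le> K"
begin

lemma \<Lambda>_diff: "g \<in> V \<Longrightarrow> h \<in> V \<Longrightarrow> \<Lambda> (\<lambda>z. g z - h z) = \<Lambda> g - \<Lambda> h"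
  using \<Lambda>_add[of g "\<lambda>z. (- 1) * h z"] \<Lambda>_cmult[of h "- 1"] V_cmult[of h "- 1"] by simp

lemma \<Lambda>_tendsto:
  assumes g: "g \<in> V" and h: "\<And>j. h j \<in> V" and lim: "(\<lambda>j::nat. N (\<lambda>z. g z - h j z)) \<longlonglongrightarrow> 0"
  shows "(\<lambda>j. \<Lambda> (h j)) \<longlonglongrightarrow> \<Lambda> g"
proof -
  have "(\<lambda>j. ennreal K * N (\<lambda>z. g z - h j z)) \<longlonglongrightarrow> ennreal K * 0"
    by (intro ennreal_tendsto_cmult lim) simp
  then have lim0: "(\<lambda>j. ennreal K * N (\<lambda>z. g z - h j z)) \<longlonglongrightarrow> 0" by simp
  have "ennreal (norm (\<Lambda> g - \<Lambda> (h j))) \<le> ennreal K * N (\<lambda>z. g z - h j z)" for j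
    using \<Lambda>_bounded[OF V_diff[OF g h]] by (simp add: \<Lambda>_diff[OF g h])
  then have "(\<lambda>j. ennreal (norm (\<Lambda> g - \<Lambda> (h j)))) \<longlonglongrightarrow> 0"
    by (intro tendsto_sandwich[OF _ _ tendsto_const lim0] always_eventually allI) auto
  then have "(\<lambda>j. norm (\<Lambda> g - \<Lambda> (h j))) \<longlonglongrightarrow> 0"
    by (simp add: ennreal_0[symmetric] tendsto_ennreal_iff del: ennreal_0)
  then have "(\<lambda>j. \<Lambda> g - \<Lambda> (h j)) \<longlonglongrightarrow> 0" by (rule tendsto_norm_zero_cancel)
  then have "(\<lambda>j. \<Lambda> g - (\<Lambda> g - \<Lambda> (h j))) \<longlonglongrightarrow> \<Lambda> g - 0" by (intro tendsto_diff tendsto_const)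
  then show ?thesis by simp
qed

definition charge :: "(real \<times> 'a) set \<Rightarrow> complex"
  where "charge E = \<Lambda> (\<lambda>z. of_real (\<omega> z) * indicator E z)"

lemma indicator_in_V: "E \<in> sets borel \<Longrightarrow> (\<lambda>z. of_real (\<omega> z) * indicator E z) \<in> V"
  by (rule \<omega>_in_V[where c = 1]) (auto simp: indicator_def)

text \<open>The differences are dominated by \<open>2 * c * \<rho>\<close> after removal of the
  weight in s, which has finite norm, so dominated convergence in the tent norm and boundedness of
  \<Lambda> apply. This gives countable additivity of \<open>charge\<close> as well as the passage
  from simple to bounded functions.\<close>

lemma \<omega>_tendsto:
  fixes b :: "real \<times> 'a \<Rightarrow> complex"
  assumes b [measurable]: "bm b" "\<And>z. norm (b z) \<le> c"
    and e [measurable]: "\<And>j. bm (e j)" "\<And>j z. norm (e j z) \<le> c"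
    and lim: "\<And>z. (\<lambda>j. e j z) \<longlonglongrightarrow> b z"
  shows "(\<lambda>j. \<Lambda> (\<lambda>z. of_real (\<omega> z) * e j z)) \<longlonglongrightarrow> \<Lambda> (\<lambda>z. of_real (\<omega> z) * b z)"
proof (rule \<Lambda>_tendsto[OF \<omega>_in_V[OF b] \<omega>_in_V[OF e]])
  have c: "0 \<le> c" using b(2) norm_ge_zero order_trans by blast
  show "(\<lambda>j. N (\<lambda>z. of_real (\<omega> z) * b z - of_real (\<omega> z) * e j z)) \<longlonglongrightarrow> 0"
  proof (rule N_diff_tendsto_0[OF \<omega>_in_V[OF b], where g' = "\<lambda>z. of_real (\<omega> z) * b z" and H = "\<lambda>z. ennreal (2 * c) * ennreal (\<rho> z)"])
    have "tent p q (wt r (\<lambda>z. ennreal (2 * c) * ennreal (\<rho> z))) = ennreal (2 * c) * tent p q (wt r (\<lambda>z. ennreal (\<rho> z)))"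
      by (intro tent_cmult p0 p q r) measurable
    then show "tent p q (wt r (\<lambda>z. ennreal (2 * c) * ennreal (\<rho> z))) < top"
      using \<rho>_finite by (simp add: ennreal_mult_less_top)
    show "wabs \<beta> (\<lambda>z. of_real (\<omega> z) * b z - of_real (\<omega> z) * e j z) z \<le> ennreal (2 * c) * ennreal (\<rho> z)" for j z
    proof -
      have "norm (b z - e j z) \<le> 2 * c" using norm_triangle_ineq4[of "b z" "e j z"] b(2)[of z] e(2)[of j z] by linarith
      then have "\<rho> z * norm (b z - e j z) \<le> 2 * c * \<rho> z"
        using \<rho>_nonneg[of z] unfolding mult.commute[of "\<rho> z"] by (rule mult_right_mono)
      then show ?thesis using wabs_\<omega>[of "\<lambda>z. b z - e j z" z] c \<rho>_nonneg[of z]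
        by (simp add: right_diff_distrib ennreal_mult[symmetric] ennreal_leI)
    qed
    show "(\<lambda>j. of_real (\<omega> z) * e j z) \<longlonglongrightarrow> of_real (\<omega> z) * b z" for z
      by (intro tendsto_mult tendsto_const lim)
  qed auto
qed

lemma charge_finite_Union:
  assumes "\<And>i::nat. A i \<in> sets borel" "disjoint_family A"
  shows "charge (\<Union>i<n. A i) = (\<Sum>i<n. charge (A i))"
proof (induction n)
  case 0
  have "\<Lambda> (\<lambda>z. 0 * (of_real (\<omega> z) * indicator {} z)) = 0"
    using indicator_in_V[of "{}"] by (subst \<Lambda>_cmult) auto
  then show ?case by (simp add: charge_def)
next
  case (Suc n)
  have disj: "(\<Union>i<n. A i) \<inter> A n = {}"
    using assms(2) by (auto simp: disjoint_family_on_def) (metis IntI empty_iff less_irrefl)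
  have "charge (\<Union>i<Suc n. A i) = \<Lambda> (\<lambda>z. of_real (\<omega> z) * indicator (\<Union>i<n. A i) z + of_real (\<omega> z) * indicator (A n) z)"
    unfolding charge_def using disj
    by (intro arg_cong[where f = \<Lambda>] ext) (auto simp: indicator_def less_Suc_eq)
  also have "\<dots> = charge (\<Union>i<n. A i) + charge (A n)"
    unfolding charge_def using assms(1) by (intro \<Lambda>_add indicator_in_V) auto
  finally show ?case using Suc by simp
qed

lemma charge_sums:
  assumes A: "range A \<subseteq> sets borel" "disjoint_family (A :: nat \<Rightarrow> _)"
  shows "(\<lambda>i. charge (A i)) sums charge (\<Union>i. A i)"
proof -
  have A': "A i \<in> sets borel" for i using A by auto
  have "(\<lambda>n. charge (\<Union>i<n. A i)) \<longlonglongrightarrow> charge (\<Union>i. A i)"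
    unfolding charge_def
  proof (rule \<omega>_tendsto[where c = 1])
    show "(\<lambda>n. indicator (\<Union>i<n. A i) z :: complex) \<longlonglongrightarrow> indicator (\<Union>i. A i) z" for z
    proof (cases "\<exists>i. z \<in> A i")
      case True
      then obtain i where i: "z \<in> A i" by blast
      have "eventually (\<lambda>n. indicator (\<Union>i<n. A i) z = (indicator (\<Union>i. A i) z :: complex)) sequentially"
        using eventually_gt_at_top[of i] by eventually_elim (use i in \<open>auto simp: indicator_def\<close>)
      then show ?thesis by (rule tendsto_eventually)
    qed (simp add: indicator_def)
  qed (use A' in \<open>auto simp: indicator_def\<close>)
  then show ?thesis unfolding sums_def charge_finite_Union[OF A' A(2)] .
qed

lemma charge_bound:
  assumes "E \<in> sets borel"
  shows "norm (charge E) \<le> K * enn2real (tent p q (wt r (\<lambda>z. ennreal (\<rho> z))))"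
proof -
  let ?t = "tent p q (wt r (\<lambda>z. ennreal (\<rho> z)))"
  have "N (\<lambda>z. of_real (\<omega> z) * indicator E z) \<le> ennreal 1 * ?t"
    using assms by (intro N_\<omega>_le) (auto simp: indicator_def)
  then have "ennreal (norm (charge E)) \<le> ennreal K * (ennreal 1 * ?t)"
    unfolding charge_def by (intro order_trans[OF \<Lambda>_bounded[OF indicator_in_V[OF assms]]] mult_left_mono) auto
  also have "\<dots> = ennreal (K * enn2real ?t)" using \<rho>_finite K by (simp add: ennreal_mult)
  finally show ?thesis using K by (simp add: ennreal_le_iff)
qed

lemma charge_null:
  assumes "E \<in> null_sets lborel"
  shows "charge E = 0"
proof -
  have E: "E \<in> sets borel" using assms by (auto simp: null_sets_def)
  have "AE z in lborel. z \<notin> E" using assms by (rule AE_not_in)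
  then have "N (\<lambda>z. of_real (\<omega> z) * indicator E z) \<le> tent p q (wt r (\<lambda>z. 0 * ennreal (\<rho> z)))"
    using E by (subst N_\<omega>) (auto intro!: tent_mono_AE p q elim!: eventually_mono)
  also have "\<dots> = 0 * tent p q (wt r (\<lambda>z. ennreal (\<rho> z)))"
    by (intro tent_cmult p0 p q r) measurable
  finally show ?thesis
    using \<Lambda>_bounded[OF indicator_in_V[OF E]] by (simp add: charge_def ennreal_eq_0_iff)
qed

lemma charge_density:
  obtains \<phi> :: "real \<times> 'a \<Rightarrow> complex" where "integrable lborel \<phi>" "\<And>E. E \<in> sets borel \<Longrightarrow> charge E = (\<integral>z. indicator E z *\<^sub>R \<phi> z \<partial>lborel)"
proof -
  let ?b = "K * enn2real (tent p q (wt r (\<lambda>z. ennreal (\<rho> z))))"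
  have Re: "bounded_charge lborel (\<lambda>E. Re (charge E)) ?b"
  proof unfold_locales
    show "(\<lambda>i. Re (charge (A i))) sums Re (charge (\<Union>i. A i))" if "range A \<subseteq> sets lborel" "disjoint_family A" for A
      using that by (intro sums_Re charge_sums) auto
    show "\<bar>Re (charge S)\<bar> \<le> ?b" if "S \<in> sets lborel" for S
      using order_trans[OF abs_Re_le_cmod charge_bound[of S]] that by simp
  qed (simp add: charge_null)
  have Im: "bounded_charge lborel (\<lambda>E. Im (charge E)) ?b"
  proof unfold_locales
    show "(\<lambda>i. Im (charge (A i))) sums Im (charge (\<Union>i. A i))" if "range A \<subseteq> sets lborel" "disjoint_family A" for A
      using that by (intro sums_Im charge_sums) auto
    show "\<bar>Im (charge S)\<bar> \<le> ?b" if "S \<in> sets lborel" for S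
      using order_trans[OF abs_Im_le_cmod charge_bound[of S]] that by simp
  qed (simp add: charge_null)
  obtain u where u: "integrable lborel u" "\<And>E. E \<in> sets borel \<Longrightarrow> Re (charge E) = (\<integral>z. indicator E z *\<^sub>R u z \<partial>lborel)"
    using bounded_charge_density[OF Re] by auto
  obtain v where v: "integrable lborel v" "\<And>E. E \<in> sets borel \<Longrightarrow> Im (charge E) = (\<integral>z. indicator E z *\<^sub>R v z \<partial>lborel)"
    using bounded_charge_density[OF Im] by auto
  show thesis
  proof (rule that[of "\<lambda>z. of_real (u z) + \<i> * of_real (v z)"])
    show "integrable lborel (\<lambda>z. of_real (u z) + \<i> * of_real (v z) :: complex)"
      using u(1) v(1) by simp
    fix E :: "(real \<times> 'a) set" assume E: "E \<in> sets borel"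
    have i: "integrable lborel (\<lambda>z. indicator E z *\<^sub>R u z)" "integrable lborel (\<lambda>z. indicator E z *\<^sub>R v z)"
      using E by (auto intro!: integrable_mult_indicator[OF _ u(1)] integrable_mult_indicator[OF _ v(1)] simp del: real_scaleR_def)
    have i': "integrable lborel (\<lambda>z. complex_of_real (indicator E z *\<^sub>R u z))"
      "integrable lborel (\<lambda>z. \<i> * complex_of_real (indicator E z *\<^sub>R v z))"
      using i by (auto intro!: integrable_of_real simp del: real_scaleR_def of_real_mult)
    have "(\<integral>z. indicator E z *\<^sub>R (of_real (u z) + \<i> * of_real (v z)) \<partial>lborel) =
      (\<integral>z. of_real (indicator E z *\<^sub>R u z) + \<i> * of_real (indicator E z *\<^sub>R v z) \<partial>lborel)"
      by (intro Bochner_Integration.integral_cong) (auto simp: indicator_def)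
    also have "\<dots> = of_real (\<integral>z. indicator E z *\<^sub>R u z \<partial>lborel) + \<i> * of_real (\<integral>z. indicator E z *\<^sub>R v z \<partial>lborel)"
      by (simp only: Bochner_Integration.integral_add[OF i'] integral_mult_right_zero integral_complex_of_real)
    also have "\<dots> = charge E"
      unfolding u(2)[OF E, symmetric] v(2)[OF E, symmetric] by (rule complex_eq[symmetric])
    finally show "charge E = (\<integral>z. indicator E z *\<^sub>R (of_real (u z) + \<i> * of_real (v z)) \<partial>lborel)" ..
  qed
qed

text \<open>Level sets reduce the claim to \<open>charge\<close>; conjugate linearity of \<Lambda>
  produces the conjugate under the integral. Membership and integrability are carried along because
  the induction step adds functions and integrals.\<close>

lemma \<Lambda>_simple:
  fixes b :: "real \<times> 'a \<Rightarrow> complex"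
  assumes \<phi>: "integrable lborel \<phi>" "\<And>E. E \<in> sets borel \<Longrightarrow> charge E = (\<integral>z. indicator E z *\<^sub>R \<phi> z \<partial>lborel)"
    and b [measurable]: "bm b" and Y: "finite Y"
  shows "(\<lambda>z. of_real (\<omega> z) * (\<Sum>y\<in>Y. y * indicator (b -` {y}) z)) \<in> V \<and>
    \<Lambda> (\<lambda>z. of_real (\<omega> z) * (\<Sum>y\<in>Y. y * indicator (b -` {y}) z)) =
    (\<integral>z. \<phi> z * cnj (\<Sum>y\<in>Y. y * indicator (b -` {y}) z) \<partial>lborel) \<and>
    integrable lborel (\<lambda>z. \<phi> z * cnj (\<Sum>y\<in>Y. y * indicator (b -` {y}) z))" using Y
proof induction
  case empty
  have V: "(\<lambda>z. of_real (\<omega> z) * indicator {} z) \<in> V" by (rule indicator_in_V) simp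
  have "\<Lambda> (\<lambda>z. 0) = 0" "(\<lambda>z. 0) \<in> V"
    using \<Lambda>_cmult[OF V, of 0] V_cmult[OF V, of 0] by simp_all
  then show ?case by simp
next
  case (insert y Y)
  let ?s = "\<lambda>z. \<Sum>y\<in>Y. y * indicator (b -` {y}) z"
  have E: "b -` {y} \<in> sets borel" using measurable_sets[OF b, of "{y}"] by simp
  have eq: "(\<lambda>z. of_real (\<omega> z) * (\<Sum>y\<in>insert y Y. y * indicator (b -` {y}) z)) =
    (\<lambda>z. y * (of_real (\<omega> z) * indicator (b -` {y}) z) + of_real (\<omega> z) * ?s z)"
    unfolding sum.insert[OF insert.hyps] distrib_left by (simp only: mult.left_commute)
  have i1: "integrable lborel (\<lambda>z. cnj y * (indicator (b -` {y}) z *\<^sub>R \<phi> z))"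
    using E by (intro integrable_mult_right integrable_mult_indicator[OF _ \<phi>(1)]) simp
  have i2: "integrable lborel (\<lambda>z. \<phi> z * cnj (?s z))" using insert.IH by blast
  have eq2: "\<phi> z * cnj (\<Sum>y\<in>insert y Y. y * indicator (b -` {y}) z) =
    cnj y * (indicator (b -` {y}) z *\<^sub>R \<phi> z) + \<phi> z * cnj (?s z)" for z
    using insert.hyps by (simp add: algebra_simps indicator_def)
  have "\<Lambda> (\<lambda>z. y * (of_real (\<omega> z) * indicator (b -` {y}) z) + of_real (\<omega> z) * ?s z) =
    cnj y * charge (b -` {y}) + \<Lambda> (\<lambda>z. of_real (\<omega> z) * ?s z)"
    unfolding charge_def using insert.IH indicator_in_V[OF E]
    by (subst \<Lambda>_add) (auto intro: V_cmult simp: \<Lambda>_cmult)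
  also have "\<dots> = (\<integral>z. cnj y * (indicator (b -` {y}) z *\<^sub>R \<phi> z) \<partial>lborel) + (\<integral>z. \<phi> z * cnj (?s z) \<partial>lborel)"
    unfolding \<phi>(2)[OF E] integral_mult_right_zero using insert.IH by (simp only:)
  also have "\<dots> = (\<integral>z. cnj y * (indicator (b -` {y}) z *\<^sub>R \<phi> z) + \<phi> z * cnj (?s z) \<partial>lborel)"
    by (rule Bochner_Integration.integral_add[symmetric, OF i1 i2])
  finally show ?case unfolding eq eq2 using insert.IH indicator_in_V[OF E] i1 i2
    by (auto intro!: V_add[OF V_cmult])
qed

lemma \<Lambda>_bounded_borel:
  fixes b :: "real \<times> 'a \<Rightarrow> complex"
  assumes \<phi>: "integrable lborel \<phi>" "\<And>E. E \<in> sets borel \<Longrightarrow> charge E = (\<integral>z. indicator E z *\<^sub>R \<phi> z \<partial>lborel)"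
    and b [measurable]: "bm b" and bj: "\<And>z. norm (b z) \<le> c"
  shows "\<Lambda> (\<lambda>z. of_real (\<omega> z) * b z) = (\<integral>z. \<phi> z * cnj (b z) \<partial>lborel)"
proof -
  have c: "0 \<le> c" using bj norm_ge_zero order_trans by blast
  have [measurable]: "bm \<phi>" using \<phi>(1) by simp
  obtain F where F: "\<And>i. simple_function lborel (F i)" "\<And>x. (\<lambda>i. F i x) \<longlonglongrightarrow> b x"
    "\<And>i x. dist (F i x) 0 \<le> 2 * dist (b x) 0"
    using borel_measurable_implies_sequence_metric[of b lborel 0] by auto
  have F_meas [measurable]: "bm (F i)" for i using borel_measurable_simple_function[OF F(1)[of i]] by simp
  have F_le: "norm (F i z) \<le> 2 * c" for i z using F(3)[of i z] bj[of z] by simp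
  have F_eq: "F i z = (\<Sum>y\<in>range (F i). y * indicator (F i -` {y}) z)" for i z
  proof -
    have fin: "finite (range (F i))" using F(1)[of i] by (simp add: simple_function_def)
    have "(\<Sum>y\<in>range (F i). y * indicator (F i -` {y}) z) = (\<Sum>y\<in>range (F i). if y = F i z then y else 0)"
      by (intro sum.cong) (auto simp: indicator_def)
    also have "\<dots> = F i z" using fin by simp
    finally show ?thesis ..
  qed
  have "\<Lambda> (\<lambda>z. of_real (\<omega> z) * F i z) = (\<integral>z. \<phi> z * cnj (F i z) \<partial>lborel)" for i
  proof -
    have fin: "finite (range (F i))" using F(1)[of i] by (simp add: simple_function_def)
    show ?thesis using \<Lambda>_simple[OF \<phi> F_meas[of i] fin] unfolding F_eq[symmetric] by simp
  qed
  moreover have "(\<lambda>i. \<Lambda> (\<lambda>z. of_real (\<omega> z) * F i z)) \<longlonglongrightarrow> \<Lambda> (\<lambda>z. of_real (\<omega> z) * b z)"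
    using bj c by (intro \<omega>_tendsto[where c = "2 * c"] F_le F(2) F_meas b) (auto intro: order_trans[of _ c])
  moreover have "(\<lambda>i. \<integral>z. \<phi> z * cnj (F i z) \<partial>lborel) \<longlonglongrightarrow> (\<integral>z. \<phi> z * cnj (b z) \<partial>lborel)"
  proof (rule integral_dominated_convergence[where w = "\<lambda>z. 2 * c * norm (\<phi> z)"])
    show "integrable lborel (\<lambda>z. 2 * c * norm (\<phi> z))" using \<phi>(1) by simp
    show "AE z in lborel. norm (\<phi> z * cnj (F i z)) \<le> 2 * c * norm (\<phi> z)" for i
      unfolding norm_mult complex_mod_cnj mult.commute[of "norm (\<phi> _)"] by (intro AE_I2 mult_right_mono F_le) simp
    show "AE z in lborel. (\<lambda>i. \<phi> z * cnj (F i z)) \<longlonglongrightarrow> \<phi> z * cnj (b z)"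
      using F(2) by (intro AE_I2 tendsto_mult tendsto_const tendsto_cnj)
  qed measurable
  ultimately show ?thesis using LIMSEQ_unique by simp
qed

text \<open>The density of the charge represents \<Lambda> on bounded multiples of \<omega>. That
  \<open>f\<close> lies in the dual tent space comes from \<open>converse_norm\<close>, and only
  then is its pairing with a general \<open>g\<close> known to be integrable, which permits the
  final passage to the limit.\<close>

lemma representation: "\<exists>f\<in>V'. \<forall>g\<in>V. \<Lambda> g = (\<integral>z. f z * cnj (g z) \<partial>dyds_over_s)"
proof -
  obtain \<phi> :: "real \<times> 'a \<Rightarrow> complex" where \<phi>: "integrable lborel \<phi>"
    "\<And>E. E \<in> sets borel \<Longrightarrow> charge E = (\<integral>z. indicator E z *\<^sub>R \<phi> z \<partial>lborel)"
    by (rule charge_density) blast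
  have [measurable]: "bm \<phi>" using \<phi>(1) by simp
  have [measurable]: "bm (\<lambda>z :: real \<times> 'a. fst z)" by (rule borel_measurable_compose_fst) simp
  \<comment> \<open>Compensates for the factor \<omega> in the test functions and for the density 1
    / s of \<open>dyds_over_s\<close>: on the half-space \<open>f * \<omega> / s\<close> is
    \<phi>.\<close>
  define f where "f z = (fst z / \<omega> z) *\<^sub>R \<phi> z" for z
  have f_meas [measurable]: "bm f" unfolding f_def by measurable
  have f_hs: "half_space_measurable f" by (rule borel_imp_half_space_measurable) measurable
  have f\<omega>: "(1 / fst z) *\<^sub>R (f z * cnj (of_real (\<omega> z) * y)) = \<phi> z * cnj y" if "z \<in> half_space" for z y
    using \<omega>_pos[OF that] that by (simp add: f_def half_space_def scaleR_conv_of_real mem_Times_iff field_simps)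
  have pair: "(\<integral>z. f z * cnj (of_real (\<omega> z) * b z) \<partial>dyds_over_s) = \<Lambda> (\<lambda>z. of_real (\<omega> z) * b z)"
    if b [measurable]: "bm b" and bc: "\<And>z. norm (b z) \<le> c" for b c
  proof -
    let ?b = "\<lambda>z. indicator half_space z *\<^sub>R b z"
    have c: "0 \<le> c" using bc norm_ge_zero order_trans by blast
    have "(\<integral>z. f z * cnj (of_real (\<omega> z) * b z) \<partial>dyds_over_s) =
      (\<integral>z. indicator half_space z *\<^sub>R (1 / fst z) *\<^sub>R (f z * cnj (of_real (\<omega> z) * b z)) \<partial>lborel)"
      by (rule integral_dyds) measurable
    also have "\<dots> = (\<integral>z. \<phi> z * cnj (?b z) \<partial>lborel)"
    proof (intro Bochner_Integration.integral_cong refl)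
      fix z
      show "indicator half_space z *\<^sub>R (1 / fst z) *\<^sub>R (f z * cnj (of_real (\<omega> z) * b z)) = \<phi> z * cnj (?b z)"
        using f\<omega>[of z "b z"] by (cases "z \<in> half_space") simp_all
    qed
    also have "\<dots> = \<Lambda> (\<lambda>z. of_real (\<omega> z) * ?b z)"
      using bc c by (intro \<Lambda>_bounded_borel[symmetric, OF \<phi>, where c = c]) (auto simp: indicator_def)
    also have "(\<lambda>z. of_real (\<omega> z) * ?b z) = (\<lambda>z. of_real (\<omega> z) * b z)"
      using \<omega>_zero by (intro ext) (auto simp: indicator_def)
    finally show ?thesis .
  qed
  have f_fin: "hs_int (\<lambda>z. ennreal (norm (f z) * \<omega> z)) < top"
  proof -
    have "hs_int (\<lambda>z. ennreal (norm (f z) * \<omega> z)) \<le> (NN z. ennreal (norm (\<phi> z)))"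
      unfolding hs_int_def
    proof (intro nn_integral_mono)
      fix z
      show "ennreal (norm (f z) * \<omega> z) * (ennreal (1 / fst z) * indicator half_space z) \<le> ennreal (norm (\<phi> z))"
      proof (cases "z \<in> half_space")
        case True
        then have s: "0 < fst z" by (auto simp: half_space_def)
        have "norm (f z) * \<omega> z * (1 / fst z) = norm (\<phi> z)"
          using \<omega>_pos[OF True] s by (simp add: f_def)
        then show ?thesis using True s \<omega>_nonneg[of z] by (simp add: ennreal_mult[symmetric])
      qed simp
    qed
    also have "\<dots> < top" using \<phi>(1) by (simp add: integrable_iff_bounded)
    finally show ?thesis .
  qed
  obtain C where C: "\<forall>(f :: real \<times> 'a \<Rightarrow> complex) D::real. bm f \<longrightarrow> 0 \<le> D \<longrightarrow>
    hs_int (\<lambda>z. ennreal (norm (f z) * \<omega> z)) < top \<longrightarrow>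
    (\<forall>b\<in>borel_measurable borel. \<forall>j::nat. (\<forall>z. norm (b z) \<le> real j) \<longrightarrow>
      ennreal (norm (\<integral>z. f z * cnj (of_real (\<omega> z) * b z) \<partial>dyds_over_s)) \<le> ennreal D * N (\<lambda>z. of_real (\<omega> z) * b z)) \<longrightarrow>
    N' f \<le> ennreal (C * D)" using converse_norm by blast
  have "N' f \<le> ennreal (C * K)"
  proof (rule C[rule_format, OF f_meas K f_fin])
    fix b :: "real \<times> 'a \<Rightarrow> complex" and j :: nat
    assume b: "bm b" "\<And>z. norm (b z) \<le> real j"
    show "ennreal (norm (\<integral>z. f z * cnj (of_real (\<omega> z) * b z) \<partial>dyds_over_s)) \<le> ennreal K * N (\<lambda>z. of_real (\<omega> z) * b z)"
      using b by (subst pair[of b "real j"]) (auto intro!: \<Lambda>_bounded \<omega>_in_V[where c = "real j"])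
  qed
  then have fV': "f \<in> V'" using f_hs by (auto simp: tent_space_def intro: le_less_trans)
  have "\<Lambda> g = (\<integral>z. f z * cnj (g z) \<partial>dyds_over_s)" if g: "g \<in> V" for g
  proof -
    have gm: "half_space_measurable g" using g by (simp add: V_iff)
    obtain g' where g' [measurable]: "bm g'" and ae: "AE z\<in>half_space in lborel. g z = g' z"
      and g'0: "\<And>z. z \<notin> half_space \<Longrightarrow> g' z = 0"
      by (rule borel_version_zero[OF gm]) blast
    \<comment> \<open>The product of \<omega> and \<open>b j\<close> equals \<open>g'\<close> where
      the latter is at most \<open>j * \<omega>\<close> and is 0 elsewhere, so both it and its
      difference from \<open>g'\<close> are dominated by the modulus of \<open>g'\<close>.\<close>
    define b where "b j z = (if norm (g' z) \<le> real j * \<omega> z then g' z / of_real (\<omega> z) else 0)" for j :: nat and z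
    have [measurable]: "bm (b j)" for j unfolding b_def by measurable
    have bj: "norm (b j z) \<le> real j" for j z
    proof (cases "\<omega> z = 0")
      case False
      then have "0 < \<omega> z" using \<omega>_nonneg[of z] by simp
      then show ?thesis by (auto simp: b_def norm_divide divide_le_eq)
    qed (simp add: b_def)
    have \<omega>b: "of_real (\<omega> z) * b j z = (if norm (g' z) \<le> real j * \<omega> z then g' z else 0)" for j z
    proof (cases "z \<in> half_space")
      case True
      then show ?thesis using \<omega>_pos[OF True] by (simp add: b_def)
    qed (simp add: g'0 \<omega>_zero)
    have \<omega>b_V: "(\<lambda>z. of_real (\<omega> z) * b j z) \<in> V" for j
      by (rule \<omega>_in_V[OF _ bj]) measurable
    have lim: "(\<lambda>j. of_real (\<omega> z) * b j z) \<longlonglongrightarrow> g' z" for z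
    proof (cases "z \<in> half_space")
      case True
      obtain j0 :: nat where j0: "norm (g' z) / \<omega> z < real j0" using reals_Archimedean2 by blast
      have "eventually (\<lambda>j. of_real (\<omega> z) * b j z = g' z) sequentially"
        using eventually_ge_at_top[of j0]
      proof eventually_elim
        case (elim j)
        then have "norm (g' z) / \<omega> z \<le> real j" using j0 by linarith
        then have "norm (g' z) \<le> real j * \<omega> z" using \<omega>_pos[OF True] by (simp add: divide_le_eq)
        then show ?case unfolding \<omega>b by simp
      qed
      then show ?thesis by (rule tendsto_eventually)
    qed (simp add: g'0 \<omega>_zero)
    have Ng: "tent p q (wt r (wabs \<beta> g')) = N g"
      using ae by (intro tent_norm_eq[symmetric] gm) (auto elim!: eventually_mono simp: wabs_def)
    have "(\<lambda>j. \<Lambda> (\<lambda>z. of_real (\<omega> z) * b j z)) \<longlonglongrightarrow> \<Lambda> g"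
    proof (rule \<Lambda>_tendsto[OF g \<omega>b_V], rule N_diff_tendsto_0[OF g g' ae, where H = "wabs \<beta> g'"])
      show "bm (wabs \<beta> g')" by (rule wabs_borel_measurable[OF g'])
      show "tent p q (wt r (wabs \<beta> g')) < top" unfolding Ng using g by (simp add: V_iff)
      show "wabs \<beta> (\<lambda>z. g' z - of_real (\<omega> z) * b j z) z \<le> wabs \<beta> g' z" for j z
        unfolding \<omega>b wabs_def by simp
    qed (use lim in auto)
    moreover have "(\<lambda>j. \<integral>z. f z * cnj (of_real (\<omega> z) * b j z) \<partial>dyds_over_s) \<longlonglongrightarrow> (\<integral>z. f z * cnj (g z) \<partial>dyds_over_s)"
    proof (rule integral_dominated_convergence[where w = "\<lambda>z. norm (f z * cnj (g z))"])
      show "integrable dyds_over_s (\<lambda>z. norm (f z * cnj (g z)))"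
        by (intro integrable_norm pairing_integrable fV' g)
      show "(\<lambda>z. f z * cnj (g z)) \<in> borel_measurable dyds_over_s"
        using pairing_integrable[OF fV' g] by simp
      show "(\<lambda>z. f z * cnj (of_real (\<omega> z) * b j z)) \<in> borel_measurable dyds_over_s" for j
        using pairing_integrable[OF fV' \<omega>b_V[of j]] by simp
      show "AE z in dyds_over_s. (\<lambda>j. f z * cnj (of_real (\<omega> z) * b j z)) \<longlonglongrightarrow> f z * cnj (g z)"
        unfolding AE_dyds_iff using ae
      proof eventually_elim
        case (elim z)
        have "(\<lambda>j. f z * cnj (of_real (\<omega> z) * b j z)) \<longlonglongrightarrow> f z * cnj (g' z)"
          by (intro tendsto_mult tendsto_const tendsto_cnj lim)
        then show ?case using elim by auto
      qed
      show "AE z in dyds_over_s. norm (f z * cnj (of_real (\<omega> z) * b j z)) \<le> norm (f z * cnj (g z))" for j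
        unfolding AE_dyds_iff using ae
      proof eventually_elim
        case (elim z)
        then show ?case unfolding \<omega>b by (auto simp: norm_mult)
      qed
    qed
    moreover have "\<Lambda> (\<lambda>z. of_real (\<omega> z) * b j z) = (\<integral>z. f z * cnj (of_real (\<omega> z) * b j z) \<partial>dyds_over_s)" for j
      by (rule pair[symmetric, OF _ bj]) measurable
    ultimately show ?thesis using LIMSEQ_unique by simp
  qed
  then show ?thesis using fV' by blast
qed

end

section \<open>Identification of the anti-dual\<close>

context weighted_tent
begin

lemma Holder: "\<exists>C>0. \<forall>f\<in>V'. \<forall>g\<in>V.
  ennreal (norm (\<integral>z. f z * cnj (g z) \<partial>dyds_over_s)) \<le> ennreal C * N' f * N g"
proof -
  obtain C where C: "C > 0" "\<And>f g :: real \<times> 'a \<Rightarrow> complex. half_space_measurable f \<Longrightarrow> half_space_measurable g \<Longrightarrow>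
    (\<integral>\<^sup>+ z. ennreal (norm (f z) * norm (g z)) \<partial>dyds_over_s) \<le> ennreal C * N' f * N g"
    using tent_norm_Holder[OF p r q] by blast
  have "ennreal (norm (\<integral>z. f z * cnj (g z) \<partial>dyds_over_s)) \<le> ennreal C * N' f * N g" if fg: "f \<in> V'" "g \<in> V" for f g
  proof -
    have "ennreal (norm (\<integral>z. f z * cnj (g z) \<partial>dyds_over_s)) \<le> (\<integral>\<^sup>+ z. ennreal (norm (f z * cnj (g z))) \<partial>dyds_over_s)"
      by (rule integral_norm_bound_ennreal[OF pairing_integrable[OF fg]])
    also have "\<dots> \<le> ennreal C * N' f * N g"
      using C(2)[of f g] fg by (simp add: tent_space_def norm_mult)
    finally show ?thesis .
  qed
  then show ?thesis using C(1) by blast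
qed

lemma pairing_linear:
  assumes "f1 \<in> V'" "f2 \<in> V'" "g \<in> V"
  shows "L2_pairing V (\<lambda>z. a * f1 z + b * f2 z) g = a * L2_pairing V f1 g + b * L2_pairing V f2 g"
proof -
  note i = pairing_integrable[OF assms(1,3)] pairing_integrable[OF assms(2,3)]
  have "(\<integral>z. (a * f1 z + b * f2 z) * cnj (g z) \<partial>dyds_over_s) =
    (\<integral>z. a * (f1 z * cnj (g z)) + b * (f2 z * cnj (g z)) \<partial>dyds_over_s)"
    by (simp add: algebra_simps)
  also have "\<dots> = a * (\<integral>z. f1 z * cnj (g z) \<partial>dyds_over_s) + b * (\<integral>z. f2 z * cnj (g z) \<partial>dyds_over_s)"
    by (subst Bochner_Integration.integral_add[OF integrable_mult_right[OF i(1)] integrable_mult_right[OF i(2)]])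
      (simp only: integral_mult_right_zero)
  finally show ?thesis using assms(3) by (simp add: L2_pairing_def)
qed

lemma pairing_in_anti_dual:
  assumes f: "f \<in> V'"
  shows "L2_pairing V f \<in> anti_dual V N"
proof -
  obtain C where C: "C > 0" "\<forall>f\<in>V'. \<forall>g\<in>V. ennreal (norm (\<integral>z. f z * cnj (g z) \<partial>dyds_over_s)) \<le> ennreal C * N' f * N g"
    using Holder by blast
  have add: "L2_pairing V f (\<lambda>z. g z + h z) = L2_pairing V f g + L2_pairing V f h" if gh: "g \<in> V" "h \<in> V" for g h
    using gh V_add[OF gh] Bochner_Integration.integral_add[OF pairing_integrable[OF f gh(1)] pairing_integrable[OF f gh(2)]]
    by (simp add: L2_pairing_def distrib_left)
  have cmult: "L2_pairing V f (\<lambda>z. c * g z) = cnj c * L2_pairing V f g" if g: "g \<in> V" for c g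
    using g V_cmult[OF g, of c] by (simp add: L2_pairing_def mult.left_commute[of _ "cnj c"])
  have "ennreal (norm (L2_pairing V f g)) \<le> ennreal (C * enn2real (N' f)) * N g" if g: "g \<in> V" for g
  proof -
    have "ennreal (C * enn2real (N' f)) = ennreal C * N' f"
      using f C(1) by (simp add: ennreal_mult tent_space_def)
    then show ?thesis using C(2) f g by (simp add: L2_pairing_def)
  qed
  then show ?thesis using add cmult unfolding anti_dual_def by (auto simp: L2_pairing_def)
qed

lemma anti_dual_imp_pairing:
  assumes "\<Lambda> \<in> anti_dual V N"
  shows "\<Lambda> \<in> L2_pairing V ` V'"
proof -
  obtain C :: real where C: "\<And>g. g \<in> V \<Longrightarrow> ennreal (norm (\<Lambda> g)) \<le> ennreal C * N g"
    using assms unfolding anti_dual_def by blast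
  interpret tent_functional p q r \<beta> \<rho> \<Lambda> "max 0 C"
  proof unfold_locales
    show "ennreal (norm (\<Lambda> g)) \<le> ennreal (max 0 C) * N g" if "g \<in> V" for g
      by (rule order_trans[OF C[OF that]]) (intro mult_right_mono ennreal_leI; simp)
  qed (use assms in \<open>auto simp: anti_dual_def\<close>)
  obtain f where f: "f \<in> V'" "\<And>g. g \<in> V \<Longrightarrow> \<Lambda> g = (\<integral>z. f z * cnj (g z) \<partial>dyds_over_s)"
    using representation by blast
  have "\<Lambda> = L2_pairing V f"
    using assms f(2) by (intro extensionalityI[of _ V]) (auto simp: L2_pairing_def anti_dual_def)
  then show ?thesis using f(1) by blast
qed

text \<open>Tested with \<omega> times the sign of a Borel version of \<open>f\<close>, the pairing
  becomes the integral of \<omega> times the modulus of \<open>f\<close>, and \<omega> is positive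
  on the half-space.\<close>

lemma pairing_zero_imp_AE:
  assumes m: "half_space_measurable f" and int: "\<And>g. g \<in> V \<Longrightarrow> integrable dyds_over_s (\<lambda>z. f z * cnj (g z))"
    and zero: "\<And>g. g \<in> V \<Longrightarrow> (\<integral>z. f z * cnj (g z) \<partial>dyds_over_s) = 0"
  shows "AE z\<in>half_space in lborel. f z = 0"
proof -
  obtain f' where f' [measurable]: "bm f'" and ae: "AE z\<in>half_space in lborel. f z = f' z"
    using half_space_borel_version[OF m] .
  define u where "u z = \<omega> z * norm (f' z)" for z
  have [measurable]: "bm u" unfolding u_def by measurable
  have u_meas: "(\<lambda>z. complex_of_real (u z)) \<in> borel_measurable dyds_over_s"
    unfolding measurable_dyds_iff by (rule borel_imp_half_space_measurable) measurable
  have g: "(\<lambda>z. of_real (\<omega> z) * sgn (f' z)) \<in> V"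
  proof (rule \<omega>_in_V[where c = 1])
    show "bm (\<lambda>z. sgn (f' z))" unfolding sgn_div_norm by measurable
  qed (simp add: norm_sgn)
  have eq: "AE z in dyds_over_s. f z * cnj (of_real (\<omega> z) * sgn (f' z)) = of_real (u z)"
    unfolding AE_dyds_iff using ae
  proof eventually_elim
    case (elim z)
    have "f' z * cnj (of_real (\<omega> z) * sgn (f' z)) = of_real (\<omega> z) * (f' z * cnj (sgn (f' z)))"
      by simp
    also have "\<dots> = of_real (u z)" unfolding mult_cnj_sgn u_def by simp
    finally show ?case using elim by simp
  qed
  have int_u: "integrable dyds_over_s (\<lambda>z. complex_of_real (u z))"
    using int[OF g] u_meas eq by (rule integrable_cong_AE_imp)
  have "complex_of_real (\<integral>z. u z \<partial>dyds_over_s) = (\<integral>z. f z * cnj (of_real (\<omega> z) * sgn (f' z)) \<partial>dyds_over_s)"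
    unfolding integral_complex_of_real[symmetric]
    by (rule integral_cong_AE[OF u_meas borel_measurable_integrable[OF int[OF g]]])
      (use eq in \<open>auto elim!: eventually_mono\<close>)
  then have "(\<integral>z. u z \<partial>dyds_over_s) = 0" unfolding zero[OF g] by simp
  moreover have "integrable dyds_over_s u" using int_u by (simp only: complex_of_real_integrable_eq)
  moreover have "0 \<le> u z" for z using \<omega>_nonneg[of z] by (simp add: u_def)
  ultimately have "AE z in dyds_over_s. u z = 0" by (subst (asm) integral_nonneg_eq_0_iff_AE) auto
  then show ?thesis unfolding AE_dyds_iff using ae
  proof eventually_elim
    case (elim z)
    then show ?case using \<omega>_pos[of z] by (auto simp: u_def)
  qed
qed

lemma pairing_eq_iff:
  assumes f: "f1 \<in> V'" "f2 \<in> V'"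
  shows "L2_pairing V f1 = L2_pairing V f2 \<longleftrightarrow> (AE z in lebesgue_on half_space. f1 z = f2 z)"
  unfolding AE_half_space_iff
proof
  assume eq: "L2_pairing V f1 = L2_pairing V f2"
  have m: "half_space_measurable f1" "half_space_measurable f2" using f by (auto simp: tent_space_def)
  have eq': "(\<integral>z. f1 z * cnj (g z) \<partial>dyds_over_s) = (\<integral>z. f2 z * cnj (g z) \<partial>dyds_over_s)" if "g \<in> V" for g
    using fun_cong[OF eq, of g] that by (simp add: L2_pairing_def)
  define h where "h z = f1 z - f2 z" for z
  have "AE z\<in>half_space in lborel. h z = 0"
  proof (rule pairing_zero_imp_AE)
    show "half_space_measurable h" unfolding h_def using m by measurable
    fix g assume g: "g \<in> V"
    note i = pairing_integrable[OF f(1) g] pairing_integrable[OF f(2) g]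
    show "integrable dyds_over_s (\<lambda>z. h z * cnj (g z))"
      unfolding h_def left_diff_distrib by (intro Bochner_Integration.integrable_diff i)
    show "(\<integral>z. h z * cnj (g z) \<partial>dyds_over_s) = 0"
      unfolding h_def left_diff_distrib using i eq'[OF g] by simp
  qed
  then show "AE z\<in>half_space in lborel. f1 z = f2 z" by (simp add: h_def)
next
  assume ae: "AE z\<in>half_space in lborel. f1 z = f2 z"
  have "(\<integral>z. f1 z * cnj (g z) \<partial>dyds_over_s) = (\<integral>z. f2 z * cnj (g z) \<partial>dyds_over_s)" if g: "g \<in> V" for g
  proof (rule integral_cong_AE)
    show "AE z in dyds_over_s. f1 z * cnj (g z) = f2 z * cnj (g z)"
      unfolding AE_dyds_iff using ae by eventually_elim simp
  qed (use pairing_integrable[OF _ g] f in auto)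
  then show "L2_pairing V f1 = L2_pairing V f2" by (auto simp: L2_pairing_def restrict_def)
qed

text \<open>Scaling to norm 1 covers all elements except those of norm 0, on which the boundedness
  of \<Lambda> gives the value 0.\<close>

lemma anti_dual_norm_bound:
  assumes \<Lambda>: "\<Lambda> \<in> anti_dual V N" and g: "g \<in> V"
  shows "ennreal (norm (\<Lambda> g)) \<le> anti_dual_norm V N \<Lambda> * N g"
proof (cases "N g = 0")
  case True
  obtain C :: real where "\<forall>g\<in>V. ennreal (norm (\<Lambda> g)) \<le> ennreal C * N g"
    using \<Lambda> unfolding anti_dual_def by blast
  then show ?thesis using g True by fastforce
next
  case False
  have gm: "half_space_measurable g" "N g < top" using g by (auto simp: V_iff)
  obtain n where n: "N g = ennreal n" "0 < n" using gm(2) False by (cases "N g") (auto simp: less_le)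
  let ?h = "\<lambda>z. complex_of_real (1 / n) * g z"
  have h: "?h \<in> V" using g by (rule V_cmult)
  have "N ?h = 1" using n by (subst N_cmult[OF gm(1)]) (simp add: ennreal_mult[symmetric] norm_divide)
  then have "ennreal (norm (\<Lambda> ?h)) \<le> anti_dual_norm V N \<Lambda>"
    unfolding anti_dual_norm_def using h by (intro SUP_upper) (simp del: times_divide_eq_left mult_1 of_real_divide)
  moreover have "\<Lambda> ?h = cnj (of_real (1 / n)) * \<Lambda> g" using \<Lambda> g unfolding anti_dual_def by blast
  then have "ennreal (norm (\<Lambda> g)) = ennreal (norm (\<Lambda> ?h)) * ennreal n"
    using n(2) by (simp add: norm_divide ennreal_mult[symmetric])
  ultimately show ?thesis unfolding n(1) by (simp add: mult_right_mono)
qed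

lemma pairing_norm_upper: "\<exists>C>0. \<forall>f\<in>V'. anti_dual_norm V N (L2_pairing V f) \<le> ennreal C * N' f"
proof -
  obtain C where C: "C > 0" "\<forall>f\<in>V'. \<forall>g\<in>V. ennreal (norm (\<integral>z. f z * cnj (g z) \<partial>dyds_over_s)) \<le> ennreal C * N' f * N g"
    using Holder by blast
  have "anti_dual_norm V N (L2_pairing V f) \<le> ennreal C * N' f" if f: "f \<in> V'" for f
    unfolding anti_dual_norm_def
  proof (rule SUP_least)
    fix g assume g: "g \<in> {g \<in> V. N g \<le> 1}"
    then have "ennreal (norm (L2_pairing V f g)) \<le> ennreal C * N' f * N g" using C(2) f by (simp add: L2_pairing_def)
    also have "\<dots> \<le> ennreal C * N' f * 1" using g by (intro mult_left_mono) auto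
    finally show "ennreal (norm (L2_pairing V f g)) \<le> ennreal C * N' f" by simp
  qed
  then show ?thesis using C(1) by blast
qed

text \<open>\<open>converse_norm\<close> is applied with \<open>D\<close> the dual norm of the
  functional, finite by the upper estimate. It speaks of Borel functions, so \<open>f\<close> is
  replaced by a Borel version with the same norm and the same pairing.\<close>

lemma pairing_norm_lower: "\<exists>c>0. \<forall>f\<in>V'. ennreal c * N' f \<le> anti_dual_norm V N (L2_pairing V f)"
proof -
  obtain C where C0: "C > 0" and C: "\<forall>(f :: real \<times> 'a \<Rightarrow> complex) D::real. bm f \<longrightarrow> 0 \<le> D \<longrightarrow>
    hs_int (\<lambda>z. ennreal (norm (f z) * \<omega> z)) < top \<longrightarrow>
    (\<forall>b\<in>borel_measurable borel. \<forall>j::nat. (\<forall>z. norm (b z) \<le> real j) \<longrightarrow>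
      ennreal (norm (\<integral>z. f z * cnj (of_real (\<omega> z) * b z) \<partial>dyds_over_s)) \<le> ennreal D * N (\<lambda>z. of_real (\<omega> z) * b z)) \<longrightarrow>
    N' f \<le> ennreal (C * D)" using converse_norm by blast
  obtain B where B: "\<forall>f\<in>V'. anti_dual_norm V N (L2_pairing V f) \<le> ennreal B * N' f"
    using pairing_norm_upper by blast
  obtain H where H: "\<And>f g :: real \<times> 'a \<Rightarrow> complex. half_space_measurable f \<Longrightarrow> half_space_measurable g \<Longrightarrow>
    (\<integral>\<^sup>+ z. ennreal (norm (f z) * norm (g z)) \<partial>dyds_over_s) \<le> ennreal H * N' f * N g"
    using tent_norm_Holder[OF p r q] by blast
  have "ennreal (1 / C) * N' f \<le> anti_dual_norm V N (L2_pairing V f)" if f: "f \<in> V'" for f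
  proof -
    let ?D = "anti_dual_norm V N (L2_pairing V f)"
    have m: "half_space_measurable f" and fin: "N' f < top" using f by (auto simp: tent_space_def)
    have D: "?D < top" using B f fin by (auto intro: le_less_trans simp: ennreal_mult_less_top)
    obtain f' where f' [measurable]: "bm f'" and ae: "AE z\<in>half_space in lborel. f z = f' z"
      using half_space_borel_version[OF m] .
    have m': "half_space_measurable f'" by (rule borel_imp_half_space_measurable) measurable
    have eqN: "N' f = N' f'" by (rule tent_norm_cong_AE[OF m m' ae])
    have f'V: "f' \<in> V'" using m' fin unfolding eqN by (simp add: tent_space_def)
    have eqL: "L2_pairing V f = L2_pairing V f'"
      unfolding pairing_eq_iff[OF f f'V] AE_half_space_iff by (rule ae)
    have "(\<lambda>z. of_real (\<omega> z) * 1) \<in> V" by (rule \<omega>_in_V[where c = 1]) auto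
    then have \<omega>V: "(\<lambda>z. complex_of_real (\<omega> z)) \<in> V" by simp
    \<comment> \<open>Hoelder's inequality is applied against \<omega>, which is itself an element
      of the space.\<close>
    have fin': "hs_int (\<lambda>z. ennreal (norm (f' z) * \<omega> z)) < top"
    proof -
      have "hs_int (\<lambda>z. ennreal (norm (f' z) * \<omega> z)) = (\<integral>\<^sup>+ z. ennreal (norm (f' z) * \<omega> z) \<partial>dyds_over_s)"
        by (rule nn_integral_dyds[symmetric, OF borel_imp_half_space_measurable]) measurable
      also have "\<dots> = (\<integral>\<^sup>+ z. ennreal (norm (f' z) * norm (complex_of_real (\<omega> z))) \<partial>dyds_over_s)"
        using \<omega>_nonneg by simp
      also have "\<dots> \<le> ennreal H * N' f' * N (\<lambda>z. complex_of_real (\<omega> z))"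
        using \<omega>V m' by (intro H) (auto simp: V_iff)
      also have "\<dots> < top" using \<omega>V fin unfolding eqN by (simp add: V_iff ennreal_mult_less_top)
      finally show ?thesis .
    qed
    have "N' f' \<le> ennreal (C * enn2real ?D)"
    proof (rule C[rule_format, OF f' _ fin'])
      fix b :: "real \<times> 'a \<Rightarrow> complex" and j :: nat
      assume b: "bm b" "\<And>z. norm (b z) \<le> real j"
      have g: "(\<lambda>z. of_real (\<omega> z) * b z) \<in> V" by (rule \<omega>_in_V[OF b])
      show "ennreal (norm (\<integral>z. f' z * cnj (of_real (\<omega> z) * b z) \<partial>dyds_over_s)) \<le> ennreal (enn2real ?D) * N (\<lambda>z. of_real (\<omega> z) * b z)"
        using anti_dual_norm_bound[OF pairing_in_anti_dual[OF f'V] g] g D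
        unfolding eqL by (simp add: L2_pairing_def)
    qed simp
    then have "ennreal (1 / C) * N' f \<le> ennreal (1 / C) * ennreal (C * enn2real ?D)"
      unfolding eqN by (intro mult_left_mono) auto
    also have "\<dots> = ?D" using C0 D by (simp add: ennreal_mult[symmetric])
    finally show ?thesis .
  qed
  then show ?thesis using C0 by (intro exI[of _ "1 / C"]) auto
qed

lemma identified: "anti_dual_identified V N V' N'"
proof -
  obtain c C where "0 < c" "0 < C" "\<forall>f\<in>V'. ennreal c * N' f \<le> anti_dual_norm V N (L2_pairing V f)"
    "\<forall>f\<in>V'. anti_dual_norm V N (L2_pairing V f) \<le> ennreal C * N' f"
    using pairing_norm_lower pairing_norm_upper by blast
  then have norms: "\<exists>c C::real. 0 < c \<and> 0 < C \<and> (\<forall>f\<in>V'. ennreal c * N' f \<le> anti_dual_norm V N (L2_pairing V f) \<and>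
      anti_dual_norm V N (L2_pairing V f) \<le> ennreal C * N' f)" by blast
  show ?thesis unfolding anti_dual_identified_def
    using norms by (intro conjI ballI allI pairing_linear pairing_eq_iff equalityI subsetI)
      (auto intro: pairing_in_anti_dual anti_dual_imp_pairing)
qed

end

theorem theorem3p24:
  fixes p q r :: ennreal and \<beta> :: real
  assumes "1 \<le> p" "p < \<infinity>" and "1 \<le> r" "r < \<infinity>" and "0 < q" "q < \<infinity>"
  shows "(\<exists>C::real. 0 < C \<and>
      (\<forall>f g :: real \<times> 'a::euclidean_space \<Rightarrow> complex.
         half_space_measurable f \<longrightarrow> half_space_measurable g \<longrightarrow>
         (\<integral>\<^sup>+ z. ennreal (norm (f z) * norm (g z)) \<partial>dyds_over_s)
           \<le> ennreal C
             * tent_norm (conj_exponent p) (conj_exponent q) (conj_exponent r) (- \<beta>) f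
             * tent_norm p q r \<beta> g)) \<and>
    anti_dual_identified
      (tent_space p q r \<beta> :: (real \<times> 'a \<Rightarrow> complex) set)
      (tent_norm p q r \<beta>)
      (tent_space (conj_exponent p) (conj_exponent q) (conj_exponent r) (- \<beta>))
      (tent_norm (conj_exponent p) (conj_exponent q) (conj_exponent r) (- \<beta>))"
proof -
  have fin: "p < top" "r < top" "q < top" and p0: "0 < p"
    using assms less_le_trans[OF zero_less_one assms(1)] by auto
  obtain \<rho> :: "real \<times> 'a \<Rightarrow> real" where \<rho>: "bm \<rho>" "\<forall>z\<in>half_space. 0 < \<rho> z"
    "\<forall>z. z \<notin> half_space \<longrightarrow> \<rho> z = 0" "tent p q (wt r (\<lambda>z. ennreal (\<rho> z))) < top"
    using positive_weight_exists[OF p0 fin(1) assms(5) fin(3) assms(3) fin(2), where 'a = 'a] by blast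
  \<comment> \<open>The weight \<rho> depends on the exponents but occurs in neither assertion; it
    only supplies test functions.\<close>
  interpret weighted_tent p q r \<beta> \<rho> by unfold_locales (use assms fin \<rho> in auto)
  show ?thesis by (intro conjI identified tent_norm_Holder[OF p r q])
qed

end
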